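(* Let $\alpha,\beta>0$. For any two functions $g^{(\mathbb{R})}$ and $h^{(\mathbb{R})}$ in $\mathbf{S}_0(\mathbb{R})$ the following statements are equivalent. (i) $g^{(\mathbb{R})}$ and $h^{(\mathbb{R})}$ generate dual Gabor frames for $L^2(\mathbb{R})$ with respect to time-frequency shifts from the lattice $\alpha\mathbb{Z}\times\beta\mathbb{Z}$. (ii) For any prime $p$ the two functions $g=g^{(\mathbb{R})}\otimes \mathbf{1}_{\mathbb{Z}_p}$ and $h=h^{(\mathbb{R})}\otimes \mathbf{1}_{\mathbb{Z}_p}$ in $\mathbf{S}_0(\mathbb{R}\times\mathbb{Q}_p)$ generate dual Gabor frames for $L^2(\mathbb{R}\times\mathbb{Q}_p)$ with respect to the lattice $$\Lambda=\{(\alpha q,q,\beta r,r) : q,r\in\mathbb{Z}[1/p]\}\subset \mathbb{R}\times\mathbb{Q}_p\times\mathbb{R}\times\mathbb{Q}_p .$$ (iii) The two functions $g$ and $h$ in $\mathbf{S}_0(\mathbb{A}_{\mathbb{Q}})$ defined by $$g=g^{(\mathbb{R})}\otimes\mathbf{1}_{\mathbb{Z}_2}\otimes\mathbf{1}_{\mathbb{Z}_3}\otimes\cdots,\qquad h=h^{(\mathbb{R})}\otimes\mathbf{1}_{\mathbb{Z}_2}\otimes\mathbf{1}_{\mathbb{Z}_3}\otimes\cdots$$ (tensor product over all primes) generate dual Gabor frames for $L^2(\mathbb{A}_{\mathbb{Q}})$ with respect to the lattice $$\Lambda=\{(\alpha q,(q)_p,\beta r,(r)_p) : q,r\in\mathbb{Q}\}\subset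 \mathbb{R}\times\mathbb{A}_{\mathbb{Q},\mathrm{fin}}\times\mathbb{R}\times\mathbb{A}_{\mathbb{Q},\mathrm{fin}} .$$
   Context: Groups and measures. $\mathbb{P}$ is the set of primes; $\mathbb{Q}_p$ is the additive group of $p$-adic numbers, $\mathbb{Z}_p$ the $p$-adic integers, with Haar measure normalized by $\mu_{\mathbb{Q}_p}(\mathbb{Z}_p)=1$. $\mathbb{Z}[1/p]$ is the set of rationals $a/p^k$ with $a,k\in\mathbb{Z}$. For $x\in\mathbb{Q}_p$, $\{x\}_p\in\mathbb{Z}[1/p]/\mathbb{Z}$ is the class of the fractional part $\sum_{k<0}a_kp^k$ of the $p$-adic expansion $x=\sum_k a_kp^k$, so $e^{2\pi i\{x\}_p}$ is well defined. $\mathbb{A}_{\mathbb{Q},\mathrm{fin}}$ is the restricted product of the $\mathbb{Q}_p$ with respect to the $\mathbb{Z}_p$ (sequences $(x_p)_p$ with $x_p\in\mathbb{Z}_p$ for all but finitely many $p$, with the restricted product topology), and $\mathbb{A}_{\mathbb{Q}}=\mathbb{R}\times\mathbb{A}_{\mathbb{Q},\mathrm{fin}}$; both carry product Haar measures, with Lebesgue measure on $\mathbb{R}$. Time-frequency shifts. Each group $G\in\{\mathbb{R},\mathbb{R}\times\mathbb{Q}_p,\mathbb{A}_{\mathbb{Q}}\}$ is identified with its dual: $\omega\in G$ acts as the character $\omega(t)=e^{2\pi i\omega t}$ for $G=\mathbb{R}$; $\omega(t)=e^{2\pi i(\omega_\infty t_\infty-\{\omega_pt_p\}_p)}$ for $G=\mathbb{R}\times\mathbb{Q}_p$;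 $\omega(t)=e^{2\pi i\omega_\infty t_\infty}\prod_{p}e^{-2\pi i\{\omega_pt_p\}_p}$ for $G=\mathbb{A}_{\mathbb{Q}}$. Set $T_xf(t)=f(t-x)$, $E_\omega f(t)=\omega(t)f(t)$ and $\pi(x,\omega)=E_\omega T_x$. A lattice is a discrete co-compact subgroup. In the lattices, $(q)_p$ denotes the constant sequence equal to $q\in\mathbb{Q}$ in every $\mathbb{Q}_p$. Dual Gabor frames. For a lattice $\Lambda\subset G\times\widehat{G}\cong G\times G$, two functions $g,h\in\mathbf{S}_0(G)$ generate dual Gabor frames for $L^2(G)$ with respect to $\Lambda$ if $f=\sum_{\lambda\in\Lambda}\langle f,\pi(\lambda)g\rangle\,\pi(\lambda)h$ for all $f\in L^2(G)$ (unconditional convergence in $L^2(G)$; inner product linear in the first entry). Feichtinger algebra $\mathbf{S}_0$. - $\mathbf{S}_0(\mathbb{R})=\{f\in L^1(\mathbb{R}):\|f\|_{\mathbf{S}_0(\mathbb{R})}=\int_{\mathbb{R}}\|f*E_\omega\gamma\|_1\,d\omega<\infty\}$, where $\gamma(x)=e^{-x^2}$. - $\mathbf{S}_0(\mathbb{Q}_p)$: let $Y_p$ be the set of finite sums $\sum_{j\ge1}c_jp^{-j}$ with $c_j\in\{0,\dots,p-1\}$ (coset representatives of $\mathbb{Q}_p/\mathbb{Z}_p$). Then $\mathbf{S}_0(\mathbb{Q}_p)$ consists of the functions $f$ such that, for every $y\in Y_p$, $f(x)=\sum_{z\in Y_p}c(y,z)e^{2\pi i\{(x-y)z\}_p}$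 for all $x\in y+\mathbb{Z}_p$, with $c\in\ell^1(Y_p\times Y_p)$; norm $\|f\|_{\mathbf{S}_0(\mathbb{Q}_p)}=\|c\|_1$. - $\mathbf{S}_0(\mathbb{R}\times\mathbb{Q}_p)$ consists of the functions $f=\sum_{j\in\mathbb{N}}f_j^{(\mathbb{R})}\otimes f_j^{(\mathbb{Q}_p)}$ with $f_j^{(\mathbb{R})}\in\mathbf{S}_0(\mathbb{R})$, $f_j^{(\mathbb{Q}_p)}\in\mathbf{S}_0(\mathbb{Q}_p)$ and $\sum_j\|f_j^{(\mathbb{R})}\|_{\mathbf{S}_0(\mathbb{R})}\|f_j^{(\mathbb{Q}_p)}\|_{\mathbf{S}_0(\mathbb{Q}_p)}<\infty$. - $\mathbf{S}_0(\mathbb{A}_{\mathbb{Q}})$ consists of the functions $f=\sum_{j\in\mathbb{N}}f_j^{(\mathbb{R})}\otimes\bigotimes_{p\in\mathbb{P}}f_j^{(\mathbb{Q}_p)}$ with $f_j^{(\mathbb{R})}\in\mathbf{S}_0(\mathbb{R})$, $f_j^{(\mathbb{Q}_p)}\in\mathbf{S}_0(\mathbb{Q}_p)$, where for each $j$ only finitely many $f_j^{(\mathbb{Q}_p)}$ differ from the indicator function $\mathbf{1}_{\mathbb{Z}_p}$, and $\sum_j\|f_j^{(\mathbb{R})}\|_{\mathbf{S}_0(\mathbb{R})}\prod_p\|f_j^{(\mathbb{Q}_p)}\|_{\mathbf{S}_0(\mathbb{Q}_p)}<\infty$. *)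

theory Defs
  imports
    "HOL-Analysis.Analysis"
    "HOL-Computational_Algebra.Primes"
    "HOL-Algebra.Ring"
    "HOL-Algebra.Product_Groups"
begin

section \<open>Gabor frames on self-dual groups\<close>

text \<open>
  A locally compact abelian group, written multiplicatively as in HOL-Algebra, together with its
  topology, its Haar measure, the identification with its dual (\<open>lca_char G \<omega> t\<close> is the value at
  \<open>t\<close> of the character attached to \<open>\<omega>\<close>) and its Feichtinger algebra.  Functions on the group are
  total functions on the underlying type; their values off the carrier are irrelevant.
\<close>

record 'a lca = "'a monoid" +
  lca_top :: "'a topology"
  lca_measure :: "'a measure"
  lca_char :: "'a \<Rightarrow> 'a \<Rightarrow> complex"
  feichtinger :: "('a \<Rightarrow> complex) set"

definition borel_sets_of :: "'a topology \<Rightarrow> 'a set set" where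
  "borel_sets_of T = sigma_sets (topspace T) {U. openin T U}"

text \<open>
  The groups below are second countable, so regularity of a Haar measure is automatic
  and is not listed as a condition.
\<close>

definition haar_measure :: "('a, 'm) monoid_scheme \<Rightarrow> 'a topology \<Rightarrow> 'a measure \<Rightarrow> bool" where
  "haar_measure G T \<mu> \<longleftrightarrow>
     space \<mu> = carrier G \<and> sets \<mu> = borel_sets_of T \<and>
     (\<forall>x\<in>carrier G. \<forall>A\<in>sets \<mu>. emeasure \<mu> (x <#\<^bsub>G\<^esub> A) = emeasure \<mu> A) \<and>
     (\<forall>K. compactin T K \<longrightarrow> emeasure \<mu> K < \<infinity>) \<and>
     (\<forall>U. openin T U \<and> U \<noteq> {} \<longrightarrow> emeasure \<mu> U > 0)"

text \<open>Discrete co-compact subgroups; \<open>Q\<close> is the quotient topology on the set of cosets.\<close>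

definition is_lattice :: "('a, 'm) monoid_scheme \<Rightarrow> 'a topology \<Rightarrow> 'a set \<Rightarrow> bool" where
  "is_lattice G T \<Lambda> \<longleftrightarrow>
     subgroup \<Lambda> G \<and>
     subtopology T \<Lambda> = discrete_topology \<Lambda> \<and>
     (\<exists>Q. quotient_map T Q (\<lambda>x. \<Lambda> #>\<^bsub>G\<^esub> x) \<and> compact_space Q)"

definition time_shift :: "('a, 'm) lca_scheme \<Rightarrow> 'a \<Rightarrow> ('a \<Rightarrow> complex) \<Rightarrow> 'a \<Rightarrow> complex" where
  "time_shift G x f = (\<lambda>t. f (t \<otimes>\<^bsub>G\<^esub> inv\<^bsub>G\<^esub> x))"

definition modulation :: "('a, 'm) lca_scheme \<Rightarrow> 'a \<Rightarrow> ('a \<Rightarrow> complex) \<Rightarrow> 'a \<Rightarrow> complex" where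
  "modulation G \<omega> f = (\<lambda>t. lca_char G \<omega> t * f t)"

definition tf_shift :: "('a, 'm) lca_scheme \<Rightarrow> 'a \<times> 'a \<Rightarrow> ('a \<Rightarrow> complex) \<Rightarrow> 'a \<Rightarrow> complex" where
  "tf_shift G = (\<lambda>(x, \<omega>) f. modulation G \<omega> (time_shift G x f))"

definition L2_norm_sq :: "'a measure \<Rightarrow> ('a \<Rightarrow> complex) \<Rightarrow> ennreal" where
  "L2_norm_sq M f = (\<integral>\<^sup>+ t. ennreal ((cmod (f t))\<^sup>2) \<partial>M)"

definition L2_space :: "'a measure \<Rightarrow> ('a \<Rightarrow> complex) set" where
  "L2_space M = {f \<in> borel_measurable M. L2_norm_sq M f < \<infinity>}"

definition L2_inner :: "'a measure \<Rightarrow> ('a \<Rightarrow> complex) \<Rightarrow> ('a \<Rightarrow> complex) \<Rightarrow> complex" where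
  "L2_inner M f g = (LINT t|M. f t * cnj (g t))"

text \<open>
  Unconditional convergence is convergence of the net of partial sums over finite subsets of the
  lattice.  The notion is only meaningful for lattices and for windows in the Feichtinger algebra,
  so both requirements are part of the definition.
\<close>

definition dual_gabor_frames ::
  "('a, 'm) lca_scheme \<Rightarrow> ('a \<times> 'a) set \<Rightarrow> ('a \<Rightarrow> complex) \<Rightarrow> ('a \<Rightarrow> complex) \<Rightarrow> bool" where
  "dual_gabor_frames G \<Lambda> g h \<longleftrightarrow>
     is_lattice (G \<times>\<times> G) (prod_topology (lca_top G) (lca_top G)) \<Lambda> \<and>
     g \<in> feichtinger G \<and> h \<in> feichtinger G \<and>
     (\<forall>f\<in>L2_space (lca_measure G).
        ((\<lambda>F. L2_norm_sq (lca_measure G)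
                (\<lambda>t. f t - (\<Sum>\<xi>\<in>F. L2_inner (lca_measure G) f (tf_shift G \<xi> g) * tf_shift G \<xi> h t)))
          \<longlongrightarrow> 0) (finite_subsets_at_top \<Lambda>))"


section \<open>The real line\<close>

definition S0_real_norm :: "(real \<Rightarrow> complex) \<Rightarrow> ennreal" where
  "S0_real_norm f =
     (\<integral>\<^sup>+ \<omega>. (\<integral>\<^sup>+ x. ennreal (cmod
        (LINT y|lborel. f y * (cis (2 * pi * \<omega> * (x - y)) * of_real (exp (- (x - y)\<^sup>2)))))
      \<partial>lborel) \<partial>lborel)"

definition S0_real :: "(real \<Rightarrow> complex) set" where
  "S0_real = {f. integrable lborel f \<and> S0_real_norm f < \<infinity>}"

definition real_lca :: "real lca" where
  "real_lca =
     \<lparr>carrier = UNIV, monoid.mult = (+), one = 0,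
      lca_top = euclidean,
      lca_measure = lborel,
      lca_char = (\<lambda>\<omega> t. cis (2 * pi * \<omega> * t)),
      feichtinger = S0_real\<rparr>"


section \<open>The p-adic numbers\<close>

text \<open>
  A p-adic number is represented by its expansion: \<open>x k\<close> is the coefficient of \<open>p\<^sup>k\<close>.  Arithmetic
  is defined through p-adic limits of the rational partial sums.
\<close>

type_synonym padic = "int \<Rightarrow> nat"

definition padic_carrier :: "nat \<Rightarrow> padic set" where
  "padic_carrier p = {x. (\<forall>k. x k < p) \<and> (\<exists>N. \<forall>k<N. x k = 0)}"

definition padic_partial :: "nat \<Rightarrow> padic \<Rightarrow> int \<Rightarrow> rat" where
  "padic_partial p x n = (\<Sum>k | k < n \<and> x k \<noteq> 0. of_nat (x k) * of_nat p powi k)"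

definition rat_padic_abs :: "nat \<Rightarrow> rat \<Rightarrow> real" where
  "rat_padic_abs p q =
     (if q = 0 then 0
      else real p powi (int (multiplicity (int p) (snd (quotient_of q))) -
                        int (multiplicity (int p) (fst (quotient_of q)))))"

definition padic_lim :: "nat \<Rightarrow> (nat \<Rightarrow> rat) \<Rightarrow> padic" where
  "padic_lim p s =
     (THE x. x \<in> padic_carrier p \<and>
        (\<lambda>m. rat_padic_abs p (s m - padic_partial p x (int m))) \<longlonglongrightarrow> 0)"

definition padic_of_rat :: "nat \<Rightarrow> rat \<Rightarrow> padic" where
  "padic_of_rat p q = padic_lim p (\<lambda>_. q)"

definition Qp :: "nat \<Rightarrow> padic ring" where
  "Qp p =
     \<lparr>carrier = padic_carrier p,
      monoid.mult = (\<lambda>x y. padic_lim p (\<lambda>m. padic_partial p x (int m) * padic_partial p y (int m))),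
      one = padic_of_rat p 1,
      zero = padic_of_rat p 0,
      add = (\<lambda>x y. padic_lim p (\<lambda>m. padic_partial p x (int m) + padic_partial p y (int m)))\<rparr>"

definition Zp :: "nat \<Rightarrow> padic set" where
  "Zp p = {x \<in> padic_carrier p. \<forall>k<0. x k = 0}"

text \<open>\<open>{x}\<^sub>p\<close>, as the representative in \<open>[0,1)\<close> of its class modulo the integers.\<close>

definition padic_frac :: "nat \<Rightarrow> padic \<Rightarrow> real" where
  "padic_frac p x = of_rat (padic_partial p x 0)"

definition padic_abs :: "nat \<Rightarrow> padic \<Rightarrow> real" where
  "padic_abs p x = (if \<forall>k. x k = 0 then 0 else real p powi (- (LEAST k. x k \<noteq> 0)))"

definition padic_top :: "nat \<Rightarrow> padic topology" where
  "padic_top p =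
     Metric_space.mtopology (padic_carrier p) (\<lambda>x y. padic_abs p (x \<ominus>\<^bsub>Qp p\<^esub> y))"

definition padic_haar :: "nat \<Rightarrow> padic measure" where
  "padic_haar p =
     (THE \<mu>. haar_measure (add_monoid (Qp p)) (padic_top p) \<mu> \<and> emeasure \<mu> (Zp p) = 1)"

definition indicator_Zp :: "nat \<Rightarrow> padic \<Rightarrow> complex" where
  "indicator_Zp p = indicator (Zp p)"

text \<open>The coset representatives \<open>Y\<^sub>p\<close> of \<open>\<rat>\<^sub>p / \<int>\<^sub>p\<close>.\<close>

definition padic_reps :: "nat \<Rightarrow> padic set" where
  "padic_reps p = {y \<in> padic_carrier p. \<forall>k\<ge>0. y k = 0}"

definition S0_padic_coeffs :: "nat \<Rightarrow> (padic \<Rightarrow> complex) \<Rightarrow> (padic \<times> padic \<Rightarrow> complex) \<Rightarrow> bool" where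
  "S0_padic_coeffs p f c \<longleftrightarrow>
     (\<lambda>yz. norm (c yz)) summable_on (padic_reps p \<times> padic_reps p) \<and>
     (\<forall>y\<in>padic_reps p. \<forall>x\<in>y <#\<^bsub>add_monoid (Qp p)\<^esub> Zp p.
        ((\<lambda>z. c (y, z) * cis (2 * pi * padic_frac p ((x \<ominus>\<^bsub>Qp p\<^esub> y) \<otimes>\<^bsub>Qp p\<^esub> z)))
           has_sum f x) (padic_reps p))"

definition S0_padic :: "nat \<Rightarrow> (padic \<Rightarrow> complex) set" where
  "S0_padic p = {f. \<exists>c. S0_padic_coeffs p f c}"

text \<open>
  The coefficients of \<open>f \<in> S0_padic p\<close> are unique on \<open>padic_reps p \<times> padic_reps p\<close>, so the
  infimum is taken over a single value.
\<close>

definition S0_padic_norm :: "nat \<Rightarrow> (padic \<Rightarrow> complex) \<Rightarrow> ennreal" where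
  "S0_padic_norm p f =
     (INF c\<in>{c. S0_padic_coeffs p f c}.
        ennreal (\<Sum>\<^sub>\<infinity>yz\<in>padic_reps p \<times> padic_reps p. norm (c yz)))"

definition Z_inv :: "nat \<Rightarrow> rat set" where
  "Z_inv p = {of_int a * of_nat p powi k | a k. True}"


section \<open>The group R x Q_p\<close>

definition real_padic_measure :: "nat \<Rightarrow> (real \<times> padic) measure" where
  "real_padic_measure p = lborel \<Otimes>\<^sub>M padic_haar p"

text \<open>
  Elements of \<open>S0_real\<close> are integrable functions, not necessarily the continuous representatives
  of their classes; accordingly the series below is required to represent \<open>f\<close> almost everywhere.
\<close>

definition S0_real_padic :: "nat \<Rightarrow> (real \<times> padic \<Rightarrow> complex) set" where
  "S0_real_padic p =
     {f \<in> borel_measurable (real_padic_measure p).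
        \<exists>(fR :: nat \<Rightarrow> real \<Rightarrow> complex) (fQ :: nat \<Rightarrow> padic \<Rightarrow> complex).
          (\<forall>j. fR j \<in> S0_real) \<and> (\<forall>j. fQ j \<in> S0_padic p) \<and>
          (\<Sum>j. S0_real_norm (fR j) * S0_padic_norm p (fQ j)) < \<infinity> \<and>
          (AE (s, x) in real_padic_measure p. (\<lambda>j. fR j s * fQ j x) sums f (s, x))}"

definition real_padic_lca :: "nat \<Rightarrow> (real \<times> padic) lca" where
  "real_padic_lca p =
     monoid.extend (real_lca \<times>\<times> add_monoid (Qp p))
       (lca.fields
         (prod_topology euclidean (padic_top p))
         (real_padic_measure p)
         (\<lambda>(\<omega>, \<eta>) (t, u). cis (2 * pi * (\<omega> * t - padic_frac p (\<eta> \<otimes>\<^bsub>Qp p\<^esub> u))))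
         (S0_real_padic p))"


section \<open>The adeles\<close>

abbreviation primes :: "nat set" where
  "primes \<equiv> {p. prime p}"

text \<open>Products over all primes in which almost all factors equal 1.\<close>

definition prime_prod :: "(nat \<Rightarrow> 'a::comm_monoid_mult) \<Rightarrow> 'a" where
  "prime_prod a = (\<Prod>p | prime p \<and> a p \<noteq> 1. a p)"

definition fin_adeles :: "(nat \<Rightarrow> padic) set" where
  "fin_adeles =
     {x \<in> (\<Pi>\<^sub>E p\<in>primes. padic_carrier p). finite {p. prime p \<and> x p \<notin> Zp p}}"

definition fin_adele_group :: "(nat \<Rightarrow> padic) monoid" where
  "fin_adele_group = (product_group primes (\<lambda>p. add_monoid (Qp p))) \<lparr>carrier := fin_adeles\<rparr>"

definition fin_adele_top :: "(nat \<Rightarrow> padic) topology" where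
  "fin_adele_top =
     topology_generated_by
       {\<Pi>\<^sub>E p\<in>primes. U p | U. (\<forall>p. prime p \<longrightarrow> openin (padic_top p) (U p)) \<and>
                          finite {p. prime p \<and> U p \<noteq> Zp p}}"

text \<open>The product of the measures \<open>padic_haar p\<close> on the restricted product.\<close>

definition fin_adele_measure :: "(nat \<Rightarrow> padic) measure" where
  "fin_adele_measure =
     (THE \<mu>. space \<mu> = fin_adeles \<and> sets \<mu> = borel_sets_of fin_adele_top \<and>
        (\<forall>A. (\<forall>p. prime p \<longrightarrow> A p \<in> sets (padic_haar p)) \<and> finite {p. prime p \<and> A p \<noteq> Zp p} \<longrightarrow>
           emeasure \<mu> (\<Pi>\<^sub>E p\<in>primes. A p) = prime_prod (\<lambda>p. emeasure (padic_haar p) (A p))))"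

definition adele_measure :: "(real \<times> (nat \<Rightarrow> padic)) measure" where
  "adele_measure = lborel \<Otimes>\<^sub>M fin_adele_measure"

text \<open>
  In the product of the norms, primes with \<open>fQ j p = 1\<^bsub>\<int>\<^sub>p\<^esub>\<close> contribute the factor 1.  The values
  off the carrier being irrelevant, \<open>fQ j p\<close> is compared with the indicator on the carrier only.
\<close>

definition S0_adele :: "(real \<times> (nat \<Rightarrow> padic) \<Rightarrow> complex) set" where
  "S0_adele =
     {f \<in> borel_measurable adele_measure.
        \<exists>(fR :: nat \<Rightarrow> real \<Rightarrow> complex) (fQ :: nat \<Rightarrow> nat \<Rightarrow> padic \<Rightarrow> complex).
          (\<forall>j. fR j \<in> S0_real) \<and> (\<forall>j p. prime p \<longrightarrow> fQ j p \<in> S0_padic p) \<and>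
          (\<forall>j. finite {p. prime p \<and> (\<exists>x\<in>padic_carrier p. fQ j p x \<noteq> indicator_Zp p x)}) \<and>
          (\<Sum>j. S0_real_norm (fR j) * prime_prod (\<lambda>p. S0_padic_norm p (fQ j p))) < \<infinity> \<and>
          (AE (s, x) in adele_measure.
             (\<lambda>j. fR j s * prime_prod (\<lambda>p. fQ j p (x p))) sums f (s, x))}"

definition adele_lca :: "(real \<times> (nat \<Rightarrow> padic)) lca" where
  "adele_lca =
     monoid.extend (real_lca \<times>\<times> fin_adele_group)
       (lca.fields
         (prod_topology euclidean fin_adele_top)
         adele_measure
         (\<lambda>(\<omega>, \<eta>) (t, u). cis (2 * pi * \<omega> * t) *
            prime_prod (\<lambda>p. cis (- 2 * pi * padic_frac p (\<eta> p \<otimes>\<^bsub>Qp p\<^esub> u p))))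
         S0_adele)"

text \<open>The constant sequence \<open>(q)\<^sub>p\<close>.\<close>

definition fin_adele_of_rat :: "rat \<Rightarrow> nat \<Rightarrow> padic" where
  "fin_adele_of_rat q = (\<lambda>p\<in>primes. padic_of_rat p q)"

end

theory Submission
  imports Defs "HOL-Probability.Probability"
begin

text \<open>
  Let \<open>H\<close> be the group of p-adic numbers or of finite adeles, \<open>K\<close> its compact open subgroup of
  integral elements, and \<open>R\<close> the ring \<open>Z[1/p]\<close> respectively \<open>Q\<close>, embedded diagonally.  The cosets of
  \<open>K\<close> are exactly the sets \<open>q + K\<close> with \<open>q\<close> in \<open>R\<close>, two of them being equal iff \<open>q\<close> changes by an
  integer, and dually for the characters given by elements of \<open>R\<close>.  Hence the functions
  \<open>e (q, r) = indicator (q + K) * \<psi> r\<close>, with \<open>q\<close> and \<open>r\<close> running over \<open>R\<close> modulo the integers, are an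
  orthonormal basis of \<open>L\<^sup>2(H)\<close>, and \<open>e (q, r)\<close> changes by a constant of modulus 1 if integers are added
  to \<open>q\<close> and \<open>r\<close>.  The time-frequency shift of \<open>g \<otimes> 1\<^sub>K\<close> by the lattice point of \<open>(q, r)\<close> is
  \<open>\<pi>(\<alpha> q, \<beta> r) g \<otimes> e (q, r)\<close>.  Since the constants cancel in the frame expansion, that expansion decouples along
  the basis into copies of the one over \<open>\<alpha> Z \<times> \<beta> Z\<close> in \<open>L\<^sup>2\<close> of the line, each conjugated by a
  unitary shift.  The uniform boundedness principle provides the domination with which convergence of
  all components gives convergence of their sum.
\<close>

section \<open>The p-adic numbers\<close>

text \<open>Limits of rational sequences, the Haar measure of each Q_p and the measure on the finite
  adeles are fixed by description operators. Existence and uniqueness come before anything else can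
  be said about them, which accounts for much of the arithmetic and measure theory. Haar measure
  arises from Lebesgue measure by reversing digits; the adelic measure is a sum, over the cosets of
  K, of infinite products of probability measures.

  Orthogonality is the easy half of the basis claim. Completeness holds because r has finite order
  modulo the integers: every level set of \<psi> r on a coset has a trigonometric polynomial as its
  indicator, and these level sets generate the Borel sets.

  The windows on the line are given as integrable functions with an integrable short-time transform.
  Fourier inversion makes them bounded almost everywhere and hence square integrable, so that each
  finite frame sum is a bounded operator. The definition of dual frames contains no Bessel bound;
  the uniform constant has to be extracted from convergence alone.\<close>

locale padic_prime =
  fixes p :: nat
  assumes prime_p: "prime p"
begin

lemma p_gt_1: "p > 1" using prime_p by (rule prime_gt_1_nat)

lemma prime_int_p: "prime (int p)" using prime_p by simp

section \<open>Powers of p and the localization of the integers at p\<close>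

definition pp :: "int \<Rightarrow> rat" where "pp n = of_nat p powi n"

lemma p_ne_0 [simp]: "p \<noteq> 0" "p > 0" using p_gt_1 by simp_all

lemma pp_pos [simp]: "pp n > 0" using p_gt_1 by (simp add: pp_def)

lemma pp_ne_0 [simp]: "pp n \<noteq> 0" using pp_pos[of n] by linarith

lemma pp_0 [simp]: "pp 0 = 1" by (simp add: pp_def)

lemma pp_add: "pp (m + n) = pp m * pp n" by (simp add: pp_def power_int_add)

lemma pp_Suc: "pp (n + 1) = pp n * of_nat p" by (simp add: pp_add) (simp add: pp_def)

lemma pp_minus: "pp (- n) = 1 / pp n" by (simp add: pp_def power_int_minus divide_inverse)

lemma pp_nat: "n \<ge> 0 \<Longrightarrow> pp n = of_int (int p ^ nat n)"
  by (simp add: pp_def power_int_def)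

lemma pp_mono: "m \<le> n \<Longrightarrow> pp m \<le> pp n"
  unfolding pp_def using p_gt_1 by (intro power_int_increasing) auto

text \<open>The localization of the integers at the prime \<open>p\<close>, that is, the rational
  numbers that are p-adic integers. Fractions may be unreduced, so closure under sums and products
  rests on one fact: a product of two denominators prime to \<open>p\<close> is again prime to
  \<open>p\<close>.\<close>

definition zl :: "rat set" where "zl = {of_int a / of_int b | a b. \<not> int p dvd b}"

lemma zlI: "\<not> int p dvd b \<Longrightarrow> of_int a / of_int b \<in> zl" by (auto simp: zl_def)

lemma zlE:
  assumes "q \<in> zl" obtains a b where "q = of_int a / of_int b" "\<not> int p dvd b" "b \<noteq> 0"
  using assms by (auto simp: zl_def)

lemma zl_int: "of_int a \<in> zl"
  using zlI[of 1 a] p_gt_1 by simp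

lemma zl_add: assumes "q \<in> zl" "r \<in> zl" shows "q + r \<in> zl"
proof -
  obtain a b c d where e: "q = of_int a / of_int b" "r = of_int c / of_int d"
    and n: "\<not> int p dvd b" "b \<noteq> 0" "\<not> int p dvd d" "d \<noteq> 0"
    using assms by (elim zlE) blast
  have "q + r = of_int (a * d + c * b) / of_int (b * d)" using n by (simp add: e add_frac_eq)
  moreover have "\<not> int p dvd b * d" using n prime_dvd_mult_iff[OF prime_int_p] by auto
  ultimately show ?thesis using zlI[of "b * d" "a * d + c * b"] by simp
qed

lemma zl_mult: assumes "q \<in> zl" "r \<in> zl" shows "q * r \<in> zl"
proof -
  obtain a b c d where e: "q = of_int a / of_int b" "r = of_int c / of_int d"
    and n: "\<not> int p dvd b" "\<not> int p dvd d"
    using assms by (elim zlE) blast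
  have "q * r = of_int (a * c) / of_int (b * d)" by (simp add: e)
  moreover have "\<not> int p dvd b * d" using n prime_dvd_mult_iff[OF prime_int_p] by auto
  ultimately show ?thesis using zlI[of "b * d" "a * c"] by simp
qed

lemma zl_minus: "q \<in> zl \<Longrightarrow> - q \<in> zl"
  using zl_mult[OF zl_int[of "- 1"], of q] by simp

text \<open>The fractional ideals \<open>p\<^sup>n \<int>\<^sub>(\<^sub>p\<^sub>)\<close>; congruences modulo them replace p-adic estimates.\<close>

definition I :: "int \<Rightarrow> rat set" where "I n = {q. q * pp (- n) \<in> zl}"

lemma I_add: "q \<in> I n \<Longrightarrow> r \<in> I n \<Longrightarrow> q + r \<in> I n"
  by (simp add: I_def distrib_right zl_add)

lemma I_minus: "q \<in> I n \<Longrightarrow> - q \<in> I n"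
  using zl_minus by (fastforce simp: I_def)

lemma I_diff: "q \<in> I n \<Longrightarrow> r \<in> I n \<Longrightarrow> q - r \<in> I n"
  using I_add[OF _ I_minus, of q n r] by simp

lemma I_0: "0 \<in> I n" using zl_int[of 0] by (simp add: I_def)

lemma I_sum: "(\<And>i. i \<in> A \<Longrightarrow> f i \<in> I n) \<Longrightarrow> sum f A \<in> I n"
  by (induction A rule: infinite_finite_induct) (auto simp: I_0 I_add)

lemma I_zero_eq: "I 0 = zl" by (simp add: I_def)

lemma I_int: "of_int a \<in> I 0" by (simp add: I_zero_eq zl_int)

lemma I_mult: assumes "q \<in> I m" "r \<in> I n" shows "q * r \<in> I (m + n)"
proof -
  have "pp (- (m + n)) = pp (- m) * pp (- n)" unfolding pp_minus pp_add by simp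
  then have "q * r * pp (- (m + n)) = (q * pp (- m)) * (r * pp (- n))" by (simp only: mult_ac)
  then show ?thesis using assms zl_mult unfolding I_def by (simp only: mem_Collect_eq)
qed

lemma pp_I: "pp n \<in> I n" using zl_int[of 1] by (simp add: I_def pp_minus)

lemma I_mono: assumes "m \<le> n" "q \<in> I n" shows "q \<in> I m"
proof -
  have "q * pp (- m) = (q * pp (- n)) * pp (n - m)" by (simp add: pp_add[symmetric] mult.assoc)
  moreover have "pp (n - m) \<in> zl" proof -
    have "0 \<le> n - m" using assms(1) by simp
    then show ?thesis unfolding pp_nat by (simp only: pp_nat zl_int)
  qed
  ultimately show ?thesis using assms(2) zl_mult[of "q * pp (- n)" "pp (n - m)"]
    unfolding I_def by (simp only: mem_Collect_eq)
qed

section \<open>Valuations of rational numbers\<close>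

lemma int_decomp: "b \<noteq> 0 \<Longrightarrow> \<exists>k c. b = int p ^ k * c \<and> \<not> int p dvd c"
  using multiplicity_decompose'[of b "int p"] prime_int_p by (metis not_prime_unit)

lemma rat_decomp:
  assumes "q \<noteq> 0"
  shows "\<exists>m a b. q = pp m * (of_int a / of_int b) \<and> \<not> int p dvd a \<and> \<not> int p dvd b"
proof -
  obtain c d where cd: "quotient_of q = (c, d)" by (cases "quotient_of q")
  have d: "d > 0" using quotient_of_denom_pos[OF cd] .
  have q: "q = of_int c / of_int d" by (rule quotient_of_div[OF cd])
  then have "c \<noteq> 0" using assms by auto
  then obtain i a where a: "c = int p ^ i * a" "\<not> int p dvd a" using int_decomp by blast
  obtain j b where b: "d = int p ^ j * b" "\<not> int p dvd b" using int_decomp[of d] d by auto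
  have "b \<noteq> 0" using b(2) by auto
  then have "q = pp (int i - int j) * (of_int a / of_int b)"
    by (simp add: q a(1) b(1) pp_def power_int_diff field_simps)
  then show ?thesis using a(2) b(2) by blast
qed

text \<open>The exponent \<open>m\<close> is the p-adic valuation. For \<open>n > m\<close>,
  clearing denominators in a membership would show \<open>p\<close> dividing \<open>a * d\<close>, a
  product of two numbers prime to \<open>p\<close>.\<close>

lemma I_unit_iff:
  assumes "\<not> int p dvd a" "\<not> int p dvd b"
  shows "pp m * (of_int a / of_int b) \<in> I n \<longleftrightarrow> n \<le> m"
proof
  assume "n \<le> m"
  have "of_int a / of_int b \<in> I 0" using assms by (simp add: I_zero_eq zlI)
  then have "pp m * (of_int a / of_int b) \<in> I (m + 0)" by (rule I_mult[OF pp_I])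
  then show "pp m * (of_int a / of_int b) \<in> I n" using \<open>n \<le> m\<close> by (simp add: I_mono)
next
  assume "pp m * (of_int a / of_int b) \<in> I n"
  then have "pp m * (of_int a / of_int b) * pp (- n) \<in> zl" by (simp add: I_def)
  then obtain c d where cd: "pp m * (of_int a / of_int b) * pp (- n) = of_int c / of_int d" "\<not> int p dvd d" "d \<noteq> 0"
    by (rule zlE)
  have b: "b \<noteq> 0" using assms by auto
  show "n \<le> m"
  proof (rule ccontr)
    assume "\<not> n \<le> m"
    then have k: "n - m > 0" by simp
    have "pp m * pp (- n) * pp (n - m) = 1" by (simp add: pp_add[symmetric])
    then have e: "pp m * pp (- n) = 1 / pp (n - m)" by (simp add: field_simps)
    have "of_int a * of_int d = (pp (n - m) * of_int c * of_int b :: rat)"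
      using cd(1,3) b e by (simp add: field_simps)
    then have "(of_int (a * d) :: rat) = of_int (int p ^ nat (n - m) * c * b)"
      using pp_nat[of "n - m"] k by simp
    then have "a * d = int p ^ nat (n - m) * c * b" by (simp only: of_int_eq_iff)
    moreover have "int p dvd int p ^ nat (n - m)" using k by (intro dvd_power) auto
    ultimately have "int p dvd a * d" by (metis dvd_mult2 mult.assoc)
    then show False using prime_dvd_mult_iff[OF prime_int_p] assms(1) cd(2) by blast
  qed
qed

lemma I_exists: "\<exists>n. q \<in> I n"
proof (cases "q = 0")
  case False
  then obtain m a b where "q = pp m * (of_int a / of_int b)" "\<not> int p dvd a" "\<not> int p dvd b"
    using rat_decomp by blast
  then have "q \<in> I m" using I_unit_iff[of a b m m] by simp
  then show ?thesis ..
qed (use I_0 in auto)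

lemma rat_padic_abs_nonneg: "rat_padic_abs p q \<ge> 0"
  by (simp add: rat_padic_abs_def)

text \<open>The bridge from absolute values to congruences: the multiplicities of numerator and
  denominator are evaluated here once, and convergence is afterwards expressed by membership in the
  ideals \<open>I n\<close>.\<close>

lemma rat_padic_abs_le_iff: "rat_padic_abs p q \<le> real p powi (- n) \<longleftrightarrow> q \<in> I n"
proof (cases "q = 0")
  case True then show ?thesis using I_0 by (simp add: rat_padic_abs_def)
next
  case False
  obtain c d where cd: "quotient_of q = (c, d)" by (cases "quotient_of q")
  have d: "d > 0" using quotient_of_denom_pos[OF cd] .
  have q: "q = of_int c / of_int d" by (rule quotient_of_div[OF cd])
  then have c: "c \<noteq> 0" using False by auto
  obtain i a where a: "c = int p ^ i * a" "\<not> int p dvd a" using int_decomp[OF c] by blast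
  obtain j b where b: "d = int p ^ j * b" "\<not> int p dvd b" using int_decomp[of d] d by auto
  have mi: "multiplicity (int p) c = i" "multiplicity (int p) d = j"
    using a b c d prime_int_p multiplicity_eqI[of "int p" i c] multiplicity_eqI[of "int p" j d]
    by (auto simp: power_add)
  have "b \<noteq> 0" using b(2) by auto
  then have "q = pp (int i - int j) * (of_int a / of_int b)"
    by (simp add: q a(1) b(1) pp_def power_int_diff field_simps)
  then have "q \<in> I n \<longleftrightarrow> n \<le> int i - int j" using I_unit_iff[OF a(2) b(2)] by simp
  moreover have "rat_padic_abs p q = real p powi (int j - int i)"
    using False by (simp add: rat_padic_abs_def cd mi)
  moreover have "real p powi (int j - int i) \<le> real p powi (- n) \<longleftrightarrow> int j - int i \<le> - n"
    using p_gt_1 power_int_increasing[of "int j - int i" "- n" "real p"]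
      power_int_strict_increasing[of "- n" "int j - int i" "real p"] by fastforce
  ultimately show ?thesis by auto
qed

subsection \<open>The rationals with denominator a power of p\<close>

abbreviation Zi :: "rat set" where "Zi \<equiv> Z_inv p"

lemma ZiI: "of_int a * pp k \<in> Zi" by (auto simp: Z_inv_def pp_def)

lemma ZiE: assumes "q \<in> Zi" obtains a k where "q = of_int a * pp k"
  using assms by (auto simp: Z_inv_def pp_def)

lemma Zi_int: "of_int a \<in> Zi" using ZiI[of a 0] by simp

lemma pp_Zi: "pp n \<in> Zi" using ZiI[of 1 n] by simp

lemma Zi_mult: "q \<in> Zi \<Longrightarrow> r \<in> Zi \<Longrightarrow> q * r \<in> Zi"
proof (elim ZiE)
  fix a k b l assume "q = of_int a * pp k" "r = of_int b * pp l"
  then have "q * r = of_int (a * b) * pp (k + l)" by (simp add: pp_add)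
  then show ?thesis by (simp only: ZiI)
qed

lemma Zi_minus: "q \<in> Zi \<Longrightarrow> - q \<in> Zi"
  using Zi_mult[OF Zi_int[of "-1"], of q] by simp

lemma Zi_add: "q \<in> Zi \<Longrightarrow> r \<in> Zi \<Longrightarrow> q + r \<in> Zi"
proof (elim ZiE)
  fix a k b l assume e: "q = of_int a * pp k" "r = of_int b * pp l"
  let ?m = "min k l"
  have "pp k = pp ?m * of_int (int p ^ nat (k - ?m))" "pp l = pp ?m * of_int (int p ^ nat (l - ?m))"
    using pp_nat[of "k - ?m"] pp_nat[of "l - ?m"] pp_add[of ?m "k - ?m"] pp_add[of ?m "l - ?m"] by simp_all
  then have "q + r = of_int (a * int p ^ nat (k - ?m) + b * int p ^ nat (l - ?m)) * pp ?m"
    unfolding e by (simp add: algebra_simps)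
  then show ?thesis by (simp only: ZiI)
qed

lemma Zi_diff: "q \<in> Zi \<Longrightarrow> r \<in> Zi \<Longrightarrow> q - r \<in> Zi"
  using Zi_add[OF _ Zi_minus, of q r] by simp

lemma Zi_sum: "(\<And>i. i \<in> A \<Longrightarrow> f i \<in> Zi) \<Longrightarrow> sum f A \<in> Zi"
  using Zi_int[of 0] by (induction A rule: infinite_finite_induct) (auto simp: Zi_add)

text \<open>The reduced denominator divides a power of \<open>p\<close> and is prime to
  \<open>p\<close>, hence is 1. This turns p-adic congruences in \<open>Z[1/p]\<close> into
  statements about integers.\<close>

lemma Zi_zl: assumes "q \<in> Zi" "q \<in> zl" shows "q \<in> \<int>"
proof -
  obtain a k where q: "q = of_int a * pp k" using assms(1) by (rule ZiE)
  show ?thesis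
  proof (cases "k \<ge> 0")
    case True then show ?thesis unfolding q by (simp add: pp_nat)
  next
    case False
    obtain c d where cd: "q = of_int c / of_int d" "\<not> int p dvd d" "d \<noteq> 0" using assms(2) by (rule zlE)
    let ?m = "int p ^ nat (- k)"
    have q': "q = of_int a / of_int ?m" using False pp_nat[of "- k"] pp_minus[of "- k"] by (simp add: q)
    then have "(of_int (a * d) :: rat) = of_int (c * ?m)"
      using cd p_gt_1 by (simp add: field_simps)
    then have "a * d = c * ?m" by (simp only: of_int_eq_iff)
    then have "?m dvd a * d" by simp
    moreover have "coprime ?m d"
      using cd(2) prime_int_p by (simp add: prime_imp_coprime)
    ultimately have "?m dvd a" by (simp add: coprime_dvd_mult_left_iff)
    then obtain e where "a = ?m * e" by (auto simp: dvd_def)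
    then have "q = of_int e" unfolding q' using p_gt_1 by simp
    then show ?thesis by simp
  qed
qed

lemma Zi_I: assumes "q \<in> Zi" "q \<in> I n" obtains d where "q = of_int d * pp n"
proof -
  have "q * pp (- n) \<in> \<int>" using assms by (intro Zi_zl Zi_mult pp_Zi) (auto simp: I_def)
  then obtain d where "q * pp (- n) = of_int d" by (auto elim: Ints_cases)
  then have "q = of_int d * pp n" by (simp add: pp_minus field_simps)
  then show ?thesis by (rule that)
qed

text \<open>The difference is an integer multiple of \<open>pp n\<close> and smaller than
  \<open>pp n\<close> in the usual absolute value. Size and congruence together pin down an element,
  which is the source of the uniqueness of expansions.\<close>

lemma Zi_I_eq:
  assumes "q \<in> Zi" "r \<in> Zi" "q - r \<in> I n" "0 \<le> q" "q < pp n" "0 \<le> r" "r < pp n"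
  shows "q = r"
proof -
  obtain d where d: "q - r = of_int d * pp n" using Zi_I[OF Zi_diff[OF assms(1,2)] assms(3)] .
  have "of_int d * pp n < 1 * pp n" using d assms(5,6) by linarith
  then have "of_int d < (1::rat)" by (rule mult_right_less_imp_less) (simp add: less_imp_le)
  moreover have "(-1) * pp n < of_int d * pp n" using d assms(4,7) by linarith
  then have "(-1 :: rat) < of_int d" by (rule mult_right_less_imp_less) (simp add: less_imp_le)
  ultimately have "d = 0" by linarith
  then show ?thesis using d by simp
qed

text \<open>After multiplication by a power of \<open>p\<close> the denominator \<open>d\<close> is
  prime to \<open>p\<close> and can be inverted modulo any power of \<open>p\<close>. Rational
  numbers thus have residues modulo \<open>I n\<close> among the values that partial sums of
  expansions can take.\<close>

lemma reduce: "\<exists>a\<in>Zi. 0 \<le> a \<and> a < pp n \<and> q - a \<in> I n"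
proof -
  obtain k0 where "q \<in> I k0" using I_exists by blast
  define k where "k = min k0 n"
  have qk: "q \<in> I k" using \<open>q \<in> I k0\<close> I_mono[of k k0 q] by (simp add: k_def)
  then obtain c d where cd: "q * pp (- k) = of_int c / of_int d" "\<not> int p dvd d" "d \<noteq> 0"
    unfolding I_def using zlE by blast
  define M where "M = int p ^ nat (n - k)"
  have kn: "k \<le> n" by (simp add: k_def)
  have M: "pp (n - k) = of_int M" "M > 0" using pp_nat[of "n - k"] kn p_gt_1 by (auto simp: M_def)
  have "coprime (int p) d" using prime_imp_coprime[OF prime_int_p cd(2)] .
  then have "coprime d M" unfolding M_def by (simp add: coprime_commute)
  then obtain e f0 where e: "e * d + f0 * M = 1" using bezout_int[of d M] by (auto simp: coprime_iff_gcd_eq_1)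
  \<comment> \<open>\<open>e\<close> inverts \<open>d\<close> modulo \<open>M\<close>, so
    \<open>b\<close> solves \<open>d * b = c\<close> modulo \<open>M\<close>; taking the remainder
    places \<open>a\<close> between 0 and \<open>pp n\<close>.\<close>
  define b where "b = (c * e) mod M"
  define a where "a = of_int b * pp k"
  have b: "0 \<le> b" "b < M" using M(2) by (auto simp: b_def)
  have "a \<in> Zi" unfolding a_def by (rule ZiI)
  moreover have "0 \<le> a" unfolding a_def using b(1) by (intro mult_nonneg_nonneg less_imp_le[OF pp_pos]) simp
  moreover have "a < pp n"
  proof -
    have "a < of_int M * pp k" unfolding a_def using b(2) by (intro mult_strict_right_mono) auto
    also have "\<dots> = pp n" by (simp flip: M(1) pp_add)
    finally show ?thesis .
  qed
  moreover have "q - a \<in> I n"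
  proof -
    have "M dvd d * b - c"
    proof -
      have "b = c * e - M * ((c * e) div M)" unfolding b_def by (simp add: minus_mult_div_eq_mod)
      then have "d * b - c = d * (c * e - M * ((c * e) div M)) - c" by (simp only:)
      also have "\<dots> = c * (e * d) - d * M * ((c * e) div M) - c" by (simp add: algebra_simps)
      also have "e * d = 1 - f0 * M" using e by linarith
      also have "c * (1 - f0 * M) - d * M * ((c * e) div M) - c = M * (- (c * f0) - d * ((c * e) div M))"
        by (simp add: algebra_simps)
      finally show ?thesis by simp
    qed
    then obtain f where f: "d * b - c = M * f" by (auto simp: dvd_def)
    then have c: "c = d * b - M * f" by simp
    have "q = of_int c / of_int d * pp k" using cd(1) by (simp add: pp_minus field_simps)
    then have "q - a = pp k * pp (n - k) * (of_int (- f) / of_int d)"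
      unfolding a_def c using cd(3) M(1) by (simp add: field_simps)
    also have "pp k * pp (n - k) = pp n" by (simp flip: pp_add)
    finally have "q - a = pp n * (of_int (- f) / of_int d)" .
    moreover have "of_int (- f) / of_int d \<in> I 0" unfolding I_zero_eq by (rule zlI[OF cd(2)])
    ultimately show ?thesis using I_mult[OF pp_I[of n], of "of_int (- f) / of_int d" 0] by simp
  qed
  ultimately show ?thesis by blast
qed

subsection \<open>Partial sums of expansions\<close>

abbreviation cP :: "padic set" where "cP \<equiv> padic_carrier p"
abbreviation P :: "padic \<Rightarrow> int \<Rightarrow> rat" where "P \<equiv> padic_partial p"

lemma carrier_less: "x \<in> cP \<Longrightarrow> x k < p" by (simp add: padic_carrier_def)

lemma carrier_bound: "x \<in> cP \<Longrightarrow> \<exists>N. \<forall>k<N. x k = 0"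
  by (simp add: padic_carrier_def)

lemma support_finite: assumes "x \<in> cP" shows "finite {k. k < n \<and> x k \<noteq> 0}"
proof -
  obtain N where N: "\<forall>k<N. x k = 0" using carrier_bound[OF assms] by blast
  have "k \<in> {N..<n}" if "k < n" "x k \<noteq> 0" for k using N that by (cases "k < N") auto
  then have "{k. k < n \<and> x k \<noteq> 0} \<subseteq> {N..<n}" by blast
  then show ?thesis by (rule finite_subset) simp
qed

lemma P_Suc: assumes "x \<in> cP" shows "P x (n + 1) = P x n + of_nat (x n) * pp n"
proof (cases "x n = 0")
  case True
  then have "k < n + 1 \<and> x k \<noteq> 0 \<longleftrightarrow> k < n \<and> x k \<noteq> 0" for k by (cases "k = n") auto
  then have "{k. k < n + 1 \<and> x k \<noteq> 0} = {k. k < n \<and> x k \<noteq> 0}" by (rule Collect_cong)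
  then show ?thesis using True by (simp add: padic_partial_def)
next
  case False
  then have "k < n + 1 \<and> x k \<noteq> 0 \<longleftrightarrow> k = n \<or> k < n \<and> x k \<noteq> 0" for k by (cases "k = n") auto
  then have "{k. k < n + 1 \<and> x k \<noteq> 0} = {k. k = n \<or> k < n \<and> x k \<noteq> 0}" by (rule Collect_cong)
  also have "\<dots> = insert n {k. k < n \<and> x k \<noteq> 0}" by blast
  finally have "{k. k < n + 1 \<and> x k \<noteq> 0} = insert n {k. k < n \<and> x k \<noteq> 0}" .
  then show ?thesis using support_finite[OF assms, of n] by (simp add: padic_partial_def pp_def)
qed

lemma P_eq_0: "(\<And>k. k < n \<Longrightarrow> x k = 0) \<Longrightarrow> P x n = 0"
  by (simp add: padic_partial_def)

lemma P_Zi: "P x n \<in> Zi"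
  unfolding padic_partial_def
proof (rule Zi_sum)
  fix k show "of_nat (x k) * of_nat p powi k \<in> Zi" using ZiI[of "int (x k)" k] by (simp add: pp_def)
qed

lemma P_bounds: assumes "x \<in> cP" shows "0 \<le> P x n" "P x n < pp n"
proof -
  obtain N where N: "\<forall>k<N. x k = 0" using carrier_bound[OF assms] by blast
  have "0 \<le> P x n \<and> P x n < pp n"
  proof (cases "n \<le> N")
    case True then show ?thesis using P_eq_0[of n x] N by simp
  next
    case False
    then have "N \<le> n" by simp
    then show ?thesis
    proof (induction n rule: int_ge_induct)
      case base then show ?case using P_eq_0[of N x] N by simp
    next
      case (step i)
      have "of_nat (x i) \<le> (of_nat p - 1 :: rat)" using carrier_less[OF assms, of i] by (simp add: of_nat_diff flip: of_nat_Suc)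
      then have "of_nat (x i) * pp i \<le> (of_nat p - 1) * pp i" by (intro mult_right_mono) (auto simp: less_imp_le)
      then show ?case using step P_Suc[OF assms, of i] pp_Suc[of i] by (auto simp: algebra_simps)
    qed
  qed
  then show "0 \<le> P x n" "P x n < pp n" by auto
qed

lemma P_cong: assumes "x \<in> cP" "m \<le> n" shows "P x n - P x m \<in> I m"
  using assms(2)
proof (induction n rule: int_ge_induct)
  case base then show ?case by (simp add: I_0)
next
  case (step i)
  have "of_nat (x i) * pp i \<in> I (0 + i)" using I_int[of "int (x i)"] by (intro I_mult pp_I) simp
  then have "of_nat (x i) * pp i \<in> I m" using step(1) by (simp add: I_mono)
  then have "(P x i - P x m) + of_nat (x i) * pp i \<in> I m" using step by (intro I_add)
  moreover have "P x (i + 1) - P x m = (P x i - P x m) + of_nat (x i) * pp i"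
    by (simp add: P_Suc[OF assms(1)])
  ultimately show ?case by (simp only:)
qed

text \<open>Partial sums are canonical representatives modulo \<open>I n\<close>: the bounds leave
  no room for two of them in one class.\<close>

lemma P_eq_iff_I: "x \<in> cP \<Longrightarrow> y \<in> cP \<Longrightarrow> P x n - P y n \<in> I n \<longleftrightarrow> P x n = P y n"
  using Zi_I_eq[OF P_Zi P_Zi _ P_bounds(1)[of x n] P_bounds(2)[of x n] P_bounds(1)[of y n] P_bounds(2)[of y n]]
  by (auto simp: I_0)

lemma P_eq_down: assumes "x \<in> cP" "y \<in> cP" "P x n = P y n" "m \<le> n" shows "P x m = P y m"
proof -
  have "(P y n - P y m) - (P x n - P x m) \<in> I m" using assms by (intro I_diff P_cong)
  then have "P x m - P y m \<in> I m" using assms(3) by simp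
  then show ?thesis using P_eq_iff_I assms by blast
qed

lemma P_eq_digits: assumes x: "x \<in> cP" and y: "y \<in> cP"
  shows "P x n = P y n \<longleftrightarrow> (\<forall>k<n. x k = y k)"
proof
  assume e: "P x n = P y n"
  show "\<forall>k<n. x k = y k"
  proof (intro allI impI)
    fix k assume "k < n"
    then have "P x k = P y k" "P x (k + 1) = P y (k + 1)" by (auto intro: P_eq_down[OF x y e])
    then have "of_nat (x k) * pp k = of_nat (y k) * pp k" using P_Suc[OF x, of k] P_Suc[OF y, of k] by simp
    then show "x k = y k" by simp
  qed
next
  assume "\<forall>k<n. x k = y k"
  then show "P x n = P y n" unfolding padic_partial_def by (intro sum.cong) auto
qed

lemma P_inject: "x \<in> cP \<Longrightarrow> y \<in> cP \<Longrightarrow> (\<And>n. P x n = P y n) \<Longrightarrow> x = y"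
  using P_eq_digits by (metis ext less_add_one)

text \<open>Being eventually congruent to each truncation of \<open>x\<close> is convergence to
  \<open>x\<close> in terms of ideals, and it also excludes every other limit. This evaluates the
  description operator in \<open>padic_lim\<close>.\<close>

lemma padic_lim_eq:
  assumes x: "x \<in> cP" and l: "\<And>n. eventually (\<lambda>m. s m - P x n \<in> I n) sequentially"
  shows "padic_lim p s = x"
  unfolding padic_lim_def
proof (rule the_equality)
  show "x \<in> cP \<and> (\<lambda>m. rat_padic_abs p (s m - P x (int m))) \<longlonglongrightarrow> 0"
  proof (rule conjI[OF x], rule order_tendstoI)
    fix a :: real assume "0 > a"
    then show "eventually (\<lambda>m. a < rat_padic_abs p (s m - P x (int m))) sequentially"
      by (intro always_eventually allI) (rule less_le_trans[OF _ rat_padic_abs_nonneg])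
  next
    fix a :: real assume "0 < a"
    moreover have "1 / real p < 1" using p_gt_1 by simp
    ultimately obtain n where n: "(1 / real p) ^ n < a" using real_arch_pow_inv by blast
    have nn: "real p powi (- int n) = (1 / real p) ^ n" by (simp add: power_int_minus field_simps power_one_over)
    show "eventually (\<lambda>m. rat_padic_abs p (s m - P x (int m)) < a) sequentially"
      using l[of "int n"] eventually_ge_at_top[of n]
    proof eventually_elim
      fix m assume 1: "s m - P x (int n) \<in> I (int n)" and "n \<le> m"
      then have nm: "int n \<le> int m" by simp
      have "(s m - P x (int n)) - (P x (int m) - P x (int n)) \<in> I (int n)"
        by (rule I_diff[OF 1 P_cong[OF x nm]])
      then have "rat_padic_abs p (s m - P x (int m)) \<le> real p powi (- int n)"
        unfolding rat_padic_abs_le_iff by simp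
      then show "rat_padic_abs p (s m - P x (int m)) < a" using n nn by linarith
    qed
  qed
next
  fix y assume "y \<in> cP \<and> (\<lambda>m. rat_padic_abs p (s m - P y (int m))) \<longlonglongrightarrow> 0"
  then have y: "y \<in> cP" and ly: "(\<lambda>m. rat_padic_abs p (s m - P y (int m))) \<longlonglongrightarrow> 0" by auto
  show "y = x"
  proof (rule P_inject[OF y x])
    fix n
    have "real p powi (- n) > 0" using p_gt_1 by simp
    then have "eventually (\<lambda>m. rat_padic_abs p (s m - P y (int m)) < real p powi (- n)) sequentially"
      using ly by (intro order_tendstoD(2)) auto
    then have "eventually (\<lambda>m. P y n - P x n \<in> I n) sequentially"
      using l[of n] eventually_ge_at_top[of "nat n"]
    proof eventually_elim
      fix m assume "rat_padic_abs p (s m - P y (int m)) < real p powi (- n)" and 2: "s m - P x n \<in> I n" "nat n \<le> m"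
      then have 1: "s m - P y (int m) \<in> I n" by (simp flip: rat_padic_abs_le_iff)
      have "P y (int m) - P y n \<in> I n" using 2 by (intro P_cong y) auto
      then have "(s m - P x n) - ((s m - P y (int m)) + (P y (int m) - P y n)) \<in> I n"
        by (rule I_diff[OF 2(1) I_add[OF 1]])
      then show "P y n - P x n \<in> I n" by simp
    qed
    then have "P y n - P x n \<in> I n" by simp
    then show "P y n = P x n" using P_eq_iff_I[OF y x] by simp
  qed
qed

text \<open>Completeness. The sequence eventually has a constant residue \<open>a n\<close> in
  \<open>[0, pp n)\<close> modulo \<open>I n\<close>; consecutive residues differ by a digit times
  \<open>pp n\<close>, and these digits are the expansion of the limit.\<close>

lemma padic_lim_exists:
  assumes c: "\<And>n. \<exists>M. \<forall>m\<ge>M. s m - s M \<in> I n"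
  shows "\<exists>x\<in>cP. \<forall>n. eventually (\<lambda>m. s m - P x n \<in> I n) sequentially"
proof -
  have "\<exists>a. a \<in> Zi \<and> 0 \<le> a \<and> a < pp n \<and> eventually (\<lambda>m. s m - a \<in> I n) sequentially" for n
  proof -
    obtain M where M: "\<And>m. m \<ge> M \<Longrightarrow> s m - s M \<in> I n" using c by blast
    obtain a where a: "a \<in> Zi" "0 \<le> a" "a < pp n" "s M - a \<in> I n" using reduce by blast
    have "eventually (\<lambda>m. s m - a \<in> I n) sequentially"
      using eventually_ge_at_top[of M]
    proof eventually_elim
      fix m assume "M \<le> m"
      then have "(s m - s M) + (s M - a) \<in> I n" using M a(4) by (intro I_add) auto
      then show "s m - a \<in> I n" by simp
    qed
    then show ?thesis using a by blast
  qed
  then obtain a where a: "\<And>n. a n \<in> Zi" "\<And>n. 0 \<le> a n" "\<And>n. a n < pp n"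
    "\<And>n. eventually (\<lambda>m. s m - a n \<in> I n) sequentially" by metis
  have ad: "\<exists>d. d < p \<and> a (n + 1) = a n + of_nat d * pp n" for n
  proof -
    have "eventually (\<lambda>m. a (n + 1) - a n \<in> I n) sequentially"
      using a(4)[of n] a(4)[of "n + 1"]
    proof eventually_elim
      fix m assume 1: "s m - a n \<in> I n" and "s m - a (n + 1) \<in> I (n + 1)"
      then have "s m - a (n + 1) \<in> I n" using I_mono[of n "n + 1"] by simp
      then have "(s m - a n) - (s m - a (n + 1)) \<in> I n" using I_diff[OF 1] by blast
      then show "a (n + 1) - a n \<in> I n" by simp
    qed
    then have "a (n + 1) - a n \<in> I n" by simp
    then obtain d where d: "a (n + 1) - a n = of_int d * pp n" using Zi_I[OF Zi_diff[OF a(1) a(1)]] by blast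
    have "(-1) * pp n < of_int d * pp n" using d a(2)[of "n + 1"] a(3)[of n] by simp
    then have "(-1::rat) < of_int d" using mult_right_less_imp_less[OF _ less_imp_le[OF pp_pos]] by blast
    moreover have "of_int d * pp n < of_nat p * pp n" unfolding d[symmetric]
      using a(3)[of "n + 1"] a(2)[of n] pp_Suc[of n] by (simp add: mult.commute)
    then have "of_int d < (of_nat p :: rat)" using mult_right_less_imp_less[OF _ less_imp_le[OF pp_pos]] by blast
    ultimately have "0 \<le> d" "d < int p" by linarith+
    then show ?thesis using d by (intro exI[of _ "nat d"]) (auto simp: algebra_simps)
  qed
  then obtain x where x: "\<And>n. x n < p" "\<And>n. a (n + 1) = a n + of_nat (x n) * pp n" by metis
  obtain M where M: "\<And>m. m \<ge> M \<Longrightarrow> s m - s M \<in> I 0" using c by blast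
  obtain k0 where k0: "s M \<in> I k0" using I_exists by blast
  \<comment> \<open>Modulo \<open>I n\<close> with \<open>n \<le> k\<close> both \<open>s M\<close>
    and the later changes of the sequence vanish. Hence the residues are 0 there and only finitely
    many negative powers of \<open>p\<close> occur.\<close>
  define k where "k = min k0 0"
  have a0: "a n = 0" if "n \<le> k" for n
  proof -
    have "eventually (\<lambda>m. a n - 0 \<in> I n) sequentially"
      using a(4)[of n] eventually_ge_at_top[of M]
    proof eventually_elim
      fix m assume 1: "s m - a n \<in> I n" and "M \<le> m"
      then have "s m - s M \<in> I n" using M I_mono[of n 0] that by (simp add: k_def)
      moreover have "s M \<in> I n" using k0 I_mono[of n k0] that by (simp add: k_def)
      ultimately have "(s m - s M) + s M \<in> I n" by (rule I_add)
      then have "((s m - s M) + s M) - (s m - a n) \<in> I n" using 1 by (rule I_diff)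
      then show "a n - 0 \<in> I n" by simp
    qed
    then have "a n - 0 \<in> I n" by simp
    then show ?thesis using Zi_I_eq[OF a(1) Zi_int[of 0], of n n] a by simp
  qed
  have x0: "x n = 0" if "n < k" for n
    using x(2)[of n] a0[of n] a0[of "n + 1"] that by simp
  have xc: "x \<in> cP" unfolding padic_carrier_def using x(1) x0 by auto
  have Pa: "P x n = a n" for n
  proof (cases "n \<le> k")
    case True then show ?thesis using a0 P_eq_0[of n x] x0 by simp
  next
    case False
    then have "k \<le> n" by simp
    then show ?thesis
    proof (induction n rule: int_ge_induct)
      case base then show ?case using a0 P_eq_0[of k x] x0 by simp
    next
      case (step i) then show ?case by (simp add: P_Suc[OF xc] x(2))
    qed
  qed
  show ?thesis by (intro bexI[OF _ xc] allI) (simp only: Pa a(4))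
qed

lemma padic_limI:
  assumes "\<And>n. \<exists>M. \<forall>m\<ge>M. s m - s M \<in> I n"
  shows "padic_lim p s \<in> cP" "eventually (\<lambda>m. s m - P (padic_lim p s) n \<in> I n) sequentially"
  using padic_lim_exists[OF assms] padic_lim_eq[of _ s] by auto

subsection \<open>Arithmetic of p-adic numbers\<close>

lemma P_eqI:
  assumes "x \<in> cP" "y \<in> cP" "\<And>n. P x n - c n \<in> I n" "\<And>n. P y n - c n \<in> I n"
  shows "x = y"
proof (rule P_inject[OF assms(1,2)])
  fix n
  have "(P x n - c n) - (P y n - c n) \<in> I n" by (rule I_diff[OF assms(3,4)])
  then show "P x n = P y n" using P_eq_iff_I[OF assms(1,2)] by simp
qed

lemma padic_lim_cong:
  assumes c: "\<And>n. \<exists>M. \<forall>m\<ge>M. s m - s M \<in> I n"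
    and e: "eventually (\<lambda>m. s m - c \<in> I n) sequentially"
  shows "P (padic_lim p s) n - c \<in> I n"
proof -
  have "eventually (\<lambda>m. P (padic_lim p s) n - c \<in> I n) sequentially"
    using e padic_limI(2)[OF c, of n]
  proof eventually_elim
    fix m assume "s m - c \<in> I n" "s m - P (padic_lim p s) n \<in> I n"
    then have "(s m - c) - (s m - P (padic_lim p s) n) \<in> I n" by (rule I_diff)
    then show "P (padic_lim p s) n - c \<in> I n" by simp
  qed
  then show ?thesis by simp
qed

lemma P_Cauchy: "x \<in> cP \<Longrightarrow> m \<ge> nat n \<Longrightarrow> P x (int m) - P x (int (nat n)) \<in> I n"
  by (rule I_mono[OF _ P_cong]) auto

lemma P_eventually: "x \<in> cP \<Longrightarrow> eventually (\<lambda>m. P x (int m) - P x n \<in> I n) sequentially"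
  using eventually_ge_at_top[of "nat n"] by eventually_elim (auto intro: P_cong)

abbreviation G :: "padic monoid" where "G \<equiv> add_monoid (Qp p)"
abbreviation R :: "rat \<Rightarrow> padic" where "R \<equiv> padic_of_rat p"

lemma G_carrier [simp]: "carrier G = cP" by (simp add: Qp_def)

text \<open>The congruence replaces any computation with carries. Beyond \<open>nat n\<close> the
  partial sums no longer change modulo \<open>I n\<close>, which gives the Cauchy condition.\<close>

lemma G_mult:
  assumes "x \<in> cP" "y \<in> cP"
  shows G_mult_closed: "x \<otimes>\<^bsub>G\<^esub> y \<in> cP"
    and P_G_mult: "P (x \<otimes>\<^bsub>G\<^esub> y) n - (P x n + P y n) \<in> I n"
proof -
  let ?s = "\<lambda>m. P x (int m) + P y (int m)"
  have e: "x \<otimes>\<^bsub>G\<^esub> y = padic_lim p ?s" by (simp add: Qp_def)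
  have c: "\<exists>M. \<forall>m\<ge>M. ?s m - ?s M \<in> I n" for n
  proof (intro exI allI impI)
    fix m assume "nat n \<le> m"
    from I_add[OF P_Cauchy[OF assms(1) this] P_Cauchy[OF assms(2) this]]
    show "?s m - ?s (nat n) \<in> I n" by (simp add: algebra_simps)
  qed
  show "x \<otimes>\<^bsub>G\<^esub> y \<in> cP" unfolding e by (rule padic_limI(1)[OF c])
  show "P (x \<otimes>\<^bsub>G\<^esub> y) n - (P x n + P y n) \<in> I n"
    unfolding e
  proof (rule padic_lim_cong[OF c])
    show "\<forall>\<^sub>F m in sequentially. ?s m - (P x n + P y n) \<in> I n"
      using P_eventually[OF assms(1)] P_eventually[OF assms(2)]
    proof eventually_elim
      fix m assume "P x (int m) - P x n \<in> I n" "P y (int m) - P y n \<in> I n"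
      from I_add[OF this] show "?s m - (P x n + P y n) \<in> I n" by (simp add: algebra_simps)
    qed
  qed
qed

lemma R_rat: shows R_carrier: "R q \<in> cP" and P_R: "P (R q) n - q \<in> I n"
proof -
  have c: "\<exists>M. \<forall>m\<ge>M. (\<lambda>_. q) m - (\<lambda>_. q) M \<in> I n" for n :: int and M :: nat by (simp add: I_0)
  show "R q \<in> cP" unfolding padic_of_rat_def by (rule padic_limI(1)[OF c])
  show "P (R q) n - q \<in> I n" unfolding padic_of_rat_def by (rule padic_lim_cong[OF c]) (simp add: I_0)
qed

lemma zero_carrier: "(\<lambda>_. 0) \<in> cP" by (simp add: padic_carrier_def)

lemma R_0: "R 0 = (\<lambda>_. 0)"
proof (rule P_eqI[OF R_carrier zero_carrier, where c="\<lambda>_. 0"])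
  show "P (R 0) n - 0 \<in> I n" for n by (rule P_R)
  show "P (\<lambda>_. 0) n - 0 \<in> I n" for n by (simp add: P_eq_0 I_0)
qed

lemma G_one: "\<one>\<^bsub>G\<^esub> = (\<lambda>_. 0)" by (simp add: Qp_def R_0)

lemma G_eqI:
  assumes "x \<in> cP" "y \<in> cP" "z \<in> cP" "\<And>n. P z n - (P x n + P y n) \<in> I n"
  shows "x \<otimes>\<^bsub>G\<^esub> y = z"
  by (rule P_eqI[OF G_mult_closed[OF assms(1,2)] assms(3) P_G_mult[OF assms(1,2)] assms(4)])

text \<open>A negative is obtained as a limit of rational numbers, its expansion being infinite in
  general.\<close>

lemma neg_exists: assumes "x \<in> cP" shows "\<exists>y\<in>cP. y \<otimes>\<^bsub>G\<^esub> x = \<one>\<^bsub>G\<^esub>"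
proof -
  let ?s = "\<lambda>m. - P x (int m)"
  have c: "\<exists>M. \<forall>m\<ge>M. ?s m - ?s M \<in> I n" for n
  proof (intro exI allI impI)
    fix m assume "nat n \<le> m"
    from I_minus[OF P_Cauchy[OF assms this]] show "?s m - ?s (nat n) \<in> I n" by simp
  qed
  have y: "padic_lim p ?s \<in> cP" by (rule padic_limI(1)[OF c])
  have "P (padic_lim p ?s) n - (- P x n) \<in> I n" for n
  proof (rule padic_lim_cong[OF c])
    show "\<forall>\<^sub>F m in sequentially. ?s m - (- P x n) \<in> I n"
      using P_eventually[OF assms]
    proof eventually_elim
      fix m assume "P x (int m) - P x n \<in> I n"
      from I_minus[OF this] show "?s m - (- P x n) \<in> I n" by simp
    qed
  qed
  from I_minus[OF this] have "P (\<lambda>_. 0) n - (P (padic_lim p ?s) n + P x n) \<in> I n" for n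
    by (simp add: P_eq_0)
  then have "padic_lim p ?s \<otimes>\<^bsub>G\<^esub> x = (\<lambda>_. 0)" by (rule G_eqI[OF y assms zero_carrier])
  then show ?thesis by (intro bexI[OF _ y]) (simp only: G_one)
qed

lemma G_comm: "x \<in> cP \<Longrightarrow> y \<in> cP \<Longrightarrow> x \<otimes>\<^bsub>G\<^esub> y = y \<otimes>\<^bsub>G\<^esub> x"
  by (simp add: Qp_def add.commute)

lemma G_assoc:
  assumes "x \<in> cP" "y \<in> cP" "z \<in> cP"
  shows "(x \<otimes>\<^bsub>G\<^esub> y) \<otimes>\<^bsub>G\<^esub> z = x \<otimes>\<^bsub>G\<^esub> (y \<otimes>\<^bsub>G\<^esub> z)"
proof (rule P_eqI[where c="\<lambda>n. P x n + P y n + P z n"])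
  note xy = G_mult_closed[OF assms(1,2)] and yz = G_mult_closed[OF assms(2,3)]
  show "(x \<otimes>\<^bsub>G\<^esub> y) \<otimes>\<^bsub>G\<^esub> z \<in> cP" by (rule G_mult_closed[OF xy assms(3)])
  show "x \<otimes>\<^bsub>G\<^esub> (y \<otimes>\<^bsub>G\<^esub> z) \<in> cP" by (rule G_mult_closed[OF assms(1) yz])
  fix n
  from I_add[OF P_G_mult[OF xy assms(3)] P_G_mult[OF assms(1,2)], of n]
  show "P ((x \<otimes>\<^bsub>G\<^esub> y) \<otimes>\<^bsub>G\<^esub> z) n - (P x n + P y n + P z n) \<in> I n"
    by (simp add: algebra_simps del: monoid.simps)
  from I_add[OF P_G_mult[OF assms(1) yz] P_G_mult[OF assms(2,3)], of n]
  show "P (x \<otimes>\<^bsub>G\<^esub> (y \<otimes>\<^bsub>G\<^esub> z)) n - (P x n + P y n + P z n) \<in> I n"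
    by (simp add: algebra_simps del: monoid.simps)
qed

lemma G_comm_group: "comm_group G"
proof (rule comm_groupI)
  fix x assume x: "x \<in> carrier G"
  then have x': "x \<in> cP" by (simp only: G_carrier)
  show "\<one>\<^bsub>G\<^esub> \<otimes>\<^bsub>G\<^esub> x = x" unfolding G_one
    by (rule G_eqI[OF zero_carrier x' x']) (simp add: P_eq_0 I_0)
  show "\<exists>y\<in>carrier G. y \<otimes>\<^bsub>G\<^esub> x = \<one>\<^bsub>G\<^esub>" using neg_exists[OF x'] by (simp only: G_carrier)
qed (simp_all only: G_carrier G_one zero_carrier G_mult_closed G_assoc, rule G_comm)

lemma G_group: "group G" using G_comm_group by (rule comm_group.axioms(2))

lemma G_inv_closed: "y \<in> cP \<Longrightarrow> inv\<^bsub>G\<^esub> y \<in> cP"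
  using group.inv_closed[OF G_group, of y] by (simp only: G_carrier)

lemma G_r_inv: "y \<in> cP \<Longrightarrow> y \<otimes>\<^bsub>G\<^esub> inv\<^bsub>G\<^esub> y = \<one>\<^bsub>G\<^esub>"
  using group.r_inv[OF G_group, of y] by (simp only: G_carrier)

lemma P_inv: assumes "y \<in> cP" shows "P (inv\<^bsub>G\<^esub> y) n + P y n \<in> I n"
proof -
  have "P (y \<otimes>\<^bsub>G\<^esub> inv\<^bsub>G\<^esub> y) n - (P y n + P (inv\<^bsub>G\<^esub> y) n) \<in> I n"
    by (rule P_G_mult[OF assms G_inv_closed[OF assms]])
  then have "- (P y n + P (inv\<^bsub>G\<^esub> y) n) \<in> I n"
    unfolding G_r_inv[OF assms] G_one by (simp add: P_eq_0)
  from I_minus[OF this] show ?thesis by (simp add: add.commute)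
qed

definition sub :: "padic \<Rightarrow> padic \<Rightarrow> padic" where "sub x y = x \<otimes>\<^bsub>G\<^esub> inv\<^bsub>G\<^esub> y"

lemma a_minus_eq_sub: "x \<ominus>\<^bsub>Qp p\<^esub> y = sub x y"
  by (simp add: sub_def a_minus_def a_inv_def)

lemma sub_closed: "x \<in> cP \<Longrightarrow> y \<in> cP \<Longrightarrow> sub x y \<in> cP"
  unfolding sub_def by (intro G_mult_closed G_inv_closed)

lemma P_sub:
  assumes "x \<in> cP" "y \<in> cP" shows "P (sub x y) n - (P x n - P y n) \<in> I n"
  using I_add[OF P_G_mult[OF assms(1) G_inv_closed[OF assms(2)]] P_inv[OF assms(2)], of n]
  by (simp add: sub_def algebra_simps del: monoid.simps)

lemma P_zero_iff: "x \<in> cP \<Longrightarrow> P x n = 0 \<longleftrightarrow> (\<forall>k<n. x k = 0)"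
  using P_eq_digits[OF _ zero_carrier, of x n] by (simp add: P_eq_0)

lemma P_in_I_iff: "x \<in> cP \<Longrightarrow> P x n \<in> I n \<longleftrightarrow> P x n = 0"
  using P_eq_iff_I[OF _ zero_carrier, of x n] by (simp add: P_eq_0)

lemma P_in_I: "x \<in> cP \<Longrightarrow> P x n = 0 \<Longrightarrow> n \<le> m \<Longrightarrow> P x m \<in> I n"
  using P_cong[of x n m] by simp

lemma P_in_I_D: assumes "x \<in> cP" "P x m \<in> I n" "n \<le> m" shows "P x n = 0"
proof -
  have "P x m - (P x m - P x n) \<in> I n" by (rule I_diff[OF assms(2) P_cong[OF assms(1,3)]])
  then show ?thesis using P_in_I_iff[OF assms(1)] by simp
qed

lemma sub_zero_iff:
  assumes "x \<in> cP" "y \<in> cP" shows "P (sub x y) n = 0 \<longleftrightarrow> P x n = P y n"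
proof -
  have "P (sub x y) n \<in> I n \<longleftrightarrow> P x n - P y n \<in> I n"
    using I_diff[OF _ P_sub[OF assms], of "P (sub x y) n" n] I_add[OF _ P_sub[OF assms], of "P x n - P y n" n] by auto
  then show ?thesis using P_in_I_iff[OF sub_closed[OF assms]] P_eq_iff_I[OF assms] by simp
qed

lemma Zp_iff: "x \<in> Zp p \<longleftrightarrow> x \<in> cP \<and> P x 0 = 0"
  using P_zero_iff[of x 0] by (auto simp: Zp_def)

lemma sub_Zp_iff: "x \<in> cP \<Longrightarrow> y \<in> cP \<Longrightarrow> sub x y \<in> Zp p \<longleftrightarrow> P x 0 = P y 0"
  using sub_zero_iff[of x y 0] by (auto simp: Zp_iff sub_closed)

lemma G_mult_sub: "x \<in> cP \<Longrightarrow> y \<in> cP \<Longrightarrow> y \<otimes>\<^bsub>G\<^esub> sub x y = x"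
proof -
  assume x: "x \<in> cP" and y: "y \<in> cP"
  have "- (P (sub x y) n - (P x n - P y n)) \<in> I n" for n by (rule I_minus[OF P_sub[OF x y]])
  then have "P x n - (P y n + P (sub x y) n) \<in> I n" for n by (simp add: algebra_simps)
  then show "y \<otimes>\<^bsub>G\<^esub> sub x y = x" by (rule G_eqI[OF y sub_closed[OF x y] x])
qed

lemma R_add: "R (q + r) = R q \<otimes>\<^bsub>G\<^esub> R r"
proof (rule P_eqI[OF R_carrier G_mult_closed[OF R_carrier R_carrier] P_R])
  fix n
  have "(P (R q \<otimes>\<^bsub>G\<^esub> R r) n - (P (R q) n + P (R r) n)) + ((P (R q) n - q) + (P (R r) n - r)) \<in> I n"
    by (intro I_add P_R P_G_mult R_carrier)
  then show "P (R q \<otimes>\<^bsub>G\<^esub> R r) n - (q + r) \<in> I n" by (simp add: algebra_simps del: monoid.simps)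
qed

lemma R_Zp_iff: "R q \<in> Zp p \<longleftrightarrow> q \<in> zl"
proof -
  have "P (R q) 0 \<in> I 0 \<longleftrightarrow> q \<in> I 0"
    using I_diff[OF _ P_R[of q 0], of "P (R q) 0"] I_add[OF _ P_R[of q 0], of q] by auto
  then show ?thesis using P_in_I_iff[OF R_carrier, of q 0] by (simp add: Zp_iff R_carrier I_zero_eq)
qed

lemma P_R_eq: "q \<in> Zi \<Longrightarrow> 0 \<le> q \<Longrightarrow> q < pp m \<Longrightarrow> P (R q) m = q"
  using Zi_I_eq[OF P_Zi _ P_R P_bounds[OF R_carrier]] .

subsection \<open>The pairing of the p-adic numbers with themselves\<close>

definition E :: "rat \<Rightarrow> complex" where "E q = cis (2 * pi * of_rat q)"

lemma E_add: "E (q + r) = E q * E r"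
  by (simp add: E_def of_rat_add cis_mult distrib_left)

lemma E_eq_1_iff: "E q = 1 \<longleftrightarrow> q \<in> \<int>"
proof
  assume "E q = 1"
  then have "cos (2 * pi * of_rat q) = 1" by (simp add: E_def complex_eq_iff)
  then obtain n :: int where "2 * pi * of_rat q = of_int n * 2 * pi" by (auto simp: cos_one_2pi_int)
  then have "(of_rat q :: real) = of_rat (of_int n)" by simp
  then have "q = of_int n" by (simp only: of_rat_eq_iff)
  then show "q \<in> \<int>" by simp
next
  assume "q \<in> \<int>"
  then obtain n where "q = of_int n" by (auto elim: Ints_cases)
  then show "E q = 1" by (simp add: E_def cis_multiple_2pi)
qed

text \<open>On \<open>Z[1/p]\<close> a difference that is a p-adic integer is an ordinary integer,
  so the character of the rationals may be evaluated on any representative modulo the p-adic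
  integers.\<close>

lemma E_cong: assumes "q \<in> Zi" "r \<in> Zi" "q - r \<in> I 0" shows "E q = E r"
proof -
  have "q - r \<in> \<int>" using assms by (intro Zi_zl Zi_diff) (auto simp: I_zero_eq)
  then have "E (q - r) = 1" by (simp add: E_eq_1_iff)
  then show ?thesis using E_add[of "q - r" r] by simp
qed

text \<open>The pairing carries the sign used in the definition of the Feichtinger algebra; the
  characters of the theorem are its conjugates and appear below as
  \<open>cnj (chi x y)\<close>.\<close>

definition chi :: "padic \<Rightarrow> padic \<Rightarrow> complex" where
  "chi x y = cis (2 * pi * padic_frac p (x \<otimes>\<^bsub>Qp p\<^esub> y))"

lemma P_bounded: assumes "x \<in> cP" shows "\<exists>k. \<forall>m. P x m \<in> I k"
proof -
  obtain N where N: "\<forall>k<N. x k = 0" using carrier_bound[OF assms] by blast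
  then have PN: "P x m = 0" if "m \<le> N" for m using that by (intro P_eq_0) auto
  have "P x m \<in> I N" for m
  proof (cases "m \<le> N")
    case True then show ?thesis by (simp add: PN I_0)
  next
    case False then show ?thesis using P_in_I[OF assms PN[of N]] by simp
  qed
  then show ?thesis by blast
qed

text \<open>The character sees the limit that defines the product only modulo p-adic integers, so
  one late product of partial sums computes it. Bilinearity of the pairing then reduces to
  bilinearity over the rationals.\<close>

lemma chi_eventually:
  assumes x: "x \<in> cP" and y: "y \<in> cP"
  shows "eventually (\<lambda>m. chi x y = E (P x (int m) * P y (int m))) sequentially"
proof -
  let ?s = "\<lambda>m. P x (int m) * P y (int m)"
  obtain k where k: "\<And>m. P x m \<in> I k" using P_bounded[OF x] by blast
  obtain l where l: "\<And>m. P y m \<in> I l" using P_bounded[OF y] by blast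
  have c: "\<exists>M. \<forall>m\<ge>M. ?s m - ?s M \<in> I n" for n
  proof (intro exI allI impI)
    \<comment> \<open>The error of one factor is multiplied by the other one, whose valuation
      \<open>k\<close> or \<open>l\<close> may be negative; the shift by \<open>min k l\<close>
      makes up for it.\<close>
    let ?M = "nat (n - min k l)"
    fix m assume m: "?M \<le> m"
    have "(P x (int m) - P x (int ?M)) * P y (int m) \<in> I (int ?M + l)"
      using m by (intro I_mult P_cong x l) auto
    moreover have "P x (int ?M) * (P y (int m) - P y (int ?M)) \<in> I (k + int ?M)"
      using m by (intro I_mult P_cong y k) auto
    moreover have "n \<le> int ?M + l" "n \<le> k + int ?M" by auto
    ultimately have "(P x (int m) - P x (int ?M)) * P y (int m) + P x (int ?M) * (P y (int m) - P y (int ?M)) \<in> I n"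
      by (meson I_add I_mono)
    then show "?s m - ?s ?M \<in> I n" by (simp add: algebra_simps)
  qed
  have e: "x \<otimes>\<^bsub>Qp p\<^esub> y = padic_lim p ?s" by (simp add: Qp_def)
  show ?thesis using padic_limI(2)[OF c, of 0]
  proof eventually_elim
    fix m assume "?s m - P (padic_lim p ?s) 0 \<in> I 0"
    then have "E (?s m) = E (P (padic_lim p ?s) 0)" by (intro E_cong Zi_mult P_Zi)
    then show "chi x y = E (?s m)" unfolding chi_def e padic_frac_def by (simp add: E_def)
  qed
qed

lemma chi_commute: "chi x y = chi y x"
  by (simp add: chi_def Qp_def mult.commute)

lemma chi_norm [simp]: "cmod (chi x y) = 1"
  by (simp add: chi_def)

lemma chi_mult_right:
  assumes x: "x \<in> cP" and y: "y \<in> cP" and z: "z \<in> cP"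
  shows "chi x (y \<otimes>\<^bsub>G\<^esub> z) = chi x y * chi x z"
proof -
  obtain k where k: "\<And>m. P x m \<in> I k" using P_bounded[OF x] by blast
  have "eventually (\<lambda>m::nat. chi x (y \<otimes>\<^bsub>G\<^esub> z) = chi x y * chi x z) sequentially"
    using chi_eventually[OF x G_mult_closed[OF y z]] chi_eventually[OF x y] chi_eventually[OF x z]
      eventually_ge_at_top[of "nat (- k)"]
  proof eventually_elim
    fix m
    assume 1: "chi x (y \<otimes>\<^bsub>G\<^esub> z) = E (P x (int m) * P (y \<otimes>\<^bsub>G\<^esub> z) (int m))"
      "chi x y = E (P x (int m) * P y (int m))" "chi x z = E (P x (int m) * P z (int m))" and m: "nat (- k) \<le> m"
    have "P x (int m) * (P (y \<otimes>\<^bsub>G\<^esub> z) (int m) - (P y (int m) + P z (int m))) \<in> I (k + int m)"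
      by (intro I_mult k P_G_mult y z)
    then have "P x (int m) * (P (y \<otimes>\<^bsub>G\<^esub> z) (int m) - (P y (int m) + P z (int m))) \<in> I 0"
      by (rule I_mono[rotated]) (use m in simp)
    then have "E (P x (int m) * P (y \<otimes>\<^bsub>G\<^esub> z) (int m)) = E (P x (int m) * (P y (int m) + P z (int m)))"
      by (intro E_cong Zi_mult Zi_add P_Zi) (simp only: right_diff_distrib)
    then show "chi x (y \<otimes>\<^bsub>G\<^esub> z) = chi x y * chi x z" by (simp only: 1 E_add distrib_left)
  qed
  then show ?thesis by simp
qed

lemma chi_mult_left: "x \<in> cP \<Longrightarrow> y \<in> cP \<Longrightarrow> z \<in> cP \<Longrightarrow> chi (x \<otimes>\<^bsub>G\<^esub> y) z = chi x z * chi y z"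
  using chi_mult_right[of z x y] by (simp only: chi_commute[of z])

text \<open>Valuations add: \<open>x\<close> has valuation at least \<open>k\<close> and
  \<open>y\<close> at least \<open>n\<close>, so the product is a p-adic integer.\<close>

lemma chi_trivial:
  assumes x: "x \<in> cP" and y: "y \<in> cP" and k: "\<And>m. P x m \<in> I k" and n: "P y n = 0" and nk: "0 \<le> k + n"
  shows "chi x y = 1"
proof -
  have "eventually (\<lambda>m::nat. chi x y = 1) sequentially"
    using chi_eventually[OF x y] eventually_ge_at_top[of "nat n"]
  proof eventually_elim
    fix m assume c: "chi x y = E (P x (int m) * P y (int m))" and m: "nat n \<le> m"
    have "P x (int m) * P y (int m) \<in> I (k + n)" using m by (intro I_mult k P_in_I y n) auto
    then have "P x (int m) * P y (int m) \<in> I 0" by (rule I_mono[OF nk])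
    then have "P x (int m) * P y (int m) \<in> \<int>" by (intro Zi_zl Zi_mult P_Zi) (simp add: I_zero_eq)
    then show "chi x y = 1" unfolding c by (simp add: E_eq_1_iff)
  qed
  then show ?thesis by simp
qed

lemma Zp_P: assumes "x \<in> Zp p" shows "P x m \<in> I 0"
proof (cases "0 \<le> m")
  case True then show ?thesis using assms P_in_I[of x 0 m] by (simp add: Zp_iff)
next
  case False
  then have "P x m = 0" using assms by (intro P_eq_0) (simp add: Zp_def)
  then show ?thesis by (simp add: I_0)
qed

lemma chi_Zp: "x \<in> Zp p \<Longrightarrow> y \<in> Zp p \<Longrightarrow> chi x y = 1"
  using chi_trivial[of x y 0 0] Zp_P[of x] by (simp add: Zp_iff)

text \<open>If all truncations of \<open>x\<close> lie in \<open>I k\<close>, changing the other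
  argument by a multiple of \<open>p^-k\<close> changes the product by a p-adic integer.\<close>

lemma chi_locally_constant:
  assumes x: "x \<in> cP"
  shows "\<exists>n\<ge>0. \<forall>u\<in>cP. \<forall>v\<in>cP. P u n = P v n \<longrightarrow> chi x u = chi x v"
proof -
  obtain k where k: "\<And>m. P x m \<in> I k" using P_bounded[OF x] by blast
  show ?thesis
  proof (intro exI[of _ "max 0 (- k)"] conjI ballI impI)
    fix u v assume u: "u \<in> cP" and v: "v \<in> cP" and e: "P u (max 0 (- k)) = P v (max 0 (- k))"
    have "chi x (sub u v) = 1"
      by (rule chi_trivial[OF x sub_closed[OF u v] k, of "max 0 (- k)"]) (use e sub_zero_iff[OF u v] in auto)
    then show "chi x u = chi x v"
      using chi_mult_right[OF x v sub_closed[OF u v]] by (simp only: G_mult_sub[OF u v] mult_1_right)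
  qed simp
qed

text \<open>Late partial sums of \<open>R 1\<close> equal 1, so a trivial value makes late partial
  sums of \<open>x\<close> integers. The element 1 will serve as the translation that makes the mean
  of a nontrivial character on a coset vanish.\<close>

lemma chi_one_ne: assumes x: "x \<in> cP" "x \<notin> Zp p" shows "chi x (R 1) \<noteq> 1"
proof
  assume c: "chi x (R 1) = 1"
  have "eventually (\<lambda>m::nat. P x 0 = 0) sequentially"
    using chi_eventually[OF x(1) R_carrier[of 1]] eventually_ge_at_top[of 1]
  proof eventually_elim
    fix m :: nat assume e: "chi x (R 1) = E (P x (int m) * P (R 1) (int m))" and "1 \<le> m"
    then have "1 * pp 1 \<le> pp (int m)" using pp_mono[of 1 "int m"] by simp
    have "1 < pp (int m)"
    proof -
      have "1 < (of_nat p :: rat)" using p_gt_1 by simp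
      moreover have "pp 1 = of_nat p" by (simp add: pp_def)
      ultimately show ?thesis using \<open>1 * pp 1 \<le> pp (int m)\<close> by simp
    qed
    then have "P (R 1) (int m) = 1" using Zi_int[of 1] by (intro P_R_eq) auto
    then have "P x (int m) \<in> \<int>" using e c by (simp add: E_eq_1_iff)
    then have "P x (int m) \<in> I 0" using I_int by (auto elim: Ints_cases)
    then show "P x 0 = 0" by (rule P_in_I_D[OF x(1)]) simp
  qed
  then show False using x by (simp add: Zp_iff)
qed

text \<open>The product with \<open>pp (- n)\<close> is a p-adic integer exactly when
  \<open>u\<close> is divisible by \<open>p^n\<close>. Characters therefore detect congruences,
  which will exhibit balls as level sets.\<close>

lemma chi_scaled_eq_1_iff:
  assumes u: "u \<in> Zp p" and n: "0 \<le> n"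
  shows "chi (R (pp (- n))) u = 1 \<longleftrightarrow> P u n = 0"
proof
  have uc: "u \<in> cP" using u by (simp add: Zp_iff)
  have pe: "P (R (pp (- n))) (int m) = pp (- n)" if "m \<ge> 1" for m
  proof (rule P_R_eq[OF pp_Zi])
    show "0 \<le> pp (- n)" by (simp add: less_imp_le)
    have "pp (- n) < pp (int m)" unfolding pp_def using p_gt_1 n that by (intro power_int_strict_increasing) auto
    then show "pp (- n) < pp (int m)" .
  qed
  {
    assume c: "chi (R (pp (- n))) u = 1"
    have "eventually (\<lambda>m::nat. P u n = 0) sequentially"
      using chi_eventually[OF R_carrier[of "pp (- n)"] uc] eventually_ge_at_top[of "max 1 (nat n)"]
    proof eventually_elim
      fix m assume e: "chi (R (pp (- n))) u = E (P (R (pp (- n))) (int m) * P u (int m))" and m: "max 1 (nat n) \<le> m"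
      then have "pp (- n) * P u (int m) \<in> \<int>" using c pe[of m] by (simp add: E_eq_1_iff)
      then have "P u (int m) \<in> I n" using zl_int by (auto simp: I_def mult.commute elim!: Ints_cases)
      then show "P u n = 0" by (rule P_in_I_D[OF uc]) (use m n in linarith)
    qed
    then show "P u n = 0" by simp
  next
    assume "P u n = 0"
    have "P (R (pp (- n))) m \<in> I (- n)" for m
    proof (cases "m \<ge> - n")
      case True
      have "(P (R (pp (- n))) m - pp (- n)) + pp (- n) \<in> I (- n)"
        using True by (intro I_add pp_I I_mono[OF _ P_R])
      then show ?thesis by simp
    next
      case False
      have "P (R (pp (- n))) m - pp (- n) \<in> I m" by (rule P_R)
      moreover have "pp (- n) \<in> I m" using False by (intro I_mono[OF _ pp_I]) simp
      ultimately have "(P (R (pp (- n))) m - pp (- n)) + pp (- n) \<in> I m" by (rule I_add)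
      then have "P (R (pp (- n))) m = 0" using P_in_I_iff[OF R_carrier] by simp
      then show ?thesis by (simp add: I_0)
    qed
    then show "chi (R (pp (- n))) u = 1" by (rule chi_trivial[OF R_carrier uc _ \<open>P u n = 0\<close>]) simp
  }
qed

subsection \<open>The topology\<close>

lemma P_cong_any: assumes "m \<le> n" shows "P x n - P x m \<in> I m"
proof (cases "finite {k. k < n \<and> x k \<noteq> 0}")
  case True
  have "{k. k < n \<and> x k \<noteq> 0} = {k. k < m \<and> x k \<noteq> 0} \<union> {k. m \<le> k \<and> k < n \<and> x k \<noteq> 0}"
    using assms by auto
  moreover have "finite {k. k < m \<and> x k \<noteq> 0}" "finite {k. m \<le> k \<and> k < n \<and> x k \<noteq> 0}"
    using assms by (auto intro: finite_subset[OF _ True])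
  then have "sum f ({k. k < m \<and> x k \<noteq> 0} \<union> {k. m \<le> k \<and> k < n \<and> x k \<noteq> 0})
     = sum f {k. k < m \<and> x k \<noteq> 0} + sum f {k. m \<le> k \<and> k < n \<and> x k \<noteq> 0}" for f :: "int \<Rightarrow> rat"
    by (rule sum.union_disjoint) auto
  ultimately have "P x n = P x m + (\<Sum>k | m \<le> k \<and> k < n \<and> x k \<noteq> 0. of_nat (x k) * of_nat p powi k)"
    unfolding padic_partial_def by (simp only:)
  moreover have "(\<Sum>k | m \<le> k \<and> k < n \<and> x k \<noteq> 0. of_nat (x k) * of_nat p powi k) \<in> I m"
  proof (rule I_sum)
    fix k assume "k \<in> {k. m \<le> k \<and> k < n \<and> x k \<noteq> 0}"
    then have k: "m \<le> k" by simp
    have "of_int (int (x k)) * pp k \<in> I (0 + k)" by (intro I_mult I_int pp_I)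
    then show "of_nat (x k) * of_nat p powi k \<in> I m" using I_mono[OF k] by (simp add: pp_def)
  qed
  ultimately show ?thesis by simp
next
  case False
  \<comment> \<open>Only finitely many indices lie between \<open>m\<close> and \<open>n\<close>, so
    both sums run over infinite sets and take the default value 0.\<close>
  have "{k. k < n \<and> x k \<noteq> 0} \<subseteq> {k. k < m \<and> x k \<noteq> 0} \<union> {m..<n}" by auto
  then have "infinite {k. k < m \<and> x k \<noteq> 0}"
    using False finite_subset[of "{k. k < n \<and> x k \<noteq> 0}" "{k. k < m \<and> x k \<noteq> 0} \<union> {m..<n}"]
    by (metis finite_UnI finite_atLeastLessThan_int)
  then show ?thesis using False by (simp add: padic_partial_def I_0)
qed

text \<open>A function that is not a valid expansion still acts in the operations like some p-adic
  number; this makes the distance symmetric on the whole type, as \<open>Metric_space\<close> requires.\<close>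

lemma canonical_rep: "\<exists>y\<in>cP. \<forall>n. P y n - P x n \<in> I n"
proof -
  have c: "\<exists>M. \<forall>m\<ge>M. P x (int m) - P x (int M) \<in> I n" for n
    by (rule exI[of _ "nat n"], intro allI impI, rule I_mono[OF _ P_cong_any]) auto
  show ?thesis
  proof (rule bexI[OF _ padic_limI(1)[OF c]], rule allI, rule padic_lim_cong[OF c])
    fix n show "eventually (\<lambda>m. P x (int m) - P x n \<in> I n) sequentially"
      using eventually_ge_at_top[of "nat n"] by eventually_elim (auto intro: P_cong_any)
  qed
qed

definition canon :: "padic \<Rightarrow> padic" where
  "canon x = (SOME y. y \<in> cP \<and> (\<forall>n. P y n - P x n \<in> I n))"

lemma canon: "canon x \<in> cP" "P (canon x) n - P x n \<in> I n"
proof -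
  have "\<exists>y. y \<in> cP \<and> (\<forall>n. P y n - P x n \<in> I n)" using canonical_rep[of x] by auto
  from someI_ex[OF this] show "canon x \<in> cP" "P (canon x) n - P x n \<in> I n" by (auto simp: canon_def)
qed

lemma canon_id: "x \<in> cP \<Longrightarrow> canon x = x"
  by (rule P_eqI[OF canon(1) _ canon(2)]) (auto simp: I_0)

lemma G_mult_canon: "x \<otimes>\<^bsub>G\<^esub> y = canon x \<otimes>\<^bsub>G\<^esub> canon y"
proof -
  let ?z = "canon x \<otimes>\<^bsub>G\<^esub> canon y"
  have "padic_lim p (\<lambda>m. P x (int m) + P y (int m)) = ?z"
  proof (rule padic_lim_eq[OF G_mult_closed[OF canon(1) canon(1)]])
    fix n
    show "eventually (\<lambda>m. P x (int m) + P y (int m) - P ?z n \<in> I n) sequentially"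
      using eventually_ge_at_top[of "nat n"]
    proof eventually_elim
      fix m assume "nat n \<le> m"
      then have nm: "n \<le> int m" by simp
      have "(P x (int m) - P x n) + (P y (int m) - P y n) - ((P (canon x) n - P x n) + (P (canon y) n - P y n)
          + (P ?z n - (P (canon x) n + P (canon y) n))) \<in> I n"
        using nm by (intro I_diff[OF I_add I_add[OF I_add]] P_cong_any canon(2) P_G_mult canon(1))
      then show "P x (int m) + P y (int m) - P ?z n \<in> I n" by (simp add: algebra_simps del: monoid.simps)
    qed
  qed
  then show ?thesis by (simp add: Qp_def)
qed

text \<open>The inverse is characterized by products with carrier elements, and those only see
  \<open>canon y\<close>.\<close>

lemma G_inv_canon: "inv\<^bsub>G\<^esub> y = inv\<^bsub>G\<^esub> (canon y)"
proof -
  have "y \<otimes>\<^bsub>G\<^esub> z = canon y \<otimes>\<^bsub>G\<^esub> z \<and> z \<otimes>\<^bsub>G\<^esub> y = z \<otimes>\<^bsub>G\<^esub> canon y" if "z \<in> cP" for z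
    using G_mult_canon[of y z] G_mult_canon[of z y] canon_id[OF that] by simp
  then show ?thesis unfolding m_inv_def G_carrier by (intro arg_cong[where f=The] ext) auto
qed

lemma sub_canon: "sub x y = sub (canon x) (canon y)"
proof -
  have "sub x y = canon x \<otimes>\<^bsub>G\<^esub> canon (inv\<^bsub>G\<^esub> (canon y))"
    unfolding sub_def G_inv_canon[of y] by (rule G_mult_canon)
  then show ?thesis by (simp only: sub_def canon_id[OF G_inv_closed[OF canon(1)]])
qed

section \<open>The p-adic distance and its balls\<close>

definition d :: "padic \<Rightarrow> padic \<Rightarrow> real" where "d x y = padic_abs p (sub x y)"

lemma padic_abs_le_iff:
  assumes z: "z \<in> cP" shows "padic_abs p z \<le> real p powi (- n) \<longleftrightarrow> P z n = 0"
proof (cases "\<forall>k. z k = 0")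
  case True then show ?thesis by (simp add: padic_abs_def P_zero_iff[OF z])
next
  case False
  then obtain k1 where k1: "z k1 \<noteq> 0" by auto
  let ?S = "{k. k < k1 + 1 \<and> z k \<noteq> 0}"
  \<comment> \<open>\<open>LEAST\<close> over the integers needs a minimum to exist: only finitely
    many nonzero digits lie at or below \<open>k1\<close>.\<close>
  define k0 where "k0 = Min ?S"
  have S: "finite ?S" "k1 \<in> ?S" using support_finite[OF z, of "k1 + 1"] k1 by auto
  then have "k0 \<in> ?S" unfolding k0_def by (intro Min_in) auto
  then have k0: "z k0 \<noteq> 0" "k0 \<le> k1" by auto
  have lt: "z k = 0" if "k < k0" for k
  proof (rule ccontr)
    assume "z k \<noteq> 0"
    then have "k \<in> ?S" using k0(2) that by simp
    then have "k0 \<le> k" unfolding k0_def by (rule Min_le[OF S(1)])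
    then show False using that by simp
  qed
  have L: "(LEAST k. z k \<noteq> 0) = k0"
  proof (rule Least_equality)
    show "z k0 \<noteq> 0" by (rule k0(1))
    fix k assume "z k \<noteq> 0"
    then show "k0 \<le> k" using lt[of k] by (cases "k < k0") simp_all
  qed
  have "padic_abs p z = real p powi (- k0)" unfolding padic_abs_def L by (rule if_not_P[OF False])
  then have "padic_abs p z \<le> real p powi (- n) \<longleftrightarrow> n \<le> k0"
    using p_gt_1 power_int_increasing[of "- k0" "- n" "real p"]
      power_int_strict_increasing[of "- n" "- k0" "real p"] by fastforce
  also have "n \<le> k0 \<longleftrightarrow> P z n = 0"
    unfolding P_zero_iff[OF z]
  proof
    assume "n \<le> k0" then show "\<forall>k<n. z k = 0" using lt by simp
  next
    assume "\<forall>k<n. z k = 0" then show "n \<le> k0" using k0(1) by (meson not_le)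
  qed
  finally show ?thesis .
qed

lemma padic_abs_nonneg: "padic_abs p z \<ge> 0"
  by (simp add: padic_abs_def)

lemma d_le_iff: "d x y \<le> real p powi (- n) \<longleftrightarrow> P (canon x) n = P (canon y) n"
  unfolding d_def sub_canon[of x y] padic_abs_le_iff[OF sub_closed[OF canon(1) canon(1)]]
  by (rule sub_zero_iff[OF canon(1) canon(1)])

lemma small_power: "r > 0 \<Longrightarrow> \<exists>n::nat. real p powi (- int n) < r"
proof -
  assume "r > 0"
  moreover have "1 / real p < 1" using p_gt_1 by simp
  ultimately obtain n where n: "(1 / real p) ^ n < r" using real_arch_pow_inv by blast
  have "real p powi (- int n) = (1 / real p) ^ n" by (simp add: power_int_minus field_simps power_one_over)
  then show ?thesis using n by (intro exI[of _ n]) simp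
qed

text \<open>The values of the distance are discrete, hence comparisons of distances reduce to comparisons with powers.\<close>

lemma padic_abs_value: "padic_abs p z = 0 \<or> (\<exists>n. padic_abs p z = real p powi (- n))"
  by (auto simp: padic_abs_def)

text \<open>Comparison of the distance with \<open>p^-n\<close> is equality of truncations, an
  equivalence relation; symmetry and the ultrametric inequality follow. Distance 0 is not a power of
  \<open>p\<close> and is handled by comparison with all of them.\<close>

lemma padic_metric: "Metric_space cP d"
proof
  fix x y
  show "0 \<le> d x y" by (simp add: d_def padic_abs_nonneg)
  have le: "d x y \<le> d y x" for x y
  proof (cases "d y x = 0")
    case True
    have "\<not> d x y > 0"
    proof
      assume "d x y > 0"
      then obtain n :: nat where n: "real p powi (- int n) < d x y" using small_power by blast
      have "d y x \<le> real p powi (- int n)" using True by simp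
      then have "d x y \<le> real p powi (- int n)" by (simp add: d_le_iff)
      then show False using n by simp
    qed
    then show ?thesis using True by simp
  next
    case False
    then obtain n where n: "d y x = real p powi (- n)" using padic_abs_value[of "sub y x"] by (auto simp: d_def)
    then have "d y x \<le> real p powi (- n)" by simp
    then have "d x y \<le> real p powi (- n)" by (simp add: d_le_iff)
    then show ?thesis using n by simp
  qed
  then show "d x y = d y x" by (intro antisym le)
next
  fix x y assume x: "x \<in> cP" and y: "y \<in> cP"
  show "d x y = 0 \<longleftrightarrow> x = y"
  proof
    assume "d x y = 0"
    then have "d x y \<le> real p powi (- n)" for n by simp
    then have "P x n = P y n" for n by (simp add: d_le_iff canon_id x y)
    then show "x = y" by (rule P_inject[OF x y])
  next
    assume e: "x = y"
    have "\<not> d x y > 0"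
    proof
      assume "d x y > 0"
      then obtain n :: nat where n: "real p powi (- int n) < d x y" using small_power by blast
      have "d x y \<le> real p powi (- int n)" by (simp add: d_le_iff e)
      then show False using n by simp
    qed
    then show "d x y = 0" using padic_abs_nonneg[of "sub x y"] by (simp add: d_def)
  qed
next
  fix x y z assume "x \<in> cP" "y \<in> cP" "z \<in> cP"
  show "d x z \<le> d x y + d y z"
  proof (cases "max (d x y) (d y z) = 0")
    case True
    have nn: "d x y \<ge> 0" "d y z \<ge> 0" by (auto simp: d_def padic_abs_nonneg)
    have "\<not> d x z > 0"
    proof
      assume "d x z > 0"
      then obtain n :: nat where n: "real p powi (- int n) < d x z" using small_power by blast
      have "d x y \<le> real p powi (- int n)" "d y z \<le> real p powi (- int n)"
        using True nn by (auto simp: max_def split: if_splits)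
      then have "d x z \<le> real p powi (- int n)" by (simp add: d_le_iff)
      then show False using n by simp
    qed
    then show ?thesis using nn by simp
  next
    case False
    have nn: "d x y \<ge> 0" "d y z \<ge> 0" by (auto simp: d_def padic_abs_nonneg)
    have "max (d x y) (d y z) = 0 \<or> (\<exists>n. max (d x y) (d y z) = real p powi (- n))"
      using padic_abs_value[of "sub x y"] padic_abs_value[of "sub y z"]
      by (cases "d x y \<le> d y z") (simp_all add: d_def max_def)
    then obtain n where n: "max (d x y) (d y z) = real p powi (- n)" using False by blast
    have "d x y \<le> real p powi (- n)" "d y z \<le> real p powi (- n)" unfolding n[symmetric] by auto
    then have "d x z \<le> real p powi (- n)" by (simp add: d_le_iff)
    then show ?thesis using n nn by (simp add: max_def split: if_splits)
  qed
qed

text \<open>The closed ball of radius \<open>p^-n\<close>, which is the coset of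
  \<open>p^n Z_p\<close> through \<open>x\<close>.\<close>

definition B :: "padic \<Rightarrow> int \<Rightarrow> padic set" where "B x n = {y \<in> cP. P y n = P x n}"

lemma B_self: "x \<in> cP \<Longrightarrow> x \<in> B x n" by (simp add: B_def)

lemma B_subset: "B x n \<subseteq> cP" by (auto simp: B_def)

lemma B_eq: "y \<in> B x n \<Longrightarrow> B y n = B x n" by (auto simp: B_def)

lemma B_mono: assumes "x \<in> cP" "m \<le> n" shows "B x n \<subseteq> B x m"
  using P_eq_down[OF _ assms(1) _ assms(2)] by (auto simp: B_def)

lemma padic_top_metric: "padic_top p = Metric_space.mtopology cP d"
  unfolding padic_top_def a_minus_eq_sub d_def[abs_def] ..

lemma topspace_padic [simp]: "topspace (padic_top p) = cP"
  unfolding padic_top_metric by (rule Metric_space.topspace_mtopology[OF padic_metric])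

lemma openin_padic_iff:
  "openin (padic_top p) U \<longleftrightarrow> U \<subseteq> cP \<and> (\<forall>x\<in>U. \<exists>n\<ge>0. B x n \<subseteq> U)"
proof -
  interpret Metric_space cP d by (rule padic_metric)
  have "(\<exists>r>0. mball x r \<subseteq> U) \<longleftrightarrow> (\<exists>n\<ge>0. B x n \<subseteq> U)" if x: "x \<in> cP" for x
  proof
    assume "\<exists>r>0. mball x r \<subseteq> U"
    then obtain r where r: "r > 0" "mball x r \<subseteq> U" by blast
    obtain n :: nat where n: "real p powi (- int n) < r" using small_power[OF r(1)] by blast
    have "B x (int n) \<subseteq> mball x r"
    proof
      fix y assume y: "y \<in> B x (int n)"
      then have yc: "y \<in> cP" by (simp add: B_def)
      have "d x y \<le> real p powi (- int n)" using y by (simp add: d_le_iff canon_id x yc B_def)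
      then show "y \<in> mball x r" using n x yc by simp
    qed
    then show "\<exists>n\<ge>0. B x n \<subseteq> U" using r(2) by (intro exI[of _ "int n"]) auto
  next
    assume "\<exists>n\<ge>0. B x n \<subseteq> U"
    then obtain n where n: "B x n \<subseteq> U" by blast
    have "mball x (real p powi (- n)) \<subseteq> B x n"
    proof
      fix y assume "y \<in> mball x (real p powi (- n))"
      then have yc: "y \<in> cP" and "d x y \<le> real p powi (- n)" by auto
      then show "y \<in> B x n" by (simp add: d_le_iff canon_id x yc B_def)
    qed
    then show "\<exists>r>0. mball x r \<subseteq> U" using n p_gt_1 by (intro exI[of _ "real p powi (- n)"]) auto
  qed
  then show ?thesis unfolding padic_top_metric openin_mtopology by blast
qed

lemma openin_B: assumes "x \<in> cP" shows "openin (padic_top p) (B x n)"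
  unfolding openin_padic_iff
proof (intro conjI ballI)
  fix y assume y: "y \<in> B x n"
  then have "B y (max n 0) \<subseteq> B y n" by (intro B_mono) (auto simp: B_def)
  then show "\<exists>n'\<ge>0. B y n' \<subseteq> B x n" using B_eq[OF y] by (intro exI[of _ "max n 0"]) auto
qed (rule B_subset)

lemma Zp_eq_B: "Zp p = B (\<lambda>_. 0) 0"
  by (auto simp: Zp_iff B_def P_eq_0)

lemma openin_Zp: "openin (padic_top p) (Zp p)"
  unfolding Zp_eq_B by (rule openin_B[OF zero_carrier])

text \<open>Two balls are nested or disjoint, so adding the empty set makes the family stable under
  intersection. It is countable because a ball is determined by a rational truncation and
  \<open>n\<close>; radii at most 1 suffice for a base of the topology.\<close>

definition balls :: "padic set set" where "balls = insert {} {B x n | x n. x \<in> cP \<and> 0 \<le> n}"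

lemma countable_balls: "countable balls"
proof -
  have "balls \<subseteq> insert {} ((\<lambda>(q, n). {y \<in> cP. P y n = q}) ` (UNIV :: (rat \<times> int) set))"
    unfolding balls_def B_def by (rule Set.insert_mono) auto
  then show ?thesis by (rule countable_subset) simp
qed

lemma Int_stable_balls: "Int_stable balls"
proof (rule Int_stableI)
  fix U V assume UV: "U \<in> balls" "V \<in> balls"
  show "U \<inter> V \<in> balls"
  proof (cases "U \<inter> V = {}")
    case True then show ?thesis by (simp add: balls_def)
  next
    case False
    then obtain z where z: "z \<in> U" "z \<in> V" by blast
    obtain x n where U: "U = B x n" "0 \<le> n" using UV(1) z(1) by (auto simp: balls_def)
    obtain y m where V: "V = B y m" "0 \<le> m" using UV(2) z(2) by (auto simp: balls_def)
    have zc: "z \<in> cP" using z U B_subset by blast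
    have e: "U = B z n" "V = B z m" using B_eq z U V by blast+
    have "U \<inter> V = B z (max n m)"
      using B_mono[OF zc, of n m] B_mono[OF zc, of m n] unfolding e by (auto simp: max_def)
    moreover have "0 \<le> max n m" using U(2) by simp
    then have "B z (max n m) \<in> balls" unfolding balls_def using zc by blast
    ultimately show ?thesis by simp
  qed
qed

lemma balls_Pow: "balls \<subseteq> Pow cP" using B_subset by (auto simp: balls_def)

lemma openin_eq_Union_balls:
  assumes "openin (padic_top p) U" shows "U = \<Union>{V \<in> balls. V \<subseteq> U}"
proof (intro equalityI subsetI)
  fix x assume x: "x \<in> U"
  then obtain n where n: "n \<ge> 0" "B x n \<subseteq> U" using assms by (auto simp: openin_padic_iff)
  have "x \<in> cP" using assms x by (auto simp: openin_padic_iff)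
  then have "B x n \<in> balls" "x \<in> B x n" using n by (auto simp: balls_def B_self)
  then show "x \<in> \<Union>{V \<in> balls. V \<subseteq> U}" using n by blast
qed blast

lemma borel_padic: "borel_sets_of (padic_top p) = sigma_sets cP balls"
  unfolding borel_sets_of_def topspace_padic
proof (rule sigma_sets_eqI)
  fix U assume "U \<in> Collect (openin (padic_top p))"
  then have "U = \<Union>{V \<in> balls. V \<subseteq> U}" by (intro openin_eq_Union_balls) simp
  moreover have "countable {V \<in> balls. V \<subseteq> U}" using countable_balls by (rule countable_subset[rotated]) auto
  then have "\<Union>{V \<in> balls. V \<subseteq> U} \<in> sigma_sets cP balls"
    by (rule sigma_sets_UNION) auto
  ultimately show "U \<in> sigma_sets cP balls" by simp
next
  fix V assume "V \<in> balls"
  then have "openin (padic_top p) V" using openin_B by (auto simp: balls_def)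
  then show "V \<in> sigma_sets cP (Collect (openin (padic_top p)))" by (simp add: sigma_sets.Basic)
qed

text \<open>\<open>Z_p\<close> is the image of a product of countably many finite digit sets,
  compact by Tychonoff. The digit map is continuous since a ball constrains finitely many
  digits.\<close>

lemma compact_Zp: "compactin (padic_top p) (Zp p)"
proof -
  let ?X = "product_topology (\<lambda>_::nat. discrete_topology {..<p}) UNIV"
  define f where "f a k = (if k < 0 then 0 else a (nat k) :: nat)" for a and k :: int
  have top: "topspace ?X = {a. \<forall>i. a i < p}" by (auto simp: PiE_iff)
  have fc: "f a \<in> cP" if "\<forall>i. a i < p" for a
    unfolding padic_carrier_def using that p_gt_1 by (auto simp: f_def intro!: exI[of _ 0])
  have "continuous_map ?X (padic_top p) f"
    unfolding continuous_map_def
  proof (intro conjI allI impI)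
    show "f \<in> topspace ?X \<rightarrow> topspace (padic_top p)" using fc unfolding top by auto
    fix U assume U: "openin (padic_top p) U"
    show "openin ?X {a \<in> topspace ?X. f a \<in> U}"
    proof (subst openin_subopen, intro ballI)
      fix a assume a: "a \<in> {a \<in> topspace ?X. f a \<in> U}"
      then have ac: "\<forall>i. a i < p" unfolding top by auto
      obtain n where n: "n \<ge> 0" "B (f a) n \<subseteq> U" using U a by (auto simp: openin_padic_iff)
      let ?V = "PiE UNIV (\<lambda>i. if i < nat n then {a i} else {..<p})"
      have "openin ?X ?V"
      proof (rule product_topology_basis)
        show "openin (discrete_topology {..<p}) (if i < nat n then {a i} else {..<p})" for i
          using ac by auto
        show "finite {i. (if i < nat n then {a i} else {..<p}) \<noteq> topspace (discrete_topology {..<p})}"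
          by (rule finite_subset[of _ "{..<nat n}"]) auto
      qed
      moreover have "a \<in> ?V" using ac by (auto simp: PiE_iff)
      moreover have "?V \<subseteq> {a \<in> topspace ?X. f a \<in> U}"
      proof
        fix b assume b: "b \<in> ?V"
        have bi: "b i \<in> (if i < nat n then {a i} else {..<p})" for i using b by (auto simp: PiE_iff)
        have bc: "\<forall>i. b i < p" using bi ac by (metis lessThan_iff singletonD)
        have "f b k = f a k" if "k < n" for k using bi[of "nat k"] that by (auto simp: f_def split: if_splits)
        then have "f b \<in> B (f a) n" using P_eq_digits[OF fc[OF bc] fc[OF ac]] fc[OF bc] by (auto simp: B_def)
        then show "b \<in> {a \<in> topspace ?X. f a \<in> U}" using n bc unfolding top by auto
      qed
      ultimately show "\<exists>T. openin ?X T \<and> a \<in> T \<and> T \<subseteq> {a \<in> topspace ?X. f a \<in> U}" by blast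
    qed
  qed
  moreover have "compact_space ?X" by (simp add: compact_space_product_topology compact_space_discrete_topology)
  ultimately have "compactin (padic_top p) (f ` topspace ?X)"
    using image_compactin unfolding compact_space_def by blast
  moreover have "f ` topspace ?X = Zp p"
  proof (intro equalityI subsetI)
    fix x assume "x \<in> f ` topspace ?X"
    then show "x \<in> Zp p" using fc unfolding top by (auto simp: Zp_def f_def)
  next
    fix x assume x: "x \<in> Zp p"
    then have "x = f (\<lambda>i. x (int i))" by (auto simp: Zp_def f_def)
    moreover have "(\<lambda>i. x (int i)) \<in> topspace ?X" unfolding top using x carrier_less by (auto simp: Zp_def)
    ultimately show "x \<in> f ` topspace ?X" by blast
  qed
  ultimately show ?thesis by simp
qed

subsection \<open>Haar measure\<close>

text \<open>The Monna map: reading the base-p digits of a nonnegative real number backwards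
  transports Lebesgue measure to a translation invariant measure.\<close>

definition digits :: "real \<Rightarrow> padic" where
  "digits t k = nat (\<lfloor>t * real p powi (k + 1)\<rfloor> mod int p)"

lemma p_powi_Suc: "real p powi (n + 1) = real p powi n * real p"
  by (simp add: power_int_add)

lemma floor_step: "\<lfloor>t * real p powi n\<rfloor> = \<lfloor>t * real p powi (n + 1)\<rfloor> div int p"
proof -
  have "t * real p powi n = (t * real p powi (n + 1)) / real_of_int (int p)" by (simp add: p_powi_Suc)
  then show ?thesis using floor_divide_real_eq_div[of "int p" "t * real p powi (n + 1)"] by simp
qed

lemma digits_small: assumes "t \<ge> 0" shows "\<exists>M. \<forall>n\<le>M. \<lfloor>t * real p powi n\<rfloor> = 0"
proof -
  have "(0::real) < 1 / (t + 1)" using assms by simp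
  then obtain j :: nat where j: "real p powi (- int j) < 1 / (t + 1)" using small_power by blast
  have "\<lfloor>t * real p powi n\<rfloor> = 0" if "n \<le> - int j" for n
  proof -
    have "real p powi n \<le> real p powi (- int j)" using that p_gt_1 by (intro power_int_increasing) auto
    then have "t * real p powi n \<le> t * (1 / (t + 1))" using j assms by (intro mult_left_mono) auto
    also have "\<dots> < 1" using assms by simp
    finally have "t * real p powi n < 1" .
    moreover have "0 \<le> t * real p powi n" using assms by simp
    ultimately show ?thesis by (simp add: floor_eq_iff)
  qed
  then show ?thesis by blast
qed

lemma digits_carrier: assumes "t \<ge> 0" shows "digits t \<in> cP"
proof -
  obtain M where M: "\<forall>n\<le>M. \<lfloor>t * real p powi n\<rfloor> = 0" using digits_small[OF assms] by blast
  have "digits t k < p" for k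
  proof -
    have "\<lfloor>t * real p powi (k + 1)\<rfloor> mod int p < int p" by simp
    then show ?thesis unfolding digits_def using p_ne_0 by (simp add: nat_less_iff)
  qed
  moreover have "digits t k = 0" if "k < M" for k using M that by (simp add: digits_def)
  ultimately show ?thesis by (auto simp: padic_carrier_def)
qed

text \<open>The digits of \<open>t\<close> below position \<open>n\<close> and the integer part of
  \<open>t * p^n\<close> determine each other; one more digit is division with remainder by
  \<open>p\<close>.\<close>

lemma digits_interval:
  assumes x: "x \<in> cP"
  shows "\<exists>J\<ge>0. \<forall>t\<ge>0. (\<forall>k<n. digits t k = x k) \<longleftrightarrow> \<lfloor>t * real p powi n\<rfloor> = J"
proof -
  obtain N where N: "\<forall>k<N. x k = 0" using carrier_bound[OF x] by blast
  \<comment> \<open>Start of the induction, where all prescribed digits are 0. The integer parts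
    vanish for very negative exponents, and a zero digit keeps the next one at zero, so they vanish
    up to \<open>n\<close>.\<close>
  have zero: "(\<forall>k<n. digits t k = x k) \<longleftrightarrow> \<lfloor>t * real p powi n\<rfloor> = 0" if t: "t \<ge> 0" and nN: "n \<le> N" for t n
  proof
    assume dg: "\<forall>k<n. digits t k = x k"
    obtain M where M: "\<forall>n\<le>M. \<lfloor>t * real p powi n\<rfloor> = 0" using digits_small[OF t] by blast
    have "i \<le> n \<longrightarrow> \<lfloor>t * real p powi i\<rfloor> = 0" if "min M n \<le> i" for i
      using that
    proof (induction i rule: int_ge_induct)
      case base then show ?case using M by simp
    next
      case (step i)
      show ?case
      proof
        assume i: "i + 1 \<le> n"
        let ?a = "\<lfloor>t * real p powi (i + 1)\<rfloor>"
        have "?a div int p = 0" using step i floor_step[of t i] by simp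
        moreover have "?a mod int p = 0"
        proof -
          have "digits t i = 0" using dg N i nN by simp
          then have "?a mod int p \<le> 0" unfolding digits_def by simp
          moreover have "0 \<le> ?a mod int p" by simp
          ultimately show ?thesis by linarith
        qed
        ultimately show "?a = 0" by (metis div_mult_mod_eq mult_zero_left add_0)
      qed
    qed
    then show "\<lfloor>t * real p powi n\<rfloor> = 0" by simp
  next
    assume z: "\<lfloor>t * real p powi n\<rfloor> = 0"
    show "\<forall>k<n. digits t k = x k"
    proof (intro allI impI)
      fix k assume k: "k < n"
      have "t * real p powi (k + 1) \<le> t * real p powi n"
        using k t p_gt_1 by (intro mult_left_mono power_int_increasing) auto
      moreover have "t * real p powi n < 1" using z by linarith
      moreover have "0 \<le> t * real p powi (k + 1)" using t by simp
      ultimately have "\<lfloor>t * real p powi (k + 1)\<rfloor> = 0" by (simp add: floor_eq_iff)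
      then show "digits t k = x k" using N k nN by (simp add: digits_def)
    qed
  qed
  show ?thesis
  proof (cases "n \<le> N")
    case True then show ?thesis using zero by (intro exI[of _ 0]) auto
  next
    case False
    then have "N \<le> n" by simp
    then show ?thesis
    proof (induction n rule: int_ge_induct)
      case base then show ?case using zero by (intro exI[of _ 0]) auto
    next
      case (step n)
      then obtain J where J: "J \<ge> 0" "\<And>t. t \<ge> 0 \<Longrightarrow> (\<forall>k<n. digits t k = x k) \<longleftrightarrow> \<lfloor>t * real p powi n\<rfloor> = J" by blast
      show ?case
      proof (intro exI[of _ "J * int p + int (x n)"] conjI allI impI)
        show "0 \<le> J * int p + int (x n)" using J(1) by simp
        fix t :: real assume t: "0 \<le> t"
        let ?a = "\<lfloor>t * real p powi (n + 1)\<rfloor>"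
        have xn: "int (x n) < int p" using carrier_less[OF x, of n] by simp
        have "(\<forall>k<n + 1. digits t k = x k) \<longleftrightarrow> (\<forall>k<n. digits t k = x k) \<and> digits t n = x n"
          by (auto simp: zless_add1_eq[symmetric]) (metis linorder_neqE_linordered_idom not_less zle_add1_eq_le)
        also have "\<dots> \<longleftrightarrow> ?a div int p = J \<and> ?a mod int p = int (x n)"
        proof -
          have "0 \<le> ?a mod int p" by simp
          then have "digits t n = x n \<longleftrightarrow> ?a mod int p = int (x n)" unfolding digits_def by (simp add: nat_eq_iff2 nat_eq_iff)
          then show ?thesis using J(2)[OF t] floor_step[of t n] by simp
        qed
        also have "\<dots> \<longleftrightarrow> ?a = J * int p + int (x n)"
        proof
          assume "?a div int p = J \<and> ?a mod int p = int (x n)"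
          then show "?a = J * int p + int (x n)" using div_mult_mod_eq[of ?a "int p"] by simp
        next
          assume "?a = J * int p + int (x n)"
          then show "?a div int p = J \<and> ?a mod int p = int (x n)" using xn p_gt_1 by simp
        qed
        finally show "(\<forall>k<n + 1. digits t k = x k) \<longleftrightarrow> ?a = J * int p + int (x n)" .
      qed
    qed
  qed
qed

text \<open>All balls of one radius come from base-p intervals of the same length. The digit map
  does not respect addition; invariance of the image measure rests on this equality of
  lengths.\<close>

lemma digits_vimage_B:
  assumes "x \<in> cP"
  shows "\<exists>J\<ge>0. digits -` B x n \<inter> {0..} = {of_int J / real p powi n ..< (of_int J + 1) / real p powi n}"
proof -
  obtain J where J: "J \<ge> 0" "\<And>t. t \<ge> 0 \<Longrightarrow> (\<forall>k<n. digits t k = x k) \<longleftrightarrow> \<lfloor>t * real p powi n\<rfloor> = J"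
    using digits_interval[OF assms] by blast
  have pos: "real p powi n > 0" using p_gt_1 by simp
  have "digits t \<in> B x n \<longleftrightarrow> of_int J / real p powi n \<le> t \<and> t < (of_int J + 1) / real p powi n" if t: "t \<ge> 0" for t
  proof -
    have "digits t \<in> B x n \<longleftrightarrow> \<lfloor>t * real p powi n\<rfloor> = J"
      using digits_carrier[OF t] P_eq_digits[OF digits_carrier[OF t] assms] J(2)[OF t] by (simp add: B_def)
    also have "\<dots> \<longleftrightarrow> of_int J \<le> t * real p powi n \<and> t * real p powi n < of_int J + 1" by (simp add: floor_eq_iff)
    finally show ?thesis using pos by (simp add: pos_divide_le_eq pos_less_divide_eq)
  qed
  moreover have "t \<ge> 0" if "of_int J / real p powi n \<le> t" for t
  proof -
    have "0 \<le> of_int J / real p powi n" using J(1) pos by simp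
    then show ?thesis using that by linarith
  qed
  ultimately show ?thesis using J(1) by (intro exI[of _ J]) auto
qed

definition \<mu> :: "padic measure" where
  "\<mu> = distr (restrict_space lborel {0..}) (sigma cP balls) digits"

lemma space_mu: "space \<mu> = cP" and sets_mu: "sets \<mu> = sigma_sets cP balls"
  using balls_Pow by (auto simp: \<mu>_def)

lemma digits_measurable: "digits \<in> measurable (restrict_space lborel {0..}) (sigma cP balls)"
proof (rule measurable_measure_of[OF balls_Pow])
  show "digits \<in> space (restrict_space lborel {0..}) \<rightarrow> cP" using digits_carrier by (auto simp: space_restrict_space)
  fix V assume "V \<in> balls"
  then consider "V = {}" | x n where "x \<in> cP" "V = B x n" by (auto simp: balls_def)
  then show "digits -` V \<inter> space (restrict_space lborel {0..}) \<in> sets (restrict_space lborel {0..})"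
  proof cases
    case 2
    obtain J where "digits -` B x n \<inter> {0..} = {of_int J / real p powi n ..< (of_int J + 1) / real p powi n}"
      using digits_vimage_B[OF 2(1)] by blast
    then show ?thesis unfolding 2 by (simp add: space_restrict_space sets_restrict_space_iff)
      (metis Int_lower2 atLeastLessThan_borel)
  qed simp
qed

lemma mu_B: assumes "x \<in> cP" "0 \<le> n" shows "emeasure \<mu> (B x n) = ennreal (real p powi (- n))"
proof -
  have Bb: "B x n \<in> sets (sigma cP balls)" using balls_Pow assms by (auto simp: balls_def)
  obtain J where J: "J \<ge> 0" "digits -` B x n \<inter> {0..} = {of_int J / real p powi n ..< (of_int J + 1) / real p powi n}"
    using digits_vimage_B[OF assms(1)] by blast
  have pos: "real p powi n > 0" using p_gt_1 by simp
  have "emeasure \<mu> (B x n) = emeasure (restrict_space lborel {0..}) (digits -` B x n \<inter> {0..})"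
    unfolding \<mu>_def using emeasure_distr[OF digits_measurable Bb] by (simp add: space_restrict_space)
  also have "\<dots> = emeasure lborel (digits -` B x n \<inter> {0..})"
    by (rule emeasure_restrict_space) auto
  also have "\<dots> = ennreal ((of_int J + 1) / real p powi n - of_int J / real p powi n)"
    unfolding J using pos by (intro emeasure_lborel_Ico divide_right_mono) auto
  also have "(of_int J + 1) / real p powi n - of_int J / real p powi n = real p powi (- n)"
    by (simp add: add_divide_distrib power_int_minus inverse_eq_divide)
  finally show ?thesis .
qed

lemma balls_cover: "\<Union>{B x 0 | x. x \<in> cP} = cP"
  using B_self B_subset by fast

lemma balls0_countable: "countable {B x 0 | x. x \<in> cP}"
  by (rule countable_subset[OF _ countable_balls]) (auto simp: balls_def)

text \<open>Balls are a generator stable under intersection, and the unit balls cover the group by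
  countably many sets of measure 1.\<close>

lemma measure_eq_if_balls:
  assumes M: "sets M = sigma_sets cP balls" "\<And>x n. x \<in> cP \<Longrightarrow> n \<ge> 0 \<Longrightarrow> emeasure M (B x n) = ennreal (real p powi (- n))"
    and N: "sets N = sigma_sets cP balls" "\<And>x n. x \<in> cP \<Longrightarrow> n \<ge> 0 \<Longrightarrow> emeasure N (B x n) = ennreal (real p powi (- n))"
  shows "M = N"
proof (rule measure_eqI_generator_eq_countable[OF Int_stable_balls balls_Pow _ M(1) N(1) _ balls_cover balls0_countable])
  show "emeasure M X = emeasure N X" if "X \<in> balls" for X using that M(2) N(2) by (auto simp: balls_def)
  show "{B x 0 |x. x \<in> cP} \<subseteq> balls" by (auto simp: balls_def)
  show "emeasure M a \<noteq> \<infinity>" if "a \<in> {B x 0 |x. x \<in> cP}" for a using that M(2)[of _ 0] by auto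
qed

section \<open>Translation invariance and uniqueness of the Haar measure\<close>

lemma sub_B_vimage:
  assumes x: "x \<in> cP" and y: "y \<in> cP"
  shows "{u \<in> cP. sub u x \<in> B y n} = B (y \<otimes>\<^bsub>G\<^esub> x) n"
proof -
  have "P (sub u x) n = P y n \<longleftrightarrow> P u n = P (y \<otimes>\<^bsub>G\<^esub> x) n" if u: "u \<in> cP" for u
  proof -
    note s = P_sub[OF u x, of n] and m = P_G_mult[OF y x, of n]
    have "P (sub u x) n - P y n \<in> I n \<longleftrightarrow> P u n - P (y \<otimes>\<^bsub>G\<^esub> x) n \<in> I n"
    proof
      assume "P (sub u x) n - P y n \<in> I n"
      from I_diff[OF this I_add[OF s m]] show "P u n - P (y \<otimes>\<^bsub>G\<^esub> x) n \<in> I n"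
        by (simp add: algebra_simps del: monoid.simps)
    next
      assume "P u n - P (y \<otimes>\<^bsub>G\<^esub> x) n \<in> I n"
      from I_add[OF this I_add[OF s m]] show "P (sub u x) n - P y n \<in> I n"
        by (simp add: algebra_simps del: monoid.simps)
    qed
    then show ?thesis using P_eq_iff_I[OF sub_closed[OF u x] y] P_eq_iff_I[OF u G_mult_closed[OF y x]] by simp
  qed
  then show ?thesis using sub_closed[OF _ x] by (auto simp: B_def)
qed

lemma l_coset_eq:
  assumes x: "x \<in> cP" and A: "A \<subseteq> cP" shows "x <#\<^bsub>G\<^esub> A = {u \<in> cP. sub u x \<in> A}"
proof -
  have s: "sub (x \<otimes>\<^bsub>G\<^esub> a) x = a" if a: "a \<in> cP" for a
  proof -
    have "sub (x \<otimes>\<^bsub>G\<^esub> a) x = (a \<otimes>\<^bsub>G\<^esub> x) \<otimes>\<^bsub>G\<^esub> inv\<^bsub>G\<^esub> x" unfolding sub_def G_comm[OF x a] ..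
    also have "\<dots> = a \<otimes>\<^bsub>G\<^esub> \<one>\<^bsub>G\<^esub>" using G_assoc[OF a x G_inv_closed[OF x]] G_r_inv[OF x] by simp
    finally show ?thesis using group.is_monoid[OF G_group] a by (metis G_carrier monoid.r_one)
  qed
  show ?thesis
  proof (intro equalityI subsetI)
    fix u assume "u \<in> x <#\<^bsub>G\<^esub> A"
    then obtain a where a: "a \<in> A" and u: "u = x \<otimes>\<^bsub>G\<^esub> a" unfolding l_coset_def by blast
    have ac: "a \<in> cP" using a A by blast
    have "u \<in> cP" unfolding u by (rule G_mult_closed[OF x ac])
    moreover have "sub u x \<in> A" unfolding u s[OF ac] by (rule a)
    ultimately show "u \<in> {u \<in> cP. sub u x \<in> A}" by blast
  next
    fix u assume "u \<in> {u \<in> cP. sub u x \<in> A}"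
    then show "u \<in> x <#\<^bsub>G\<^esub> A" using G_mult_sub[OF _ x, of u] unfolding l_coset_def by blast
  qed
qed

lemma sub_measurable: assumes x: "x \<in> cP" and M: "sets M = sigma_sets cP balls" "sets N = sigma_sets cP balls"
  shows "(\<lambda>u. sub u x) \<in> measurable M N"
proof -
  have sp: "space M = cP" "space N = cP"
    using M sets_eq_imp_space_eq[of M "sigma cP balls"] sets_eq_imp_space_eq[of N "sigma cP balls"] balls_Pow by auto
  show ?thesis
  proof (rule measurable_sigma_sets[OF M(2) balls_Pow])
    show "(\<lambda>u. sub u x) \<in> space M \<rightarrow> cP" using sub_closed[OF _ x] by (auto simp: sp)
    fix V assume "V \<in> balls"
    then consider "V = {}" | y n where "y \<in> cP" "n \<ge> 0" "V = B y n" by (auto simp: balls_def)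
    then show "(\<lambda>u. sub u x) -` V \<inter> space M \<in> sets M"
    proof cases
      case 2
      have "(\<lambda>u. sub u x) -` V \<inter> space M = B (y \<otimes>\<^bsub>G\<^esub> x) n"
        using sub_B_vimage[OF x 2(1), of n] by (auto simp: sp 2)
      moreover have "B (y \<otimes>\<^bsub>G\<^esub> x) n \<in> balls" using G_mult_closed[OF 2(1) x] 2(2) unfolding balls_def by blast
      ultimately show ?thesis unfolding M by (simp add: sigma_sets.Basic)
    qed simp
  qed
qed

text \<open>Translations permute the balls of a given radius, so the translated measure agrees with
  the original one on balls.\<close>

lemma mu_translate:
  assumes x: "x \<in> cP" and A: "A \<in> sets \<mu>"
  shows "emeasure \<mu> (x <#\<^bsub>G\<^esub> A) = emeasure \<mu> A"
proof -
  have m: "(\<lambda>u. sub u x) \<in> measurable \<mu> \<mu>" by (rule sub_measurable[OF x sets_mu sets_mu])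
  have "distr \<mu> \<mu> (\<lambda>u. sub u x) = \<mu>"
  proof (rule measure_eq_if_balls)
    fix y n assume yn: "y \<in> cP" "(0::int) \<le> n"
    then have "B y n \<in> sets \<mu>" by (auto simp: sets_mu balls_def intro: sigma_sets.Basic)
    then have "emeasure (distr \<mu> \<mu> (\<lambda>u. sub u x)) (B y n) = emeasure \<mu> {u \<in> cP. sub u x \<in> B y n}"
      using m by (simp add: emeasure_distr space_mu vimage_def Int_def conj_commute)
    also have "\<dots> = ennreal (real p powi (- n))"
      unfolding sub_B_vimage[OF x yn(1)] by (rule mu_B[OF G_mult_closed[OF yn(1) x] yn(2)])
    finally show "emeasure (distr \<mu> \<mu> (\<lambda>u. sub u x)) (B y n) = ennreal (real p powi (- n))" .
  qed (simp_all add: sets_mu mu_B)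
  then have "emeasure \<mu> A = emeasure (distr \<mu> \<mu> (\<lambda>u. sub u x)) A" by simp
  also have "\<dots> = emeasure \<mu> {u \<in> cP. sub u x \<in> A}"
    using m A by (simp add: emeasure_distr space_mu vimage_def Int_def conj_commute)
  also have "{u \<in> cP. sub u x \<in> A} = x <#\<^bsub>G\<^esub> A"
    using l_coset_eq[OF x] sets.sets_into_space[OF A] by (simp add: space_mu)
  finally show ?thesis by simp
qed

lemma mu_haar: "haar_measure G (padic_top p) \<mu>"
  unfolding haar_measure_def
proof (intro conjI ballI allI impI)
  show "space \<mu> = carrier G" by (simp only: space_mu G_carrier)
  show "sets \<mu> = borel_sets_of (padic_top p)" by (simp add: sets_mu borel_padic)
  show "emeasure \<mu> (x <#\<^bsub>G\<^esub> A) = emeasure \<mu> A" if "x \<in> carrier G" "A \<in> sets \<mu>" for x A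
    using mu_translate that by (simp only: G_carrier)
  fix K assume K: "compactin (padic_top p) K"
  have "K \<subseteq> \<Union>{B x 0 | x. x \<in> cP}" using K compactin_subset_topspace[OF K] unfolding balls_cover by simp
  moreover have "\<forall>U\<in>{B x 0 | x. x \<in> cP}. openin (padic_top p) U" using openin_B by blast
  ultimately obtain F where F: "finite F" "F \<subseteq> {B x 0 | x. x \<in> cP}" "K \<subseteq> \<Union>F"
    using K unfolding compactin_def by meson
  have Fs: "V \<in> sets \<mu>" "emeasure \<mu> V = 1" if "V \<in> F" for V
    using that F(2) mu_B[of _ 0] by (auto simp: sets_mu balls_def intro!: sigma_sets.Basic)
  have "emeasure \<mu> K \<le> emeasure \<mu> (\<Union>F)" using F Fs by (intro emeasure_mono sets.finite_Union) auto
  also have "\<dots> = emeasure \<mu> (\<Union>V\<in>F. V)" by simp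
  also have "\<dots> \<le> (\<Sum>V\<in>F. emeasure \<mu> V)" using F Fs by (intro emeasure_subadditive_finite) auto
  also have "\<dots> = of_nat (card F)" using Fs by simp
  also have "\<dots> < \<infinity>" by (simp add: of_nat_less_top)
  finally show "emeasure \<mu> K < \<infinity>" .
next
  fix U assume U: "openin (padic_top p) U \<and> U \<noteq> {}"
  then obtain x where x: "x \<in> U" by blast
  have UU: "U \<subseteq> cP" "\<forall>x\<in>U. \<exists>n\<ge>0. B x n \<subseteq> U" using U unfolding openin_padic_iff by blast+
  then have xc: "x \<in> cP" using x by blast
  obtain n where n: "n \<ge> 0" "B x n \<subseteq> U" using UU(2) x by blast
  have "0 < ennreal (real p powi (- n))" using p_gt_1 by simp
  also have "\<dots> = emeasure \<mu> (B x n)" by (rule mu_B[OF xc n(1), symmetric])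
  also have "\<dots> \<le> emeasure \<mu> U"
    using U n by (intro emeasure_mono) (auto simp: sets_mu borel_padic[symmetric] borel_sets_of_def intro!: sigma_sets.Basic)
  finally show "0 < emeasure \<mu> U" .
qed

text \<open>Invariance gives all balls of one radius the same measure, and a ball splits into
  \<open>p\<close> balls of the next smaller radius. Starting from the normalization on
  \<open>Z_p\<close>, induction determines the measure of every ball of radius at most 1.\<close>

lemma haar_unique:
  assumes h: "haar_measure G (padic_top p) M" and Z: "emeasure M (Zp p) = 1"
  shows "M = \<mu>"
proof (rule measure_eq_if_balls[OF _ _ sets_mu mu_B])
  show sM: "sets M = sigma_sets cP balls" using h by (simp add: haar_measure_def borel_padic)
  have Bs: "B x n \<in> sets M" if "x \<in> cP" "0 \<le> n" for x n
    using that by (auto simp: sM balls_def intro!: sigma_sets.Basic)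
  have inv: "emeasure M (B x n) = emeasure M (B (\<lambda>_. 0) n)" if x: "x \<in> cP" and n: "0 \<le> n" for x n
  proof -
    have "x <#\<^bsub>G\<^esub> B (\<lambda>_. 0) n = B ((\<lambda>_. 0) \<otimes>\<^bsub>G\<^esub> x) n"
      unfolding l_coset_eq[OF x B_subset] by (rule sub_B_vimage[OF x zero_carrier])
    also have "(\<lambda>_. 0) \<otimes>\<^bsub>G\<^esub> x = x" by (rule G_eqI[OF zero_carrier x x]) (simp add: P_eq_0 I_0)
    finally have "x <#\<^bsub>G\<^esub> B (\<lambda>_. 0) n = B x n" .
    then show ?thesis using h Bs[OF zero_carrier n] x unfolding haar_measure_def G_carrier by metis
  qed
  have z: "emeasure M (B (\<lambda>_. 0) (int n)) = ennreal (real p powi (- int n))" for n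
  proof (induction n)
    case 0 then show ?case using Z by (simp add: Zp_eq_B)
  next
    case (Suc n)
    \<comment> \<open>The elements \<open>j p^n\<close> with \<open>j < p\<close> represent the
      smaller balls inside the ball of radius \<open>p^-n\<close> around 0.\<close>
    define X where "X j = (\<lambda>k. if k = int n then j else 0)" for j :: nat
    have Xc: "X j \<in> cP" if "j < p" for j
      using that by (auto simp: X_def padic_carrier_def intro!: exI[of _ 0])
    have "B (\<lambda>_. 0) (int n) = (\<Union>j<p. B (X j) (int n + 1))"
    proof (intro equalityI subsetI)
      fix y assume y: "y \<in> B (\<lambda>_. 0) (int n)"
      then have yc: "y \<in> cP" by (simp add: B_def)
      have y0: "\<forall>k<int n. y k = 0" using y P_eq_digits[OF yc zero_carrier] by (simp add: B_def)
      have "\<forall>k<int n + 1. y k = X (y (int n)) k" using y0 by (auto simp: X_def)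
      then have "P y (int n + 1) = P (X (y (int n))) (int n + 1)"
        by (rule P_eq_digits[OF yc Xc[OF carrier_less[OF yc]], THEN iffD2])
      then have "y \<in> B (X (y (int n))) (int n + 1)" unfolding B_def using yc by blast
      then show "y \<in> (\<Union>j<p. B (X j) (int n + 1))" using carrier_less[OF yc] by blast
    next
      fix y assume "y \<in> (\<Union>j<p. B (X j) (int n + 1))"
      then obtain j where j: "j < p" "y \<in> B (X j) (int n + 1)" by blast
      then have yc: "y \<in> cP" by (simp add: B_def)
      have "P y (int n + 1) = P (X j) (int n + 1)" using j(2) unfolding B_def by blast
      then have e: "\<forall>k<int n + 1. y k = X j k" by (rule P_eq_digits[OF yc Xc[OF j(1)], THEN iffD1])
      have "\<forall>k<int n. y k = 0"
      proof (intro allI impI)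
        fix k assume "k < int n"
        then have "y k = X j k" using e[rule_format, of k] by simp
        then show "y k = 0" using \<open>k < int n\<close> by (simp add: X_def)
      qed
      then show "y \<in> B (\<lambda>_. 0) (int n)" using P_eq_digits[OF yc zero_carrier] yc by (simp add: B_def)
    qed
    moreover have "disjoint_family_on (\<lambda>j. B (X j) (int n + 1)) {..<p}"
      unfolding disjoint_family_on_def
    proof (intro ballI impI equals0I)
      fix i j y assume ij: "i \<in> {..<p}" "j \<in> {..<p}" "i \<noteq> j" "y \<in> B (X i) (int n + 1) \<inter> B (X j) (int n + 1)"
      then have "P (X i) (int n + 1) = P (X j) (int n + 1)" unfolding B_def by simp
      moreover have "i < p" "j < p" using ij by auto
      ultimately have "\<forall>k<int n + 1. X i k = X j k" using P_eq_digits[OF Xc Xc] by blast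
      then have "X i (int n) = X j (int n)" by (rule allE[of _ "int n"]) simp
      then show False using ij(3) by (simp add: X_def)
    qed
    ultimately have "emeasure M (B (\<lambda>_. 0) (int n)) = (\<Sum>j<p. emeasure M (B (X j) (int n + 1)))"
      using sum_emeasure[of "\<lambda>j. B (X j) (int n + 1)" "{..<p}" M] Bs Xc by (simp add: image_subset_iff)
    also have "\<dots> = (\<Sum>j<p. emeasure M (B (\<lambda>_. 0) (int n + 1)))"
      using inv Xc by (intro sum.cong) auto
    also have "\<dots> = of_nat p * emeasure M (B (\<lambda>_. 0) (int n + 1))" by simp
    finally have e: "of_nat p * emeasure M (B (\<lambda>_. 0) (int n + 1)) = ennreal (real p powi (- int n))"
      using Suc.IH by simp
    let ?v = "emeasure M (B (\<lambda>_. 0) (int n + 1))"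
    have "?v \<noteq> \<infinity>"
    proof
      assume "?v = \<infinity>"
      then have "of_nat p * ?v = \<infinity>" using p_ne_0 by (simp add: ennreal_mult_top)
      then show False using e by simp
    qed
    then obtain r where r: "?v = ennreal r" "r \<ge> 0" by (cases ?v) auto
    have "ennreal (real p * r) = ennreal (real p powi (- int n))"
      using e r by (simp add: ennreal_mult ennreal_of_nat_eq_real_of_nat)
    then have "real p * r = real p powi (- int n)" using r(2) by (subst (asm) ennreal_inj) auto
    then have "r = real p powi (- int n) / real p" using p_ne_0 by (simp add: field_simps)
    also have "\<dots> = real p powi (- (int n + 1))"
      by (simp add: power_int_diff power_int_minus divide_inverse power_int_add)
    finally show ?case using r by (simp add: add.commute)
  qed
  show "emeasure M (B x n) = ennreal (real p powi (- n))" if "x \<in> cP" "0 \<le> n" for x n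
    using inv[OF that] z[of "nat n"] that(2) by simp
qed auto

lemma padic_haar_eq: "padic_haar p = \<mu>"
  unfolding padic_haar_def
proof (rule the_equality)
  have "emeasure \<mu> (Zp p) = 1" unfolding Zp_eq_B using mu_B[OF zero_carrier, of 0] by simp
  then show "haar_measure G (padic_top p) \<mu> \<and> emeasure \<mu> (Zp p) = 1" using mu_haar by simp
qed (auto intro: haar_unique)

end

section \<open>The finite adeles\<close>

lemma padic_primeI: "prime p \<Longrightarrow> padic_prime p" by (rule padic_prime.intro)

text \<open>The adelic arguments involve all primes at once, so the constants of the p-adic
  development take the prime as an argument here.\<close>

abbreviation "ball_at \<equiv> padic_prime.B"
abbreviation "balls_at \<equiv> padic_prime.balls"
abbreviation "sub_at \<equiv> padic_prime.sub"
abbreviation "zl_at \<equiv> padic_prime.zl"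
abbreviation "chi_at \<equiv> padic_prime.chi"

lemma haar_sets: "prime p \<Longrightarrow> sets (padic_haar p) = sigma_sets (padic_carrier p) (balls_at p)"
  by (simp add: padic_prime.padic_haar_eq padic_prime.sets_mu padic_primeI)

lemma haar_space: "prime p \<Longrightarrow> space (padic_haar p) = padic_carrier p"
  by (simp add: padic_prime.padic_haar_eq padic_prime.space_mu padic_primeI)

lemma haar_ball: "prime p \<Longrightarrow> x \<in> padic_carrier p \<Longrightarrow> 0 \<le> n \<Longrightarrow>
    emeasure (padic_haar p) (ball_at p x n) = ennreal (real p powi (- n))"
  by (simp add: padic_prime.padic_haar_eq padic_prime.mu_B padic_primeI)

lemma ball_in_balls: "prime p \<Longrightarrow> x \<in> padic_carrier p \<Longrightarrow> 0 \<le> n \<Longrightarrow> ball_at p x n \<in> balls_at p"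
  unfolding padic_prime.balls_def[OF padic_primeI] by blast

lemma balls_sets: "prime p \<Longrightarrow> V \<in> balls_at p \<Longrightarrow> V \<in> sets (padic_haar p)"
  by (simp add: haar_sets sigma_sets.Basic)

lemma Zp_ball: "prime p \<Longrightarrow> Zp p = ball_at p (\<lambda>_. 0) 0"
  by (rule padic_prime.Zp_eq_B[OF padic_primeI])

lemma Zp_balls: "prime p \<Longrightarrow> Zp p \<in> balls_at p"
  unfolding Zp_ball by (rule ball_in_balls) (auto intro: padic_prime.zero_carrier padic_primeI)

lemma haar_Zp: "prime p \<Longrightarrow> emeasure (padic_haar p) (Zp p) = 1"
  unfolding Zp_ball by (subst haar_ball) (auto intro: padic_prime.zero_carrier padic_primeI)

lemma Zp_subset: "Zp p \<subseteq> padic_carrier p" by (auto simp: Zp_def)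

lemma balls_le_1: assumes p: "prime p" and V: "V \<in> balls_at p" shows "emeasure (padic_haar p) V \<le> 1"
proof -
  consider "V = {}" | x n where "x \<in> padic_carrier p" "0 \<le> n" "V = ball_at p x n"
    using V unfolding padic_prime.balls_def[OF padic_primeI[OF p]] by blast
  then show ?thesis
  proof cases
    case 2
    have "real p powi (- n) \<le> real p powi 0"
      using 2(2) prime_gt_1_nat[OF p] by (intro power_int_increasing) auto
    then show ?thesis unfolding 2(3) haar_ball[OF p 2(1,2)] by simp
  qed simp
qed

subsection \<open>The topology\<close>

text \<open>A countable base of the restricted product topology, stable under intersection; it takes
  the place that the balls have at a single prime.\<close>

definition adele_boxes :: "(nat \<Rightarrow> padic) set set" where
  "adele_boxes = {\<Pi>\<^sub>E p\<in>primes. U p | U. (\<forall>p. prime p \<longrightarrow> U p \<in> balls_at p) \<and> finite {p. prime p \<and> U p \<noteq> Zp p}}"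

lemma fin_adeles_component: "x \<in> fin_adeles \<Longrightarrow> prime p \<Longrightarrow> x p \<in> padic_carrier p"
  by (auto simp: fin_adeles_def PiE_iff)

lemma fin_adeles_bad: "x \<in> fin_adeles \<Longrightarrow> finite {p. prime p \<and> x p \<notin> Zp p}"
  by (simp add: fin_adeles_def)

lemma fin_adeles_ext: "x \<in> fin_adeles \<Longrightarrow> x \<in> extensional primes"
  by (auto simp: fin_adeles_def PiE_iff)

lemma fin_adelesI:
  "x \<in> extensional primes \<Longrightarrow> (\<And>p. prime p \<Longrightarrow> x p \<in> padic_carrier p) \<Longrightarrow> finite {p. prime p \<and> x p \<notin> Zp p} \<Longrightarrow> x \<in> fin_adeles"
  by (auto simp: fin_adeles_def PiE_iff)

lemma box_subset_fin_adeles: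
  assumes "\<And>p. prime p \<Longrightarrow> U p \<subseteq> padic_carrier p" "finite {p. prime p \<and> U p \<noteq> Zp p}"
  shows "(\<Pi>\<^sub>E p\<in>primes. U p) \<subseteq> fin_adeles"
proof
  fix x assume x: "x \<in> (\<Pi>\<^sub>E p\<in>primes. U p)"
  show "x \<in> fin_adeles"
  proof (rule fin_adelesI)
    show "finite {p. prime p \<and> x p \<notin> Zp p}"
      by (rule finite_subset[OF _ assms(2)]) (use x in \<open>auto simp: PiE_iff\<close>)
  qed (use x assms(1) in \<open>auto simp: PiE_iff\<close>)
qed

lemma ball_subset_carrier: "prime p \<Longrightarrow> V \<in> balls_at p \<Longrightarrow> V \<subseteq> padic_carrier p"
  using padic_prime.balls_Pow[OF padic_primeI] by blast

lemma adele_boxes_Pow: "adele_boxes \<subseteq> Pow fin_adeles"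
  unfolding adele_boxes_def using box_subset_fin_adeles ball_subset_carrier by blast

lemma openin_ball: "prime p \<Longrightarrow> V \<in> balls_at p \<Longrightarrow> openin (padic_top p) V"
  unfolding padic_prime.balls_def[OF padic_primeI] using padic_prime.openin_B[OF padic_primeI] by auto

lemma openin_box:
  assumes "\<And>p. prime p \<Longrightarrow> openin (padic_top p) (U p)" "finite {p. prime p \<and> U p \<noteq> Zp p}"
  shows "openin fin_adele_top (\<Pi>\<^sub>E p\<in>primes. U p)"
  unfolding fin_adele_top_def by (rule topology_generated_by_Basis) (use assms in blast)

lemma openin_adele_box: "V \<in> adele_boxes \<Longrightarrow> openin fin_adele_top V"
  unfolding adele_boxes_def using openin_box openin_ball by blast

lemma openin_padic_carrier: "prime p \<Longrightarrow> openin (padic_top p) (padic_carrier p)"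
  by (metis openin_topspace padic_prime.topspace_padic padic_primeI)

lemma topspace_fin_adele: "topspace fin_adele_top = fin_adeles"
proof (intro equalityI subsetI)
  fix x assume "x \<in> topspace fin_adele_top"
  then obtain U where U: "x \<in> (\<Pi>\<^sub>E p\<in>primes. U p)" "\<forall>p. prime p \<longrightarrow> openin (padic_top p) (U p)"
    "finite {p. prime p \<and> U p \<noteq> Zp p}"
    unfolding fin_adele_top_def topology_generated_by_topspace by blast
  have "U p \<subseteq> padic_carrier p" if "prime p" for p
    using U(2) that openin_subset[of "padic_top p" "U p"] padic_prime.topspace_padic[OF padic_primeI[OF that]] by blast
  then show "x \<in> fin_adeles" using box_subset_fin_adeles[of U] U by blast
next
  fix x assume x: "x \<in> fin_adeles"
  let ?U = "\<lambda>p. if x p \<in> Zp p then Zp p else padic_carrier p"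
  have "openin fin_adele_top (\<Pi>\<^sub>E p\<in>primes. ?U p)"
  proof (rule openin_box)
    show "finite {p. prime p \<and> ?U p \<noteq> Zp p}"
      by (rule finite_subset[OF _ fin_adeles_bad[OF x]]) auto
    show "openin (padic_top p) (?U p)" if "prime p" for p
      using openin_padic_carrier[OF that] padic_prime.openin_Zp[OF padic_primeI[OF that]] by simp
  qed
  moreover have "x \<in> (\<Pi>\<^sub>E p\<in>primes. ?U p)"
    using fin_adeles_ext[OF x] fin_adeles_component[OF x] by (auto simp: PiE_iff)
  ultimately show "x \<in> topspace fin_adele_top" using openin_subset by blast
qed

lemma Int_stable_adele_boxes: "Int_stable adele_boxes"
proof (rule Int_stableI)
  fix A B assume "A \<in> adele_boxes" "B \<in> adele_boxes"
  then obtain U V where U: "A = (\<Pi>\<^sub>E p\<in>primes. U p)" "\<forall>p. prime p \<longrightarrow> U p \<in> balls_at p" "finite {p. prime p \<and> U p \<noteq> Zp p}"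
    and V: "B = (\<Pi>\<^sub>E p\<in>primes. V p)" "\<forall>p. prime p \<longrightarrow> V p \<in> balls_at p" "finite {p. prime p \<and> V p \<noteq> Zp p}"
    unfolding adele_boxes_def by blast
  have "A \<inter> B = (\<Pi>\<^sub>E p\<in>primes. U p \<inter> V p)" unfolding U V by (rule PiE_Int)
  moreover have "\<forall>p. prime p \<longrightarrow> U p \<inter> V p \<in> balls_at p"
    using U(2) V(2) padic_prime.Int_stable_balls[OF padic_primeI] by (auto simp: Int_stable_def)
  moreover have "finite {p. prime p \<and> U p \<inter> V p \<noteq> Zp p}"
    by (rule finite_subset[OF _ finite_UnI[OF U(3) V(3)]]) auto
  ultimately show "A \<inter> B \<in> adele_boxes" unfolding adele_boxes_def by blast
qed

lemma adele_box_basis: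
  assumes "openin fin_adele_top W" "x \<in> W"
  shows "\<exists>V\<in>adele_boxes. x \<in> V \<and> V \<subseteq> W"
proof -
  have "generate_topology_on {\<Pi>\<^sub>E p\<in>primes. U p | U. (\<forall>p. prime p \<longrightarrow> openin (padic_top p) (U p)) \<and>
                          finite {p. prime p \<and> U p \<noteq> Zp p}} W"
    using assms(1) unfolding fin_adele_top_def by (rule openin_topology_generated_by)
  then have "\<forall>x\<in>W. \<exists>V\<in>adele_boxes. x \<in> V \<and> V \<subseteq> W"
  proof (induction rule: generate_topology_on.induct)
    case Empty then show ?case by simp
  next
    case (Int a b)
    show ?case
    proof
      fix x assume "x \<in> a \<inter> b"
      then obtain V W where "V \<in> adele_boxes" "x \<in> V" "V \<subseteq> a" "W \<in> adele_boxes" "x \<in> W" "W \<subseteq> b"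
        using Int.IH by blast
      moreover have "V \<inter> W \<in> adele_boxes"
        using calculation Int_stable_adele_boxes by (auto simp: Int_stable_def)
      ultimately show "\<exists>V\<in>adele_boxes. x \<in> V \<and> V \<subseteq> a \<inter> b" by (intro bexI[of _ "V \<inter> W"]) auto
    qed
  next
    case (UN K)
    show ?case
    proof
      fix x assume "x \<in> \<Union>K"
      then obtain k where k: "k \<in> K" "x \<in> k" by blast
      then obtain V where "V \<in> adele_boxes" "x \<in> V" "V \<subseteq> k" using UN.IH[OF k(1)] by blast
      then show "\<exists>V\<in>adele_boxes. x \<in> V \<and> V \<subseteq> \<Union>K" using k(1) by blast
    qed
  next
    case (Basis s)
    then obtain U where U: "s = (\<Pi>\<^sub>E p\<in>primes. U p)" "\<forall>p. prime p \<longrightarrow> openin (padic_top p) (U p)"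
      "finite {p. prime p \<and> U p \<noteq> Zp p}" by blast
    show ?case
    proof
      fix x assume x: "x \<in> s"
      \<comment> \<open>A factor equal to \<open>Zp p\<close> must be kept as it is: shrinking it at
        infinitely many primes would leave the family of boxes.\<close>
      have "\<exists>V. V \<in> balls_at p \<and> x p \<in> V \<and> V \<subseteq> U p \<and> (U p = Zp p \<longrightarrow> V = Zp p)" if p: "prime p" for p
      proof (cases "U p = Zp p")
        case True then show ?thesis using Zp_balls[OF p] x U(1) p by (auto simp: PiE_iff)
      next
        case False
        have xU: "x p \<in> U p" using x p unfolding U(1) by (auto simp: PiE_iff)
        have "U p = \<Union>{V \<in> balls_at p. V \<subseteq> U p}"
          using padic_prime.openin_eq_Union_balls[OF padic_primeI[OF p]] U(2) p by blast
        then have "x p \<in> \<Union>{V \<in> balls_at p. V \<subseteq> U p}" using xU by simp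
        then show ?thesis using False by blast
      qed
      then obtain V where V: "\<And>p. prime p \<Longrightarrow> V p \<in> balls_at p \<and> x p \<in> V p \<and> V p \<subseteq> U p \<and> (U p = Zp p \<longrightarrow> V p = Zp p)"
        by metis
      have "finite {p. prime p \<and> V p \<noteq> Zp p}" by (rule finite_subset[OF _ U(3)]) (use V in auto)
      then have "(\<Pi>\<^sub>E p\<in>primes. V p) \<in> adele_boxes" unfolding adele_boxes_def using V by blast
      moreover have "x \<in> (\<Pi>\<^sub>E p\<in>primes. V p)" using x V unfolding U(1) by (auto simp: PiE_iff)
      moreover have "(\<Pi>\<^sub>E p\<in>primes. V p) \<subseteq> s" unfolding U(1) using V by (intro PiE_mono) auto
      ultimately show "\<exists>V\<in>adele_boxes. x \<in> V \<and> V \<subseteq> s" by blast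
    qed
  qed
  then show ?thesis using assms(2) by blast
qed

lemma countable_adele_boxes: "countable adele_boxes"
proof -
  \<comment> \<open>A box is given by its finitely many exceptional primes and a ball at each of
    them. An index that is not prime gets the single choice \<open>{}\<close>, which keeps the
    product of choices countable.\<close>
  let ?F = "{S :: nat set. finite S}"
  let ?box = "\<lambda>S f. \<Pi>\<^sub>E p\<in>primes. if p \<in> S then f p else Zp p"
  have "adele_boxes \<subseteq> (\<Union>S\<in>?F. ?box S ` (\<Pi>\<^sub>E p\<in>S. if prime p then balls_at p else {{}}))"
  proof
    fix A assume "A \<in> adele_boxes"
    then obtain U where U: "A = (\<Pi>\<^sub>E p\<in>primes. U p)" "\<forall>p. prime p \<longrightarrow> U p \<in> balls_at p" "finite {p. prime p \<and> U p \<noteq> Zp p}"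
      unfolding adele_boxes_def by blast
    let ?S = "{p. prime p \<and> U p \<noteq> Zp p}"
    have "A = ?box ?S (restrict U ?S)" unfolding U(1) by (rule PiE_cong) auto
    moreover have "restrict U ?S \<in> (\<Pi>\<^sub>E p\<in>?S. if prime p then balls_at p else {{}})" using U(2) by auto
    ultimately show "A \<in> (\<Union>S\<in>?F. ?box S ` (\<Pi>\<^sub>E p\<in>S. if prime p then balls_at p else {{}}))" using U(3) by blast
  qed
  moreover have "countable ?F" using countable_Collect_finite by blast
  moreover have "countable (\<Pi>\<^sub>E p\<in>S. if prime p then balls_at p else {{}})" if "finite S" for S
    using that padic_prime.countable_balls[OF padic_primeI] by (intro countable_PiE) auto
  ultimately show ?thesis by (intro countable_subset[of adele_boxes] countable_UN) auto
qed

lemma borel_adele: "borel_sets_of fin_adele_top = sigma_sets fin_adeles adele_boxes"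
  unfolding borel_sets_of_def topspace_fin_adele
proof (rule sigma_sets_eqI)
  fix U assume "U \<in> Collect (openin fin_adele_top)"
  then have "U = \<Union>{V \<in> adele_boxes. V \<subseteq> U}" using adele_box_basis[of U] by blast
  moreover have "countable {V \<in> adele_boxes. V \<subseteq> U}" using countable_adele_boxes by (rule countable_subset[rotated]) auto
  then have "\<Union>{V \<in> adele_boxes. V \<subseteq> U} \<in> sigma_sets fin_adeles adele_boxes"
    by (rule sigma_sets_UNION) auto
  ultimately show "U \<in> sigma_sets fin_adeles adele_boxes" by simp
next
  fix V assume "V \<in> adele_boxes"
  then show "V \<in> sigma_sets fin_adeles (Collect (openin fin_adele_top))"
    using openin_adele_box by (simp add: sigma_sets.Basic)
qed

text \<open>Around \<open>x\<close> the other components are confined to \<open>Zp q\<close>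
  wherever \<open>x q\<close> is integral, so the neighbourhood is a box with finitely many
  exceptional primes.\<close>

lemma component_vimage_open:
  assumes p: "prime p" and V: "openin (padic_top p) V"
  shows "openin fin_adele_top {x \<in> fin_adeles. x p \<in> V}"
proof (subst openin_subopen, intro ballI)
  fix x assume x: "x \<in> {x \<in> fin_adeles. x p \<in> V}"
  let ?U = "\<lambda>q. if q = p then V else if x q \<in> Zp q then Zp q else padic_carrier q"
  have Vc: "V \<subseteq> padic_carrier p" using openin_subset[OF V] padic_prime.topspace_padic[OF padic_primeI[OF p]] by simp
  have fin: "finite {q. prime q \<and> ?U q \<noteq> Zp q}"
    by (rule finite_subset[of _ "insert p {q. prime q \<and> x q \<notin> Zp q}"]) (use x fin_adeles_bad[of x] in auto)
  have "openin fin_adele_top (\<Pi>\<^sub>E q\<in>primes. ?U q)"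
    using V openin_padic_carrier padic_prime.openin_Zp[OF padic_primeI] by (intro openin_box fin) auto
  moreover have "x \<in> (\<Pi>\<^sub>E q\<in>primes. ?U q)"
    using x fin_adeles_ext[of x] fin_adeles_component[of x] by (auto simp: PiE_iff)
  moreover have "(\<Pi>\<^sub>E q\<in>primes. ?U q) \<subseteq> {x \<in> fin_adeles. x p \<in> V}"
  proof -
    have "(\<Pi>\<^sub>E q\<in>primes. ?U q) \<subseteq> fin_adeles" using Vc Zp_subset by (intro box_subset_fin_adeles fin) auto
    moreover have "y p \<in> V" if "y \<in> (\<Pi>\<^sub>E q\<in>primes. ?U q)" for y
      using PiE_mem[OF that, of p] p by simp
    ultimately show ?thesis by blast
  qed
  ultimately show "\<exists>T. openin fin_adele_top T \<and> x \<in> T \<and> T \<subseteq> {x \<in> fin_adeles. x p \<in> V}" by blast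
qed

lemma component_vimage_sets:
  assumes p: "prime p" and A: "A \<in> sets (padic_haar p)"
  shows "{x \<in> fin_adeles. x p \<in> A} \<in> borel_sets_of fin_adele_top"
proof -
  have s: "sets (sigma fin_adeles adele_boxes) = borel_sets_of fin_adele_top"
    using adele_boxes_Pow by (simp add: borel_adele)
  have sp: "space (sigma fin_adeles adele_boxes) = fin_adeles" using adele_boxes_Pow by simp
  have "(\<lambda>x. x p) \<in> measurable (sigma fin_adeles adele_boxes) (padic_haar p)"
  proof (rule measurable_sigma_sets[OF haar_sets[OF p] padic_prime.balls_Pow[OF padic_primeI[OF p]]])
    show "(\<lambda>x. x p) \<in> space (sigma fin_adeles adele_boxes) \<rightarrow> padic_carrier p"
      using fin_adeles_component p by (auto simp: sp)
    fix V assume "V \<in> balls_at p"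
    then have "openin fin_adele_top {x \<in> fin_adeles. x p \<in> V}"
      by (intro component_vimage_open[OF p] openin_ball[OF p])
    moreover have "(\<lambda>x. x p) -` V \<inter> space (sigma fin_adeles adele_boxes) = {x \<in> fin_adeles. x p \<in> V}"
      by (auto simp: sp)
    ultimately show "(\<lambda>x. x p) -` V \<inter> space (sigma fin_adeles adele_boxes) \<in> sets (sigma fin_adeles adele_boxes)"
      unfolding s by (simp add: borel_sets_of_def sigma_sets.Basic)
  qed
  from measurable_sets[OF this A]
  have "(\<lambda>x. x p) -` A \<inter> space (sigma fin_adeles adele_boxes) \<in> borel_sets_of fin_adele_top" unfolding s .
  moreover have "(\<lambda>x. x p) -` A \<inter> space (sigma fin_adeles adele_boxes) = {x \<in> fin_adeles. x p \<in> A}"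
    by (auto simp: sp)
  ultimately show ?thesis by simp
qed

text \<open>All but finitely many factors are \<open>Zp p\<close>, which an open box takes care of;
  the remaining ones are cut out by preimages under the component maps.\<close>

lemma box_sets:
  assumes A: "\<And>p. prime p \<Longrightarrow> A p \<in> sets (padic_haar p)" and fin: "finite {p. prime p \<and> A p \<noteq> Zp p}"
  shows "(\<Pi>\<^sub>E p\<in>primes. A p) \<in> borel_sets_of fin_adele_top"
proof -
  let ?S = "{p. prime p \<and> A p \<noteq> Zp p}"
  let ?U = "\<lambda>p. if p \<in> ?S then padic_carrier p else Zp p"
  interpret sigma_algebra fin_adeles "borel_sets_of fin_adele_top"
    unfolding borel_adele by (rule sigma_algebra_sigma_sets[OF adele_boxes_Pow])
  have Ac: "A p \<subseteq> padic_carrier p" if "prime p" for p using sets.sets_into_space[OF A[OF that]] haar_space[OF that] by simp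
  have "openin fin_adele_top (\<Pi>\<^sub>E p\<in>primes. ?U p)"
  proof (rule openin_box)
    show "finite {p. prime p \<and> ?U p \<noteq> Zp p}" by (rule finite_subset[OF _ fin]) auto
  qed (use openin_padic_carrier padic_prime.openin_Zp[OF padic_primeI] in auto)
  then have 1: "(\<Pi>\<^sub>E p\<in>primes. ?U p) \<in> borel_sets_of fin_adele_top"
    by (simp add: borel_sets_of_def sigma_sets.Basic)
  have bx: "(\<Pi>\<^sub>E p\<in>primes. A p) \<subseteq> fin_adeles" by (rule box_subset_fin_adeles[OF Ac fin])
  have "(\<Pi>\<^sub>E p\<in>primes. A p) = (\<Pi>\<^sub>E p\<in>primes. ?U p) \<inter> (\<Inter>p\<in>?S. {x \<in> fin_adeles. x p \<in> A p}) \<inter> fin_adeles"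
  proof (intro equalityI subsetI)
    fix x assume x: "x \<in> (\<Pi>\<^sub>E p\<in>primes. A p)"
    have xA: "x p \<in> A p" if "prime p" for p using PiE_mem[OF x] that by simp
    have "x \<in> fin_adeles" using x bx by blast
    moreover have "x \<in> (\<Pi>\<^sub>E p\<in>primes. ?U p)"
    proof -
      have "x p \<in> ?U p" if "prime p" for p using xA[OF that] Ac[OF that] that by auto
      then show ?thesis using x by (auto simp: PiE_iff)
    qed
    ultimately show "x \<in> (\<Pi>\<^sub>E p\<in>primes. ?U p) \<inter> (\<Inter>p\<in>?S. {x \<in> fin_adeles. x p \<in> A p}) \<inter> fin_adeles"
      using xA by blast
  next
    fix x assume x: "x \<in> (\<Pi>\<^sub>E p\<in>primes. ?U p) \<inter> (\<Inter>p\<in>?S. {x \<in> fin_adeles. x p \<in> A p}) \<inter> fin_adeles"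
    have "x p \<in> A p" if p: "prime p" for p
    proof (cases "p \<in> ?S")
      case True then show ?thesis using x by blast
    next
      case False
      have "x p \<in> ?U p" using x p by (blast dest: PiE_mem)
      then show ?thesis using False p by simp
    qed
    then show "x \<in> (\<Pi>\<^sub>E p\<in>primes. A p)" using x by (auto simp: PiE_iff)
  qed
  moreover have "\<dots> \<in> borel_sets_of fin_adele_top"
  proof (cases "?S = {}")
    \<comment> \<open>Without exceptional primes the intersection over the empty index set is
      \<open>UNIV\<close>.\<close>
    case True
    then have "(\<Inter>p\<in>?S. {x \<in> fin_adeles. x p \<in> A p}) = UNIV" by (simp only: image_empty Inter_empty)
    then show ?thesis using Int[OF 1 top] by (simp only: Int_UNIV_right)
  next
    case False
    have "(\<Inter>p\<in>?S. {x \<in> fin_adeles. x p \<in> A p}) \<in> borel_sets_of fin_adele_top"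
      using component_vimage_sets A by (intro finite_INT[OF fin False]) blast
    then show ?thesis using 1 by (intro Int) auto
  qed
  ultimately show ?thesis by simp
qed

subsection \<open>The measure\<close>

lemma prime_prod_eq:
  assumes "finite S" "\<And>p. p \<in> S \<Longrightarrow> prime p" "\<And>p. prime p \<Longrightarrow> p \<notin> S \<Longrightarrow> a p = 1"
  shows "prime_prod a = (\<Prod>p\<in>S. a p)"
  unfolding prime_prod_def using assms by (intro prod.mono_neutral_left) auto

text \<open>The Haar measure of \<open>Q_p\<close> is infinite, while an infinite product needs
  probability factors. On a single coset of \<open>Z_p\<close> the restricted Haar measure is
  one.\<close>

definition reps_measure :: "nat \<Rightarrow> padic \<Rightarrow> padic measure" where
  "reps_measure p y = density (padic_haar p) (indicator (ball_at p y 0))"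

lemma reps_carrier: "y \<in> padic_reps p \<Longrightarrow> y \<in> padic_carrier p"
  by (simp add: padic_reps_def)

lemma reps_measure_emeasure:
  assumes p: "prime p" and y: "y \<in> padic_reps p" and A: "A \<in> sets (padic_haar p)"
  shows "emeasure (reps_measure p y) A = emeasure (padic_haar p) (A \<inter> ball_at p y 0)"
proof -
  have B: "ball_at p y 0 \<in> sets (padic_haar p)"
    by (intro balls_sets ball_in_balls p reps_carrier y) simp
  have "emeasure (reps_measure p y) A = (\<integral>\<^sup>+u. indicator (ball_at p y 0) u * indicator A u \<partial>padic_haar p)"
    unfolding reps_measure_def using A B by (intro emeasure_density) auto
  also have "\<dots> = (\<integral>\<^sup>+u. indicator (A \<inter> ball_at p y 0) u \<partial>padic_haar p)"
    by (intro nn_integral_cong) (auto simp: indicator_def)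
  also have "\<dots> = emeasure (padic_haar p) (A \<inter> ball_at p y 0)" using A B by simp
  finally show ?thesis .
qed

lemma reps_measure_prob: assumes p: "prime p" and y: "y \<in> padic_reps p" shows "prob_space (reps_measure p y)"
proof (rule prob_spaceI)
  have "space (reps_measure p y) = space (padic_haar p)" by (simp add: reps_measure_def)
  then have "emeasure (reps_measure p y) (space (reps_measure p y)) = emeasure (padic_haar p) (space (padic_haar p) \<inter> ball_at p y 0)"
    using reps_measure_emeasure[OF p y sets.top] by simp
  also have "space (padic_haar p) \<inter> ball_at p y 0 = ball_at p y 0"
    using padic_prime.B_subset[OF padic_primeI[OF p]] haar_space[OF p] by blast
  also have "emeasure (padic_haar p) (ball_at p y 0) = 1"
    using haar_ball[OF p reps_carrier[OF y], of 0] by simp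
  finally show "emeasure (reps_measure p y) (space (reps_measure p y)) = 1" .
qed

text \<open>Representatives have digits at negative positions only, and these are fixed by the
  coset.\<close>

lemma reps_disjoint:
  assumes p: "prime p" and x: "x \<in> padic_reps p" "y \<in> padic_reps p" "z \<in> ball_at p x 0" "z \<in> ball_at p y 0"
  shows "x = y"
proof -
  interpret padic_prime p by (rule padic_primeI[OF p])
  have "P x 0 = P y 0" using x(3,4) by (simp add: B_def)
  then have "\<forall>k<0. x k = y k" using P_eq_digits[OF reps_carrier[OF x(1)] reps_carrier[OF x(2)]] by blast
  moreover have "\<forall>k\<ge>0. x k = y k" using x(1,2) by (simp add: padic_reps_def)
  ultimately show ?thesis by (intro ext) (metis linorder_not_less)
qed

lemma zero_reps: "prime p \<Longrightarrow> (\<lambda>_. 0) \<in> padic_reps p"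
  using padic_prime.zero_carrier[OF padic_primeI] by (simp add: padic_reps_def)

lemma reps_cover:
  assumes p: "prime p" shows "(\<Union>y\<in>padic_reps p. ball_at p y 0) = padic_carrier p"
proof -
  interpret padic_prime p by (rule padic_primeI[OF p])
  show ?thesis
  proof (intro equalityI subsetI)
    fix u assume u: "u \<in> padic_carrier p"
    define y where "y k = (if k < 0 then u k else 0)" for k :: int
    have y: "y \<in> padic_reps p" using u p_gt_1 unfolding padic_reps_def padic_carrier_def y_def by fastforce
    have "P u 0 = P y 0" using P_eq_digits[OF u reps_carrier[OF y], of 0] by (simp add: y_def)
    then have "u \<in> ball_at p y 0" using u by (simp add: B_def)
    then show "u \<in> (\<Union>y\<in>padic_reps p. ball_at p y 0)" using y by blast
  qed (auto simp: B_def)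
qed

lemma countable_reps: assumes p: "prime p" shows "countable (padic_reps p)"
proof -
  interpret padic_prime p by (rule padic_primeI[OF p])
  have "inj_on (\<lambda>y. P y 0) (padic_reps p)"
  proof (rule inj_onI)
    fix x y assume xy: "x \<in> padic_reps p" "y \<in> padic_reps p" "P x 0 = P y 0"
    have "x \<in> B x 0" "x \<in> B y 0" using xy reps_carrier[of x p] by (auto simp: B_def)
    then show "x = y" using reps_disjoint[OF p xy(1,2)] by blast
  qed
  moreover have "countable ((\<lambda>y. P y 0) ` padic_reps p)" by (rule countable_subset[OF subset_UNIV]) simp
  ultimately show ?thesis by (rule countable_image_inj_on[rotated])
qed

lemma haar_sum_reps:
  assumes p: "prime p" and A: "A \<in> sets (padic_haar p)"
  shows "emeasure (padic_haar p) A = (\<integral>\<^sup>+y. emeasure (reps_measure p y) A \<partial>count_space (padic_reps p))"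
proof -
  have As: "A \<subseteq> padic_carrier p" using sets.sets_into_space[OF A] haar_space[OF p] by simp
  have B: "ball_at p y 0 \<in> sets (padic_haar p)" if "y \<in> padic_reps p" for y
    using that by (intro balls_sets ball_in_balls p reps_carrier) auto
  have "A = (\<Union>y\<in>padic_reps p. A \<inter> ball_at p y 0)" using reps_cover[OF p] As by blast
  then have "emeasure (padic_haar p) A = emeasure (padic_haar p) (\<Union>y\<in>padic_reps p. A \<inter> ball_at p y 0)" by simp
  also have "\<dots> = (\<integral>\<^sup>+y. emeasure (padic_haar p) (A \<inter> ball_at p y 0) \<partial>count_space (padic_reps p))"
    by (rule emeasure_UN_countable)
       (use A B countable_reps[OF p] reps_disjoint[OF p] in \<open>auto simp: disjoint_family_on_def\<close>)
  also have "\<dots> = (\<integral>\<^sup>+y. emeasure (reps_measure p y) A \<partial>count_space (padic_reps p))"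
    by (rule nn_integral_cong) (simp add: reps_measure_emeasure[OF p _ A])
  finally show ?thesis .
qed

text \<open>Representatives of the finite adeles modulo the integral ones: fractional parts at
  finitely many primes.\<close>

definition adele_reps :: "(nat \<Rightarrow> padic) set" where
  "adele_reps = {d \<in> (\<Pi>\<^sub>E p\<in>primes. padic_reps p). finite {p. prime p \<and> d p \<noteq> (\<lambda>_. 0)}}"

abbreviation coset_prod :: "(nat \<Rightarrow> padic) \<Rightarrow> (nat \<Rightarrow> padic) measure" where
  "coset_prod d \<equiv> PiM primes (\<lambda>p. reps_measure p (d p))"

text \<open>Each coset of the integral adeles carries an infinite product of probability measures;
  the integral against counting measure adds these up.\<close>

definition adele_mu :: "(nat \<Rightarrow> padic) measure" where
  "adele_mu = measure_of fin_adeles (borel_sets_of fin_adele_top)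
      (\<lambda>A. \<integral>\<^sup>+d. emeasure (coset_prod d) A \<partial>count_space adele_reps)"

lemma borel_adele_sigma_algebra: "sigma_algebra fin_adeles (borel_sets_of fin_adele_top)"
  unfolding borel_adele by (rule sigma_algebra_sigma_sets[OF adele_boxes_Pow])

lemma space_adele_mu: "space adele_mu = fin_adeles"
  and sets_adele_mu: "sets adele_mu = borel_sets_of fin_adele_top"
proof -
  interpret sigma_algebra fin_adeles "borel_sets_of fin_adele_top" by (rule borel_adele_sigma_algebra)
  show "space adele_mu = fin_adeles" "sets adele_mu = borel_sets_of fin_adele_top"
    unfolding adele_mu_def using space_closed by (auto simp: space_measure_of_conv sigma_sets_eq)
qed

text \<open>The finite adeles are the union over \<open>n\<close> of the boxes that are integral at
  all primes from \<open>n\<close> on, each of which is measurable in the full product.\<close>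

lemma fin_adeles_coset_prod: "fin_adeles \<in> sets (coset_prod d)"
proof -
  let ?M = "coset_prod d"
  have sp: "space ?M = (\<Pi>\<^sub>E p\<in>primes. padic_carrier p)"
    unfolding space_PiM by (rule PiE_cong) (simp add: reps_measure_def haar_space)
  have Z: "(\<Pi>\<^sub>E p\<in>primes. if p < n then padic_carrier p else Zp p) \<in> sets ?M" for n
  proof (rule sets_PiM_I_countable)
    fix p assume "p \<in> primes"
    then have p: "prime p" by simp
    have "padic_carrier p \<in> sets (padic_haar p)" using sets.top[of "padic_haar p"] haar_space[OF p] by simp
    then show "(if p < n then padic_carrier p else Zp p) \<in> sets (reps_measure p (d p))"
      using balls_sets[OF p Zp_balls[OF p]] by (simp add: reps_measure_def)
  qed simp
  have eq: "fin_adeles = (\<Union>n. \<Pi>\<^sub>E p\<in>primes. if p < n then padic_carrier p else Zp p)"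
  proof (intro equalityI subsetI)
    fix x assume x: "x \<in> fin_adeles"
    obtain n where n: "\<forall>p\<in>{p. prime p \<and> x p \<notin> Zp p}. p < n"
      using fin_adeles_bad[OF x] finite_nat_set_iff_bounded by blast
    have "x \<in> (\<Pi>\<^sub>E p\<in>primes. if p < n then padic_carrier p else Zp p)"
      using fin_adeles_ext[OF x] fin_adeles_component[OF x] n by (auto simp: PiE_iff)
    then show "x \<in> (\<Union>n. \<Pi>\<^sub>E p\<in>primes. if p < n then padic_carrier p else Zp p)" by blast
  next
    fix x assume "x \<in> (\<Union>n. \<Pi>\<^sub>E p\<in>primes. if p < n then padic_carrier p else Zp p)"
    then obtain n where x: "x \<in> (\<Pi>\<^sub>E p\<in>primes. if p < n then padic_carrier p else Zp p)" by blast
    have "(\<Pi>\<^sub>E p\<in>primes. if p < n then padic_carrier p else Zp p) \<subseteq> fin_adeles"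
      by (rule box_subset_fin_adeles) (use Zp_subset in \<open>auto intro!: finite_subset[of _ "{..<n}"]\<close>)
    then show "x \<in> fin_adeles" using x by blast
  qed
  show ?thesis unfolding eq by (rule sets.countable_UN) (use Z in blast)
qed

lemma borel_adele_coset_prod: "borel_sets_of fin_adele_top \<subseteq> sets (coset_prod d)"
  unfolding borel_adele
proof
  fix A assume "A \<in> sigma_sets fin_adeles adele_boxes"
  then show "A \<in> sets (coset_prod d)"
  proof (induction rule: sigma_sets.induct)
    case (Basic A)
    then obtain U where U: "A = (\<Pi>\<^sub>E p\<in>primes. U p)" "\<forall>p. prime p \<longrightarrow> U p \<in> balls_at p"
      unfolding adele_boxes_def by blast
    show ?case unfolding U(1)
      using U(2) balls_sets by (intro sets_PiM_I_countable) (auto simp: reps_measure_def)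
  qed (auto intro: fin_adeles_coset_prod)
qed

text \<open>Countable additivity is the interchange of the sum over cosets with the sum over the
  disjoint sets.\<close>

lemma emeasure_adele_mu:
  assumes A: "A \<in> borel_sets_of fin_adele_top"
  shows "emeasure adele_mu A = (\<integral>\<^sup>+d. emeasure (coset_prod d) A \<partial>count_space adele_reps)"
  unfolding adele_mu_def
proof (rule emeasure_measure_of_sigma[OF borel_adele_sigma_algebra _ _ A])
  show "positive (borel_sets_of fin_adele_top) (\<lambda>A. \<integral>\<^sup>+d. emeasure (coset_prod d) A \<partial>count_space adele_reps)"
    by (simp add: positive_def)
  show "countably_additive (borel_sets_of fin_adele_top) (\<lambda>A. \<integral>\<^sup>+d. emeasure (coset_prod d) A \<partial>count_space adele_reps)"
  proof (rule countably_additiveI)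
    fix A :: "nat \<Rightarrow> (nat \<Rightarrow> padic) set"
    assume A: "range A \<subseteq> borel_sets_of fin_adele_top" "disjoint_family A"
    have "(\<Sum>i. \<integral>\<^sup>+d. emeasure (coset_prod d) (A i) \<partial>count_space adele_reps)
       = (\<integral>\<^sup>+d. (\<Sum>i. emeasure (coset_prod d) (A i)) \<partial>count_space adele_reps)"
      by (rule nn_integral_suminf[symmetric]) simp
    also have "\<dots> = (\<integral>\<^sup>+d. emeasure (coset_prod d) (\<Union>i. A i) \<partial>count_space adele_reps)"
      using A borel_adele_coset_prod by (intro nn_integral_cong suminf_emeasure) auto
    finally show "(\<Sum>i. \<integral>\<^sup>+d. emeasure (coset_prod d) (A i) \<partial>count_space adele_reps)
       = (\<integral>\<^sup>+d. emeasure (coset_prod d) (\<Union>i. A i) \<partial>count_space adele_reps)" .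
  qed
qed

lemma adele_reps_component: "d \<in> adele_reps \<Longrightarrow> prime p \<Longrightarrow> d p \<in> padic_reps p"
  by (auto simp: adele_reps_def PiE_iff)

text \<open>Off \<open>S\<close> the box has the factor \<open>Zp p\<close>. A coset with a nonzero
  representative there meets the box in a null set; on the other cosets the constraints off
  \<open>S\<close> hold almost surely, and the box becomes a cylinder over the finite set
  \<open>S\<close>.\<close>

lemma coset_prod_box:
  assumes d: "d \<in> adele_reps" and A: "\<And>p. prime p \<Longrightarrow> A p \<in> sets (padic_haar p)"
    and S: "finite S" "\<And>p. p \<in> S \<Longrightarrow> prime p" "\<And>p. prime p \<Longrightarrow> p \<notin> S \<Longrightarrow> A p = Zp p"
  shows "emeasure (coset_prod d) (\<Pi>\<^sub>E p\<in>primes. A p) =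
    (if \<forall>p. prime p \<and> p \<notin> S \<longrightarrow> d p = (\<lambda>_. 0) then \<Prod>p\<in>S. emeasure (reps_measure p (d p)) (A p) else 0)"
proof -
  let ?M = "coset_prod d"
  have prob: "prob_space (reps_measure p (d p))" if "p \<in> primes" for p
    using that reps_measure_prob adele_reps_component[OF d] by simp
  have Am: "A p \<in> sets (reps_measure p (d p))" if "prime p" for p using A[OF that] by (simp add: reps_measure_def)
  have sp: "space ?M = (\<Pi>\<^sub>E p\<in>primes. padic_carrier p)"
    unfolding space_PiM by (rule PiE_cong) (simp add: reps_measure_def haar_space)
  have Ac: "A p \<subseteq> padic_carrier p" if "prime p" for p using sets.sets_into_space[OF A[OF that]] haar_space[OF that] by simp
  have bM: "(\<Pi>\<^sub>E p\<in>primes. A p) \<in> sets ?M" by (rule sets_PiM_I_countable) (use Am in auto)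
  have S': "S \<subseteq> primes" using S(2) by auto
  show ?thesis
  proof (cases "\<forall>p. prime p \<and> p \<notin> S \<longrightarrow> d p = (\<lambda>_. 0)")
    case True
    let ?E = "prod_emb primes (\<lambda>p. reps_measure p (d p)) S (Pi\<^sub>E S A)"
    have "AE x in ?M. x p \<in> Zp p" if p: "p \<in> primes - S" for p
    proof (rule AE_PiM_component[OF prob])
      have pp: "prime p" and dp: "d p = (\<lambda>_. 0)" using p True by auto
      interpret prob_space "reps_measure p (d p)" by (rule prob) (use pp in simp)
      have Z: "Zp p \<in> sets (padic_haar p)" by (rule balls_sets[OF pp Zp_balls[OF pp]])
      have "emeasure (reps_measure p (d p)) (Zp p) = 1"
        using reps_measure_emeasure[OF pp adele_reps_component[OF d pp] Z] haar_Zp[OF pp]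
        unfolding dp Zp_ball[OF pp, symmetric] by simp
      then have "prob (Zp p) = 1" by (simp add: measure_def)
      moreover have "Zp p \<in> events" using Z by (simp add: reps_measure_def)
      ultimately show "AE x in reps_measure p (d p). x \<in> Zp p" using prob_eq_1 by blast
    qed (use p in auto)
    then have "AE x in ?M. \<forall>p\<in>primes - S. x p \<in> Zp p" by (subst AE_ball_countable) auto
    then have ae: "AE x in ?M. x \<in> (\<Pi>\<^sub>E p\<in>primes. A p) \<longleftrightarrow> x \<in> ?E"
    proof (rule AE_mp, intro AE_I2 impI)
      fix x assume x: "x \<in> space ?M" "\<forall>p\<in>primes - S. x p \<in> Zp p"
      have "x \<in> ?E \<longleftrightarrow> (\<forall>p\<in>S. x p \<in> A p)"
        using x(1) by (auto simp: prod_emb_def space_PiM PiE_iff)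
      moreover have "x \<in> (\<Pi>\<^sub>E p\<in>primes. A p) \<longleftrightarrow> (\<forall>p\<in>S. x p \<in> A p)"
      proof
        assume "x \<in> (\<Pi>\<^sub>E p\<in>primes. A p)" then show "\<forall>p\<in>S. x p \<in> A p" using S' by (auto simp: PiE_iff)
      next
        assume h: "\<forall>p\<in>S. x p \<in> A p"
        have "x p \<in> A p" if "prime p" for p
          using h x(2) S(3)[OF that] that by (cases "p \<in> S") auto
        then show "x \<in> (\<Pi>\<^sub>E p\<in>primes. A p)" using x(1) unfolding sp by (auto simp: PiE_iff)
      qed
      ultimately show "x \<in> (\<Pi>\<^sub>E p\<in>primes. A p) \<longleftrightarrow> x \<in> ?E" by simp
    qed
    have "?E \<in> sets ?M" by (rule measurable_prod_emb) (use S(1) S' Am in \<open>auto intro!: sets_PiM_I_finite\<close>)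
    then have "emeasure ?M (\<Pi>\<^sub>E p\<in>primes. A p) = emeasure ?M ?E" by (intro emeasure_eq_AE ae bM)
    also have "\<dots> = (\<Prod>p\<in>S. emeasure (reps_measure p (d p)) (A p))"
      by (rule emeasure_PiM_emb[OF prob S' S(1)]) (use Am S(2) in auto)
    finally show ?thesis using True by simp
  next
    case False
    then obtain p where p: "prime p" "p \<notin> S" "d p \<noteq> (\<lambda>_. 0)" by blast
    have dp: "d p \<in> padic_reps p" by (rule adele_reps_component[OF d p(1)])
    have "Zp p \<inter> ball_at p (d p) 0 = {}"
    proof (rule equals0I)
      fix z assume "z \<in> Zp p \<inter> ball_at p (d p) 0"
      then have "(\<lambda>_. 0) = d p" unfolding Zp_ball[OF p(1)]
        by (intro reps_disjoint[OF p(1) zero_reps[OF p(1)] dp]) auto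
      then show False using p(3) by simp
    qed
    then have z: "emeasure (reps_measure p (d p)) (Zp p) = 0"
      using reps_measure_emeasure[OF p(1) dp balls_sets[OF p(1) Zp_balls[OF p(1)]]] by simp
    let ?E = "prod_emb primes (\<lambda>p. reps_measure p (d p)) {p} (Pi\<^sub>E {p} (\<lambda>p. Zp p))"
    have Zs: "Zp p \<in> sets (reps_measure p (d p))"
      using balls_sets[OF p(1) Zp_balls[OF p(1)]] by (simp add: reps_measure_def)
    have "emeasure ?M ?E = (\<Prod>q\<in>{p}. emeasure (reps_measure q (d q)) (Zp q))"
      by (rule emeasure_PiM_emb[OF prob]) (use p Zs in auto)
    then have E0: "emeasure ?M ?E = 0" using z by simp
    have "(\<Pi>\<^sub>E p\<in>primes. A p) \<subseteq> ?E"
    proof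
      fix x assume x: "x \<in> (\<Pi>\<^sub>E p\<in>primes. A p)"
      then have "x \<in> space ?M" using sets.sets_into_space[OF bM] by blast
      moreover have "x p \<in> Zp p" using PiE_mem[OF x, of p] p S(3) by simp
      ultimately show "x \<in> ?E" by (auto simp: prod_emb_def space_PiM)
    qed
    moreover have "?E \<in> sets ?M" by (rule measurable_prod_emb) (use p Zs in \<open>auto intro!: sets_PiM_I_finite\<close>)
    ultimately have "emeasure ?M (\<Pi>\<^sub>E p\<in>primes. A p) \<le> 0" using emeasure_mono[of _ ?E ?M] E0 by metis
    then show ?thesis unfolding if_not_P[OF False] by simp
  qed
qed

text \<open>Only cosets with representatives supported in \<open>S\<close> contribute. The sum over
  them runs over a finite product of index sets, and Fubini turns the sum of products into a product
  of sums, each of them a local Haar measure by \<open>haar_sum_reps\<close>.\<close>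

lemma adele_mu_box:
  assumes A: "\<And>p. prime p \<Longrightarrow> A p \<in> sets (padic_haar p)" and fin: "finite {p. prime p \<and> A p \<noteq> Zp p}"
  shows "emeasure adele_mu (\<Pi>\<^sub>E p\<in>primes. A p) = prime_prod (\<lambda>p. emeasure (padic_haar p) (A p))"
proof -
  define S where "S = {p. prime p \<and> A p \<noteq> Zp p}"
  have S: "finite S" "\<And>p. p \<in> S \<Longrightarrow> prime p" "\<And>p. prime p \<Longrightarrow> p \<notin> S \<Longrightarrow> A p = Zp p"
    using fin by (auto simp: S_def)
  let ?f = "\<lambda>d. \<Prod>p\<in>S. emeasure (reps_measure p (d p)) (A p)"
  let ?D = "{d \<in> adele_reps. \<forall>p. prime p \<and> p \<notin> S \<longrightarrow> d p = (\<lambda>_. 0)}"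
  \<comment> \<open>The product of counting measures asks for sigma-finiteness at every natural
    number, so indices that are not prime get the empty set.\<close>
  let ?R = "\<lambda>p. if prime p then padic_reps p else {}"
  have bx: "(\<Pi>\<^sub>E p\<in>primes. A p) \<in> borel_sets_of fin_adele_top" by (rule box_sets[OF A fin])
  have "emeasure adele_mu (\<Pi>\<^sub>E p\<in>primes. A p) =
    (\<integral>\<^sup>+d. (if \<forall>p. prime p \<and> p \<notin> S \<longrightarrow> d p = (\<lambda>_. 0) then ?f d else 0) \<partial>count_space adele_reps)"
    unfolding emeasure_adele_mu[OF bx]
  proof (rule nn_integral_cong)
    fix d assume "d \<in> space (count_space adele_reps)"
    then have "d \<in> adele_reps" by simp
    then show "emeasure (coset_prod d) (\<Pi>\<^sub>E p\<in>primes. A p) = (if \<forall>p. prime p \<and> p \<notin> S \<longrightarrow> d p = (\<lambda>_. 0) then ?f d else 0)"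
      by (rule coset_prod_box[OF _ A S])
  qed
  also have "\<dots> = (\<integral>\<^sup>+d. (if \<forall>p. prime p \<and> p \<notin> S \<longrightarrow> d p = (\<lambda>_. 0) then ?f d else 0) \<partial>count_space ?D)"
    by (rule nn_integral_count_space_eq) auto
  also have "\<dots> = (\<integral>\<^sup>+d. ?f (restrict d S) \<partial>count_space ?D)"
    by (rule nn_integral_cong) auto
  also have "\<dots> = (\<integral>\<^sup>+d. ?f d \<partial>count_space (Pi\<^sub>E S ?R))"
  \<comment> \<open>Restriction to \<open>S\<close> is inverted by extending with the zero
    representative on the other primes and with \<open>undefined\<close> off the primes.\<close>
  proof (rule nn_integral_bij_count_space, rule bij_betwI[where g="\<lambda>d p. if p \<in> S then d p else if prime p then (\<lambda>_. 0) else undefined"])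
    show "(\<lambda>d. restrict d S) \<in> ?D \<rightarrow> Pi\<^sub>E S ?R"
      using S(2) adele_reps_component by auto
    show "(\<lambda>d p. if p \<in> S then d p else if prime p then (\<lambda>_. 0) else undefined) \<in> Pi\<^sub>E S ?R \<rightarrow> ?D"
    proof
      fix d assume d: "d \<in> Pi\<^sub>E S ?R"
      have dS: "d p \<in> padic_reps p" if "p \<in> S" for p using PiE_mem[OF d that] S(2)[OF that] by simp
      let ?d = "\<lambda>p. if p \<in> S then d p else if prime p then (\<lambda>_. 0) else undefined"
      have "?d \<in> (\<Pi>\<^sub>E p\<in>primes. padic_reps p)"
        using dS zero_reps S(2) by (auto simp: PiE_iff extensional_def)
      moreover have "finite {p. prime p \<and> ?d p \<noteq> (\<lambda>_. 0)}" by (rule finite_subset[OF _ S(1)]) auto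
      ultimately show "?d \<in> ?D" unfolding adele_reps_def by auto
    qed
    fix d assume "d \<in> ?D"
    then have d: "d \<in> extensional primes" "\<forall>p. prime p \<and> p \<notin> S \<longrightarrow> d p = (\<lambda>_. 0)" by (auto simp: adele_reps_def PiE_iff)
    show "(\<lambda>p. if p \<in> S then restrict d S p else if prime p then (\<lambda>_. 0) else undefined) = d"
      by (rule ext) (use d in \<open>auto simp: extensional_def\<close>)
  next
    fix d assume "d \<in> Pi\<^sub>E S ?R"
    then have "d \<in> extensional S" by (auto simp: PiE_iff)
    then show "restrict (\<lambda>p. if p \<in> S then d p else if prime p then (\<lambda>_. 0) else undefined) S = d"
      by (intro ext) (auto simp: extensional_def)
  qed
  also have "\<dots> = (\<integral>\<^sup>+d. ?f d \<partial>PiM S (\<lambda>p. count_space (?R p)))"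
    using countable_reps by (subst count_space_PiM_finite[OF S(1)]) auto
  also have "\<dots> = (\<Prod>p\<in>S. \<integral>\<^sup>+y. emeasure (reps_measure p y) (A p) \<partial>count_space (?R p))"
  proof -
    interpret product_sigma_finite "\<lambda>p. count_space (?R p)"
      by (rule product_sigma_finite.intro, rule sigma_finite_measure_count_space_countable)
         (use countable_reps in auto)
    show ?thesis by (rule product_nn_integral_prod[OF S(1)]) simp
  qed
  also have "\<dots> = (\<Prod>p\<in>S. emeasure (padic_haar p) (A p))"
    using S(2) haar_sum_reps A by (intro prod.cong) auto
  also have "\<dots> = prime_prod (\<lambda>p. emeasure (padic_haar p) (A p))"
    by (rule prime_prod_eq[symmetric]) (use S haar_Zp in auto)
  finally show ?thesis .
qed

lemma prime_prod_finite:
  assumes "\<And>p. prime p \<Longrightarrow> a p < (\<infinity> :: ennreal)" shows "prime_prod a < \<infinity>"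
proof (cases "finite {p. prime p \<and> a p \<noteq> 1}")
  case True
  have "(\<Prod>p\<in>F. a p) < \<infinity>" if "F \<subseteq> {p. prime p \<and> a p \<noteq> 1}" for F
    using finite_subset[OF that True] that
  proof (induction F rule: finite_induct)
    case (insert q F)
    then have "a q < \<infinity>" using assms by blast
    then show ?case using insert by (simp add: ennreal_mult_less_top)
  qed simp
  then show ?thesis unfolding prime_prod_def by blast
next
  \<comment> \<open>A product over an infinite index set defaults to 1.\<close>
  case False then show ?thesis unfolding prime_prod_def by simp
qed

lemma adele_box_cover: "\<Union>adele_boxes = fin_adeles"
proof
  have o: "openin fin_adele_top fin_adeles" by (metis openin_topspace topspace_fin_adele)
  show "fin_adeles \<subseteq> \<Union>adele_boxes"
  proof
    fix x assume "x \<in> fin_adeles"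
    from adele_box_basis[OF o this] show "x \<in> \<Union>adele_boxes" by blast
  qed
qed (use adele_boxes_Pow in auto)

lemma adele_measure_unique:
  assumes M: "sets M = borel_sets_of fin_adele_top" and N: "sets N = borel_sets_of fin_adele_top"
    and eq: "\<And>A. (\<And>p. prime p \<Longrightarrow> A p \<in> balls_at p) \<Longrightarrow> finite {p. prime p \<and> A p \<noteq> Zp p} \<Longrightarrow>
      emeasure M (\<Pi>\<^sub>E p\<in>primes. A p) = prime_prod (\<lambda>p. emeasure (padic_haar p) (A p)) \<and>
      emeasure N (\<Pi>\<^sub>E p\<in>primes. A p) = prime_prod (\<lambda>p. emeasure (padic_haar p) (A p))"
  shows "M = N"
proof (rule measure_eqI_generator_eq_countable[OF Int_stable_adele_boxes adele_boxes_Pow _ _ _ subset_refl adele_box_cover countable_adele_boxes])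
  show "sets M = sigma_sets fin_adeles adele_boxes" "sets N = sigma_sets fin_adeles adele_boxes"
    using M N by (simp_all add: borel_adele)
  fix X assume "X \<in> adele_boxes"
  then obtain U where U: "X = (\<Pi>\<^sub>E p\<in>primes. U p)" "\<forall>p. prime p \<longrightarrow> U p \<in> balls_at p" "finite {p. prime p \<and> U p \<noteq> Zp p}"
    unfolding adele_boxes_def by blast
  have e: "emeasure M X = prime_prod (\<lambda>p. emeasure (padic_haar p) (U p)) \<and> emeasure N X = prime_prod (\<lambda>p. emeasure (padic_haar p) (U p))"
    unfolding U(1) by (rule eq) (use U in auto)
  then show "emeasure M X = emeasure N X" by simp
  have "prime_prod (\<lambda>p. emeasure (padic_haar p) (U p)) < \<infinity>"
    by (rule prime_prod_finite) (use U(2) balls_le_1 in \<open>auto intro: le_less_trans[OF _ ennreal_one_less_top]\<close>)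
  then show "emeasure M X \<noteq> \<infinity>" using e by simp
qed

lemma fin_adele_measure_eq: "fin_adele_measure = adele_mu"
  unfolding fin_adele_measure_def
proof (rule the_equality)
  show "space adele_mu = fin_adeles \<and> sets adele_mu = borel_sets_of fin_adele_top \<and>
    (\<forall>A. (\<forall>p. prime p \<longrightarrow> A p \<in> sets (padic_haar p)) \<and> finite {p. prime p \<and> A p \<noteq> Zp p} \<longrightarrow>
       emeasure adele_mu (\<Pi>\<^sub>E p\<in>primes. A p) = prime_prod (\<lambda>p. emeasure (padic_haar p) (A p)))"
    using adele_mu_box by (simp add: space_adele_mu sets_adele_mu)
  fix M :: "(nat \<Rightarrow> padic) measure"
  assume M: "space M = fin_adeles \<and> sets M = borel_sets_of fin_adele_top \<and>
    (\<forall>A. (\<forall>p. prime p \<longrightarrow> A p \<in> sets (padic_haar p)) \<and> finite {p. prime p \<and> A p \<noteq> Zp p} \<longrightarrow>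
       emeasure M (\<Pi>\<^sub>E p\<in>primes. A p) = prime_prod (\<lambda>p. emeasure (padic_haar p) (A p)))"
  show "M = adele_mu"
  proof (rule adele_measure_unique)
    show "sets M = borel_sets_of fin_adele_top" using M by simp
    show "sets adele_mu = borel_sets_of fin_adele_top" by (rule sets_adele_mu)
    fix A assume "\<And>p. prime p \<Longrightarrow> A p \<in> balls_at p" and fin: "finite {p. prime p \<and> A p \<noteq> Zp p}"
    then have A: "\<And>p. prime p \<Longrightarrow> A p \<in> sets (padic_haar p)" by (intro balls_sets)
    show "emeasure M (\<Pi>\<^sub>E p\<in>primes. A p) = prime_prod (\<lambda>p. emeasure (padic_haar p) (A p)) \<and>
      emeasure adele_mu (\<Pi>\<^sub>E p\<in>primes. A p) = prime_prod (\<lambda>p. emeasure (padic_haar p) (A p))"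
      using M A fin adele_mu_box[OF A fin] by blast
  qed
qed

section \<open>Square-integrable functions\<close>

text \<open>A real-valued norm makes subtraction and scaling convenient; on \<open>L2_space\<close>
  its square agrees with \<open>L2_norm_sq\<close>. Outside, the integral may take its default value
  0.\<close>

definition L2_norm :: "'a measure \<Rightarrow> ('a \<Rightarrow> complex) \<Rightarrow> real" where
  "L2_norm M f = sqrt (LINT t|M. (cmod (f t))\<^sup>2)"

lemma L2_space_measurable: "f \<in> L2_space M \<Longrightarrow> f \<in> borel_measurable M"
  by (simp add: L2_space_def)

lemma L2_space_integrable: "f \<in> L2_space M \<Longrightarrow> integrable M (\<lambda>t. (cmod (f t))\<^sup>2)"
  by (rule integrableI_bounded) (auto simp: L2_space_def L2_norm_sq_def)

lemma L2_spaceI: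
  assumes "f \<in> borel_measurable M" "integrable M (\<lambda>t. (cmod (f t))\<^sup>2)"
  shows "f \<in> L2_space M"
  using assms by (simp add: L2_space_def L2_norm_sq_def nn_integral_eq_integral)

lemma L2_norm_nonneg [simp]: "0 \<le> L2_norm M f"
  by (simp add: L2_norm_def)

lemma L2_norm_square: "(L2_norm M f)\<^sup>2 = (LINT t|M. (cmod (f t))\<^sup>2)"
  by (simp add: L2_norm_def)

lemma L2_norm_sq_eq: "f \<in> L2_space M \<Longrightarrow> L2_norm_sq M f = ennreal ((L2_norm M f)\<^sup>2)"
  by (simp add: L2_norm_sq_def L2_norm_square L2_space_integrable nn_integral_eq_integral)

lemma L2_norm_leI:
  assumes "f \<in> L2_space M" "L2_norm_sq M f \<le> ennreal (a\<^sup>2)" "0 \<le> a"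
  shows "L2_norm M f \<le> a"
proof -
  have "(L2_norm M f)\<^sup>2 \<le> a\<^sup>2" using assms(2) L2_norm_sq_eq[OF assms(1)]
    by (simp add: ennreal_le_iff)
  then show ?thesis using assms(3) by (rule power2_le_imp_le)
qed

text \<open>The best weight is the ratio of the two square roots. If \<open>A\<close> or
  \<open>B\<close> is 0 it degenerates, and a weight depending on \<open>x\<close> yields a
  contradiction instead.\<close>

lemma le_sqrt_mult_if_weighted:
  fixes x A B :: real
  assumes w: "\<And>s. s > 0 \<Longrightarrow> x \<le> (s * A + B / s) / 2" and "A \<ge> 0" "B \<ge> 0"
  shows "x \<le> sqrt A * sqrt B"
proof (rule ccontr)
  assume n: "\<not> ?thesis"
  then have x: "x > 0" using assms by (smt (verit) mult_nonneg_nonneg real_sqrt_ge_zero)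
  show False
  proof (cases "A = 0 \<or> B = 0")
    case True
    then show False
    proof
      \<comment> \<open>The weight \<open>B / x\<close> would give
        \<open>x \<le> x / 2\<close>.\<close>
      assume A: "A = 0"
      have "B \<noteq> 0"
      proof
        assume "B = 0" then show False using w[of 1] x A by simp
      qed
      then show False using w[of "B / x"] x A assms by simp
    next
      assume B: "B = 0"
      have "A \<noteq> 0"
      proof
        assume "A = 0" then show False using w[of 1] x B by simp
      qed
      then show False using w[of "x / A"] x B assms by simp
    qed
  next
    case False
    then have p: "A > 0" "B > 0" using assms by auto
    define a b where "a = sqrt A" and "b = sqrt B"
    have ab: "A = a * a" "B = b * b" "a > 0" "b > 0" using p by (simp_all add: a_def b_def)
    have "x \<le> ((b / a) * A + B / (b / a)) / 2" using w[of "b / a"] ab by simp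
    also have "\<dots> = a * b" using ab by (simp add: field_simps)
    finally show False using n by (simp add: a_def b_def)
  qed
qed

section \<open>Cauchy-Schwarz and triangle inequalities\<close>

lemma L2_inner_integrable:
  assumes "f \<in> L2_space M" "g \<in> L2_space M"
  shows "integrable M (\<lambda>t. f t * cnj (g t))"
proof (rule Bochner_Integration.integrable_bound[where f="\<lambda>t. (cmod (f t))\<^sup>2 + (cmod (g t))\<^sup>2"])
  show "integrable M (\<lambda>t. (cmod (f t))\<^sup>2 + (cmod (g t))\<^sup>2)"
    using assms by (simp add: L2_space_integrable)
  note [measurable] = assms[THEN L2_space_measurable]
  show "(\<lambda>t. f t * cnj (g t)) \<in> borel_measurable M"
    by (intro borel_measurable_times measurable_compose[OF L2_space_measurable[OF assms(2)]]
         L2_space_measurable[OF assms(1)] borel_measurable_continuous_onI continuous_intros)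
  show "AE x in M. norm (f x * cnj (g x)) \<le> norm ((cmod (f x))\<^sup>2 + (cmod (g x))\<^sup>2)"
  proof (rule AE_I2)
    fix x
    have "0 \<le> (cmod (f x) - cmod (g x))\<^sup>2" by simp
    then have "2 * (cmod (f x) * cmod (g x)) \<le> (cmod (f x))\<^sup>2 + (cmod (g x))\<^sup>2"
      by (simp add: power2_diff)
    then show "norm (f x * cnj (g x)) \<le> norm ((cmod (f x))\<^sup>2 + (cmod (g x))\<^sup>2)"
      by (simp add: norm_mult) (smt (verit) mult_nonneg_nonneg norm_ge_zero)
  qed
qed

text \<open>The pointwise inequality \<open>2 a b \<le> s a^2 + b^2 / s\<close> is integrated and
  then optimized over \<open>s\<close>.\<close>

lemma L2_Cauchy_Schwarz_norm:
  assumes f: "f \<in> L2_space M" and g: "g \<in> L2_space M"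
  shows "(LINT t|M. cmod (f t) * cmod (g t)) \<le> L2_norm M f * L2_norm M g"
proof -
  let ?A = "LINT t|M. (cmod (f t))\<^sup>2" and ?B = "LINT t|M. (cmod (g t))\<^sup>2"
  have i: "integrable M (\<lambda>t. cmod (f t) * cmod (g t))"
    using integrable_norm[OF L2_inner_integrable[OF f g]] by (simp add: norm_mult)
  have "(LINT t|M. cmod (f t) * cmod (g t)) \<le> (s * ?A + ?B / s) / 2" if s: "s > 0" for s
  proof -
    have "(LINT t|M. cmod (f t) * cmod (g t)) \<le> (LINT t|M. (s * (cmod (f t))\<^sup>2 + (cmod (g t))\<^sup>2 / s) / 2)"
    proof (rule integral_mono[OF i])
      show "integrable M (\<lambda>t. (s * (cmod (f t))\<^sup>2 + (cmod (g t))\<^sup>2 / s) / 2)"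
        using L2_space_integrable[OF f] L2_space_integrable[OF g] by simp
      fix t
      have "0 \<le> (s * cmod (f t) - cmod (g t))\<^sup>2 / s" using s by simp
      also have "\<dots> = s * (cmod (f t))\<^sup>2 + (cmod (g t))\<^sup>2 / s - 2 * (cmod (f t) * cmod (g t))"
        using s by (simp add: power2_eq_square field_simps)
      finally show "cmod (f t) * cmod (g t) \<le> (s * (cmod (f t))\<^sup>2 + (cmod (g t))\<^sup>2 / s) / 2" by simp
    qed
    also have "\<dots> = (s * ?A + ?B / s) / 2"
      using L2_space_integrable[OF f] L2_space_integrable[OF g] by simp
    finally show ?thesis .
  qed
  from le_sqrt_mult_if_weighted[OF this] show ?thesis by (simp add: L2_norm_def)
qed

lemma L2_Cauchy_Schwarz:
  assumes "f \<in> L2_space M" "g \<in> L2_space M"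
  shows "cmod (L2_inner M f g) \<le> L2_norm M f * L2_norm M g"
proof -
  have "cmod (L2_inner M f g) \<le> (LINT t|M. cmod (f t * cnj (g t)))"
    unfolding L2_inner_def by (rule integral_norm_bound)
  then show ?thesis using L2_Cauchy_Schwarz_norm[OF assms] by (simp add: norm_mult)
qed

lemma L2_space_cmult:
  assumes "f \<in> L2_space M" shows "(\<lambda>t. c * f t) \<in> L2_space M"
  using assms L2_space_integrable[OF assms] L2_space_measurable[OF assms]
  by (intro L2_spaceI) (auto simp: norm_mult power_mult_distrib)

lemma L2_norm_cmult: "L2_norm M (\<lambda>t. c * f t) = cmod c * L2_norm M f"
  by (simp add: L2_norm_def norm_mult power_mult_distrib real_sqrt_mult)

lemma L2_add:
  assumes f: "f \<in> L2_space M" and g: "g \<in> L2_space M"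
  shows L2_space_add: "(\<lambda>t. f t + g t) \<in> L2_space M"
    and L2_norm_add: "L2_norm M (\<lambda>t. f t + g t) \<le> L2_norm M f + L2_norm M g"
proof -
  note [measurable] = L2_space_measurable[OF f] L2_space_measurable[OF g]
  note If = L2_space_integrable[OF f] and Ig = L2_space_integrable[OF g]
  have i: "integrable M (\<lambda>t. cmod (f t) * cmod (g t))"
    using integrable_norm[OF L2_inner_integrable[OF f g]] by (simp add: norm_mult)
  have b: "(cmod (f t + g t))\<^sup>2 \<le> (cmod (f t))\<^sup>2 + 2 * (cmod (f t) * cmod (g t)) + (cmod (g t))\<^sup>2" for t
  proof -
    have "(cmod (f t + g t))\<^sup>2 \<le> (cmod (f t) + cmod (g t))\<^sup>2"
      by (rule power_mono[OF norm_triangle_ineq]) simp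
    then show ?thesis by (simp add: power2_sum algebra_simps)
  qed
  have I: "integrable M (\<lambda>t. (cmod (f t))\<^sup>2 + 2 * (cmod (f t) * cmod (g t)) + (cmod (g t))\<^sup>2)"
    using If Ig i by simp
  have J: "integrable M (\<lambda>t. (cmod (f t + g t))\<^sup>2)"
  proof (rule Bochner_Integration.integrable_bound[OF I], measurable, rule AE_I2)
    fix t show "norm ((cmod (f t + g t))\<^sup>2) \<le> norm ((cmod (f t))\<^sup>2 + 2 * (cmod (f t) * cmod (g t)) + (cmod (g t))\<^sup>2)"
      using b[of t] by simp
  qed
  then show "(\<lambda>t. f t + g t) \<in> L2_space M" by (intro L2_spaceI) auto
  have "(L2_norm M (\<lambda>t. f t + g t))\<^sup>2 \<le> (LINT t|M. (cmod (f t))\<^sup>2 + 2 * (cmod (f t) * cmod (g t)) + (cmod (g t))\<^sup>2)"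
    unfolding L2_norm_square by (rule integral_mono[OF J I b])
  also have "\<dots> = (L2_norm M f)\<^sup>2 + 2 * (LINT t|M. cmod (f t) * cmod (g t)) + (L2_norm M g)\<^sup>2"
    using If Ig i by (simp add: L2_norm_square)
  also have "\<dots> \<le> (L2_norm M f)\<^sup>2 + 2 * (L2_norm M f * L2_norm M g) + (L2_norm M g)\<^sup>2"
    using L2_Cauchy_Schwarz_norm[OF f g] by simp
  also have "\<dots> = (L2_norm M f + L2_norm M g)\<^sup>2" by (simp add: power2_sum)
  finally show "L2_norm M (\<lambda>t. f t + g t) \<le> L2_norm M f + L2_norm M g"
    by (rule power2_le_imp_le) simp
qed

lemma L2_space_zero: "(\<lambda>t. 0) \<in> L2_space M"
  by (rule L2_spaceI) auto

lemma L2_norm_zero [simp]: "L2_norm M (\<lambda>t. 0) = 0"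
  by (simp add: L2_norm_def)

lemma L2_space_diff:
  assumes "f \<in> L2_space M" "g \<in> L2_space M" shows "(\<lambda>t. f t - g t) \<in> L2_space M"
  using L2_space_add[OF assms(1) L2_space_cmult[OF assms(2), of "-1"]] by simp

lemma L2_norm_diff:
  assumes "f \<in> L2_space M" "g \<in> L2_space M"
  shows "L2_norm M (\<lambda>t. f t - g t) \<le> L2_norm M f + L2_norm M g"
  using L2_norm_add[OF assms(1) L2_space_cmult[OF assms(2), of "-1"]]
    L2_norm_cmult[of M "-1" g] by simp

lemma L2_sum:
  assumes "\<And>i. i \<in> I \<Longrightarrow> f i \<in> L2_space M"
  shows L2_space_sum: "(\<lambda>t. \<Sum>i\<in>I. f i t) \<in> L2_space M"
    and L2_norm_sum: "L2_norm M (\<lambda>t. \<Sum>i\<in>I. f i t) \<le> (\<Sum>i\<in>I. L2_norm M (f i))"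
proof -
  have "(\<lambda>t. \<Sum>i\<in>I. f i t) \<in> L2_space M \<and> L2_norm M (\<lambda>t. \<Sum>i\<in>I. f i t) \<le> (\<Sum>i\<in>I. L2_norm M (f i))"
    using assms
  proof (induction I rule: infinite_finite_induct)
    case (insert x F)
    then have IH: "(\<lambda>t. \<Sum>i\<in>F. f i t) \<in> L2_space M" "L2_norm M (\<lambda>t. \<Sum>i\<in>F. f i t) \<le> (\<Sum>i\<in>F. L2_norm M (f i))"
      and x: "f x \<in> L2_space M" by auto
    show ?case using L2_add[OF x IH(1)] IH(2) insert.hyps by simp
  qed (auto simp: L2_space_zero)
  then show "(\<lambda>t. \<Sum>i\<in>I. f i t) \<in> L2_space M"
    "L2_norm M (\<lambda>t. \<Sum>i\<in>I. f i t) \<le> (\<Sum>i\<in>I. L2_norm M (f i))" by auto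
qed

text \<open>Fatou's lemma for the squared moduli.\<close>

lemma L2_limit:
  assumes g: "\<And>m. g m \<in> L2_space M" and b: "\<And>m. L2_norm M (g m) \<le> a" and a: "0 \<le> a"
    and f: "f \<in> borel_measurable M" and lim: "AE x in M. (\<lambda>m. g m x) \<longlonglongrightarrow> f x"
  shows "f \<in> L2_space M" "L2_norm M f \<le> a"
proof -
  note [measurable] = f L2_space_measurable[OF g]
  have "L2_norm_sq M f = (\<integral>\<^sup>+x. liminf (\<lambda>m. ennreal ((cmod (g m x))\<^sup>2)) \<partial>M)"
    unfolding L2_norm_sq_def
  proof (rule nn_integral_cong_AE, use lim in eventually_elim)
    fix x assume "(\<lambda>m. g m x) \<longlonglongrightarrow> f x"
    then have "(\<lambda>m. ennreal ((cmod (g m x))\<^sup>2)) \<longlonglongrightarrow> ennreal ((cmod (f x))\<^sup>2)"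
      by (intro tendsto_ennrealI tendsto_intros)
    then show "ennreal ((cmod (f x))\<^sup>2) = liminf (\<lambda>m. ennreal ((cmod (g m x))\<^sup>2))"
      by (rule lim_imp_Liminf[OF trivial_limit_sequentially, symmetric])
  qed
  also have "\<dots> \<le> liminf (\<lambda>m. L2_norm_sq M (g m))"
    unfolding L2_norm_sq_def by (rule nn_integral_liminf) measurable
  also have "\<dots> \<le> liminf (\<lambda>m. ennreal (a\<^sup>2))"
  proof (rule Liminf_mono, rule always_eventually, rule allI)
    fix m show "L2_norm_sq M (g m) \<le> ennreal (a\<^sup>2)"
      using power_mono[OF b[of m], of 2] by (simp add: L2_norm_sq_eq[OF g])
  qed
  also have "\<dots> = ennreal (a\<^sup>2)" by (rule Liminf_const) simp
  finally have *: "L2_norm_sq M f \<le> ennreal (a\<^sup>2)" .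
  then show "f \<in> L2_space M" unfolding L2_space_def using f
    by (auto simp: order.strict_trans1[OF _ ennreal_less_top])
  then show "L2_norm M f \<le> a" using * a by (rule L2_norm_leI)
qed

text \<open>Riesz-Fischer with an explicit tail bound: by Fatou the sum of the moduli is square
  integrable, so the series converges absolutely almost everywhere, and the bound for partial sums
  passes to the limit. The tail bound is what the gliding hump consumes.\<close>

lemma L2_complete:
  fixes f :: "nat \<Rightarrow> 'a \<Rightarrow> complex" and c :: "nat \<Rightarrow> real"
  assumes f: "\<And>n. f n \<in> L2_space M" and b: "\<And>n. L2_norm M (f n) \<le> c n" and c: "summable c"
  shows "\<exists>F\<in>L2_space M. \<forall>n. L2_norm M (\<lambda>x. F x - (\<Sum>k<n. f k x)) \<le> (\<Sum>k. c (k + n))"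
proof -
  have c0: "c n \<ge> 0" for n using b[of n] L2_norm_nonneg[of M "f n"] by linarith
  note [measurable] = L2_space_measurable[OF f]
  let ?s = "\<lambda>x. (\<Sum>k. ennreal (cmod (f k x)))"
  have absL2: "(\<lambda>x. complex_of_real (cmod (f k x))) \<in> L2_space M" for k
    using L2_space_integrable[OF f] by (intro L2_spaceI) auto
  have absn: "L2_norm M (\<lambda>x. complex_of_real (cmod (f k x))) = L2_norm M (f k)" for k
    by (simp add: L2_norm_def)
  have S: "(\<integral>\<^sup>+x. (?s x)\<^sup>2 \<partial>M) \<le> ennreal ((suminf c)\<^sup>2)"
  proof -
    have "(\<integral>\<^sup>+x. (?s x)\<^sup>2 \<partial>M) = (\<integral>\<^sup>+x. liminf (\<lambda>m. ennreal ((\<Sum>k<m. cmod (f k x))\<^sup>2)) \<partial>M)"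
    proof (rule nn_integral_cong)
      fix x
      have "(\<lambda>m. \<Sum>k<m. ennreal (cmod (f k x))) \<longlonglongrightarrow> ?s x"
        by (intro summable_LIMSEQ) simp
      then have "(\<lambda>m. (\<Sum>k<m. ennreal (cmod (f k x)))\<^sup>2) \<longlonglongrightarrow> (?s x)\<^sup>2"
        unfolding power2_eq_square by (intro tendsto_mult_ennreal) auto
      then show "(?s x)\<^sup>2 = liminf (\<lambda>m. ennreal ((\<Sum>k<m. cmod (f k x))\<^sup>2))"
        using lim_imp_Liminf[OF trivial_limit_sequentially] by (fastforce simp: ennreal_power sum_nonneg)
    qed
    also have "\<dots> \<le> liminf (\<lambda>m. \<integral>\<^sup>+x. ennreal ((\<Sum>k<m. cmod (f k x))\<^sup>2) \<partial>M)"
      by (rule nn_integral_liminf) measurable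
    also have "\<dots> \<le> liminf (\<lambda>m. ennreal ((suminf c)\<^sup>2))"
    proof (rule Liminf_mono, rule always_eventually, rule allI)
      fix m
      let ?g = "\<lambda>x. \<Sum>k<m. complex_of_real (cmod (f k x))"
      have g: "?g \<in> L2_space M" by (rule L2_space_sum) (rule absL2)
      have "L2_norm M ?g \<le> (\<Sum>k<m. L2_norm M (f k))"
        using L2_norm_sum[of "{..<m}" "\<lambda>k x. complex_of_real (cmod (f k x))" M, OF absL2] by (simp add: absn)
      also have "\<dots> \<le> (\<Sum>k<m. c k)" by (rule sum_mono) (rule b)
      also have "\<dots> \<le> suminf c" by (rule sum_le_suminf[OF c]) (auto simp: c0)
      finally have "(L2_norm M ?g)\<^sup>2 \<le> (suminf c)\<^sup>2" by (rule power_mono) simp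
      moreover have "(\<integral>\<^sup>+x. ennreal ((\<Sum>k<m. cmod (f k x))\<^sup>2) \<partial>M) = L2_norm_sq M ?g"
        unfolding L2_norm_sq_def of_real_sum[symmetric] norm_of_real by simp
      ultimately show "(\<integral>\<^sup>+x. ennreal ((\<Sum>k<m. cmod (f k x))\<^sup>2) \<partial>M) \<le> ennreal ((suminf c)\<^sup>2)"
        by (simp add: L2_norm_sq_eq[OF g])
    qed
    also have "\<dots> = ennreal ((suminf c)\<^sup>2)" by (rule Liminf_const) simp
    finally show ?thesis .
  qed
  then have "(\<integral>\<^sup>+x. (?s x)\<^sup>2 \<partial>M) \<noteq> \<infinity>" by (auto simp: top_unique)
  then have "AE x in M. (?s x)\<^sup>2 \<noteq> \<infinity>" by (intro nn_integral_noteq_infinite) measurable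
  then have ae: "AE x in M. summable (\<lambda>k. f k x)"
  proof eventually_elim
    fix x assume "(?s x)\<^sup>2 \<noteq> \<infinity>"
    then have "?s x \<noteq> \<infinity>" by (auto simp: power2_eq_square ennreal_top_mult)
    then have "summable (\<lambda>k. cmod (f k x))" by (intro summable_suminf_not_top) auto
    then show "summable (\<lambda>k. f k x)" by (rule summable_norm_cancel)
  qed
  define F where "F x = (\<Sum>k. f k x)" for x
  have Fm[measurable]: "F \<in> borel_measurable M" unfolding F_def by measurable
  have main: "(\<lambda>x. F x - (\<Sum>k<n. f k x)) \<in> L2_space M \<and>
      L2_norm M (\<lambda>x. F x - (\<Sum>k<n. f k x)) \<le> (\<Sum>k. c (k + n))" for n
  proof -
    let ?g = "\<lambda>m x. \<Sum>k<m. f (k + n) x"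
    have cn: "summable (\<lambda>k. c (k + n))" using c by (simp add: summable_iff_shift)
    have g: "?g m \<in> L2_space M" for m by (rule L2_space_sum) (rule f)
    have gb: "L2_norm M (?g m) \<le> (\<Sum>k. c (k + n))" for m
    proof -
      have "L2_norm M (?g m) \<le> (\<Sum>k<m. L2_norm M (f (k + n)))" by (rule L2_norm_sum) (rule f)
      also have "\<dots> \<le> (\<Sum>k<m. c (k + n))" by (rule sum_mono) (rule b)
      also have "\<dots> \<le> (\<Sum>k. c (k + n))" by (rule sum_le_suminf[OF cn]) (auto simp: c0)
      finally show ?thesis .
    qed
    have l: "AE x in M. (\<lambda>m. ?g m x) \<longlonglongrightarrow> F x - (\<Sum>k<n. f k x)"
      using ae
    proof eventually_elim
      fix x assume s: "summable (\<lambda>k. f k x)"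
      then have "(\<lambda>k. f k x) sums F x" by (simp add: F_def summable_sums)
      then have "(\<lambda>k. f (k + n) x) sums (F x - (\<Sum>k<n. f k x))"
        by (rule sums_split_initial_segment)
      then show "(\<lambda>m. ?g m x) \<longlonglongrightarrow> F x - (\<Sum>k<n. f k x)" by (simp add: sums_def)
    qed
    have "(\<lambda>x. F x - (\<Sum>k<n. f k x)) \<in> borel_measurable M" by measurable
    from L2_limit[OF g gb suminf_nonneg[OF cn] this l] show ?thesis by (simp add: c0)
  qed
  have "F \<in> L2_space M" using main[of 0] by simp
  then show ?thesis using main by blast
qed

text \<open>Gliding hump: the sum of a rapidly decreasing sequence of bad functions is unbounded on
  the corresponding members of the family.\<close>

lemma L2_uniform_boundedness:
  fixes P :: "'i \<Rightarrow> ('a \<Rightarrow> complex) \<Rightarrow> real"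
  assumes nn: "\<And>j f. j \<in> J \<Longrightarrow> 0 \<le> P j f"
    and add: "\<And>j f g. j \<in> J \<Longrightarrow> f \<in> L2_space M \<Longrightarrow> g \<in> L2_space M \<Longrightarrow>
          P j (\<lambda>x. f x + g x) \<le> P j f + P j g"
    and scale: "\<And>j f c. j \<in> J \<Longrightarrow> f \<in> L2_space M \<Longrightarrow> P j (\<lambda>x. c * f x) = cmod c * P j f"
    and cont: "\<And>j. j \<in> J \<Longrightarrow> \<exists>B. \<forall>f\<in>L2_space M. P j f \<le> B * L2_norm M f"
    and bdd: "\<And>f. f \<in> L2_space M \<Longrightarrow> \<exists>B. \<forall>j\<in>J. P j f \<le> B"
  shows "\<exists>C\<ge>0. \<forall>j\<in>J. \<forall>f\<in>L2_space M. P j f \<le> C * L2_norm M f"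
proof (rule ccontr)
  assume no: "\<not> ?thesis"
  obtain B where B: "\<And>j f. j \<in> J \<Longrightarrow> f \<in> L2_space M \<Longrightarrow> P j f \<le> B j * L2_norm M f"
    using cont by metis
  obtain p where p: "\<And>f j. f \<in> L2_space M \<Longrightarrow> j \<in> J \<Longrightarrow> P j f \<le> p f"
    using bdd by metis
  \<comment> \<open>A function violating the constant \<open>\<bar>A\<bar> / \<delta>\<close> is
    rescaled to norm \<open>\<delta>\<close>. Its norm cannot be 0, since the individual bound
    \<open>B j\<close> would then force \<open>P j f \<le> 0\<close>.\<close>
  have ex: "\<exists>j\<in>J. \<exists>f\<in>L2_space M. L2_norm M f \<le> \<delta> \<and> P j f > A" if d: "\<delta> > 0" for \<delta> A :: real
  proof -
    let ?C = "\<bar>A\<bar> / \<delta>"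
    obtain j f where jf: "j \<in> J" "f \<in> L2_space M" "P j f > ?C * L2_norm M f"
      using no d by (metis abs_ge_zero divide_nonneg_pos not_le)
    have n0: "L2_norm M f > 0"
    proof (rule ccontr)
      assume "\<not> ?thesis"
      then have "L2_norm M f = 0" using L2_norm_nonneg[of M f] by linarith
      then show False using B[OF jf(1,2)] jf(3) by simp
    qed
    let ?c = "complex_of_real (\<delta> / L2_norm M f)"
    have c: "cmod ?c = \<delta> / L2_norm M f" using d n0 by (simp only: norm_of_real) simp
    have "P j (\<lambda>x. ?c * f x) = \<delta> / L2_norm M f * P j f" using scale[OF jf(1,2)] c by metis
    also have "\<dots> > \<delta> / L2_norm M f * (?C * L2_norm M f)"
      using jf(3) d n0 by (intro mult_strict_left_mono) auto
    also have "\<delta> / L2_norm M f * (?C * L2_norm M f) = \<bar>A\<bar>" using d n0 by simp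
    finally have "P j (\<lambda>x. ?c * f x) > A" by linarith
    moreover have "L2_norm M (\<lambda>x. ?c * f x) \<le> \<delta>" unfolding L2_norm_cmult c using n0 by simp
    ultimately show ?thesis using jf L2_space_cmult[OF jf(2), of ?c] by blast
  qed
  \<comment> \<open>State of the recursion: the sum \<open>s\<close> of the earlier humps, a size
    \<open>\<delta>\<close>, the next hump \<open>f\<close> and a member \<open>j\<close> on which
    \<open>f\<close> outweighs whatever \<open>s\<close> can contribute.\<close>
  define Q where "Q = (\<lambda>n (s, \<delta>::real, f, j). s \<in> L2_space M \<and> \<delta> > 0 \<and> f \<in> L2_space M \<and> j \<in> J \<and>
      L2_norm M f \<le> \<delta> \<and> P j f > real n + p s + 1)"
  \<comment> \<open>All later humps together have norm at most \<open>2 * \<delta>'\<close>, the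
    sizes being at least halved at each step; the last condition keeps their effect on
    \<open>P j\<close> at most 1.\<close>
  define R where "R = (\<lambda>(n::nat) (s::'a\<Rightarrow>complex, \<delta>::real, f::'a\<Rightarrow>complex, j) (s', \<delta>'::real, f'::'a\<Rightarrow>complex, j'::'i).
      s' = (\<lambda>x. s x + f x) \<and> \<delta>' \<le> \<delta> / 2 \<and> B j * (2 * \<delta>') \<le> 1)"
  obtain j0 f0 where f0: "j0 \<in> J" "f0 \<in> L2_space M" "L2_norm M f0 \<le> 1" "P j0 f0 > real 0 + p (\<lambda>_. 0) + 1"
    using ex[of 1 "real 0 + p (\<lambda>_. 0) + 1"] by auto
  have "\<exists>X. (\<forall>n. (Q n (X n) \<and> (n = 0 \<longrightarrow> fst (X n) = (\<lambda>_. 0))) \<and> R n (X n) (X (Suc n)))"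
  proof (rule dependent_nat_choice)
    show "\<exists>x. Q 0 x \<and> (0 = (0::nat) \<longrightarrow> fst x = (\<lambda>_. 0))"
      using f0 L2_space_zero[of M] by (intro exI[of _ "(\<lambda>_. 0, 1, f0, j0)"]) (auto simp: Q_def)
    fix x n assume "Q n x \<and> (n = 0 \<longrightarrow> fst x = (\<lambda>_. 0))"
    then obtain s \<delta> f j where x: "x = (s, \<delta>, f, j)" and q: "Q n (s, \<delta>, f, j)"
      by (cases x) auto
    let ?s = "\<lambda>x. s x + f x" and ?d = "min (\<delta> / 2) (1 / (2 * (\<bar>B j\<bar> + 1)))"
    have d: "?d > 0" using q by (simp add: Q_def)
    have "B j * (2 * ?d) \<le> (\<bar>B j\<bar> + 1) * (2 * ?d)" using d by (intro mult_right_mono) auto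
    also have "\<dots> \<le> (\<bar>B j\<bar> + 1) * (2 * (1 / (2 * (\<bar>B j\<bar> + 1))))" by (intro mult_left_mono) auto
    also have "\<dots> = 1" by (simp add: field_simps)
    finally have Bd: "B j * (2 * ?d) \<le> 1" .
    obtain j' f' where "j' \<in> J" "f' \<in> L2_space M" "L2_norm M f' \<le> ?d" "P j' f' > real (Suc n) + p ?s + 1"
      using ex[OF d] by blast
    then have "Q (Suc n) (?s, ?d, f', j')" using q d L2_space_add[of s M f] by (auto simp: Q_def)
    moreover have "R n x (?s, ?d, f', j')" using Bd by (simp add: R_def x)
    ultimately show "\<exists>y. (Q (Suc n) y \<and> (Suc n = 0 \<longrightarrow> fst y = (\<lambda>_. 0))) \<and> R n x y" by blast
  qed
  then obtain X where X: "\<And>n. Q n (X n)" "fst (X 0) = (\<lambda>_. 0)" "\<And>n. R n (X n) (X (Suc n))" by blast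
  define s \<delta> f j where "s n = fst (X n)" and "\<delta> n = fst (snd (X n))"
    and "f n = fst (snd (snd (X n)))" and "j n = snd (snd (snd (X n)))" for n
  have Xn: "X n = (s n, \<delta> n, f n, j n)" for n by (simp add: s_def \<delta>_def f_def j_def)
  have q: "s n \<in> L2_space M" "\<delta> n > 0" "f n \<in> L2_space M" "j n \<in> J" "L2_norm M (f n) \<le> \<delta> n"
    "P (j n) (f n) > real n + p (s n) + 1" for n
    using X(1)[of n] by (auto simp: Xn Q_def)
  have r: "s (Suc n) = (\<lambda>x. s n x + f n x)" "\<delta> (Suc n) \<le> \<delta> n / 2" "B (j n) * (2 * \<delta> (Suc n)) \<le> 1" for n
    using X(3)[of n] by (auto simp: Xn R_def)
  have s_sum: "s n = (\<lambda>x. \<Sum>k<n. f k x)" for n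
    by (induction n) (use X(2) in \<open>auto simp: s_def[symmetric] r(1)\<close>)
  have dk: "\<delta> (k + n) \<le> \<delta> n * (1/2) ^ k" for k n
  proof (induction k)
    case (Suc k) then show ?case using r(2)[of "k + n"] by simp
  qed simp
  have geo: "(\<lambda>k. \<delta> n * (1/2) ^ k) sums (\<delta> n * 2)" for n
    using sums_mult[OF geometric_sums[of "1/2::real"], of "\<delta> n"] by simp
  have summ: "summable (\<lambda>k. \<delta> (k + n))" for n
    by (rule summable_comparison_test'[OF sums_summable[OF geo[of n]]]) (use dk q(2) in \<open>simp add: abs_of_pos\<close>)
  have tail: "(\<Sum>k. \<delta> (k + n)) \<le> 2 * \<delta> n" for n
    using suminf_le[OF dk summ[of n] sums_summable[OF geo[of n]]] sums_unique[OF geo[of n]] by linarith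
  obtain F where F: "F \<in> L2_space M" "\<And>n. L2_norm M (\<lambda>x. F x - (\<Sum>k<n. f k x)) \<le> (\<Sum>k. \<delta> (k + n))"
    using L2_complete[of f M \<delta>, OF q(3) q(5)] summ[of 0] by auto
  have "real n \<le> p F" for n
  proof -
    let ?t = "\<lambda>x. F x - s (Suc n) x"
    have t: "?t \<in> L2_space M" using F(1) q(1) by (rule L2_space_diff)
    have "L2_norm M ?t \<le> 2 * \<delta> (Suc n)" using F(2)[of "Suc n"] tail[of "Suc n"] by (simp add: s_sum)
    have Bt: "P (j n) ?t \<le> 1"
    proof (cases "B (j n) \<ge> 0")
      case True
      have "P (j n) ?t \<le> B (j n) * L2_norm M ?t" by (rule B[OF q(4) t])
      also have "\<dots> \<le> B (j n) * (2 * \<delta> (Suc n))"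
        using True \<open>L2_norm M ?t \<le> 2 * \<delta> (Suc n)\<close> by (rule mult_left_mono[rotated])
      finally show ?thesis using r(3)[of n] by linarith
    next
      case False
      have "P (j n) ?t \<le> B (j n) * L2_norm M ?t" by (rule B[OF q(4) t])
      also have "\<dots> \<le> 0" using False by (intro mult_nonpos_nonneg) auto
      finally show ?thesis by linarith
    qed
    have m: "P (j n) (\<lambda>x. (-1) * g x) = P (j n) g" if "g \<in> L2_space M" for g
      using scale[OF q(4)[of n] that, of "-1"] by simp
    \<comment> \<open>The hump is the full sum \<open>F\<close> minus the earlier humps minus the
      tail, so \<open>P (j n) F\<close> has to be at least \<open>n\<close>.\<close>
    have "P (j n) (f n) = P (j n) (\<lambda>x. F x + ((-1) * s n x + (-1) * ?t x))"
      by (rule arg_cong[where f="P (j n)"]) (auto simp: r(1))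
    also have "\<dots> \<le> P (j n) F + P (j n) (\<lambda>x. (-1) * s n x + (-1) * ?t x)"
      by (rule add[OF q(4) F(1)]) (intro L2_space_add L2_space_cmult q(1) t)
    also have "P (j n) (\<lambda>x. (-1) * s n x + (-1) * ?t x) \<le> P (j n) (\<lambda>x. (-1) * s n x) + P (j n) (\<lambda>x. (-1) * ?t x)"
      by (rule add[OF q(4)]) (intro L2_space_cmult q(1) t)+
    also have "\<dots> = P (j n) (s n) + P (j n) ?t" using m[OF q(1)] m[OF t] by simp
    finally show ?thesis using Bt p[OF q(1)[of n] q(4)[of n]] q(6)[of n] p[OF F(1) q(4)[of n]] by linarith
  qed
  then show False using reals_Archimedean2[of "p F"] by (meson not_le)
qed

section \<open>Square-integrability of the Feichtinger algebra\<close>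

lemma integrable_mult_kernel:
  fixes f :: "real \<Rightarrow> complex" and k :: "real \<Rightarrow> real" and u :: "real \<times> real \<Rightarrow> complex"
  assumes f: "integrable lborel f" and k: "integrable lborel k"
    and u: "u \<in> borel_measurable (lborel \<Otimes>\<^sub>M lborel)" and u1: "\<And>z. cmod (u z) \<le> 1"
  shows "integrable (lborel \<Otimes>\<^sub>M lborel) (\<lambda>(y, x). f y * (u (y, x) * of_real (k x)))"
proof -
  have "integrable (lborel \<Otimes>\<^sub>M lborel) (\<lambda>(y, x). f y * complex_of_real (k x))"
  proof -
    have [measurable]: "f \<in> borel_measurable borel" "k \<in> borel_measurable borel"
      using f k by auto
    show ?thesis
    proof (rule lborel_pair.Fubini_integrable)
      show "(\<lambda>(y, x). f y * complex_of_real (k x)) \<in> borel_measurable (lborel \<Otimes>\<^sub>M lborel)"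
        by measurable
      have "integrable lborel (\<lambda>x. norm (f x) * (LINT y|lborel. \<bar>k y\<bar>))"
        using f by (intro integrable_mult_left integrable_norm)
      then show "integrable lborel (\<lambda>x. LINT y|lborel. norm ((\<lambda>(y, x). f y * complex_of_real (k x)) (x, y)))"
        by (simp add: norm_mult)
      show "AE x in lborel. integrable lborel (\<lambda>y. (\<lambda>(y, x). f y * complex_of_real (k x)) (x, y))"
        using k by (intro AE_I2) simp
    qed
  qed
  moreover have "(\<lambda>(y, x). f y * (u (y, x) * of_real (k x))) \<in> borel_measurable (lborel \<Otimes>\<^sub>M lborel)"
  proof -
    have [measurable]: "f \<in> borel_measurable borel" "k \<in> borel_measurable borel"
      using f k by auto
    note [measurable] = u
    have "(\<lambda>z. f (fst z) * (u z * of_real (k (snd z)))) \<in> borel_measurable (lborel \<Otimes>\<^sub>M lborel)"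
      by measurable
    then show ?thesis by (simp add: case_prod_beta')
  qed
  ultimately show ?thesis
  proof (rule Bochner_Integration.integrable_bound, intro AE_I2)
    fix z :: "real \<times> real"
    have "cmod (u z) * (cmod (f (fst z)) * \<bar>k (snd z)\<bar>) \<le> 1 * (cmod (f (fst z)) * \<bar>k (snd z)\<bar>)"
      by (rule mult_right_mono[OF u1]) simp
    then show "norm (case z of (y, x) \<Rightarrow> f y * (u (y, x) * complex_of_real (k x)))
        \<le> norm (case z of (y, x) \<Rightarrow> f y * complex_of_real (k x))"
      by (simp add: case_prod_beta' norm_mult mult_ac)
  qed
qed

section \<open>The Fourier transform on the line and its inversion\<close>

definition fourier :: "(real \<Rightarrow> complex) \<Rightarrow> real \<Rightarrow> complex" where
  "fourier f \<omega> = (LINT y|lborel. f y * cis (- (2 * pi * \<omega> * y)))"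

lemma cis_measurable [measurable (raw)]:
  "f \<in> borel_measurable M \<Longrightarrow> (\<lambda>x. cis (f x)) \<in> borel_measurable M"
  by (rule measurable_compose[where g=cis and N=borel])
     (auto intro!: borel_measurable_continuous_onI continuous_intros)

lemma fourier_measurable [measurable]:
  assumes "integrable lborel f" shows "fourier f \<in> borel_measurable borel"
proof -
  have [measurable]: "f \<in> borel_measurable borel" using assms by auto
  have "(\<lambda>\<omega>. LINT y|lborel. f y * cis (- (2 * pi * \<omega> * y))) \<in> borel_measurable borel"
    by (rule lborel.borel_measurable_lebesgue_integral) measurable
  then show ?thesis by (simp add: fourier_def[abs_def])
qed

lemma gauss_integrable: "integrable lborel (\<lambda>x::real. exp (- x\<^sup>2))"
  and gauss_integral: "(LINT x|lborel. exp (- (x::real)\<^sup>2)) = sqrt pi"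
proof -
  \<comment> \<open>A normal density with variance 1/2, rescaled.\<close>
  have e: "(\<lambda>x::real. exp (- x\<^sup>2)) = (\<lambda>x. sqrt pi * normal_density 0 (1 / sqrt 2) x)"
    by (auto simp: normal_density_def fun_eq_iff power_divide real_sqrt_divide field_simps)
  show "integrable lborel (\<lambda>x::real. exp (- x\<^sup>2))" unfolding e
    by (intro integrable_mult_right integrable_normal_density) simp
  show "(LINT x|lborel. exp (- (x::real)\<^sup>2)) = sqrt pi" unfolding e
    by (simp add: integral_normal_density)
qed

text \<open>Integrating the short-time transform with phase corrections over the time variable
  recovers the Fourier transform.\<close>

lemma fourier_le_short_time:
  assumes f: "integrable lborel f"
  shows "ennreal (sqrt pi * cmod (fourier f \<omega>)) \<le>
     (\<integral>\<^sup>+ x. ennreal (cmod (LINT y|lborel. f y * (cis (2 * pi * \<omega> * (x - y)) * of_real (exp (- (x - y)\<^sup>2))))) \<partial>lborel)"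
proof -
  define V where "V x = (LINT y|lborel. f y * (cis (2 * pi * \<omega> * (x - y)) * of_real (exp (- (x - y)\<^sup>2))))" for x
  let ?K = "\<lambda>y x. f y * (cis (- (2 * pi * \<omega> * y)) * of_real (exp (- (x - y)\<^sup>2)))"
  have [measurable]: "f \<in> borel_measurable borel" using f by auto
  have gi: "integrable lborel (\<lambda>x::real. exp (- (x - y)\<^sup>2))" for y :: real
    using lborel_integrable_real_affine[OF gauss_integrable, of 1 "- y"] by (simp add: algebra_simps)
  have gv: "(LINT x|lborel. exp (- (x - y)\<^sup>2)) = sqrt pi" for y :: real
    using lborel_integral_real_affine[of 1 "\<lambda>x. exp (- x\<^sup>2)" "- y"] gauss_integral by (simp add: algebra_simps)
  have K: "integrable (lborel \<Otimes>\<^sub>M lborel) (case_prod ?K)"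
  proof (rule lborel_pair.Fubini_integrable)
    show "case_prod ?K \<in> borel_measurable (lborel \<Otimes>\<^sub>M lborel)" by measurable
    have "integrable lborel (\<lambda>y. norm (f y) * sqrt pi)"
      using f by (intro integrable_mult_left integrable_norm)
    then show "integrable lborel (\<lambda>y. LINT x|lborel. norm (case (y, x) of (y, x) \<Rightarrow> ?K y x))"
      by (simp add: norm_mult gv)
    show "AE y in lborel. integrable lborel (\<lambda>x. case (y, x) of (y, x) \<Rightarrow> ?K y x)"
      by (intro AE_I2) (simp only: prod.case, intro integrable_mult_right integrable_of_real gi)
  qed
  \<comment> \<open>The phase leaves the modulus of \<open>V x\<close> unchanged and moves all
    dependence on \<open>x\<close> into the Gaussian, which integrates to \<open>sqrt pi\<close> in
    \<open>x\<close>.\<close>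
  have Vx: "(LINT y|lborel. ?K y x) = cis (- (2 * pi * \<omega> * x)) * V x" for x
  proof -
    have "?K y x = cis (- (2 * pi * \<omega> * x)) * (f y * (cis (2 * pi * \<omega> * (x - y)) * of_real (exp (- (x - y)\<^sup>2))))" for y
    proof -
      have "cis (- (2 * pi * \<omega> * y)) = cis (- (2 * pi * \<omega> * x)) * cis (2 * pi * \<omega> * (x - y))"
        by (simp add: cis_mult algebra_simps)
      then show ?thesis by (simp only: mult_ac)
    qed
    then show ?thesis by (simp only: V_def Bochner_Integration.integral_mult_right_zero)
  qed
  have "(LINT y|lborel. LINT x|lborel. ?K y x) = sqrt pi * fourier f \<omega>"
  proof -
    have "(LINT x|lborel. ?K y x) = f y * cis (- (2 * pi * \<omega> * y)) * complex_of_real (sqrt pi)" for y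
      using gv[of y] by (simp add: mult.assoc)
    then have "(LINT y|lborel. LINT x|lborel. ?K y x) = (LINT y|lborel. f y * cis (- (2 * pi * \<omega> * y)) * complex_of_real (sqrt pi))"
      by (rule Bochner_Integration.integral_cong[OF refl])
    also have "\<dots> = fourier f \<omega> * complex_of_real (sqrt pi)"
      unfolding fourier_def by (rule Bochner_Integration.integral_mult_left_zero)
    finally show ?thesis by (simp only: mult.commute)
  qed
  then have eq: "sqrt pi * fourier f \<omega> = (LINT x|lborel. cis (- (2 * pi * \<omega> * x)) * V x)"
    using lborel_pair.Fubini_integral[OF K] Vx by simp
  have int: "integrable lborel (\<lambda>x. cis (- (2 * pi * \<omega> * x)) * V x)"
    using lborel_pair.integrable_snd[OF K] by (simp add: Vx)
  have "ennreal (sqrt pi * cmod (fourier f \<omega>)) = ennreal (norm (LINT x|lborel. cis (- (2 * pi * \<omega> * x)) * V x))"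
    by (simp add: eq[symmetric] norm_mult)
  also have "\<dots> \<le> ennreal (LINT x|lborel. norm (cis (- (2 * pi * \<omega> * x)) * V x))"
    by (intro ennreal_leI integral_norm_bound)
  also have "\<dots> = (\<integral>\<^sup>+x. ennreal (norm (cis (- (2 * pi * \<omega> * x)) * V x)) \<partial>lborel)"
    by (rule nn_integral_eq_integral[symmetric]) (use int in auto)
  also have "\<dots> = (\<integral>\<^sup>+x. ennreal (cmod (V x)) \<partial>lborel)" by (simp add: norm_mult)
  finally show ?thesis by (simp add: V_def)
qed

lemma S0_real_fourier_integrable:
  assumes "f \<in> S0_real" shows "integrable lborel (fourier f)"
proof (rule integrableI_bounded)
  have f: "integrable lborel f" using assms by (simp add: S0_real_def)
  note [measurable] = fourier_measurable[OF f]
  show "fourier f \<in> borel_measurable lborel" using fourier_measurable[OF f] by simp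
  have "(\<integral>\<^sup>+\<omega>. ennreal (cmod (fourier f \<omega>)) \<partial>lborel) \<le> (\<integral>\<^sup>+\<omega>. ennreal (sqrt pi * cmod (fourier f \<omega>)) \<partial>lborel)"
  proof (intro nn_integral_mono ennreal_leI)
    fix \<omega> 
    have "1 \<le> sqrt pi" using pi_ge_two by simp
    then show "cmod (fourier f \<omega>) \<le> sqrt pi * cmod (fourier f \<omega>)"
      using mult_right_mono[of 1 "sqrt pi" "cmod (fourier f \<omega>)"] by simp
  qed
  also have "\<dots> \<le> S0_real_norm f"
    unfolding S0_real_norm_def by (intro nn_integral_mono fourier_le_short_time f)
  also have "\<dots> < \<infinity>" using assms by (simp add: S0_real_def)
  finally show "(\<integral>\<^sup>+\<omega>. ennreal (norm (fourier f \<omega>)) \<partial>lborel) < \<infinity>" .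
qed

text \<open>The characteristic function of the standard normal distribution, after the substitution
  \<open>x = \<sigma> \<omega>\<close>.\<close>

lemma gauss_fourier:
  assumes s: "\<sigma> > 0"
  shows "(LINT \<omega>|lborel. cis (2 * pi * \<omega> * u) * of_real (exp (- (\<sigma> * \<omega>)\<^sup>2 / 2)))
     = of_real (normal_density 0 (\<sigma> / (2 * pi)) u)"
proof -
  have "complex_of_real (exp (- (2 * pi * u / \<sigma>)\<^sup>2 / 2)) = char std_normal_distribution (2 * pi * u / \<sigma>)"
    by (simp add: char_std_normal_distribution)
  also have "\<dots> = (LINT x|lborel. std_normal_density x *\<^sub>R iexp (2 * pi * u / \<sigma> * x))"
    unfolding char_def by (subst integral_density) auto
  also have "\<dots> = \<bar>\<sigma>\<bar> *\<^sub>R (LINT x|lborel. std_normal_density (0 + \<sigma> * x) *\<^sub>R iexp (2 * pi * u / \<sigma> * (0 + \<sigma> * x)))"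
    by (rule lborel_integral_real_affine) (use s in simp)
  also have "\<dots> = \<sigma> / sqrt (2 * pi) * (LINT x|lborel. cis (2 * pi * x * u) * of_real (exp (- (\<sigma> * x)\<^sup>2 / 2)))"
    using s by (simp add: std_normal_density_def scaleR_conv_of_real cis_conv_exp mult_ac)
  finally have "(LINT x|lborel. cis (2 * pi * x * u) * of_real (exp (- (\<sigma> * x)\<^sup>2 / 2)))
      = of_real (sqrt (2 * pi) / \<sigma> * exp (- (2 * pi * u / \<sigma>)\<^sup>2 / 2))"
    using s by (simp add: field_simps)
  also have "sqrt (2 * pi) / \<sigma> * exp (- (2 * pi * u / \<sigma>)\<^sup>2 / 2) = normal_density 0 (\<sigma> / (2 * pi)) u"
  proof -
    have "sqrt (2 * pi * (\<sigma> / (2 * pi))\<^sup>2) = \<sigma> / sqrt (2 * pi)"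
      using s by (simp add: real_sqrt_mult power2_eq_square real_sqrt_divide field_simps)
    then show ?thesis using s by (simp add: normal_density_def power_divide field_simps)
  qed
  finally show ?thesis .
qed

text \<open>The substitution \<open>s = y + z / (n + 1)\<close> turns the shrinking density into a
  fixed one; away from the end points the indicator is locally constant at \<open>y\<close>, and
  dominated convergence applies.\<close>

lemma normal_mass_interval_limit:
  fixes a b y :: real
  assumes "y \<noteq> a" "y \<noteq> b"
  shows "(\<lambda>n. LINT s|lborel. indicator {a..b} s * normal_density 0 (inverse (Suc n)) (s - y))
     \<longlonglongrightarrow> indicator {a..b} y"
proof -
  have e: "(LINT s|lborel. indicator {a..b} s * normal_density 0 (inverse (Suc n)) (s - y))
      = (LINT z|lborel. indicator {a..b} (y + inverse (Suc n) * z) * std_normal_density z)" for n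
  proof -
    have "(LINT s|lborel. indicator {a..b} s * normal_density 0 (inverse (Suc n)) (s - y))
      = \<bar>inverse (Suc n)\<bar> *\<^sub>R (LINT z|lborel. indicator {a..b} (y + inverse (Suc n) * z) *
           normal_density 0 (inverse (Suc n)) ((y + inverse (Suc n) * z) - y))"
      by (rule lborel_integral_real_affine) simp
    also have "\<dots> = (LINT z|lborel. indicator {a..b} (y + inverse (Suc n) * z) * std_normal_density z)"
    proof -
      have "\<bar>inverse (Suc n)\<bar> * normal_density 0 (inverse (Suc n)) ((y + inverse (Suc n) * z) - y) = std_normal_density z" for z
        by (simp add: normal_density_def real_sqrt_mult power_mult_distrib)
      then have "indicator {a..b} (y + inverse (Suc n) * z) * std_normal_density z
         = \<bar>inverse (Suc n)\<bar> * (indicator {a..b} (y + inverse (Suc n) * z) *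
           normal_density 0 (inverse (Suc n)) ((y + inverse (Suc n) * z) - y))" for z
        by (metis mult.left_commute)
      then show ?thesis by (simp only: Bochner_Integration.integral_mult_right_zero real_scaleR_def)
    qed
    finally show ?thesis .
  qed
  have "(\<lambda>n. LINT z|lborel. indicator {a..b} (y + inverse (Suc n) * z) * std_normal_density z)
     \<longlonglongrightarrow> (LINT z|lborel. indicator {a..b} y * std_normal_density z)"
  proof (rule integral_dominated_convergence[where w=std_normal_density])
    show "AE z in lborel. (\<lambda>n. indicator {a..b} (y + inverse (Suc n) * z) * std_normal_density z)
        \<longlonglongrightarrow> indicator {a..b} y * std_normal_density z"
    proof (rule AE_I2)
      fix z :: real
      have lim: "(\<lambda>n. y + inverse (Suc n) * z) \<longlonglongrightarrow> y + 0 * z"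
        by (intro tendsto_intros LIMSEQ_inverse_real_of_nat)
      have "eventually (\<lambda>n. indicator {a..b} (y + inverse (Suc n) * z) = (indicator {a..b} y :: real)) sequentially"
      proof (cases "a < y \<and> y < b")
        case True
        then have "eventually (\<lambda>n. y + inverse (Suc n) * z \<in> {a<..<b}) sequentially"
          using lim by (intro topological_tendstoD) auto
        then show ?thesis by eventually_elim (use True in auto)
      next
        case False
        then have "y \<in> - {a..b}" using assms by auto
        then have "eventually (\<lambda>n. y + inverse (Suc n) * z \<in> - {a..b}) sequentially"
          using lim by (intro topological_tendstoD) auto
        then show ?thesis by eventually_elim (use \<open>y \<in> - {a..b}\<close> in auto)
      qed
      then show "(\<lambda>n. indicator {a..b} (y + inverse (Suc n) * z) * std_normal_density z)
        \<longlonglongrightarrow> indicator {a..b} y * std_normal_density z"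
        by (intro tendsto_mult tendsto_const tendsto_eventually)
    qed
  qed (auto simp: indicator_def)
  then show ?thesis unfolding e by simp
qed

text \<open>Closed intervals are stable under intersection and generate the Borel sets. Cutting down
  to \<open>[-m, m]\<close> makes \<open>d\<close> integrable, so the sets with integral 0 are
  closed under complements and disjoint unions.\<close>

lemma AE_eq_if_interval_integrals_eq:
  fixes d :: "real \<Rightarrow> complex"
  assumes int: "\<And>a b. set_integrable lborel {a..b} d"
    and zero: "\<And>a b. (LINT x:{a..b}|lborel. d x) = 0"
  shows "AE x in lborel. d x = 0"
proof -
  have E: "sets lborel = sigma_sets UNIV (range (\<lambda>(a, b). {a..b::real}))"
    by (simp add: borel_eq_atLeastAtMost)
  have "AE x in lborel. indicator {- real m..real m} x *\<^sub>R d x = 0" for m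
  proof (rule sigma_finite_measure.density_zero[OF lborel.sigma_finite_measure_axioms])
    let ?d = "\<lambda>x. indicator {- real m..real m} x *\<^sub>R d x"
    show I: "integrable lborel ?d" using int[of "- real m" "real m"] by (simp add: set_integrable_def)
    have IA: "set_integrable lborel A ?d" if "A \<in> sets lborel" for A
      unfolding set_integrable_def by (rule integrable_mult_indicator[OF that I])
    fix A assume "A \<in> sets (lborel :: real measure)"
    then have A: "A \<in> sigma_sets UNIV (range (\<lambda>(a, b). {a..b::real}))"
      by (simp only: E)
    have "Int_stable (range (\<lambda>(a, b). {a..b::real}))"
      by (auto simp: Int_stable_def image_iff)
    moreover have "range (\<lambda>(a, b). {a..b::real}) \<subseteq> Pow UNIV" by simp
    ultimately show "set_lebesgue_integral lborel A ?d = 0"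
    using A proof (induction A rule: sigma_sets_induct_disjoint)
      case (basic A)
      then obtain a b where A: "A = {a..b}" by auto
      have "set_lebesgue_integral lborel A ?d = (LINT x:{max a (-real m)..min b (real m)}|lborel. d x)"
        unfolding set_lebesgue_integral_def A
        by (intro Bochner_Integration.integral_cong) (auto simp: indicator_def)
      then show ?case using zero by simp
    next
      case empty then show ?case by (simp add: set_lebesgue_integral_def)
    next
      case (compl A)
      then have A: "A \<in> sets lborel" by (simp only: E)
      have "set_lebesgue_integral lborel UNIV ?d = set_lebesgue_integral lborel (UNIV - A) ?d + set_lebesgue_integral lborel A ?d"
        using A by (subst set_integral_Un[symmetric]) (auto intro!: IA simp: Un_absorb2 Diff_partition)
      moreover have "set_lebesgue_integral lborel UNIV ?d = 0"
        using zero[of "-real m" "real m"] by (simp add: set_lebesgue_integral_def)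
      ultimately show ?case using compl by simp
    next
      case (union A)
      have A: "A i \<in> sets lborel" for i using union(2) unfolding E by blast
      show ?case
        using union A by (subst lebesgue_integral_countable_add)
          (auto intro!: IA simp: disjoint_family_on_def)
    qed
  qed
  then have "AE x in lborel. \<forall>m. indicator {- real m..real m} x *\<^sub>R d x = 0"
    by (subst AE_all_countable) auto
  then show ?thesis
  proof eventually_elim
    fix x assume *: "\<forall>m. indicator {- real m..real m} x *\<^sub>R d x = 0"
    obtain m where "\<bar>x\<bar> < real m" using reals_Archimedean2 by blast
    then show "d x = 0" using *[rule_format, of m] by (auto simp: indicator_def)
  qed
qed

text \<open>Gaussian summation: \<open>A n\<close> tends to the inverse transform by dominated
  convergence, and equals the convolution of \<open>f\<close> with a narrow normal density.
  Comparing integrals over intervals in place of values takes the place of a differentiation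
  theorem.\<close>

lemma fourier_inversion:
  assumes f: "integrable lborel f" and F: "integrable lborel (fourier f)"
  shows "AE s in lborel. f s = (LINT \<omega>|lborel. fourier f \<omega> * cis (2 * pi * \<omega> * s))"
proof -
  define h where "h s = (LINT \<omega>|lborel. fourier f \<omega> * cis (2 * pi * \<omega> * s))" for s
  \<comment> \<open>The factor \<open>2 * pi\<close> makes the transform of \<open>k n\<close> the
    normal density of standard deviation \<open>1 / (n + 1)\<close>.\<close>
  define k where "k n \<omega> = exp (- ((2 * pi * inverse (Suc n)) * \<omega>)\<^sup>2 / 2)" for n :: nat and \<omega> :: real
  define A where "A n s = (LINT \<omega>|lborel. fourier f \<omega> * cis (2 * pi * \<omega> * s) * of_real (k n \<omega>))" for n s
  note [measurable] = fourier_measurable[OF f]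
  have [measurable]: "f \<in> borel_measurable borel" using f by auto
  have km[measurable]: "k n \<in> borel_measurable borel" for n unfolding k_def by measurable
  have k1: "0 \<le> k n \<omega>" "k n \<omega> \<le> 1" for n \<omega> by (auto simp: k_def)
  have hm[measurable]: "h \<in> borel_measurable borel"
    unfolding h_def[abs_def] by (rule lborel.borel_measurable_lebesgue_integral) measurable
  have Am[measurable]: "A n \<in> borel_measurable borel" for n
    unfolding A_def[abs_def] by (rule lborel.borel_measurable_lebesgue_integral) measurable
  let ?N = "LINT \<omega>|lborel. cmod (fourier f \<omega>)"
  have hb: "cmod (h s) \<le> ?N" for s
  proof -
    have "cmod (h s) \<le> (LINT \<omega>|lborel. cmod (fourier f \<omega> * cis (2 * pi * \<omega> * s)))"
      unfolding h_def by (rule integral_norm_bound)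
    then show ?thesis by (simp add: norm_mult)
  qed
  have Ab: "cmod (A n s) \<le> ?N" for n s
  proof -
    have "cmod (A n s) \<le> (LINT \<omega>|lborel. cmod (fourier f \<omega>))"
      unfolding A_def
    proof (rule order_trans[OF integral_norm_bound], rule integral_mono)
      show "integrable lborel (\<lambda>\<omega>. cmod (fourier f \<omega>))" using F by simp
      show le: "cmod (fourier f \<omega> * cis (2 * pi * \<omega> * s) * of_real (k n \<omega>)) \<le> cmod (fourier f \<omega>)" for \<omega>
        using k1[of n \<omega>] mult_left_le[of "k n \<omega>" "cmod (fourier f \<omega>)"] by (simp add: norm_mult)
      show "integrable lborel (\<lambda>\<omega>. cmod (fourier f \<omega> * cis (2 * pi * \<omega> * s) * of_real (k n \<omega>)))"
        by (rule integrable_norm, rule Bochner_Integration.integrable_bound[OF F]) (use le in auto)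
    qed
    then show ?thesis .
  qed
  have Al: "(\<lambda>n. A n s) \<longlonglongrightarrow> h s" for s
    unfolding A_def h_def
  proof (rule integral_dominated_convergence[where w="\<lambda>\<omega>. cmod (fourier f \<omega>)"])
    show "integrable lborel (\<lambda>\<omega>. cmod (fourier f \<omega>))" using F by simp
    show "AE \<omega> in lborel. (\<lambda>n. fourier f \<omega> * cis (2 * pi * \<omega> * s) * of_real (k n \<omega>)) \<longlonglongrightarrow> fourier f \<omega> * cis (2 * pi * \<omega> * s)"
    proof (rule AE_I2)
      fix \<omega> :: real
      have "(\<lambda>n. k n \<omega>) \<longlonglongrightarrow> exp (- ((2 * pi * 0) * \<omega>)\<^sup>2 / 2)"
        unfolding k_def by (intro tendsto_intros LIMSEQ_inverse_real_of_nat) simp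
      then have "(\<lambda>n. fourier f \<omega> * cis (2 * pi * \<omega> * s) * of_real (k n \<omega>)) \<longlonglongrightarrow> fourier f \<omega> * cis (2 * pi * \<omega> * s) * of_real 1"
        by (intro tendsto_intros) simp
      then show "(\<lambda>n. fourier f \<omega> * cis (2 * pi * \<omega> * s) * of_real (k n \<omega>)) \<longlonglongrightarrow> fourier f \<omega> * cis (2 * pi * \<omega> * s)" by simp
    qed
    show "AE \<omega> in lborel. cmod (fourier f \<omega> * cis (2 * pi * \<omega> * s) * of_real (k n \<omega>)) \<le> cmod (fourier f \<omega>)" for n
      using k1 by (auto simp: norm_mult intro!: mult_left_le)
  qed measurable
  have ki: "integrable lborel (k n)" for n
  proof -
    have "k n = (\<lambda>x. exp (- (0 + (sqrt 2 * pi * inverse (Suc n)) * x)\<^sup>2))"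
      by (auto simp: k_def fun_eq_iff power_mult_distrib)
    then show ?thesis
      using lborel_integrable_real_affine[OF gauss_integrable, of "sqrt 2 * pi * inverse (Suc n)" 0] by simp
  qed
  have AG: "A n s = (LINT y|lborel. f y * of_real (normal_density 0 (inverse (Suc n)) (s - y)))" for n s
  proof -
    let ?K = "\<lambda>y \<omega>. f y * (cis (2 * pi * \<omega> * (s - y)) * of_real (k n \<omega>))"
    have K: "integrable (lborel \<Otimes>\<^sub>M lborel) (case_prod ?K)"
      using integrable_mult_kernel[OF f ki[of n], of "\<lambda>(y, \<omega>). cis (2 * pi * \<omega> * (s - y))"]
      by (simp add: case_prod_beta')
    have 1: "(LINT y|lborel. ?K y \<omega>) = fourier f \<omega> * cis (2 * pi * \<omega> * s) * of_real (k n \<omega>)" for \<omega>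
    proof -
      have "?K y \<omega> = (f y * cis (- (2 * pi * \<omega> * y))) * (cis (2 * pi * \<omega> * s) * of_real (k n \<omega>))" for y
      proof -
        have "cis (2 * pi * \<omega> * (s - y)) = cis (- (2 * pi * \<omega> * y)) * cis (2 * pi * \<omega> * s)"
          by (simp add: cis_mult algebra_simps)
        then show ?thesis by (simp only: mult_ac)
      qed
      then have "(LINT y|lborel. ?K y \<omega>) = (LINT y|lborel. (f y * cis (- (2 * pi * \<omega> * y))) * (cis (2 * pi * \<omega> * s) * of_real (k n \<omega>)))"
        by (rule Bochner_Integration.integral_cong[OF refl])
      also have "\<dots> = fourier f \<omega> * (cis (2 * pi * \<omega> * s) * of_real (k n \<omega>))"
        unfolding fourier_def by (rule Bochner_Integration.integral_mult_left_zero)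
      finally show ?thesis by (simp only: mult.assoc)
    qed
    have 2: "(LINT \<omega>|lborel. ?K y \<omega>) = f y * of_real (normal_density 0 (inverse (Suc n)) (s - y))" for y
      using gauss_fourier[of "2 * pi * inverse (Suc n)" "s - y"] by (simp add: k_def)
    show ?thesis unfolding A_def 1[symmetric] 2[symmetric] by (rule lborel_pair.Fubini_integral[OF K])
  qed
  have eq: "(LINT s:{a..b}|lborel. f s) = (LINT s:{a..b}|lborel. h s)" for a b
  proof (rule LIMSEQ_unique)
    show "(\<lambda>n. LINT s:{a..b}|lborel. A n s) \<longlonglongrightarrow> (LINT s:{a..b}|lborel. h s)"
      unfolding set_lebesgue_integral_def
    proof (rule integral_dominated_convergence[where w="\<lambda>s. indicator {a..b} s * ?N"])
      show "AE s in lborel. norm (indicator {a..b} s *\<^sub>R A n s) \<le> indicator {a..b} s * ?N" for n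
        using Ab by (auto simp: indicator_def)
      show "AE s in lborel. (\<lambda>n. indicator {a..b} s *\<^sub>R A n s) \<longlonglongrightarrow> indicator {a..b} s *\<^sub>R h s"
        by (intro AE_I2 tendsto_intros Al)
      have "integrable lborel (indicat_real {a..b})" by (rule integrable_real_indicator) (auto simp: emeasure_lborel_Icc_eq)
      then show "integrable lborel (\<lambda>s. indicator {a..b} s * ?N)" by (rule integrable_mult_left)
    qed auto
    \<comment> \<open>By Fubini the smoothing moves from \<open>f\<close> to the indicator of the
      interval; \<open>\<phi> n\<close> is this smoothed indicator, bounded by 1.\<close>
    define \<phi> where "\<phi> n y = (LINT s|lborel. indicator {a..b} s * normal_density 0 (inverse (Suc n)) (s - y))" for n y
    have nd: "integrable lborel (\<lambda>s. normal_density 0 (inverse (Suc n)) (s - y))"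
       "(LINT s|lborel. normal_density 0 (inverse (Suc n)) (s - y)) = 1" for n and y :: real
      using lborel_integrable_real_affine[OF integrable_normal_density[of "inverse (Suc n)" 0], of 1 "- y"]
        lborel_integral_real_affine[of 1 "normal_density 0 (inverse (Suc n))" "- y"]
        integral_normal_density[of "inverse (Suc n)" 0]
      by (simp_all add: algebra_simps)
    have ndi: "integrable lborel (\<lambda>s. indicator {a..b} s * normal_density 0 (inverse (Suc n)) (s - y))" for n y
      using integrable_mult_indicator[OF _ nd(1), of "{a..b}"] by simp
    have \<phi>1: "0 \<le> \<phi> n y" "\<phi> n y \<le> 1" for n y
    proof -
      show "0 \<le> \<phi> n y" unfolding \<phi>_def by (rule Bochner_Integration.integral_nonneg) simp
      have "\<phi> n y \<le> (LINT s|lborel. normal_density 0 (inverse (Suc n)) (s - y))"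
        unfolding \<phi>_def by (rule integral_mono[OF ndi nd(1)]) (auto simp: indicator_def)
      then show "\<phi> n y \<le> 1" using nd(2) by simp
    qed
    have \<phi>m[measurable]: "\<phi> n \<in> borel_measurable borel" for n
      unfolding \<phi>_def[abs_def] by (rule lborel.borel_measurable_lebesgue_integral) measurable
    have "(LINT s:{a..b}|lborel. A n s) = (LINT y|lborel. f y * of_real (\<phi> n y))" for n
    proof -
      let ?K = "\<lambda>y s. f y * of_real (indicator {a..b} s * normal_density 0 (inverse (Suc n)) (s - y))"
      have K: "integrable (lborel \<Otimes>\<^sub>M lborel) (case_prod ?K)"
      proof (rule lborel_pair.Fubini_integrable)
        show "case_prod ?K \<in> borel_measurable (lborel \<Otimes>\<^sub>M lborel)" by measurable
        have e: "(LINT s|lborel. norm (case (y, s) of (y, s) \<Rightarrow> ?K y s)) = norm (f y) * \<phi> n y" for y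
          by (simp add: norm_mult abs_mult \<phi>_def mult.assoc)
        show "integrable lborel (\<lambda>y. LINT s|lborel. norm (case (y, s) of (y, s) \<Rightarrow> ?K y s))"
          unfolding e by (rule Bochner_Integration.integrable_bound[OF f])
            (use \<phi>1 in \<open>auto simp: abs_mult intro!: mult_left_le\<close>)
        show "AE y in lborel. integrable lborel (\<lambda>s. case (y, s) of (y, s) \<Rightarrow> ?K y s)"
          using ndi by (intro AE_I2) (simp del: of_real_mult)
      qed
      have 1: "(LINT s|lborel. ?K y s) = f y * of_real (\<phi> n y)" for y
        by (simp add: \<phi>_def del: of_real_mult)
      have 2: "(LINT y|lborel. ?K y s) = indicator {a..b} s *\<^sub>R A n s" for s
        by (auto simp: AG indicator_def)
      show ?thesis using lborel_pair.Fubini_integral[OF K]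
        unfolding set_lebesgue_integral_def 1 2 by simp
    qed
    moreover have "(\<lambda>n. LINT y|lborel. f y * of_real (\<phi> n y)) \<longlonglongrightarrow> (LINT y|lborel. indicator {a..b} y *\<^sub>R f y)"
    proof (rule integral_dominated_convergence[where w="\<lambda>y. cmod (f y)"])
      have "AE y in lborel. y \<noteq> a \<and> y \<noteq> b"
        using AE_lborel_singleton[of a] AE_lborel_singleton[of b] by eventually_elim auto
      then show "AE y in lborel. (\<lambda>n. f y * of_real (\<phi> n y)) \<longlonglongrightarrow> indicator {a..b} y *\<^sub>R f y"
      proof eventually_elim
        fix y assume "y \<noteq> a \<and> y \<noteq> b"
        then have "(\<lambda>n. \<phi> n y) \<longlonglongrightarrow> indicator {a..b} y"
          unfolding \<phi>_def by (intro normal_mass_interval_limit) auto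
        then have "(\<lambda>n. f y * of_real (\<phi> n y)) \<longlonglongrightarrow> f y * of_real (indicator {a..b} y)"
          by (intro tendsto_intros)
        then show "(\<lambda>n. f y * of_real (\<phi> n y)) \<longlonglongrightarrow> indicator {a..b} y *\<^sub>R f y"
          by (simp add: scaleR_conv_of_real mult.commute)
      qed
      show "AE y in lborel. norm (f y * of_real (\<phi> n y)) \<le> cmod (f y)" for n
        using \<phi>1 by (auto simp: norm_mult intro!: mult_left_le)
    qed (use f in auto)
    ultimately show "(\<lambda>n. LINT s:{a..b}|lborel. A n s) \<longlonglongrightarrow> (LINT s:{a..b}|lborel. f s)"
      by (simp add: set_lebesgue_integral_def)
  qed
  have hi: "set_integrable lborel {a..b} h" for a b
  proof -
    have "integrable lborel (indicat_real {a..b})"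
      by (rule integrable_real_indicator) (auto simp: emeasure_lborel_Icc_eq)
    then have "integrable lborel (\<lambda>s. indicator {a..b} s * ?N)" by (rule integrable_mult_left)
    then show ?thesis unfolding set_integrable_def
      by (rule Bochner_Integration.integrable_bound)
         (use hb in \<open>auto simp: indicator_def intro: order_trans\<close>)
  qed
  have fi: "set_integrable lborel {a..b} f" for a b
    unfolding set_integrable_def using f by (intro integrable_mult_indicator) auto
  have "AE s in lborel. f s - h s = 0"
    by (rule AE_eq_if_interval_integrals_eq) (use fi hi eq in \<open>auto simp: set_integral_diff\<close>)
  then show ?thesis by (simp add: h_def)
qed

text \<open>Inversion bounds \<open>f\<close> almost everywhere by the integral of the modulus of
  its transform, and a bounded integrable function is square integrable.\<close>

lemma S0_real_subset_L2:
  assumes "f \<in> S0_real" shows "f \<in> L2_space lborel"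
proof -
  have f: "integrable lborel f" using assms by (simp add: S0_real_def)
  let ?N = "LINT \<omega>|lborel. cmod (fourier f \<omega>)"
  have b: "cmod (LINT \<omega>|lborel. fourier f \<omega> * cis (2 * pi * \<omega> * s)) \<le> ?N" for s
  proof -
    have "cmod (LINT \<omega>|lborel. fourier f \<omega> * cis (2 * pi * \<omega> * s)) \<le> (LINT \<omega>|lborel. cmod (fourier f \<omega> * cis (2 * pi * \<omega> * s)))"
      by (rule integral_norm_bound)
    then show ?thesis by (simp add: norm_mult)
  qed
  have [measurable]: "f \<in> borel_measurable borel" using f by auto
  show ?thesis
  proof (rule L2_spaceI)
    show "integrable lborel (\<lambda>t. (cmod (f t))\<^sup>2)"
    proof (rule Bochner_Integration.integrable_bound)
      show "integrable lborel (\<lambda>s. ?N * cmod (f s))" using f by simp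
      show "AE s in lborel. norm ((cmod (f s))\<^sup>2) \<le> norm (?N * cmod (f s))"
        using fourier_inversion[OF f S0_real_fourier_integrable[OF assms]]
      proof eventually_elim
        fix s assume "f s = (LINT \<omega>|lborel. fourier f \<omega> * cis (2 * pi * \<omega> * s))"
        then have "cmod (f s) \<le> ?N" using b[of s] by simp
        then have "cmod (f s) * cmod (f s) \<le> ?N * cmod (f s)" by (rule mult_right_mono) simp
        then show "norm ((cmod (f s))\<^sup>2) \<le> norm (?N * cmod (f s))"
          by (simp add: power2_eq_square)
      qed
    qed measurable
  qed simp
qed

section \<open>Bases of characters on cosets\<close>

lemma L2_inner_simps:
  assumes "f \<in> L2_space M" "g \<in> L2_space M" "h \<in> L2_space M"
  shows L2_inner_add_left: "L2_inner M (\<lambda>t. f t + g t) h = L2_inner M f h + L2_inner M g h"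
    and L2_inner_diff_left: "L2_inner M (\<lambda>t. f t - g t) h = L2_inner M f h - L2_inner M g h"
    and L2_inner_diff_right: "L2_inner M h (\<lambda>t. f t - g t) = L2_inner M h f - L2_inner M h g"
  using L2_inner_integrable[OF assms(1,3)] L2_inner_integrable[OF assms(2,3)]
    L2_inner_integrable[OF assms(3,1)] L2_inner_integrable[OF assms(3,2)]
  by (simp_all add: L2_inner_def algebra_simps)

lemma L2_inner_cmult_left: "L2_inner M (\<lambda>t. c * f t) g = c * L2_inner M f g"
  by (simp add: L2_inner_def mult.assoc)

lemma L2_inner_cmult_right: "L2_inner M f (\<lambda>t. c * g t) = cnj c * L2_inner M f g"
  by (simp add: L2_inner_def mult.left_commute)

lemma L2_inner_commute: "L2_inner M f g = cnj (L2_inner M g f)"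
  unfolding L2_inner_def by (subst Bochner_Integration.integral_cnj[symmetric]) (simp add: mult.commute)

lemma L2_inner_zero_left [simp]: "L2_inner M (\<lambda>t. 0) g = 0"
  by (simp add: L2_inner_def)

lemma L2_inner_sum_left:
  assumes "\<And>i. i \<in> J \<Longrightarrow> f i \<in> L2_space M" "g \<in> L2_space M"
  shows "L2_inner M (\<lambda>t. \<Sum>i\<in>J. f i t) g = (\<Sum>i\<in>J. L2_inner M (f i) g)"
  using assms(1)
  by (induction J rule: infinite_finite_induct)
     (auto simp: L2_inner_add_left assms(2) L2_space_sum)

lemma L2_inner_self: "L2_inner M f f = of_real ((L2_norm M f)\<^sup>2)"
  unfolding L2_inner_def L2_norm_square
  by (simp add: complex_norm_square[symmetric] del: of_real_power)

text \<open>Completing the square. With the coefficients of \<open>f\<close> as \<open>a\<close> it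
  yields Bessel's inequality; with arbitrary \<open>a\<close> it shows how close any combination can
  come.\<close>

lemma L2_norm_diff_orthonormal_sum:
  assumes J: "finite J" and e: "\<And>i. i \<in> J \<Longrightarrow> e i \<in> L2_space M"
    and on: "\<And>i j. i \<in> J \<Longrightarrow> j \<in> J \<Longrightarrow> L2_inner M (e i) (e j) = (if i = j then 1 else 0)"
    and f: "f \<in> L2_space M"
  shows "(L2_norm M (\<lambda>u. f u - (\<Sum>i\<in>J. a i * e i u)))\<^sup>2
     = (L2_norm M f)\<^sup>2 - (\<Sum>i\<in>J. (cmod (L2_inner M f (e i)))\<^sup>2) + (\<Sum>i\<in>J. (cmod (a i - L2_inner M f (e i)))\<^sup>2)"
proof -
  let ?c = "\<lambda>i. L2_inner M f (e i)"
  let ?s = "\<lambda>u. \<Sum>i\<in>J. a i * e i u"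
  have ae: "(\<lambda>u. a i * e i u) \<in> L2_space M" if "i \<in> J" for i by (rule L2_space_cmult[OF e[OF that]])
  have s: "?s \<in> L2_space M" by (rule L2_space_sum[OF ae])
  have sl: "L2_inner M ?s g = (\<Sum>i\<in>J. a i * L2_inner M (e i) g)" if "g \<in> L2_space M" for g
    by (subst L2_inner_sum_left[OF ae that]) (auto simp: L2_inner_cmult_left)
  have se: "L2_inner M ?s (e j) = a j" if j: "j \<in> J" for j
  proof -
    have "L2_inner M ?s (e j) = (\<Sum>i\<in>J. if i = j then a i else 0)"
      unfolding sl[OF e[OF j]] by (rule sum.cong) (auto simp: on j)
    then show ?thesis using J j by simp
  qed
  have ss: "L2_inner M ?s ?s = (\<Sum>i\<in>J. a i * cnj (a i))"
    unfolding sl[OF s] by (rule sum.cong[OF refl]) (simp add: L2_inner_commute[of M "e _" ?s] se)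
  have sf: "L2_inner M ?s f = (\<Sum>i\<in>J. a i * cnj (?c i))"
    unfolding sl[OF f] by (rule sum.cong[OF refl]) (subst L2_inner_commute, simp)
  have fs: "L2_inner M f ?s = (\<Sum>i\<in>J. cnj (a i) * ?c i)"
    by (subst L2_inner_commute, subst sf) simp
  have "complex_of_real ((L2_norm M (\<lambda>u. f u - ?s u))\<^sup>2) = L2_inner M f f - L2_inner M ?s f - (L2_inner M f ?s - L2_inner M ?s ?s)"
    unfolding L2_inner_self[symmetric]
    by (subst L2_inner_diff_left[OF f s L2_space_diff[OF f s]])
       (simp add: L2_inner_diff_right[OF f s f] L2_inner_diff_right[OF f s s])
  also have "\<dots> = L2_inner M f f + (\<Sum>i\<in>J. a i * cnj (a i) - a i * cnj (?c i) - cnj (a i) * ?c i)"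
    unfolding ss sf fs by (simp add: sum_subtractf)
  also have "(\<Sum>i\<in>J. a i * cnj (a i) - a i * cnj (?c i) - cnj (a i) * ?c i)
     = (\<Sum>i\<in>J. (a i - ?c i) * cnj (a i - ?c i) - ?c i * cnj (?c i))"
    by (rule sum.cong[OF refl]) (simp add: algebra_simps)
  also have "\<dots> = of_real ((\<Sum>i\<in>J. (cmod (a i - ?c i))\<^sup>2) - (\<Sum>i\<in>J. (cmod (?c i))\<^sup>2))"
  proof -
    have "z * cnj z = of_real ((cmod z)\<^sup>2)" for z by (rule complex_norm_square[symmetric])
    then show ?thesis by (simp only: sum_subtractf of_real_diff of_real_sum)
  qed
  finally have "complex_of_real ((L2_norm M (\<lambda>u. f u - ?s u))\<^sup>2) =
     of_real ((L2_norm M f)\<^sup>2 + ((\<Sum>i\<in>J. (cmod (a i - ?c i))\<^sup>2) - (\<Sum>i\<in>J. (cmod (?c i))\<^sup>2)))"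
    unfolding L2_inner_self by simp
  then show ?thesis unfolding of_real_eq_iff by simp
qed

text \<open>Initial segments of an enumeration exhaust the index set, and Fatou's lemma passes to
  the limit.\<close>

lemma nn_integral_count_space_le:
  fixes f :: "'i \<Rightarrow> ennreal"
  assumes I: "countable I" and b: "\<And>J. finite J \<Longrightarrow> J \<subseteq> I \<Longrightarrow> sum f J \<le> B"
  shows "(\<integral>\<^sup>+i. f i \<partial>count_space I) \<le> B"
proof (cases "I = {}")
  case False
  define J where "J n = from_nat_into I ` {..<n}" for n :: nat
  have J: "finite (J n)" "J n \<subseteq> I" for n using from_nat_into[OF False] by (auto simp: J_def)
  have "(\<integral>\<^sup>+i. f i \<partial>count_space I) = (\<integral>\<^sup>+i. liminf (\<lambda>n. f i * indicator (J n) i) \<partial>count_space I)"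
  proof (rule nn_integral_cong)
    fix i assume "i \<in> space (count_space I)"
    then obtain k where k: "i = from_nat_into I k" using from_nat_into_surj[OF I, of i] by auto
    have "eventually (\<lambda>n. f i * indicator (J n) i = f i) sequentially"
      using eventually_gt_at_top[of k] by eventually_elim (auto simp: J_def k)
    then have "(\<lambda>n. f i * indicator (J n) i) \<longlonglongrightarrow> f i" by (rule tendsto_eventually)
    then show "f i = liminf (\<lambda>n. f i * indicator (J n) i)"
      by (rule lim_imp_Liminf[OF trivial_limit_sequentially, symmetric])
  qed
  also have "\<dots> \<le> liminf (\<lambda>n. \<integral>\<^sup>+i. f i * indicator (J n) i \<partial>count_space I)"
    by (rule nn_integral_liminf) auto
  also have "\<dots> \<le> liminf (\<lambda>n. B)"
  proof (rule Liminf_mono, rule always_eventually, rule allI)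
    fix n
    have "(\<integral>\<^sup>+i. f i * indicator (J n) i \<partial>count_space I) = (\<integral>\<^sup>+i. f i \<partial>count_space (J n))"
      using J(1)[of n] J(2)[of n] by (subst (1 2) nn_integral_count_space_indicator)
        (auto intro!: nn_integral_cong simp: indicator_def)
    also have "\<dots> = sum f (J n)" by (rule nn_integral_count_space_finite[OF J(1)])
    finally show "(\<integral>\<^sup>+i. f i * indicator (J n) i \<partial>count_space I) \<le> B" using b[OF J] by simp
  qed
  also have "\<dots> = B" by (rule Liminf_const) simp
  finally show ?thesis .
qed (simp add: nn_integral_empty)

lemma sum_le_nn_integral_count_space:
  fixes f :: "'i \<Rightarrow> ennreal"
  assumes "finite J" "J \<subseteq> I"
  shows "sum f J \<le> (\<integral>\<^sup>+i. f i \<partial>count_space I)"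
proof -
  have "sum f J = (\<integral>\<^sup>+i. f i \<partial>count_space J)" by (simp add: nn_integral_count_space_finite assms)
  also have "\<dots> \<le> (\<integral>\<^sup>+i. f i \<partial>count_space I)"
    using assms by (subst (1 2) nn_integral_count_space_indicator)
      (auto intro!: nn_integral_mono simp: indicator_def)
  finally show ?thesis .
qed

text \<open>\<open>C q\<close> stands for \<open>q + K\<close> and \<open>\<psi> r\<close> for the
  character of frequency \<open>r\<close>, without any group operation on \<open>'h\<close>. Unit
  measure of the cosets and vanishing means of nonintegral frequencies give orthonormality;
  constancy of integral frequencies on cosets lets frequencies be reduced modulo the integers.
  \<open>generated\<close> is the assumption behind completeness.\<close>

locale coset_characters =
  fixes M :: "'h measure" and R :: "rat set" and C :: "rat \<Rightarrow> 'h set" and \<psi> :: "rat \<Rightarrow> 'h \<Rightarrow> complex"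
  assumes R_int: "of_int n \<in> R"
    and R_add: "q \<in> R \<Longrightarrow> r \<in> R \<Longrightarrow> q + r \<in> R"
    and R_minus: "q \<in> R \<Longrightarrow> - q \<in> R"
    and C_sets: "q \<in> R \<Longrightarrow> C q \<in> sets M"
    and C_measure: "q \<in> R \<Longrightarrow> emeasure M (C q) = 1"
    and C_cover: "space M = (\<Union>q\<in>R. C q)"
    and C_int: "q \<in> R \<Longrightarrow> C (q + of_int n) = C q"
    and C_disj: "q \<in> R \<Longrightarrow> r \<in> R \<Longrightarrow> u \<in> C q \<Longrightarrow> u \<in> C r \<Longrightarrow> q - r \<in> \<int>"
    and psi_measurable: "r \<in> R \<Longrightarrow> \<psi> r \<in> borel_measurable M"
    and psi_norm: "r \<in> R \<Longrightarrow> u \<in> space M \<Longrightarrow> cmod (\<psi> r u) = 1"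
    and psi_add: "r \<in> R \<Longrightarrow> s \<in> R \<Longrightarrow> u \<in> space M \<Longrightarrow> \<psi> (r + s) u = \<psi> r u * \<psi> s u"
    and psi_int: "q \<in> R \<Longrightarrow> u \<in> C q \<Longrightarrow> v \<in> C q \<Longrightarrow> \<psi> (of_int n) u = \<psi> (of_int n) v"
    and psi_integral: "q \<in> R \<Longrightarrow> r \<in> R \<Longrightarrow> r \<notin> \<int> \<Longrightarrow> (LINT u|M. indicator (C q) u * \<psi> r u) = 0"
    and generated: "sets M \<subseteq> sigma_sets (space M) {{u \<in> C q. \<psi> r u = w} | q r w. q \<in> R \<and> r \<in> R}"
begin

lemma countable_R: "countable R"
  by (rule countable_subset[OF subset_UNIV]) simp

lemma C_subset: "q \<in> R \<Longrightarrow> C q \<subseteq> space M"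
  using C_cover by auto

lemma sigma_finite: "sigma_finite_measure M"
  by (rule sigma_finite_measure.intro, rule exI[of _ "C ` R"])
     (use countable_R C_sets C_cover C_measure in auto)

lemma C_nonempty: "q \<in> R \<Longrightarrow> C q \<noteq> {}"
  using C_measure[of q] by auto

lemma R_diff: "q \<in> R \<Longrightarrow> r \<in> R \<Longrightarrow> q - r \<in> R"
  using R_add[of q "- r"] R_minus[of r] by simp

lemma R_frac: "q \<in> R \<Longrightarrow> frac q \<in> R"
  unfolding frac_def by (intro R_diff R_int)

lemma R_zero: "0 \<in> R" using R_int[of 0] by simp

lemma R_mult: "q \<in> R \<Longrightarrow> of_nat k * q \<in> R"
  by (induction k) (auto simp: R_zero R_add algebra_simps)

lemma psi_zero: "u \<in> space M \<Longrightarrow> \<psi> 0 u = 1"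
  using psi_add[of 0 0 u] psi_norm[of 0 u] R_zero by auto

lemma psi_mult: "r \<in> R \<Longrightarrow> u \<in> space M \<Longrightarrow> \<psi> (of_nat k * r) u = \<psi> r u ^ k"
proof (induction k)
  case (Suc k)
  have "\<psi> (r + of_nat k * r) u = \<psi> r u * \<psi> (of_nat k * r) u"
    by (rule psi_add[OF Suc.prems(1) R_mult[OF Suc.prems(1)] Suc.prems(2)])
  then show ?case using Suc by (simp add: algebra_simps)
qed (simp add: psi_zero)

lemma psi_cnj: "r \<in> R \<Longrightarrow> u \<in> space M \<Longrightarrow> cnj (\<psi> r u) = \<psi> (- r) u"
proof -
  assume *: "r \<in> R" "u \<in> space M"
  have "\<psi> r u * \<psi> (- r) u = 1" using psi_add[OF *(1) R_minus[OF *(1)] *(2)] psi_zero[OF *(2)] by simp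
  moreover have "\<psi> r u * cnj (\<psi> r u) = 1" using psi_norm[OF *] by (simp add: complex_norm_square[symmetric])
  ultimately show ?thesis by (metis mult_cancel_left mult_zero_left zero_neq_one)
qed

lemma psi_diff: "r \<in> R \<Longrightarrow> s \<in> R \<Longrightarrow> u \<in> space M \<Longrightarrow> \<psi> (r - s) u = \<psi> r u * cnj (\<psi> s u)"
  using psi_add[of r "- s" u] psi_cnj[of s u] R_minus[of s] by simp

definition e :: "rat \<times> rat \<Rightarrow> 'h \<Rightarrow> complex" where
  "e i u = indicator (C (fst i)) u * \<psi> (snd i) u"

definition Y :: "rat set" where "Y = R \<inter> {0..<1}"

lemma Y_R: "y \<in> Y \<Longrightarrow> y \<in> R" by (simp add: Y_def)

lemma frac_Y: "q \<in> R \<Longrightarrow> frac q \<in> Y"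
  by (simp add: Y_def R_frac frac_ge_0 frac_lt_1)

lemma Y_unique: "y \<in> Y \<Longrightarrow> z \<in> Y \<Longrightarrow> y - z \<in> \<int> \<Longrightarrow> y = z"
proof -
  assume a: "y \<in> Y" "z \<in> Y" "y - z \<in> \<int>"
  then obtain n where n: "y - z = of_int n" by (auto elim: Ints_cases)
  have "of_int n < (1 :: rat)" "(-1 :: rat) < of_int n" using a(1,2) n[symmetric] by (auto simp: Y_def)
  then have "n = 0" by linarith
  then show ?thesis using n by simp
qed

lemma countable_Y: "countable Y" using countable_R by (simp add: Y_def)

lemma e_measurable: "q \<in> R \<Longrightarrow> r \<in> R \<Longrightarrow> e (q, r) \<in> borel_measurable M"
  unfolding e_def using C_sets[of q] psi_measurable[of r] by simp

lemma e_norm: "q \<in> R \<Longrightarrow> r \<in> R \<Longrightarrow> cmod (e (q, r) u) = indicator (C q) u"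
  using C_subset[of q] psi_norm[of r u] by (auto simp: e_def indicator_def)

lemma e_L2: "q \<in> R \<Longrightarrow> r \<in> R \<Longrightarrow> e (q, r) \<in> L2_space M"
proof (rule L2_spaceI)
  assume a: "q \<in> R" "r \<in> R"
  have "integrable M (indicat_real (C q))"
    by (rule integrable_real_indicator) (use C_sets C_measure a in auto)
  moreover have "(cmod (e (q, r) t))\<^sup>2 = indicator (C q) t" for t
    by (simp add: e_norm[OF a] indicator_def)
  ultimately show "integrable M (\<lambda>t. (cmod (e (q, r) t))\<^sup>2)" by simp
qed (rule e_measurable)

lemma e_inner:
  assumes "q \<in> R" "r \<in> R" "q' \<in> R" "r' \<in> R"
  shows "L2_inner M (e (q, r)) (e (q', r')) =
     (if q - q' \<in> \<int> then LINT u|M. indicator (C q) u * \<psi> (r - r') u else 0)"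
proof (cases "q - q' \<in> \<int>")
  case True
  then obtain n where "q - q' = of_int n" by (auto elim: Ints_cases)
  then have "C q = C q'" using C_int[OF assms(3), of n] by (simp add: algebra_simps)
  then have "e (q, r) u * cnj (e (q', r') u) = indicator (C q) u * \<psi> (r - r') u" for u
    using psi_diff[OF assms(2,4), of u] C_subset[OF assms(1)] by (auto simp: e_def indicator_def)
  then show ?thesis using True by (simp add: L2_inner_def)
next
  case False
  then have "e (q, r) u * cnj (e (q', r') u) = 0" for u
    using C_disj[OF assms(1,3)] by (auto simp: e_def indicator_def)
  then show ?thesis using False unfolding L2_inner_def by (simp only: if_False Bochner_Integration.integral_zero)
qed

lemma e_orthonormal:
  assumes "i \<in> Y \<times> Y" "j \<in> Y \<times> Y"
  shows "L2_inner M (e i) (e j) = (if i = j then 1 else 0)"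
proof -
  obtain y z y' z' where ij: "i = (y, z)" "j = (y', z')" by (cases i, cases j)
  have Y: "y \<in> Y" "z \<in> Y" "y' \<in> Y" "z' \<in> Y" using assms ij by auto
  note R = Y[THEN Y_R]
  have yy: "y - y' \<in> \<int> \<longleftrightarrow> y = y'" using Y_unique[OF Y(1,3)] by auto
  have zz: "z - z' \<in> \<int> \<longleftrightarrow> z = z'" using Y_unique[OF Y(2,4)] by auto
  have 1: "(LINT u|M. indicator (C y) u * \<psi> 0 u) = 1"
  proof -
    have "(LINT u|M. indicator (C y) u * \<psi> 0 u) = (LINT u|M. complex_of_real (indicator (C y) u))"
      using C_subset[OF R(1)] by (intro Bochner_Integration.integral_cong) (auto simp: indicator_def psi_zero)
    then show ?thesis using C_sets[OF R(1)] C_measure[OF R(1)] C_subset[OF R(1)]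
      by (simp add: measure_def Int_absorb2)
  qed
  show ?thesis
    unfolding ij e_inner[OF R] yy using zz psi_integral[OF R(1) R_diff[OF R(2,4)]] 1 by auto
qed

text \<open>Trigonometric polynomials on one coset. Confinement to one coset makes them closed under
  multiplication, since there the basis functions multiply by adding frequencies.\<close>

inductive_set trig :: "rat \<Rightarrow> ('h \<Rightarrow> complex) set" for q :: rat where
  zero: "(\<lambda>u. 0) \<in> trig q"
| add: "f \<in> trig q \<Longrightarrow> r \<in> R \<Longrightarrow> (\<lambda>u. f u + c * e (q, r) u) \<in> trig q"

lemma trig_add: "g \<in> trig q \<Longrightarrow> f \<in> trig q \<Longrightarrow> (\<lambda>u. f u + g u) \<in> trig q"
proof (induction arbitrary: f rule: trig.induct)
  case (add g r c)
  then show ?case using trig.add[OF add.IH[OF add.prems] add.hyps(2), of c] by (simp add: add.assoc)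
qed simp

lemma trig_e: "r \<in> R \<Longrightarrow> (\<lambda>u. c * e (q, r) u) \<in> trig q"
  using trig.add[OF trig.zero] by simp

lemma trig_cmult: "f \<in> trig q \<Longrightarrow> (\<lambda>u. c * f u) \<in> trig q"
proof (induction rule: trig.induct)
  case (add f r d)
  then show ?case using trig.add[OF add.IH, of r "c * d"] by (simp add: algebra_simps)
qed (simp add: trig.zero)

lemma trig_mult_e:
  assumes q: "q \<in> R" and r: "r \<in> R" and "f \<in> trig q" shows "(\<lambda>u. f u * e (q, r) u) \<in> trig q"
  using assms(3)
proof (induction rule: trig.induct)
  case (add f s c)
  have "e (q, s) u * e (q, r) u = e (q, s + r) u" for u
    using C_subset[OF q] psi_add[OF add.hyps(2) r, of u] by (auto simp: e_def indicator_def)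
  then have "(f u + c * e (q, s) u) * e (q, r) u = f u * e (q, r) u + c * e (q, s + r) u" for u
    by (simp add: algebra_simps)
  then show ?case using trig.add[OF add.IH R_add[OF add.hyps(2) r], of c] by simp
qed (simp add: trig.zero)

lemma trig_mult:
  assumes q: "q \<in> R" and "g \<in> trig q" "f \<in> trig q" shows "(\<lambda>u. f u * g u) \<in> trig q"
  using assms(2)
proof (induction rule: trig.induct)
  case (add g r c)
  have "(\<lambda>u. f u * g u + c * (f u * e (q, r) u)) \<in> trig q"
    by (rule trig_add[OF trig_cmult[OF trig_mult_e[OF q add.hyps(2) assms(3)]] add.IH])
  then show ?case by (simp add: algebra_simps)
qed (simp add: trig.zero)

lemma trig_sum: "(\<And>i. i \<in> J \<Longrightarrow> f i \<in> trig q) \<Longrightarrow> (\<lambda>u. \<Sum>i\<in>J. f i u) \<in> trig q"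
  by (induction J rule: infinite_finite_induct) (auto simp: trig.zero intro!: trig_add)

lemma trig_L2:
  assumes "q \<in> R" shows "f \<in> trig q \<Longrightarrow> f \<in> L2_space M"
proof (induction rule: trig.induct)
  case (add f r c)
  then show ?case by (intro L2_space_add L2_space_cmult e_L2[OF assms])
qed (rule L2_space_zero)

text \<open>A root-of-unity filter expresses the level sets of a character as trigonometric polynomials.\<close>

lemma level_set_trig:
  assumes q: "q \<in> R" and r: "r \<in> R"
  shows "(\<lambda>u. indicator {u \<in> C q. \<psi> r u = w} u) \<in> trig q"
proof (cases "{u \<in> C q. \<psi> r u = w} = {}")
  case True then show ?thesis by (simp add: trig.zero)
next
  case False
  then obtain v where v: "v \<in> C q" "\<psi> r v = w" by auto
  obtain a b where ab: "quotient_of r = (a, b)" by (cases "quotient_of r")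
  \<comment> \<open>\<open>N\<close> is the denominator of \<open>r\<close>, so
    \<open>\<psi> r\<close> to the power \<open>N\<close> has integral frequency and is constant on
    the coset. Hence \<open>\<psi> r u / w\<close> is an \<open>N\<close>-th root of unity, and the
    mean of its powers decides whether it is 1.\<close>
  define N where "N = nat b"
  have b: "b > 0" using quotient_of_denom_pos[OF ab] .
  then have N: "N > 0" and "of_nat N = (of_int b :: rat)" by (auto simp: N_def)
  moreover have "r = of_int a / of_int b" by (rule quotient_of_div[OF ab])
  ultimately have Nr: "of_nat N * r = of_int a" using b by simp
  have sp: "u \<in> space M" if "u \<in> C q" for u using C_subset[OF q] that by auto
  have w: "w \<noteq> 0" using psi_norm[OF r sp[OF v(1)]] v(2) by auto
  have "indicator {u \<in> C q. \<psi> r u = w} u = (\<Sum>k<N. (1 / (of_nat N * w ^ k)) * e (q, of_nat k * r) u)" for u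
  proof (cases "u \<in> C q")
    case True
    let ?x = "\<psi> r u / w"
    have "\<psi> r u ^ N = w ^ N"
      using psi_int[OF q True v(1), of a] psi_mult[OF r sp[OF True], of N] psi_mult[OF r sp[OF v(1)], of N]
      by (simp add: Nr v(2))
    then have xN: "?x ^ N = 1" using w by (simp add: power_divide)
    have "(\<Sum>k<N. (1 / (of_nat N * w ^ k)) * e (q, of_nat k * r) u) = (\<Sum>k<N. ?x ^ k) / of_nat N"
      unfolding sum_divide_distrib using True psi_mult[OF r sp[OF True]]
      by (intro sum.cong) (auto simp: e_def power_divide)
    also have "(\<Sum>k<N. ?x ^ k) = (if ?x = 1 then of_nat N else 0)"
      using geometric_sum[of ?x N] xN by auto
    finally show ?thesis using True w N by (auto simp: indicator_def)
  qed (auto simp: e_def)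
  then have eq: "(\<lambda>u. indicator {u \<in> C q. \<psi> r u = w} u) = (\<lambda>u. \<Sum>k<N. (1 / (of_nat N * w ^ k)) * e (q, of_nat k * r) u)"
    by (rule ext)
  show ?thesis unfolding eq by (intro trig_sum trig_e R_mult r)
qed

definition approx :: "rat \<Rightarrow> ('h \<Rightarrow> complex) set" where
  "approx q = {f \<in> L2_space M. \<forall>\<epsilon>>0. \<exists>g\<in>trig q. L2_norm M (\<lambda>u. f u - g u) < \<epsilon>}"

lemma approx_L2: "f \<in> approx q \<Longrightarrow> f \<in> L2_space M"
  by (simp add: approx_def)

lemma approxD: "f \<in> approx q \<Longrightarrow> \<epsilon> > 0 \<Longrightarrow> \<exists>g\<in>trig q. L2_norm M (\<lambda>u. f u - g u) < \<epsilon>"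
  by (simp add: approx_def)

lemma trig_approx: "q \<in> R \<Longrightarrow> f \<in> trig q \<Longrightarrow> f \<in> approx q"
  unfolding approx_def using trig_L2 by (auto intro!: bexI[of _ f])

lemma approx_limit:
  assumes f: "f \<in> L2_space M" and q: "q \<in> R"
    and l: "\<And>\<epsilon>. \<epsilon> > 0 \<Longrightarrow> \<exists>g\<in>approx q. L2_norm M (\<lambda>u. f u - g u) < \<epsilon>"
  shows "f \<in> approx q"
  unfolding approx_def
proof (intro CollectI conjI f allI impI)
  fix \<epsilon> :: real assume "\<epsilon> > 0"
  then obtain g where g: "g \<in> approx q" "L2_norm M (\<lambda>u. f u - g u) < \<epsilon> / 2" using l[of "\<epsilon> / 2"] by auto
  then obtain h where h: "h \<in> trig q" "L2_norm M (\<lambda>u. g u - h u) < \<epsilon> / 2"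
    using \<open>\<epsilon> > 0\<close> approxD[OF g(1), of "\<epsilon> / 2"] by auto
  have "L2_norm M (\<lambda>u. (f u - g u) + (g u - h u)) \<le> L2_norm M (\<lambda>u. f u - g u) + L2_norm M (\<lambda>u. g u - h u)"
    using f approx_L2[OF g(1)] trig_L2[OF q h(1)] by (intro L2_norm_add L2_space_diff)
  then show "\<exists>g\<in>trig q. L2_norm M (\<lambda>u. f u - g u) < \<epsilon>"
    using g(2) h by (intro bexI[of _ h]) auto
qed

lemma approx_add_cmult:
  assumes q: "q \<in> R" and f: "f \<in> approx q" and g: "g \<in> approx q"
  shows "(\<lambda>u. f u + c * g u) \<in> approx q"
  unfolding approx_def
proof (intro CollectI conjI allI impI)
  show "(\<lambda>u. f u + c * g u) \<in> L2_space M"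
    by (intro L2_space_add L2_space_cmult approx_L2[OF f] approx_L2[OF g])
  fix \<epsilon> :: real assume e: "\<epsilon> > 0"
  define \<delta> where "\<delta> = \<epsilon> / (2 * (1 + cmod c))"
  have p: "1 + cmod c > 0" by (simp add: add_pos_nonneg)
  have d: "\<delta> > 0" using e p by (simp add: \<delta>_def)
  obtain f' where f': "f' \<in> trig q" "L2_norm M (\<lambda>u. f u - f' u) < \<epsilon> / 2"
    using e approxD[OF f, of "\<epsilon> / 2"] by auto
  obtain g' where g': "g' \<in> trig q" "L2_norm M (\<lambda>u. g u - g' u) < \<delta>"
    using approxD[OF g d] by auto
  have L: "(\<lambda>u. f u - f' u) \<in> L2_space M" "(\<lambda>u. g u - g' u) \<in> L2_space M"
    using approx_L2[OF f] approx_L2[OF g] trig_L2[OF q] f'(1) g'(1) by (auto intro: L2_space_diff)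
  have "L2_norm M (\<lambda>u. (f u - f' u) + c * (g u - g' u)) \<le> L2_norm M (\<lambda>u. f u - f' u) + cmod c * L2_norm M (\<lambda>u. g u - g' u)"
    using L2_norm_add[OF L(1) L2_space_cmult[OF L(2), of c]] by (simp only: L2_norm_cmult)
  also have "\<dots> < \<epsilon> / 2 + \<epsilon> / 2"
  proof (rule add_less_le_mono[OF f'(2)])
    have "cmod c * L2_norm M (\<lambda>u. g u - g' u) \<le> (1 + cmod c) * \<delta>"
      using g'(2) by (intro mult_mono) auto
    also have "\<dots> = \<epsilon> / 2" using p by (simp add: \<delta>_def field_simps)
    finally show "cmod c * L2_norm M (\<lambda>u. g u - g' u) \<le> \<epsilon> / 2" .
  qed
  finally show "\<exists>h\<in>trig q. L2_norm M (\<lambda>u. f u + c * g u - h u) < \<epsilon>"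
    by (intro bexI[of _ "\<lambda>u. f' u + c * g' u"] trig_add trig_cmult f' g') (simp add: algebra_simps)
qed

lemma approx_sum:
  assumes q: "q \<in> R" and f: "\<And>i. i \<in> J \<Longrightarrow> f i \<in> approx q"
  shows "(\<lambda>u. \<Sum>i\<in>J. c i * f i u) \<in> approx q"
  using f
proof (induction J rule: infinite_finite_induct)
  case (insert x F)
  then have "(\<lambda>u. (\<Sum>i\<in>F. c i * f i u) + c x * f x u) \<in> approx q"
    by (intro approx_add_cmult[OF q]) auto
  then show ?case using insert by (simp add: add.commute)
qed (auto intro: trig_approx[OF q trig.zero])

lemma L2_indicator:
  assumes "A \<in> sets M" "A \<subseteq> C q" "q \<in> R"
  shows "(\<lambda>u. indicator A u :: complex) \<in> L2_space M"
    and "(L2_norm M (\<lambda>u. indicator A u))\<^sup>2 = measure M A"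
proof -
  have "emeasure M A \<le> 1" using emeasure_mono[OF assms(2) C_sets[OF assms(3)]] C_measure[OF assms(3)] by simp
  then have fin: "emeasure M A < \<infinity>" by (auto simp: top.not_eq_extremum order.strict_trans1[OF _ ennreal_one_less_top])
  have s: "(cmod (indicator A u))\<^sup>2 = indicat_real A u" for u by (auto simp: indicator_def)
  show "(\<lambda>u. indicator A u :: complex) \<in> L2_space M"
    using assms(1) fin by (intro L2_spaceI) (auto simp: s)
  show "(L2_norm M (\<lambda>u. indicator A u))\<^sup>2 = measure M A"
    unfolding L2_norm_square s using sets.sets_into_space[OF assms(1)] assms(1) fin by (simp add: Int_absorb2)
qed

text \<open>Products of trigonometric polynomials are again such, so sets with a trigonometric
  indicator are stable under intersection; Dynkin's lemma extends approximability from them to the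
  generated sigma-algebra on the coset.\<close>

lemma indicator_approx:
  assumes q: "q \<in> R" and A: "A \<in> sets M"
  shows "(\<lambda>u. indicator (A \<inter> C q) u) \<in> approx q"
proof -
  define P where "P = {A. A \<subseteq> C q \<and> (\<lambda>u. indicator A u) \<in> trig q}"
  have PS: "P \<subseteq> Pow (C q)" by (auto simp: P_def)
  have stable: "Int_stable P"
  proof (rule Int_stableI)
    fix A B assume "A \<in> P" "B \<in> P"
    moreover have "(\<lambda>u. indicator (A \<inter> B) u :: complex) = (\<lambda>u. indicator A u * indicator B u)"
      by (rule ext) (rule indicator_inter_arith)
    ultimately show "A \<inter> B \<in> P" using trig_mult[OF q, of "\<lambda>u. indicator B u" "\<lambda>u. indicator A u"]
      by (simp add: P_def le_infI1)
  qed
  have CP: "C q \<in> P"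
  proof -
    have "(\<lambda>u. 1 * e (q, 0) u) = (\<lambda>u. indicator (C q) u)"
      using psi_zero C_subset[OF q] by (auto simp: e_def indicator_def fun_eq_iff)
    then show ?thesis using trig_e[OF R_zero, of 1 q] by (simp add: P_def)
  qed
  \<comment> \<open>The trace on \<open>C q\<close> of the generated sigma-algebra is generated by
    the traces of the level sets. A level set on a different coset has empty trace, and one on the
    same coset lies in \<open>P\<close>.\<close>
  let ?G = "{{u \<in> C q. \<psi> r u = w} | q r w. q \<in> R \<and> r \<in> R}"
  have "C q \<in> sigma_sets (space M) ?G" using generated C_sets[OF q] by blast
  moreover have "A \<inter> C q \<in> (\<inter>) (C q) ` sigma_sets (space M) ?G"
    using generated A by (auto simp: Int_commute)
  ultimately have "A \<inter> C q \<in> sigma_sets (C q) ((\<inter>) (C q) ` ?G)"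
    by (simp only: sigma_sets_Int[OF _ C_subset[OF q]])
  moreover have "(\<inter>) (C q) ` ?G \<subseteq> P"
  proof
    fix B assume "B \<in> (\<inter>) (C q) ` ?G"
    then obtain q' r w where B: "B = C q \<inter> {u \<in> C q'. \<psi> r u = w}" "q' \<in> R" "r \<in> R" by auto
    show "B \<in> P"
    proof (cases "q' - q \<in> \<int>")
      case True
      then obtain n where "q' - q = of_int n" by (auto elim: Ints_cases)
      then have "C q' = C q" using C_int[OF q, of n] by (simp add: algebra_simps)
      then have "B = {u \<in> C q. \<psi> r u = w}" using B by auto
      then show ?thesis using level_set_trig[OF q B(3)] by (auto simp: P_def)
    next
      case False
      then have "B = {}" using C_disj[OF B(2) q] by (auto simp: B(1))
      moreover have "(indicator {} :: 'h \<Rightarrow> complex) = (\<lambda>u. 0)" by (rule ext) simp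
      ultimately show ?thesis using trig.zero[of q] by (simp only: P_def mem_Collect_eq empty_subsetI simp_thms)
    qed
  qed
  ultimately have "A \<inter> C q \<in> sigma_sets (C q) P" by (rule set_mp[OF sigma_sets_mono', rotated])
  from stable PS this have "A \<inter> C q \<in> sets M \<and> (\<lambda>u. indicator (A \<inter> C q) u) \<in> approx q"
  proof (induction rule: sigma_sets_induct_disjoint)
    case (basic B)
    then have t: "(\<lambda>u. indicator B u) \<in> trig q" and B: "B \<subseteq> C q" by (auto simp: P_def)
    have "(\<lambda>u. indicator B u :: complex) \<in> borel_measurable M"
      using trig_L2[OF q t] by (rule L2_space_measurable)
    then have "{u \<in> space M. indicator B u = (1 :: complex)} \<in> sets M" by simp
    moreover have "{u \<in> space M. indicator B u = (1 :: complex)} = B"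
      using B C_subset[OF q] by (auto simp: indicator_def split: if_splits)
    ultimately show ?case using trig_approx[OF q t] by simp
  next
    case empty then show ?case using trig_approx[OF q trig.zero] by simp
  next
    case (compl B)
    then have B: "B \<subseteq> C q" using sigma_sets_into_sp[OF PS] by blast
    have "(\<lambda>u. indicator (C q) u + (-1) * indicator B u) \<in> approx q"
      using CP compl by (intro approx_add_cmult[OF q]) (auto simp: P_def intro: trig_approx[OF q])
    moreover have "(\<lambda>u. indicator (C q) u + (-1) * indicator B u :: complex) = (\<lambda>u. indicator (C q - B) u)"
      using B by (auto simp: indicator_def fun_eq_iff)
    ultimately show ?case using compl C_sets[OF q] by auto
  next
    case (union B)
    have Bs: "range B \<subseteq> sets M" using union by auto
    have BC: "(\<Union>i. B i) \<subseteq> C q" using union sigma_sets_into_sp[OF PS] by blast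
    have US: "(\<Union>i. B i) \<in> sets M" using Bs by auto
    let ?U = "\<lambda>n. \<Union>i<n. B i"
    have Un: "?U n \<in> sets M" for n using Bs by auto
    have "(\<lambda>u. indicator (\<Union>i. B i) u) \<in> approx q"
    proof (rule approx_limit[OF L2_indicator(1)[OF US BC q] q])
      fix \<epsilon> :: real assume "\<epsilon> > 0"
      have D: "(\<Union>i. B i) - ?U n \<in> sets M" for n using US Un by auto
      \<comment> \<open>The squared distance to the finite partial sum is the measure of the
        remaining union, which decreases to the empty set inside a coset of measure 1.\<close>
      have "(\<lambda>n. emeasure M ((\<Union>i. B i) - ?U n)) \<longlonglongrightarrow> emeasure M (\<Inter>n. (\<Union>i. B i) - ?U n)"
      proof (rule Lim_emeasure_decseq)
        show "range (\<lambda>n. (\<Union>i. B i) - ?U n) \<subseteq> sets M" using D by auto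
        show "decseq (\<lambda>n. (\<Union>i. B i) - ?U n)"
          unfolding decseq_def by (intro allI impI Diff_mono order_refl UN_mono) auto
        have "(\<Union>i. B i) - ?U n \<subseteq> C q" for n using BC by blast
        then show "emeasure M ((\<Union>i. B i) - ?U n) \<noteq> \<infinity>" for n
          using emeasure_mono[of "(\<Union>i. B i) - ?U n" "C q" M] C_sets[OF q] C_measure[OF q]
          by (auto simp: top_unique)
      qed
      also have "(\<Inter>n. (\<Union>i. B i) - ?U n) = {}"
      proof (rule equals0I)
        fix x assume x: "x \<in> (\<Inter>n. (\<Union>i. B i) - ?U n)"
        then obtain i where "x \<in> B i" by blast
        then have "x \<in> ?U (Suc i)" by blast
        then show False using x by blast
      qed
      finally have "(\<lambda>n. emeasure M ((\<Union>i. B i) - ?U n)) \<longlonglongrightarrow> 0" by simp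
      then have "eventually (\<lambda>n. emeasure M ((\<Union>i. B i) - ?U n) < ennreal (\<epsilon>\<^sup>2)) sequentially"
        using \<open>\<epsilon> > 0\<close> by (intro order_tendstoD(2)) auto
      then obtain n where n: "emeasure M ((\<Union>i. B i) - ?U n) < ennreal (\<epsilon>\<^sup>2)"
        by (auto dest: eventually_happens)
      have sA: "(\<lambda>u. \<Sum>i<n. 1 * indicator (B i) u) \<in> approx q" using union by (intro approx_sum[OF q]) auto
      have e: "(\<lambda>u. indicator (\<Union>i. B i) u - (\<Sum>i<n. 1 * indicator (B i) u) :: complex)
          = (\<lambda>u. indicator ((\<Union>i. B i) - ?U n) u)"
      proof
        fix u
        have "disjoint_family_on B {..<n}" using union(1) by (auto simp: disjoint_family_on_def)
        then have "(\<Sum>i<n. 1 * indicator (B i) u :: complex) = indicator (?U n) u"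
          by (simp add: indicator_UN_disjoint)
        then show "indicator (\<Union>i. B i) u - (\<Sum>i<n. 1 * indicator (B i) u) = (indicator ((\<Union>i. B i) - ?U n) u :: complex)"
          by (auto simp: indicator_def)
      qed
      have "L2_norm M (\<lambda>u. indicator ((\<Union>i. B i) - ?U n) u) < \<epsilon>"
      proof -
        define W where "W = (\<Union>i. B i) - ?U n"
        have W: "W \<in> sets M" "W \<subseteq> C q" "emeasure M W < ennreal (\<epsilon>\<^sup>2)"
          using D[of n] n subset_trans[OF Diff_subset BC] unfolding W_def by blast+
        have "emeasure M W = ennreal (measure M W)"
          using W(3) by (intro emeasure_eq_ennreal_measure) (rule less_imp_neq, erule order.strict_trans, rule ennreal_less_top)
        then have "measure M W < \<epsilon>\<^sup>2" using W(3) by (simp add: ennreal_less_iff)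
        then have "(L2_norm M (\<lambda>u. indicator W u))\<^sup>2 < \<epsilon>\<^sup>2"
          by (simp only: L2_indicator(2)[OF W(1,2) q])
        then show ?thesis unfolding W_def by (rule power2_less_imp_less) (rule less_imp_le[OF \<open>\<epsilon> > 0\<close>])
      qed
      then show "\<exists>g\<in>approx q. L2_norm M (\<lambda>u. indicator (\<Union>i. B i) u - g u) < \<epsilon>"
        unfolding e[symmetric] by (rule bexI[OF _ sA])
    qed
    then show ?case using US by simp
  qed
  then show ?thesis by simp
qed

lemma L2_coset_approx:
  assumes q: "q \<in> R" and f: "f \<in> L2_space M"
  shows "(\<lambda>u. indicator (C q) u * f u) \<in> approx q"
proof -
  have Cq[measurable]: "C q \<in> sets M" by (rule C_sets[OF q])
  have fm[measurable]: "f \<in> borel_measurable M" by (rule L2_space_measurable[OF f])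
  let ?f = "\<lambda>u. indicator (C q) u * f u"
  have fL: "?f \<in> L2_space M"
  proof (rule L2_spaceI)
    show "integrable M (\<lambda>t. (cmod (?f t))\<^sup>2)"
      by (rule Bochner_Integration.integrable_bound[OF L2_space_integrable[OF f]])
         (auto simp: indicator_def)
  qed measurable
  obtain F where F: "\<And>i. simple_function M (F i)" "\<And>x. x \<in> space M \<Longrightarrow> (\<lambda>i. F i x) \<longlonglongrightarrow> f x"
    "\<And>i x. x \<in> space M \<Longrightarrow> dist (F i x) 0 \<le> 2 * dist (f x) 0"
    using borel_measurable_implies_sequence_metric[OF fm, of 0] by blast
  have Fm[measurable]: "F i \<in> borel_measurable M" for i using F(1) by (rule borel_measurable_simple_function)
  let ?F = "\<lambda>i u. indicator (C q) u * F i u"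
  have FA: "?F i \<in> approx q" for i
  proof -
    let ?A = "\<lambda>c. (F i -` {c} \<inter> space M)"
    have fin: "finite (F i ` space M)" using F(1) by (simp add: simple_function_def)
    have "(\<lambda>u. \<Sum>c\<in>F i ` space M. c * indicator (?A c \<inter> C q) u) \<in> approx q"
      using F(1) by (intro approx_sum[OF q] indicator_approx[OF q]) (auto simp: simple_function_def)
    moreover have "(\<Sum>c\<in>F i ` space M. c * indicator (?A c \<inter> C q) u) = ?F i u" for u
    proof (cases "u \<in> C q")
      case True
      then have u: "u \<in> space M" using C_subset[OF q] by auto
      have "(\<Sum>c\<in>F i ` space M. c * indicator (?A c \<inter> C q) u) = (\<Sum>c\<in>F i ` space M. if c = F i u then c else 0)"
        using u True by (intro sum.cong) (auto simp: indicator_def)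
      then show ?thesis using fin u True by simp
    qed auto
    ultimately show ?thesis by simp
  qed
  show ?thesis
  proof (rule approx_limit[OF fL q])
    fix \<epsilon> :: real assume e: "\<epsilon> > 0"
    have "(\<lambda>i. LINT u|M. (cmod (?f u - ?F i u))\<^sup>2) \<longlonglongrightarrow> (LINT u|M. (0::real))"
    \<comment> \<open>Simple functions with \<open>cmod (F i u) \<le> 2 * cmod (f u)\<close> differ
      from \<open>f\<close> by at most \<open>3 * cmod (f u)\<close>, hence the 9.\<close>
    proof (rule integral_dominated_convergence[where w="\<lambda>u. 9 * (cmod (f u))\<^sup>2"])
      show "integrable M (\<lambda>u. 9 * (cmod (f u))\<^sup>2)" using L2_space_integrable[OF f] by simp
      show "AE u in M. (\<lambda>i. (cmod (?f u - ?F i u))\<^sup>2) \<longlonglongrightarrow> 0"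
      proof (rule AE_I2)
        fix u assume "u \<in> space M"
        then have "(\<lambda>i. (cmod (?f u - ?F i u))\<^sup>2) \<longlonglongrightarrow> (cmod (?f u - indicator (C q) u * f u))\<^sup>2"
          by (intro tendsto_intros F)
        then show "(\<lambda>i. (cmod (?f u - ?F i u))\<^sup>2) \<longlonglongrightarrow> 0" by simp
      qed
      show "AE u in M. norm ((cmod (?f u - ?F i u))\<^sup>2) \<le> 9 * (cmod (f u))\<^sup>2" for i
      proof (rule AE_I2)
        fix u assume "u \<in> space M"
        then have "cmod (F i u) \<le> 2 * cmod (f u)" using F(3)[of u i] by simp
        then have "cmod (f u - F i u) \<le> 3 * cmod (f u)" using norm_triangle_ineq4[of "f u" "F i u"] by linarith
        then have "(cmod (f u - F i u))\<^sup>2 \<le> (3 * cmod (f u))\<^sup>2" by (intro power_mono) auto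
        then show "norm ((cmod (?f u - ?F i u))\<^sup>2) \<le> 9 * (cmod (f u))\<^sup>2"
          by (auto simp: indicator_def power_mult_distrib)
      qed
    qed measurable
    then have "(\<lambda>i. L2_norm M (\<lambda>u. ?f u - ?F i u)) \<longlonglongrightarrow> 0" by (simp flip: L2_norm_square)
    then have "eventually (\<lambda>i. L2_norm M (\<lambda>u. ?f u - ?F i u) < \<epsilon>) sequentially"
      using e by (rule order_tendstoD(2))
    then obtain i where "L2_norm M (\<lambda>u. ?f u - ?F i u) < \<epsilon>" by (auto dest: eventually_happens)
    then show "\<exists>g\<in>approx q. L2_norm M (\<lambda>u. ?f u - g u) < \<epsilon>"
      by (rule bexI[where x="?F i", OF _ FA])
  qed
qed

end

section \<open>Sums as integrals over counting measure\<close>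

lemma nn_integral_count_space_times:
  fixes g :: "'i \<Rightarrow> 'j \<Rightarrow> ennreal"
  shows "(\<integral>\<^sup>+y. \<integral>\<^sup>+z. g y z \<partial>count_space B \<partial>count_space A) = (\<integral>\<^sup>+i. g (fst i) (snd i) \<partial>count_space (A \<times> B))"
proof -
  have "(\<integral>\<^sup>+y. \<integral>\<^sup>+z. g y z \<partial>count_space B \<partial>count_space A)
     = (\<integral>\<^sup>+y. \<integral>\<^sup>+z. (\<lambda>i. g (fst i) (snd i) * indicator (A \<times> B) i) (y, z) \<partial>count_space UNIV \<partial>count_space UNIV)"
  proof -
    have "(\<integral>\<^sup>+y. \<integral>\<^sup>+z. g y z \<partial>count_space B \<partial>count_space A)
       = (\<integral>\<^sup>+y. (\<integral>\<^sup>+z. g y z \<partial>count_space B) * indicator A y \<partial>count_space UNIV)"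
      by (rule nn_integral_count_space_indicator) simp
    moreover have "(\<integral>\<^sup>+z. g y z \<partial>count_space B) * indicator A y
       = (\<integral>\<^sup>+z. g y z * indicator (A \<times> B) (y, z) \<partial>count_space UNIV)" for y
      by (subst nn_integral_count_space_indicator) (auto simp: indicator_def intro!: nn_integral_cong)
    ultimately show ?thesis by simp
  qed
  also have "\<dots> = (\<integral>\<^sup>+i. g (fst i) (snd i) * indicator (A \<times> B) i \<partial>count_space UNIV)"
    by (rule nn_integral_fst_count_space)
  finally show ?thesis by (simp add: nn_integral_count_space_indicator)
qed

lemma nn_integral_count_space_split:
  fixes f :: "'i \<Rightarrow> ennreal"
  assumes "finite J" "J \<subseteq> I"
  shows "(\<integral>\<^sup>+i. f i \<partial>count_space I) = sum f J + (\<integral>\<^sup>+i. f i \<partial>count_space (I - J))"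
proof -
  have "(\<integral>\<^sup>+i. f i \<partial>count_space I) = (\<integral>\<^sup>+i. f i * indicator J i + f i * indicator (I - J) i \<partial>count_space I)"
    by (rule nn_integral_cong) (auto simp: indicator_def)
  also have "\<dots> = (\<integral>\<^sup>+i. f i * indicator J i \<partial>count_space I) + (\<integral>\<^sup>+i. f i * indicator (I - J) i \<partial>count_space I)"
    by (rule nn_integral_add) auto
  also have "(\<integral>\<^sup>+i. f i * indicator J i \<partial>count_space I) = (\<integral>\<^sup>+i. f i \<partial>count_space J)"
    using assms by (subst (1 2) nn_integral_count_space_indicator) (auto intro!: nn_integral_cong simp: indicator_def)
  also have "\<dots> = sum f J" by (rule nn_integral_count_space_finite[OF assms(1)])
  also have "(\<integral>\<^sup>+i. f i * indicator (I - J) i \<partial>count_space I) = (\<integral>\<^sup>+i. f i \<partial>count_space (I - J))"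
    using assms by (subst (1 2) nn_integral_count_space_indicator) (auto intro!: nn_integral_cong simp: indicator_def)
  finally show ?thesis .
qed

text \<open>Otherwise every finite sum would stay \<open>\<epsilon>\<close> below the finite total,
  and so would the total itself.\<close>

lemma nn_integral_count_space_tail:
  fixes f :: "'i \<Rightarrow> ennreal"
  assumes I: "countable I" and fin: "(\<integral>\<^sup>+i. f i \<partial>count_space I) < \<infinity>" and \<epsilon>: "\<epsilon> > (0::ennreal)"
  shows "\<exists>J. finite J \<and> J \<subseteq> I \<and> (\<integral>\<^sup>+i. f i \<partial>count_space (I - J)) \<le> \<epsilon>"
proof (rule ccontr)
  assume n: "\<not> ?thesis"
  let ?S = "\<integral>\<^sup>+i. f i \<partial>count_space I"
  have "?S \<le> ?S - \<epsilon>"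
  proof (rule nn_integral_count_space_le[OF I])
    fix J assume J: "finite J" "J \<subseteq> I"
    have "sum f J + \<epsilon> \<le> sum f J + (\<integral>\<^sup>+i. f i \<partial>count_space (I - J))"
      using n J by (intro add_left_mono) (auto simp: not_le less_imp_le)
    also have "\<dots> = ?S" by (rule nn_integral_count_space_split[OF J, symmetric])
    finally have a: "sum f J + \<epsilon> \<le> ?S" .
    then have "\<epsilon> \<noteq> \<infinity>" using fin by (auto simp: top_unique)
    then show "sum f J \<le> ?S - \<epsilon>"
      using ennreal_minus_mono[OF a order_refl[of \<epsilon>]] by simp
  qed
  moreover have "?S \<ge> \<epsilon>"
  proof -
    have "(\<integral>\<^sup>+i. f i \<partial>count_space (I - {})) > \<epsilon>" using n by (metis empty_subsetI finite.emptyI not_le)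
    then show ?thesis by simp
  qed
  ultimately have "?S - \<epsilon> + \<epsilon> \<le> ?S - \<epsilon>" by (simp add: diff_add_cancel_ennreal)
  moreover have "?S - \<epsilon> < \<infinity>" using fin by (meson diff_le_self_ennreal le_less_trans)
  ultimately show False using \<epsilon>
    by (metis add.right_neutral ennreal_add_left_cancel_le infinity_ennreal_def less_irrefl not_le)
qed

section \<open>Parseval's identity\<close>

context coset_characters
begin

text \<open>Bessel's inequality gives one direction. For the other, a nearby trigonometric
  polynomial is written over frequencies in \<open>Y\<close>, and the best approximation identity
  bounds the squared norm by the coefficients at these frequencies plus the squared error.\<close>

lemma coset_Parseval:
  assumes y: "y \<in> Y" and f: "f \<in> L2_space M"
  shows "L2_norm_sq M (\<lambda>u. indicator (C y) u * f u)
      = (\<integral>\<^sup>+z. ennreal ((cmod (L2_inner M f (e (y, z))))\<^sup>2) \<partial>count_space Y)"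
proof -
  let ?f = "\<lambda>u. indicator (C y) u * f u"
  let ?c = "\<lambda>z. L2_inner M ?f (e (y, z))"
  have yR: "y \<in> R" using y by (rule Y_R)
  have fa: "?f \<in> approx y" by (rule L2_coset_approx[OF yR f])
  note fL = approx_L2[OF fa]
  have c: "?c z = L2_inner M f (e (y, z))" for z
    unfolding L2_inner_def by (rule Bochner_Integration.integral_cong) (auto simp: e_def indicator_def)
  have on: "L2_inner M (e (y, z)) (e (y, z')) = (if z = z' then 1 else 0)" if "z \<in> Y" "z' \<in> Y" for z z'
    using e_orthonormal[of "(y, z)" "(y, z')"] y that by auto
  have eL: "e (y, z) \<in> L2_space M" if "z \<in> Y" for z by (rule e_L2[OF yR Y_R[OF that]])
  have best: "(L2_norm M (\<lambda>u. ?f u - (\<Sum>z\<in>J. a z * e (y, z) u)))\<^sup>2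
     = (L2_norm M ?f)\<^sup>2 - (\<Sum>z\<in>J. (cmod (?c z))\<^sup>2) + (\<Sum>z\<in>J. (cmod (a z - ?c z))\<^sup>2)"
    if J: "finite J" "J \<subseteq> Y" for J a
    by (rule L2_norm_diff_orthonormal_sum[OF J(1) eL on fL]) (use J in auto)
  \<comment> \<open>The integral part of a frequency only contributes a constant on the coset, so
    every frequency can be moved into \<open>Y\<close>.\<close>
  have trig_repr: "\<exists>J a. finite J \<and> J \<subseteq> Y \<and> (\<forall>u. g u = (\<Sum>z\<in>J. a z * e (y, z) u))" if "g \<in> trig y" for g
    using that
  proof (induction rule: trig.induct)
    case zero show ?case by (rule exI[of _ "{}"]) auto
  next
    case (add g r d)
    then obtain J a where J: "finite J" "J \<subseteq> Y" "\<And>u. g u = (\<Sum>z\<in>J. a z * e (y, z) u)" by auto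
    obtain v where v: "v \<in> C y" using C_nonempty[OF yR] by auto
    \<comment> \<open>\<open>frac r\<close> may already belong to \<open>J\<close>, hence the sum of
      two contributions.\<close>
    define b where "b z = (if z \<in> J then a z else 0) + (if z = frac r then d * \<psi> (of_int \<lfloor>r\<rfloor>) v else 0)" for z
    have er: "e (y, r) u = \<psi> (of_int \<lfloor>r\<rfloor>) v * e (y, frac r) u" for u
    proof (cases "u \<in> C y")
      case True
      have "\<psi> (of_int \<lfloor>r\<rfloor> + frac r) u = \<psi> (of_int \<lfloor>r\<rfloor>) u * \<psi> (frac r) u"
        using True C_subset[OF yR] add.hyps by (intro psi_add R_int R_frac) auto
      moreover have "of_int \<lfloor>r\<rfloor> + frac r = r" by (simp add: frac_def)
      ultimately show ?thesis using True psi_int[OF yR True v] by (simp add: e_def)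
    qed (simp add: e_def)
    let ?K = "insert (frac r) J"
    have "g u + d * e (y, r) u = (\<Sum>z\<in>?K. b z * e (y, z) u)" for u
    proof -
      have "(\<Sum>z\<in>?K. b z * e (y, z) u) = (\<Sum>z\<in>?K. (if z \<in> J then a z else 0) * e (y, z) u) +
          (\<Sum>z\<in>?K. (if z = frac r then d * \<psi> (of_int \<lfloor>r\<rfloor>) v * e (y, frac r) u else 0))"
        unfolding sum.distrib[symmetric] by (rule sum.cong) (auto simp: b_def algebra_simps)
      also have "(\<Sum>z\<in>?K. (if z \<in> J then a z else 0) * e (y, z) u) = (\<Sum>z\<in>J. a z * e (y, z) u)"
        using J(1) by (intro sum.mono_neutral_cong_right) auto
      also have "(\<Sum>z\<in>?K. (if z = frac r then d * \<psi> (of_int \<lfloor>r\<rfloor>) v * e (y, frac r) u else 0)) = d * e (y, r) u"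
        using J(1) by (subst sum.delta) (auto simp: er[of u])
      finally show ?thesis using J(3) by simp
    qed
    then show ?case using J frac_Y[OF add.hyps(2)] by (intro exI[of _ ?K] exI[of _ b]) auto
  qed
  have "(\<integral>\<^sup>+z. ennreal ((cmod (?c z))\<^sup>2) \<partial>count_space Y) \<le> L2_norm_sq M ?f"
  proof (rule nn_integral_count_space_le[OF countable_Y])
    fix J assume J: "finite J" "J \<subseteq> Y"
    have "(\<Sum>z\<in>J. (cmod (?c z))\<^sup>2) \<le> (L2_norm M ?f)\<^sup>2"
      using best[OF J, of ?c] zero_le_power2[of "L2_norm M (\<lambda>u. ?f u - (\<Sum>z\<in>J. ?c z * e (y, z) u))"] by simp
    then show "(\<Sum>z\<in>J. ennreal ((cmod (?c z))\<^sup>2)) \<le> L2_norm_sq M ?f"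
      by (simp add: L2_norm_sq_eq[OF fL] sum_ennreal ennreal_leI)
  qed
  moreover have "L2_norm_sq M ?f \<le> (\<integral>\<^sup>+z. ennreal ((cmod (?c z))\<^sup>2) \<partial>count_space Y)"
  proof (rule ennreal_le_epsilon)
    fix \<epsilon> :: real assume e: "0 < \<epsilon>"
    obtain g where g: "g \<in> trig y" "L2_norm M (\<lambda>u. ?f u - g u) < sqrt \<epsilon>"
      using approxD[OF fa, of "sqrt \<epsilon>"] e by auto
    obtain J a where J: "finite J" "J \<subseteq> Y" and ga: "\<And>u. g u = (\<Sum>z\<in>J. a z * e (y, z) u)"
      using trig_repr[OF g(1)] by blast
    have "(L2_norm M (\<lambda>u. ?f u - g u))\<^sup>2 < (sqrt \<epsilon>)\<^sup>2" using g(2) by (intro power_strict_mono) auto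
    then have "(L2_norm M (\<lambda>u. ?f u - g u))\<^sup>2 < \<epsilon>" using e by simp
    moreover have "(\<Sum>z\<in>J. (cmod (a z - ?c z))\<^sup>2) \<ge> 0" by (intro sum_nonneg) auto
    ultimately have "(L2_norm M ?f)\<^sup>2 \<le> (\<Sum>z\<in>J. (cmod (?c z))\<^sup>2) + \<epsilon>"
      using best[OF J, of a] by (simp add: ga)
    then have "L2_norm_sq M ?f \<le> ennreal ((\<Sum>z\<in>J. (cmod (?c z))\<^sup>2) + \<epsilon>)"
      by (simp add: L2_norm_sq_eq[OF fL] ennreal_leI)
    also have "\<dots> = (\<Sum>z\<in>J. ennreal ((cmod (?c z))\<^sup>2)) + ennreal \<epsilon>"
      using e by (simp add: ennreal_plus sum_nonneg sum_ennreal)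
    also have "\<dots> \<le> (\<integral>\<^sup>+z. ennreal ((cmod (?c z))\<^sup>2) \<partial>count_space Y) + ennreal \<epsilon>"
      by (rule add_right_mono[OF sum_le_nn_integral_count_space[OF J]])
    finally show "L2_norm_sq M ?f \<le> (\<integral>\<^sup>+z. ennreal ((cmod (?c z))\<^sup>2) \<partial>count_space Y) + ennreal \<epsilon>" .
  qed
  ultimately show ?thesis unfolding c by (rule antisym[rotated])
qed

lemma unique_coset:
  assumes "u \<in> space M" shows "\<exists>!y. y \<in> Y \<and> u \<in> C y"
proof -
  obtain q where q: "q \<in> R" "u \<in> C q" using assms C_cover by auto
  have "C (frac q) = C q" using C_int[OF q(1), of "- \<lfloor>q\<rfloor>"] by (simp add: frac_def)
  then have 1: "frac q \<in> Y \<and> u \<in> C (frac q)" using q frac_Y by auto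
  show ?thesis
  proof (rule ex1I[of _ "frac q"], rule 1)
    fix y assume y: "y \<in> Y \<and> u \<in> C y"
    have "y - frac q \<in> \<int>" using y 1 by (intro C_disj[of y "frac q" u] Y_R) auto
    then show "y = frac q" using y 1 by (intro Y_unique) auto
  qed
qed

text \<open>Every point lies in exactly one coset with index in \<open>Y\<close>, so Tonelli makes
  the squared norm the sum of its parts over the cosets.\<close>

lemma Parseval:
  assumes f: "f \<in> L2_space M"
  shows "L2_norm_sq M f = (\<integral>\<^sup>+i. ennreal ((cmod (L2_inner M f (e i)))\<^sup>2) \<partial>count_space (Y \<times> Y))"
proof -
  have [measurable]: "f \<in> borel_measurable M" by (rule L2_space_measurable[OF f])
  have Cm: "C y \<in> sets M" if "y \<in> Y" for y by (rule C_sets[OF Y_R[OF that]])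
  have "L2_norm_sq M f = (\<integral>\<^sup>+u. \<integral>\<^sup>+y. ennreal ((cmod (indicator (C y) u * f u))\<^sup>2) \<partial>count_space Y \<partial>M)"
    unfolding L2_norm_sq_def
  proof (rule nn_integral_cong)
    fix u assume "u \<in> space M"
    from unique_coset[OF this] obtain y where y: "y \<in> Y \<and> u \<in> C y" and uy: "\<forall>z. z \<in> Y \<and> u \<in> C z \<longrightarrow> z = y"
      by (rule ex1E) (rule that)
    have "(\<integral>\<^sup>+z. ennreal ((cmod (indicator (C z) u * f u))\<^sup>2) \<partial>count_space Y)
        = (\<integral>\<^sup>+z. ennreal ((cmod (f u))\<^sup>2) * indicator {y} z \<partial>count_space Y)"
    proof (rule nn_integral_cong)
      fix z assume "z \<in> space (count_space Y)"
      then have "z \<in> Y" by simp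
      then have "u \<in> C z \<longleftrightarrow> z = y" using y uy by blast
      then show "ennreal ((cmod (indicator (C z) u * f u))\<^sup>2) = ennreal ((cmod (f u))\<^sup>2) * indicator {y} z"
        by (cases "z = y") auto
    qed
    also have "\<dots> = ennreal ((cmod (f u))\<^sup>2)"
      using y by (subst nn_integral_cmult_indicator) auto
    finally show "ennreal ((cmod (f u))\<^sup>2) = (\<integral>\<^sup>+z. ennreal ((cmod (indicator (C z) u * f u))\<^sup>2) \<partial>count_space Y)" ..
  qed
  also have "\<dots> = (\<integral>\<^sup>+y. L2_norm_sq M (\<lambda>u. indicator (C y) u * f u) \<partial>count_space Y)"
    unfolding L2_norm_sq_def
  proof (rule nn_integral_count_space_nn_integral[OF countable_Y])
    fix y assume "y \<in> Y"
    then have [measurable]: "C y \<in> sets M" by (rule Cm)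
    show "(\<lambda>u. ennreal ((cmod (indicator (C y) u * f u))\<^sup>2)) \<in> borel_measurable M" by measurable
  qed
  also have "\<dots> = (\<integral>\<^sup>+y. \<integral>\<^sup>+z. ennreal ((cmod (L2_inner M f (e (y, z))))\<^sup>2) \<partial>count_space Y \<partial>count_space Y)"
    by (rule nn_integral_cong) (simp add: coset_Parseval[OF _ f])
  also have "\<dots> = (\<integral>\<^sup>+i. ennreal ((cmod (L2_inner M f (e i)))\<^sup>2) \<partial>count_space (Y \<times> Y))"
    by (subst nn_integral_count_space_times) simp
  finally show ?thesis .
qed

section \<open>Coefficient functions on the product with the line\<close>

abbreviation RM :: "(real \<times> 'h) measure" where "RM \<equiv> lborel \<Otimes>\<^sub>M M"

text \<open>The coefficient of \<open>f\<close> along the basis function \<open>e i\<close>, as a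
  function of the real variable. Slices of \<open>f\<close> are square integrable for almost every
  \<open>t\<close>, so additivity of \<open>comp\<close> in \<open>f\<close> is available almost
  everywhere.\<close>

definition comp :: "(real \<times> 'h \<Rightarrow> complex) \<Rightarrow> rat \<times> rat \<Rightarrow> real \<Rightarrow> complex" where
  "comp f i t = L2_inner M (\<lambda>u. f (t, u)) (e i)"

lemma pair_sf: "pair_sigma_finite lborel M"
  by (intro pair_sigma_finite.intro sigma_finite lborel.sigma_finite_measure_axioms)

lemma slice_L2:
  assumes f: "f \<in> L2_space RM"
  shows "AE t in lborel. (\<lambda>u. f (t, u)) \<in> L2_space M"
proof -
  interpret sigma_finite_measure M by (rule sigma_finite)
  have [measurable]: "f \<in> borel_measurable RM" by (rule L2_space_measurable[OF f])
  have "(\<integral>\<^sup>+t. L2_norm_sq M (\<lambda>u. f (t, u)) \<partial>lborel) = L2_norm_sq RM f"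
    unfolding L2_norm_sq_def by (rule nn_integral_fst) measurable
  then have "(\<integral>\<^sup>+t. L2_norm_sq M (\<lambda>u. f (t, u)) \<partial>lborel) \<noteq> \<infinity>" using f by (simp add: L2_space_def)
  moreover have "(\<lambda>t. L2_norm_sq M (\<lambda>u. f (t, u))) \<in> borel_measurable lborel"
    unfolding L2_norm_sq_def by measurable
  ultimately have "AE t in lborel. L2_norm_sq M (\<lambda>u. f (t, u)) \<noteq> \<infinity>"
    by (intro nn_integral_noteq_infinite)
  then show ?thesis
    by eventually_elim (auto simp: L2_space_def top.not_eq_extremum)
qed

lemma comp_measurable:
  assumes [measurable]: "f \<in> borel_measurable RM" and i: "i \<in> R \<times> R"
  shows "comp f i \<in> borel_measurable lborel"
proof -
  interpret sigma_finite_measure M by (rule sigma_finite)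
  have em[measurable]: "e i \<in> borel_measurable M" using e_measurable i by auto
  have [measurable]: "(\<lambda>u. cnj (e i u)) \<in> borel_measurable M"
    by (rule measurable_compose[OF em]) (auto intro!: borel_measurable_continuous_onI continuous_intros)
  have "(\<lambda>t. LINT u|M. f (t, u) * cnj (e i u)) \<in> borel_measurable lborel"
    by (rule borel_measurable_lebesgue_integral) measurable
  then show ?thesis by (simp add: comp_def[abs_def] L2_inner_def)
qed

text \<open>Parseval's identity on almost every slice, then Tonelli.\<close>

lemma product_Parseval:
  assumes f: "f \<in> L2_space RM"
  shows "L2_norm_sq RM f = (\<integral>\<^sup>+i. L2_norm_sq lborel (comp f i) \<partial>count_space (Y \<times> Y))"
proof -
  interpret sigma_finite_measure M by (rule sigma_finite)
  have fm[measurable]: "f \<in> borel_measurable RM" by (rule L2_space_measurable[OF f])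
  have "L2_norm_sq RM f = (\<integral>\<^sup>+t. L2_norm_sq M (\<lambda>u. f (t, u)) \<partial>lborel)"
    unfolding L2_norm_sq_def by (rule nn_integral_fst[symmetric]) measurable
  also have "\<dots> = (\<integral>\<^sup>+t. \<integral>\<^sup>+i. ennreal ((cmod (comp f i t))\<^sup>2) \<partial>count_space (Y \<times> Y) \<partial>lborel)"
    by (rule nn_integral_cong_AE, use slice_L2[OF f] in eventually_elim) (simp add: Parseval comp_def)
  also have "\<dots> = (\<integral>\<^sup>+i. L2_norm_sq lborel (comp f i) \<partial>count_space (Y \<times> Y))"
    unfolding L2_norm_sq_def
  proof (rule nn_integral_count_space_nn_integral)
    fix i assume "i \<in> Y \<times> Y"
    then have [measurable]: "comp f i \<in> borel_measurable lborel"
      using Y_R by (intro comp_measurable[OF fm]) auto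
    show "(\<lambda>t. ennreal ((cmod (comp f i t))\<^sup>2)) \<in> borel_measurable lborel" by measurable
  qed (use countable_Y in auto)
  finally show ?thesis .
qed

lemma comp_L2:
  assumes f: "f \<in> L2_space RM" and i: "i \<in> Y \<times> Y"
  shows "comp f i \<in> L2_space lborel"
proof -
  have "L2_norm_sq lborel (comp f i) = (\<Sum>j\<in>{i}. L2_norm_sq lborel (comp f j))" by simp
  also have "\<dots> \<le> (\<integral>\<^sup>+i. L2_norm_sq lborel (comp f i) \<partial>count_space (Y \<times> Y))"
    using i by (intro sum_le_nn_integral_count_space) auto
  also have "\<dots> = L2_norm_sq RM f" by (rule product_Parseval[OF f, symmetric])
  also have "\<dots> < \<infinity>" using f by (simp add: L2_space_def)
  finally have "L2_norm_sq lborel (comp f i) < \<infinity>" .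
  moreover have "comp f i \<in> borel_measurable lborel"
    using Y_R i by (intro comp_measurable[OF L2_space_measurable[OF f]]) auto
  ultimately show ?thesis by (simp add: L2_space_def)
qed

definition tensor :: "(real \<Rightarrow> complex) \<Rightarrow> rat \<times> rat \<Rightarrow> real \<times> 'h \<Rightarrow> complex" where
  "tensor \<phi> i = (\<lambda>(t, u). \<phi> t * e i u)"

lemma tensor_L2:
  assumes \<phi>: "\<phi> \<in> L2_space lborel" and i: "i \<in> R \<times> R"
  shows "tensor \<phi> i \<in> L2_space RM"
proof -
  interpret sigma_finite_measure M by (rule sigma_finite)
  have [measurable]: "\<phi> \<in> borel_measurable borel" "e i \<in> borel_measurable M"
    using L2_space_measurable[OF \<phi>] e_measurable i by auto
  have e: "e i \<in> L2_space M" using e_L2 i by auto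
  have m: "tensor \<phi> i \<in> borel_measurable RM" unfolding tensor_def by measurable
  have "L2_norm_sq RM (tensor \<phi> i) = (\<integral>\<^sup>+t. \<integral>\<^sup>+u. ennreal ((cmod (\<phi> t))\<^sup>2) * ennreal ((cmod (e i u))\<^sup>2) \<partial>M \<partial>lborel)"
    unfolding L2_norm_sq_def using m
    by (subst nn_integral_fst[symmetric]) (auto simp: tensor_def norm_mult power_mult_distrib ennreal_mult)
  also have "\<dots> = L2_norm_sq lborel \<phi> * L2_norm_sq M (e i)"
    unfolding L2_norm_sq_def by (simp add: nn_integral_cmult nn_integral_multc)
  also have "\<dots> < \<infinity>" using \<phi> e by (simp add: L2_space_def ennreal_mult_less_top)
  finally show ?thesis using m by (simp add: L2_space_def)
qed

lemma comp_tensor: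
  assumes "i \<in> Y \<times> Y" "j \<in> Y \<times> Y"
  shows "comp (tensor \<phi> i) j t = (if i = j then \<phi> t else 0)"
  unfolding comp_def tensor_def prod.case L2_inner_cmult_left using e_orthonormal[OF assms] by simp

lemma inner_tensor:
  assumes f: "f \<in> L2_space RM" and \<phi>: "\<phi> \<in> L2_space lborel" and i: "i \<in> R \<times> R"
  shows "L2_inner RM f (tensor \<phi> i) = L2_inner lborel (comp f i) \<phi>"
proof -
  interpret pair_sigma_finite lborel M by (rule pair_sf)
  have I: "integrable RM (\<lambda>x. f x * cnj (tensor \<phi> i x))"
    by (rule L2_inner_integrable[OF f tensor_L2[OF \<phi> i]])
  have "L2_inner RM f (tensor \<phi> i) = (LINT t|lborel. LINT u|M. f (t, u) * cnj (tensor \<phi> i (t, u)))"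
    unfolding L2_inner_def by (rule integral_fst'[OF I, symmetric])
  also have "\<dots> = L2_inner lborel (comp f i) \<phi>"
    unfolding L2_inner_def comp_def
  proof (rule Bochner_Integration.integral_cong[OF refl])
    fix t
    have "(LINT u|M. f (t, u) * cnj (tensor \<phi> i (t, u))) = (LINT u|M. (f (t, u) * cnj (e i u)) * cnj (\<phi> t))"
      by (rule Bochner_Integration.integral_cong) (auto simp: tensor_def)
    then show "(LINT u|M. f (t, u) * cnj (tensor \<phi> i (t, u))) = (LINT u|M. f (t, u) * cnj (e i u)) * cnj (\<phi> t)"
      by simp
  qed
  finally show ?thesis .
qed

end

section \<open>Frame expansions on a product with the real line\<close>

lemma eventually_finite_subsetsE:
  assumes "eventually P (finite_subsets_at_top A)"
  obtains X where "finite X" "X \<subseteq> A" "\<And>F. finite F \<Longrightarrow> X \<subseteq> F \<Longrightarrow> F \<subseteq> A \<Longrightarrow> P F"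
  using assms unfolding eventually_finite_subsets_at_top
  by (elim exE conjE) (rule that, assumption+, elim allE impE, intro conjI, assumption+)

definition real_tf :: "real \<Rightarrow> real \<Rightarrow> (real \<Rightarrow> complex) \<Rightarrow> real \<Rightarrow> complex" where
  "real_tf a b \<phi> t = cis (2 * pi * b * t) * \<phi> (t - a)"

text \<open>Inverse and adjoint of the unitary \<open>real_tf a b\<close>. It differs from
  \<open>real_tf (- a) (- b)\<close> by a phase.\<close>

definition real_tf_inv :: "real \<Rightarrow> real \<Rightarrow> (real \<Rightarrow> complex) \<Rightarrow> real \<Rightarrow> complex" where
  "real_tf_inv a b \<phi> t = cis (- (2 * pi * b * (t + a))) * \<phi> (t + a)"

lemma L2_norm_sq_shift:
  assumes [measurable]: "\<phi> \<in> borel_measurable borel"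
  shows "L2_norm_sq lborel (real_tf a b \<phi>) = L2_norm_sq lborel \<phi>"
    and "L2_norm_sq lborel (real_tf_inv a b \<phi>) = L2_norm_sq lborel \<phi>"
  using nn_integral_real_affine[of "\<lambda>t. ennreal ((cmod (\<phi> t))\<^sup>2)" 1 "- a"]
    nn_integral_real_affine[of "\<lambda>t. ennreal ((cmod (\<phi> t))\<^sup>2)" 1 a]
  by (simp_all add: L2_norm_sq_def real_tf_def real_tf_inv_def norm_mult algebra_simps)

lemma shift_L2:
  assumes "\<phi> \<in> L2_space lborel"
  shows "real_tf a b \<phi> \<in> L2_space lborel" and "real_tf_inv a b \<phi> \<in> L2_space lborel"
proof -
  have [measurable]: "\<phi> \<in> borel_measurable borel" using L2_space_measurable[OF assms] by simp
  have [measurable]: "real_tf a b \<phi> \<in> borel_measurable borel" unfolding real_tf_def[abs_def] by measurable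
  have [measurable]: "real_tf_inv a b \<phi> \<in> borel_measurable borel" unfolding real_tf_inv_def[abs_def] by measurable
  show "real_tf a b \<phi> \<in> L2_space lborel" "real_tf_inv a b \<phi> \<in> L2_space lborel"
    using assms by (auto simp: L2_space_def L2_norm_sq_shift)
qed

lemma shift_unshift: "real_tf a b (real_tf_inv a b \<phi>) = \<phi>"
  by (rule ext) (simp add: real_tf_def real_tf_inv_def cis_mult flip: mult.assoc)

lemma L2_inner_shift: "L2_inner lborel \<phi> (real_tf a b \<theta>) = L2_inner lborel (real_tf_inv a b \<phi>) \<theta>"
proof -
  have "L2_inner lborel \<phi> (real_tf a b \<theta>) = (LINT t|lborel. \<phi> (a + 1 * t) * cnj (real_tf a b \<theta> (a + 1 * t)))"
    unfolding L2_inner_def using lborel_integral_real_affine[of 1 "\<lambda>t. \<phi> t * cnj (real_tf a b \<theta> t)" a] by simp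
  also have "\<dots> = L2_inner lborel (real_tf_inv a b \<phi>) \<theta>"
    unfolding L2_inner_def
    by (rule Bochner_Integration.integral_cong) (auto simp: real_tf_def real_tf_inv_def cis_cnj add.commute)
  finally show ?thesis .
qed

text \<open>Modulations and translations commute up to a phase. The phase does not depend on
  \<open>t\<close>, which lets it cancel between a coefficient and its vector.\<close>

lemma shift_shift: "real_tf (a + a') (b + b') \<phi> = (\<lambda>t. cis (2 * pi * b' * a) * real_tf a b (real_tf a' b' \<phi>) t)"
proof
  fix t
  have "cis (2 * pi * (b + b') * t) = cis (2 * pi * b' * a) * (cis (2 * pi * b * t) * cis (2 * pi * b' * (t - a)))"
    by (simp add: cis_mult algebra_simps)
  then show "real_tf (a + a') (b + b') \<phi> t = cis (2 * pi * b' * a) * real_tf a b (real_tf a' b' \<phi>) t"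
    by (simp add: real_tf_def algebra_simps)
qed

definition frame_sum ::
  "real \<Rightarrow> real \<Rightarrow> (real \<Rightarrow> complex) \<Rightarrow> (real \<Rightarrow> complex) \<Rightarrow> (rat \<times> rat) set \<Rightarrow> (real \<Rightarrow> complex) \<Rightarrow> real \<Rightarrow> complex"
  where "frame_sum \<alpha> \<beta> g h F \<phi> t =
    (\<Sum>k\<in>F. L2_inner lborel \<phi> (real_tf (\<alpha> * of_rat (fst k)) (\<beta> * of_rat (snd k)) g) *
       real_tf (\<alpha> * of_rat (fst k)) (\<beta> * of_rat (snd k)) h t)"

lemma frame_sum_L2: "h \<in> L2_space lborel \<Longrightarrow> frame_sum \<alpha> \<beta> g h F \<phi> \<in> L2_space lborel"
  unfolding frame_sum_def[abs_def] by (intro L2_space_sum L2_space_cmult shift_L2)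

text \<open>Conjugation by the shift at \<open>(y, z)\<close> carries the frame sum over
  \<open>G\<close> to that over the translate of \<open>G\<close>; with \<open>G\<close> integral
  this covers every class of lattice indices modulo the integers.\<close>

lemma frame_sum_translate:
  "frame_sum \<alpha> \<beta> g h ((\<lambda>k. (y + fst k, z + snd k)) ` G) \<phi>
     = real_tf (\<alpha> * of_rat y) (\<beta> * of_rat z) (frame_sum \<alpha> \<beta> g h G (real_tf_inv (\<alpha> * of_rat y) (\<beta> * of_rat z) \<phi>))"
proof
  fix t
  let ?a = "\<alpha> * of_rat y" and ?b = "\<beta> * of_rat z"
  let ?s = "\<lambda>k. real_tf (\<alpha> * of_rat (fst k)) (\<beta> * of_rat (snd k))"
  have inj: "inj_on (\<lambda>k. (y + fst k, z + snd k)) G" by (auto simp: inj_on_def prod_eq_iff)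
  have "frame_sum \<alpha> \<beta> g h ((\<lambda>k. (y + fst k, z + snd k)) ` G) \<phi> t =
    (\<Sum>k\<in>G. L2_inner lborel \<phi> (real_tf (?a + \<alpha> * of_rat (fst k)) (?b + \<beta> * of_rat (snd k)) g) *
       real_tf (?a + \<alpha> * of_rat (fst k)) (?b + \<beta> * of_rat (snd k)) h t)"
    unfolding frame_sum_def by (subst sum.reindex[OF inj]) (simp add: of_rat_add distrib_left)
  also have "\<dots> = (\<Sum>k\<in>G. L2_inner lborel (real_tf_inv ?a ?b \<phi>) (?s k g) * real_tf ?a ?b (?s k h) t)"
  proof (rule sum.cong[OF refl])
    fix k :: "rat \<times> rat"
    let ?c = "cis (2 * pi * (\<beta> * of_rat (snd k)) * ?a)"
    have "cnj ?c * ?c = 1" by (simp add: cis_cnj cis_mult)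
    moreover have "(cnj ?c * A) * (?c * B) = (cnj ?c * ?c) * (A * B)" for A B by (simp only: mult_ac)
    ultimately have c: "(cnj ?c * A) * (?c * B) = A * B" for A B by (simp only: mult_1)
    show "L2_inner lborel \<phi> (real_tf (?a + \<alpha> * of_rat (fst k)) (?b + \<beta> * of_rat (snd k)) g) *
       real_tf (?a + \<alpha> * of_rat (fst k)) (?b + \<beta> * of_rat (snd k)) h t
      = L2_inner lborel (real_tf_inv ?a ?b \<phi>) (?s k g) * real_tf ?a ?b (?s k h) t"
      unfolding shift_shift L2_inner_cmult_right c L2_inner_shift ..
  qed
  also have "\<dots> = real_tf ?a ?b (frame_sum \<alpha> \<beta> g h G (real_tf_inv ?a ?b \<phi>)) t"
    by (simp add: frame_sum_def real_tf_def sum_distrib_left mult_ac)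
  finally show "frame_sum \<alpha> \<beta> g h ((\<lambda>k. (y + fst k, z + snd k)) ` G) \<phi> t
     = real_tf ?a ?b (frame_sum \<alpha> \<beta> g h G (real_tf_inv ?a ?b \<phi>)) t" .
qed

text \<open>\<open>\<phi>\<close> is the shift of its own inverse shift, so the whole error is a
  shift of the error over \<open>G\<close>, and shifts are isometries.\<close>

lemma frame_error_translate:
  assumes \<phi>: "\<phi> \<in> L2_space lborel" and h: "h \<in> L2_space lborel"
  shows "L2_norm_sq lborel (\<lambda>t. \<phi> t - frame_sum \<alpha> \<beta> g h ((\<lambda>k. (y + fst k, z + snd k)) ` G) \<phi> t)
    = L2_norm_sq lborel (\<lambda>t. real_tf_inv (\<alpha> * of_rat y) (\<beta> * of_rat z) \<phi> t -
        frame_sum \<alpha> \<beta> g h G (real_tf_inv (\<alpha> * of_rat y) (\<beta> * of_rat z) \<phi>) t)"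
proof -
  let ?a = "\<alpha> * of_rat y" and ?b = "\<beta> * of_rat z"
  let ?d = "\<lambda>t. real_tf_inv ?a ?b \<phi> t - frame_sum \<alpha> \<beta> g h G (real_tf_inv ?a ?b \<phi>) t"
  have "(\<lambda>t. \<phi> t - frame_sum \<alpha> \<beta> g h ((\<lambda>k. (y + fst k, z + snd k)) ` G) \<phi> t) = real_tf ?a ?b ?d"
  proof
    fix t
    have "\<phi> t = real_tf ?a ?b (real_tf_inv ?a ?b \<phi>) t" by (simp add: shift_unshift)
    then show "\<phi> t - frame_sum \<alpha> \<beta> g h ((\<lambda>k. (y + fst k, z + snd k)) ` G) \<phi> t = real_tf ?a ?b ?d t"
      unfolding frame_sum_translate by (simp add: real_tf_def right_diff_distrib)
  qed
  moreover have "?d \<in> L2_space lborel" by (intro L2_space_diff shift_L2 frame_sum_L2 \<phi> h)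
  then have "?d \<in> borel_measurable borel" using L2_space_measurable by fastforce
  ultimately show ?thesis by (simp add: L2_norm_sq_shift)
qed

text \<open>For a fixed function convergence of the net bounds all finite partial sums, including
  those far from the limit, and the uniform boundedness principle makes the bound proportional to
  the norm.\<close>

lemma frame_sum_bounded:
  assumes g: "g \<in> L2_space lborel" and h: "h \<in> L2_space lborel"
    and conv: "\<And>\<phi>. \<phi> \<in> L2_space lborel \<Longrightarrow>
      ((\<lambda>G. L2_norm_sq lborel (\<lambda>t. \<phi> t - frame_sum \<alpha> \<beta> g h G \<phi> t)) \<longlongrightarrow> 0) (finite_subsets_at_top I)"
  shows "\<exists>C\<ge>0. \<forall>G\<in>{G. finite G \<and> G \<subseteq> I}. \<forall>\<phi>\<in>L2_space lborel.
     L2_norm lborel (frame_sum \<alpha> \<beta> g h G \<phi>) \<le> C * L2_norm lborel \<phi>"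
proof (rule L2_uniform_boundedness[where P="\<lambda>G \<phi>. L2_norm lborel (frame_sum \<alpha> \<beta> g h G \<phi>)"])
  let ?s = "\<lambda>k. real_tf (\<alpha> * of_rat (fst k)) (\<beta> * of_rat (snd k))"
  fix G and \<phi> \<theta> :: "real \<Rightarrow> complex" assume G: "G \<in> {G. finite G \<and> G \<subseteq> I}" and \<phi>: "\<phi> \<in> L2_space lborel" and \<theta>: "\<theta> \<in> L2_space lborel"
  have "frame_sum \<alpha> \<beta> g h G (\<lambda>x. \<phi> x + \<theta> x) = (\<lambda>t. frame_sum \<alpha> \<beta> g h G \<phi> t + frame_sum \<alpha> \<beta> g h G \<theta> t)"
    unfolding frame_sum_def[abs_def]
    by (simp add: L2_inner_add_left[OF \<phi> \<theta> shift_L2(1)[OF g]] sum.distrib distrib_right)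
  then show "L2_norm lborel (frame_sum \<alpha> \<beta> g h G (\<lambda>x. \<phi> x + \<theta> x)) \<le>
      L2_norm lborel (frame_sum \<alpha> \<beta> g h G \<phi>) + L2_norm lborel (frame_sum \<alpha> \<beta> g h G \<theta>)"
    using L2_norm_add[OF frame_sum_L2[OF h] frame_sum_L2[OF h]] by simp
next
  fix G c and \<phi> :: "real \<Rightarrow> complex" assume "G \<in> {G. finite G \<and> G \<subseteq> I}" and \<phi>: "\<phi> \<in> L2_space lborel"
  have "frame_sum \<alpha> \<beta> g h G (\<lambda>x. c * \<phi> x) = (\<lambda>t. c * frame_sum \<alpha> \<beta> g h G \<phi> t)"
    unfolding frame_sum_def[abs_def] by (simp add: L2_inner_cmult_left sum_distrib_left mult.assoc)
  then show "L2_norm lborel (frame_sum \<alpha> \<beta> g h G (\<lambda>x. c * \<phi> x)) = cmod c * L2_norm lborel (frame_sum \<alpha> \<beta> g h G \<phi>)"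
    by (simp add: L2_norm_cmult)
next
  let ?s = "\<lambda>k. real_tf (\<alpha> * of_rat (fst k)) (\<beta> * of_rat (snd k))"
  fix G assume "G \<in> {G. finite G \<and> G \<subseteq> I}"
  show "\<exists>B. \<forall>\<phi>\<in>L2_space lborel. L2_norm lborel (frame_sum \<alpha> \<beta> g h G \<phi>) \<le> B * L2_norm lborel \<phi>"
  proof (intro exI ballI)
    fix \<phi> :: "real \<Rightarrow> complex" assume \<phi>: "\<phi> \<in> L2_space lborel"
    have "L2_norm lborel (frame_sum \<alpha> \<beta> g h G \<phi>) \<le> (\<Sum>k\<in>G. L2_norm lborel (\<lambda>t. L2_inner lborel \<phi> (?s k g) * ?s k h t))"
      unfolding frame_sum_def[abs_def] by (intro L2_norm_sum L2_space_cmult shift_L2 h)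
    also have "\<dots> \<le> (\<Sum>k\<in>G. (L2_norm lborel (?s k g) * L2_norm lborel (?s k h)) * L2_norm lborel \<phi>)"
    proof (rule sum_mono)
      fix k
      have "cmod (L2_inner lborel \<phi> (?s k g)) * L2_norm lborel (?s k h) \<le> (L2_norm lborel \<phi> * L2_norm lborel (?s k g)) * L2_norm lborel (?s k h)"
        by (rule mult_right_mono[OF L2_Cauchy_Schwarz[OF \<phi> shift_L2(1)[OF g]]]) simp
      then show "L2_norm lborel (\<lambda>t. L2_inner lborel \<phi> (?s k g) * ?s k h t) \<le> (L2_norm lborel (?s k g) * L2_norm lborel (?s k h)) * L2_norm lborel \<phi>"
        unfolding L2_norm_cmult by (simp add: mult_ac)
    qed
    finally show "L2_norm lborel (frame_sum \<alpha> \<beta> g h G \<phi>) \<le> (\<Sum>k\<in>G. L2_norm lborel (?s k g) * L2_norm lborel (?s k h)) * L2_norm lborel \<phi>"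
      by (simp add: sum_distrib_right)
  qed
next
  fix \<phi> :: "real \<Rightarrow> complex" assume \<phi>: "\<phi> \<in> L2_space lborel"
  have "eventually (\<lambda>G. L2_norm_sq lborel (\<lambda>t. \<phi> t - frame_sum \<alpha> \<beta> g h G \<phi> t) < 1) (finite_subsets_at_top I)"
    using conv[OF \<phi>] by (rule order_tendstoD(2)) simp
  then obtain X where X: "finite X" "X \<subseteq> I"
    "\<And>G. finite G \<Longrightarrow> X \<subseteq> G \<Longrightarrow> G \<subseteq> I \<Longrightarrow> L2_norm_sq lborel (\<lambda>t. \<phi> t - frame_sum \<alpha> \<beta> g h G \<phi> t) < 1"
    by (rule eventually_finite_subsetsE) (rule that)
  show "\<exists>B. \<forall>G\<in>{G. finite G \<and> G \<subseteq> I}. L2_norm lborel (frame_sum \<alpha> \<beta> g h G \<phi>) \<le> B"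
  proof (intro exI ballI)
    fix G assume "G \<in> {G. finite G \<and> G \<subseteq> I}"
    then have G: "finite G" "G \<subseteq> I" by auto
    \<comment> \<open>Enlarging \<open>G\<close> by \<open>X\<close> brings the sum within distance
      1 of \<open>\<phi>\<close>. What was added is a sum over a subset of the fixed finite set
      \<open>X\<close>, and there are finitely many such subsets.\<close>
    let ?d = "\<lambda>t. \<phi> t - frame_sum \<alpha> \<beta> g h (G \<union> X) \<phi> t"
    have d: "?d \<in> L2_space lborel" by (intro L2_space_diff \<phi> frame_sum_L2 h)
    have "L2_norm_sq lborel ?d < 1" using X G by (intro X(3)) auto
    then have n1: "L2_norm lborel ?d \<le> 1" by (intro L2_norm_leI[OF d]) auto
    have "frame_sum \<alpha> \<beta> g h (G \<union> X) \<phi> t = frame_sum \<alpha> \<beta> g h G \<phi> t + frame_sum \<alpha> \<beta> g h (X - G) \<phi> t" for t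
      unfolding frame_sum_def using G X by (subst sum.union_disjoint[symmetric]) (auto simp: Un_Diff_cancel)
    then have "frame_sum \<alpha> \<beta> g h G \<phi> = (\<lambda>t. (\<phi> t - ?d t) - frame_sum \<alpha> \<beta> g h (X - G) \<phi> t)" by auto
    then have "L2_norm lborel (frame_sum \<alpha> \<beta> g h G \<phi>) \<le> L2_norm lborel (\<lambda>t. \<phi> t - ?d t) + L2_norm lborel (frame_sum \<alpha> \<beta> g h (X - G) \<phi>)"
      by (simp only:) (rule L2_norm_diff[OF L2_space_diff[OF \<phi> d] frame_sum_L2[OF h]])
    moreover have "L2_norm lborel (\<lambda>t. \<phi> t - ?d t) \<le> L2_norm lborel \<phi> + 1"
      using L2_norm_diff[OF \<phi> d] n1 by linarith
    moreover have "L2_norm lborel (frame_sum \<alpha> \<beta> g h (X - G) \<phi>) \<le> (\<Sum>S\<in>Pow X. L2_norm lborel (frame_sum \<alpha> \<beta> g h S \<phi>))"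
      using X(1) by (intro member_le_sum) auto
    ultimately show "L2_norm lborel (frame_sum \<alpha> \<beta> g h G \<phi>) \<le> L2_norm lborel \<phi> + 1 + (\<Sum>S\<in>Pow X. L2_norm lborel (frame_sum \<alpha> \<beta> g h S \<phi>))"
      by linarith
  qed
qed simp

lemma tendsto_0_ennrealI:
  fixes X :: "'i \<Rightarrow> ennreal"
  assumes "\<And>\<epsilon>::real. \<epsilon> > 0 \<Longrightarrow> eventually (\<lambda>i. X i \<le> ennreal \<epsilon>) F"
  shows "(X \<longlongrightarrow> 0) F"
proof (rule order_tendstoI)
  fix a :: ennreal assume "0 < a"
  then obtain b where b: "0 < b" "b < a" using dense by blast
  then have "b = ennreal (enn2real b)" "enn2real b > 0"
    using less_le_trans[OF b(2) top_greatest] by (auto simp: enn2real_positive_iff ennreal_enn2real_if)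
  then show "eventually (\<lambda>i. X i < a) F"
    using assms[of "enn2real b"] b by (auto elim!: eventually_mono)
qed simp

section \<open>Decoupling of the frame sums along the basis\<close>

context coset_characters
begin

text \<open>Labels the basis function to which \<open>e k\<close> is proportional.\<close>

definition cl :: "rat \<times> rat \<Rightarrow> rat \<times> rat" where "cl k = (frac (fst k), frac (snd k))"

lemma cl_Y: "k \<in> R \<times> R \<Longrightarrow> cl k \<in> Y \<times> Y"
  by (auto simp: cl_def frac_Y)

lemma e_cl:
  assumes k: "k \<in> R \<times> R"
  shows "\<exists>\<kappa>. cmod \<kappa> = 1 \<and> (\<forall>u. e k u = \<kappa> * e (cl k) u)"
proof -
  obtain q r where kq: "k = (q, r)" by (cases k)
  have q: "q \<in> R" and r: "r \<in> R" using k kq by auto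
  obtain v where v: "v \<in> C q" using C_nonempty[OF q] by auto
  have Cf: "C (frac q) = C q" using C_int[OF q, of "- \<lfloor>q\<rfloor>"] by (simp add: frac_def)
  have "e (q, r) u = \<psi> (of_int \<lfloor>r\<rfloor>) v * e (frac q, frac r) u" for u
  proof (cases "u \<in> C q")
    case True
    have "\<psi> (of_int \<lfloor>r\<rfloor> + frac r) u = \<psi> (of_int \<lfloor>r\<rfloor>) u * \<psi> (frac r) u"
      using True C_subset[OF q] r by (intro psi_add R_int R_frac) auto
    moreover have "of_int \<lfloor>r\<rfloor> + frac r = r" by (simp add: frac_def)
    ultimately show ?thesis using True psi_int[OF q True v] by (simp add: e_def Cf)
  qed (simp add: e_def Cf)
  moreover have "cmod (\<psi> (of_int \<lfloor>r\<rfloor>) v) = 1" using v C_subset[OF q] by (intro psi_norm R_int) auto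
  ultimately show ?thesis unfolding kq cl_def by auto
qed

lemma tensor_term:
  assumes f: "f \<in> L2_space RM" and g: "g \<in> L2_space lborel" and k: "k \<in> R \<times> R"
  shows "L2_inner RM f (tensor g k) * tensor h k x = L2_inner lborel (comp f (cl k)) g * tensor h (cl k) x"
proof -
  obtain \<kappa> where \<kappa>: "cmod \<kappa> = 1" "\<And>u. e k u = \<kappa> * e (cl k) u" using e_cl[OF k] by auto
  have t: "tensor \<phi> k = (\<lambda>x. \<kappa> * tensor \<phi> (cl k) x)" for \<phi>
    by (auto simp: tensor_def \<kappa>(2))
  have "cl k \<in> R \<times> R" using cl_Y[OF k] Y_R by (auto simp: mem_Times_iff)
  then have 1: "L2_inner RM f (tensor g k) = cnj \<kappa> * L2_inner lborel (comp f (cl k)) g"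
    unfolding t L2_inner_cmult_right by (simp add: inner_tensor[OF f g])
  have "cnj \<kappa> * \<kappa> = 1" using \<kappa>(1) complex_norm_square[of \<kappa>] by (simp add: mult.commute)
  moreover have "(cnj \<kappa> * A) * (\<kappa> * B) = (cnj \<kappa> * \<kappa>) * (A * B)" for A B by (simp only: mult_ac)
  ultimately have "(cnj \<kappa> * A) * (\<kappa> * B) = A * B" for A B by (simp only: mult_1)
  then show ?thesis by (simp only: 1) (simp only: t)
qed

context
  fixes \<alpha> \<beta> :: real and g h :: "real \<Rightarrow> complex"
  assumes g: "g \<in> L2_space lborel" and h: "h \<in> L2_space lborel"
begin

abbreviation sh :: "rat \<times> rat \<Rightarrow> (real \<Rightarrow> complex) \<Rightarrow> real \<Rightarrow> complex" where
  "sh k \<equiv> real_tf (\<alpha> * of_rat (fst k)) (\<beta> * of_rat (snd k))"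

definition product_sum :: "(rat \<times> rat) set \<Rightarrow> (real \<times> 'h \<Rightarrow> complex) \<Rightarrow> real \<times> 'h \<Rightarrow> complex" where
  "product_sum F f x = (\<Sum>k\<in>F. L2_inner RM f (tensor (sh k g) k) * tensor (sh k h) k x)"

text \<open>A term with index \<open>k\<close> lies in the component labelled \<open>cl k\<close>,
  so the partial sum over \<open>F\<close> splits exactly, before any limit, into frame sums on the
  line over the classes in \<open>F\<close>.\<close>

lemma product_error:
  assumes f: "f \<in> L2_space RM" and F: "finite F" "F \<subseteq> R \<times> R"
  shows "L2_norm_sq RM (\<lambda>x. f x - product_sum F f x)
    = (\<integral>\<^sup>+j. L2_norm_sq lborel (\<lambda>t. comp f j t - frame_sum \<alpha> \<beta> g h {k\<in>F. cl k = j} (comp f j) t) \<partial>count_space (Y \<times> Y))"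
proof -
  have F': "k \<in> R \<times> R" if "k \<in> F" for k using that F by auto
  have S: "product_sum F f \<in> L2_space RM"
    unfolding product_sum_def[abs_def] using F'
    by (intro L2_space_sum L2_space_cmult tensor_L2 shift_L2 h) auto
  have "comp (product_sum F f) j t = frame_sum \<alpha> \<beta> g h {k\<in>F. cl k = j} (comp f j) t"
    if j: "j \<in> Y \<times> Y" for j t
  proof -
    have jR: "j \<in> R \<times> R" using j Y_R by auto
    let ?c = "\<lambda>k. L2_inner lborel (comp f (cl k)) (sh k g)"
    have "product_sum F f = (\<lambda>x. \<Sum>k\<in>F. ?c k * tensor (sh k h) (cl k) x)"
      unfolding product_sum_def[abs_def]
      using tensor_term[OF f shift_L2(1)[OF g] F'] by (intro ext sum.cong) auto
    then have "comp (product_sum F f) j t = L2_inner M (\<lambda>u. \<Sum>k\<in>F. (?c k * sh k h t) * e (cl k) u) (e j)"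
      by (simp add: comp_def tensor_def mult.assoc)
    also have "\<dots> = (\<Sum>k\<in>F. L2_inner M (\<lambda>u. (?c k * sh k h t) * e (cl k) u) (e j))"
    proof (rule L2_inner_sum_left)
      fix k assume "k \<in> F"
      then have "cl k \<in> Y \<times> Y" by (intro cl_Y F')
      then show "(\<lambda>u. (?c k * sh k h t) * e (cl k) u) \<in> L2_space M"
        using e_L2[of "fst (cl k)" "snd (cl k)"] Y_R by (intro L2_space_cmult) (auto simp: mem_Times_iff)
    next
      show "e j \<in> L2_space M" using e_L2 jR by auto
    qed
    also have "\<dots> = (\<Sum>k\<in>F. if cl k = j then ?c k * sh k h t else 0)"
      using e_orthonormal[OF cl_Y[OF F'] j] by (intro sum.cong) (auto simp: L2_inner_cmult_left)
    also have "\<dots> = (\<Sum>k\<in>{k\<in>F. cl k = j}. ?c k * sh k h t)"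
      using F(1) by (intro sum.inter_filter[symmetric])
    also have "\<dots> = frame_sum \<alpha> \<beta> g h {k\<in>F. cl k = j} (comp f j) t"
      unfolding frame_sum_def by (rule sum.cong) auto
    finally show ?thesis .
  qed
  note comp_S = this
  have D: "(\<lambda>x. f x - product_sum F f x) \<in> L2_space RM" by (rule L2_space_diff[OF f S])
  have "L2_norm_sq lborel (comp (\<lambda>x. f x - product_sum F f x) j)
     = L2_norm_sq lborel (\<lambda>t. comp f j t - frame_sum \<alpha> \<beta> g h {k\<in>F. cl k = j} (comp f j) t)"
    if j: "j \<in> Y \<times> Y" for j
    unfolding L2_norm_sq_def
  \<comment> \<open>Subtracting inner products requires both slices to be square integrable, which
    holds for almost every \<open>t\<close>.\<close>
  proof (rule nn_integral_cong_AE, use slice_L2[OF f] slice_L2[OF S] in eventually_elim)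
    fix t assume t: "(\<lambda>u. f (t, u)) \<in> L2_space M" "(\<lambda>u. product_sum F f (t, u)) \<in> L2_space M"
    have ej: "e j \<in> L2_space M" using e_L2 j Y_R by auto
    have "comp (\<lambda>x. f x - product_sum F f x) j t = comp f j t - comp (product_sum F f) j t"
      unfolding comp_def by (rule L2_inner_diff_left[OF t ej])
    then show "ennreal ((cmod (comp (\<lambda>x. f x - product_sum F f x) j t))\<^sup>2) =
        ennreal ((cmod (comp f j t - frame_sum \<alpha> \<beta> g h {k \<in> F. cl k = j} (comp f j) t))\<^sup>2)"
      by (simp add: comp_S[OF j])
  qed
  then show ?thesis unfolding product_Parseval[OF D] by (intro nn_integral_cong) auto
qed

text \<open>Having label \<open>j\<close> means differing from \<open>j\<close> by integers in both
  entries.\<close>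

lemma class_translate:
  assumes F: "F \<subseteq> R \<times> R" and j: "j \<in> Y \<times> Y"
  shows "{k\<in>F. cl k = j} = (\<lambda>k. (fst j + fst k, snd j + snd k)) ` {k\<in>\<int> \<times> \<int>. (fst j + fst k, snd j + snd k) \<in> F}"
proof -
  have fr: "frac q = y \<longleftrightarrow> q - y \<in> \<int>" if "y \<in> Y" for q y :: rat
    using that by (auto simp: frac_unique_iff Y_def)
  have cl: "cl k = j \<longleftrightarrow> fst k - fst j \<in> \<int> \<and> snd k - snd j \<in> \<int>" for k
    using fr[of "fst j" "fst k"] fr[of "snd j" "snd k"] j by (auto simp: cl_def prod_eq_iff mem_Times_iff)
  show ?thesis
  proof (intro equalityI subsetI)
    fix k assume "k \<in> {k\<in>F. cl k = j}"
    then show "k \<in> (\<lambda>k. (fst j + fst k, snd j + snd k)) ` {k\<in>\<int> \<times> \<int>. (fst j + fst k, snd j + snd k) \<in> F}"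
      by (intro image_eqI[where x="(fst k - fst j, snd k - snd j)"]) (auto simp: cl)
  qed (auto simp: cl)
qed

text \<open>Dominated convergence over the components: each error tends to 0 and is at most
  \<open>(1 + B)^2\<close> times the energy of its component, and these energies have the finite sum
  \<open>L2_norm_sq RM f\<close>.\<close>

lemma frame_product_if:
  assumes conv: "\<And>\<phi>. \<phi> \<in> L2_space lborel \<Longrightarrow>
      ((\<lambda>G. L2_norm_sq lborel (\<lambda>t. \<phi> t - frame_sum \<alpha> \<beta> g h G \<phi> t)) \<longlongrightarrow> 0) (finite_subsets_at_top (\<int> \<times> \<int>))"
    and f: "f \<in> L2_space RM"
  shows "((\<lambda>F. L2_norm_sq RM (\<lambda>x. f x - product_sum F f x)) \<longlongrightarrow> 0) (finite_subsets_at_top (R \<times> R))"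
proof (rule tendsto_0_ennrealI)
  fix \<epsilon> :: real assume \<epsilon>: "\<epsilon> > 0"
  obtain B where B: "B \<ge> 0" "\<And>G \<phi>. finite G \<Longrightarrow> G \<subseteq> \<int> \<times> \<int> \<Longrightarrow> \<phi> \<in> L2_space lborel \<Longrightarrow>
     L2_norm lborel (frame_sum \<alpha> \<beta> g h G \<phi>) \<le> B * L2_norm lborel \<phi>"
    using frame_sum_bounded[OF g h conv] by auto
  define G where "G F j = {k\<in>\<int> \<times> \<int>. (fst j + fst k, snd j + snd k) \<in> F}" for F and j :: "rat \<times> rat"
  \<comment> \<open>The component moved back by the inverse shift, so that its error is taken over
    the integral points \<open>G F j\<close>.\<close>
  define u where "u j = real_tf_inv (\<alpha> * of_rat (fst j)) (\<beta> * of_rat (snd j)) (comp f j)" for j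
  define D where "D F j = L2_norm_sq lborel (\<lambda>t. u j t - frame_sum \<alpha> \<beta> g h (G F j) (u j) t)" for F j
  have cL: "comp f j \<in> L2_space lborel" if "j \<in> Y \<times> Y" for j by (rule comp_L2[OF f that])
  have uL: "u j \<in> L2_space lborel" if "j \<in> Y \<times> Y" for j
    unfolding u_def by (rule shift_L2(2)[OF cL[OF that]])
  have err: "L2_norm_sq RM (\<lambda>x. f x - product_sum F f x) = (\<integral>\<^sup>+j. D F j \<partial>count_space (Y \<times> Y))"
    if F: "finite F" "F \<subseteq> R \<times> R" for F
    unfolding product_error[OF f F]
  proof (rule nn_integral_cong)
    fix j assume "j \<in> space (count_space (Y \<times> Y))"
    then have j: "j \<in> Y \<times> Y" by simp
    show "L2_norm_sq lborel (\<lambda>t. comp f j t - frame_sum \<alpha> \<beta> g h {k\<in>F. cl k = j} (comp f j) t) = D F j"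
      unfolding class_translate[OF F(2) j] frame_error_translate[OF cL[OF j] h] D_def u_def G_def ..
  qed
  have Gfin: "finite (G F j)" "G F j \<subseteq> \<int> \<times> \<int>" if "finite F" for F j
  proof -
    have "G F j \<subseteq> (\<lambda>k. (fst k - fst j, snd k - snd j)) ` F"
      by (force simp: G_def image_iff)
    then show "finite (G F j)" using that by (rule finite_subset[OF _ finite_imageI])
    show "G F j \<subseteq> \<int> \<times> \<int>" by (auto simp: G_def)
  qed
  let ?K = "(1 + B)\<^sup>2"
  \<comment> \<open>Triangle inequality with the uniform bound \<open>B\<close> on the partial sums,
    squared; it does not depend on \<open>F\<close>.\<close>
  have Db: "D F j \<le> ennreal ?K * L2_norm_sq lborel (comp f j)" if F: "finite F" and j: "j \<in> Y \<times> Y" for F j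
  proof -
    let ?d = "\<lambda>t. u j t - frame_sum \<alpha> \<beta> g h (G F j) (u j) t"
    have d: "?d \<in> L2_space lborel" by (intro L2_space_diff uL[OF j] frame_sum_L2[OF h])
    have "L2_norm lborel ?d \<le> L2_norm lborel (u j) + L2_norm lborel (frame_sum \<alpha> \<beta> g h (G F j) (u j))"
      by (rule L2_norm_diff[OF uL[OF j] frame_sum_L2[OF h]])
    also have "\<dots> \<le> L2_norm lborel (u j) + B * L2_norm lborel (u j)"
      using B(2)[OF Gfin[OF F] uL[OF j]] by simp
    also have "\<dots> = (1 + B) * L2_norm lborel (u j)" by (simp add: distrib_right)
    finally have "(L2_norm lborel ?d)\<^sup>2 \<le> ((1 + B) * L2_norm lborel (u j))\<^sup>2" by (rule power_mono) simp
    then have "D F j \<le> ennreal ?K * L2_norm_sq lborel (u j)"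
      unfolding D_def L2_norm_sq_eq[OF d] L2_norm_sq_eq[OF uL[OF j]]
      by (subst ennreal_mult[symmetric]) (auto simp: power_mult_distrib intro: ennreal_leI)
    moreover have "comp f j \<in> borel_measurable borel" using L2_space_measurable[OF cL[OF j]] by simp
    ultimately show ?thesis by (simp add: u_def L2_norm_sq_shift)
  qed
  have cI: "countable (Y \<times> Y)" using countable_Y by simp
  \<comment> \<open>Chosen so that the tail, enlarged by the constant \<open>(1 + B)^2\<close>,
    contributes at most \<open>\<epsilon> / 2\<close>.\<close>
  define \<delta> where "\<delta> = \<epsilon> / (2 * ?K)"
  have K: "?K > 0" using B(1) by simp
  have "(\<integral>\<^sup>+j. L2_norm_sq lborel (comp f j) \<partial>count_space (Y \<times> Y)) < \<infinity>"
    using f by (simp add: product_Parseval[OF f, symmetric] L2_space_def)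
  moreover have "ennreal \<delta> > 0" using \<epsilon> K by (simp add: \<delta>_def)
  ultimately have "\<exists>J. finite J \<and> J \<subseteq> Y \<times> Y \<and>
    (\<integral>\<^sup>+j. L2_norm_sq lborel (comp f j) \<partial>count_space (Y \<times> Y - J)) \<le> ennreal \<delta>"
    by (rule nn_integral_count_space_tail[OF cI])
  then obtain J where J: "finite J" "J \<subseteq> Y \<times> Y"
    "(\<integral>\<^sup>+j. L2_norm_sq lborel (comp f j) \<partial>count_space (Y \<times> Y - J)) \<le> ennreal \<delta>"
    by (elim exE conjE) (rule that)
  \<comment> \<open>The other half of \<open>\<epsilon>\<close> is shared by the components in
    \<open>J\<close>; the added 1 covers an empty \<open>J\<close>.\<close>
  define \<eta> where "\<eta> = \<epsilon> / (2 * (real (card J) + 1))"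
  have \<eta>: "\<eta> > 0" using \<epsilon> by (simp add: \<eta>_def)
  have "eventually (\<lambda>F. D F j < ennreal \<eta>) (finite_subsets_at_top (R \<times> R))" if j: "j \<in> J" for j
  proof -
    have jY: "j \<in> Y \<times> Y" using j J by auto
    \<comment> \<open>As \<open>F\<close> grows through the finite subsets of
      \<open>R \<times> R\<close>, its class of \<open>j\<close>, moved to the origin, exhausts the
      integral points.\<close>
    have "filterlim (\<lambda>F. G F j) (finite_subsets_at_top (\<int> \<times> \<int>)) (finite_subsets_at_top (R \<times> R))"
      unfolding filterlim_finite_subsets_at_top
    proof (intro allI impI)
      fix X :: "(rat \<times> rat) set" assume X: "finite X \<and> X \<subseteq> \<int> \<times> \<int>"
      let ?X = "(\<lambda>k. (fst j + fst k, snd j + snd k)) ` X"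
      have "a + b \<in> R" if "a \<in> Y" "b \<in> \<int>" for a b
        using R_add[OF Y_R[OF that(1)]] R_int that(2) by (auto elim: Ints_cases)
      then have "finite ?X" "?X \<subseteq> R \<times> R" using X jY by (auto simp: mem_Times_iff subset_iff)
      moreover have "X \<subseteq> G F j" if "?X \<subseteq> F" for F using that X by (auto simp: G_def)
      ultimately show "\<forall>\<^sub>F F in finite_subsets_at_top (R \<times> R). finite (G F j) \<and> X \<subseteq> G F j \<and> G F j \<subseteq> \<int> \<times> \<int>"
        unfolding eventually_finite_subsets_at_top using Gfin by (intro exI[of _ ?X]) auto
    qed
    from filterlim_compose[OF conv[OF uL[OF jY]] this]
    have "((\<lambda>F. D F j) \<longlongrightarrow> 0) (finite_subsets_at_top (R \<times> R))" by (simp add: D_def)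
    then show ?thesis by (rule order_tendstoD(2)) (use \<eta> in simp)
  qed
  then have "eventually (\<lambda>F. \<forall>j\<in>J. D F j < ennreal \<eta>) (finite_subsets_at_top (R \<times> R))"
    using J(1) by (simp add: eventually_ball_finite)
  moreover have "eventually (\<lambda>F. finite F \<and> F \<subseteq> R \<times> R) (finite_subsets_at_top (R \<times> R))"
    by (rule eventually_finite_subsets_at_top_weakI) auto
  ultimately show "eventually (\<lambda>F. L2_norm_sq RM (\<lambda>x. f x - product_sum F f x) \<le> ennreal \<epsilon>) (finite_subsets_at_top (R \<times> R))"
  proof eventually_elim
    fix F assume s: "\<forall>j\<in>J. D F j < ennreal \<eta>" and "finite F \<and> F \<subseteq> R \<times> R"
    then have F: "finite F" "F \<subseteq> R \<times> R" by auto
    have "L2_norm_sq RM (\<lambda>x. f x - product_sum F f x) = sum (D F) J + (\<integral>\<^sup>+j. D F j \<partial>count_space (Y \<times> Y - J))"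
      unfolding err[OF F] by (rule nn_integral_count_space_split[OF J(1,2)])
    also have "sum (D F) J \<le> (\<Sum>j\<in>J. ennreal \<eta>)" using s by (intro sum_mono) auto
    also have "(\<Sum>j\<in>J. ennreal \<eta>) = ennreal (real (card J) * \<eta>)"
      using \<eta> by (simp add: ennreal_mult ennreal_of_nat_eq_real_of_nat)
    also have "\<dots> \<le> ennreal (\<epsilon> / 2)"
    proof (rule ennreal_leI)
      have "real (card J) * \<eta> \<le> (real (card J) + 1) * \<eta>" using \<eta> by (intro mult_right_mono) auto
      also have "\<dots> = \<epsilon> / 2" by (simp add: \<eta>_def field_simps add_nonneg_eq_0_iff)
      finally show "real (card J) * \<eta> \<le> \<epsilon> / 2" .
    qed
    also have "(\<integral>\<^sup>+j. D F j \<partial>count_space (Y \<times> Y - J)) \<le> (\<integral>\<^sup>+j. ennreal ?K * L2_norm_sq lborel (comp f j) \<partial>count_space (Y \<times> Y - J))"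
      by (rule nn_integral_mono) (auto intro: Db[OF F(1)])
    also have "\<dots> = ennreal ?K * (\<integral>\<^sup>+j. L2_norm_sq lborel (comp f j) \<partial>count_space (Y \<times> Y - J))"
      by (rule nn_integral_cmult) simp
    also have "\<dots> \<le> ennreal ?K * ennreal \<delta>" by (rule mult_left_mono[OF J(3)]) simp
    also have "\<dots> = ennreal (\<epsilon> / 2)"
      using K \<epsilon> B(1) by (subst ennreal_mult[symmetric]) (auto simp: \<delta>_def)
    also have "ennreal (\<epsilon> / 2) + ennreal (\<epsilon> / 2) = ennreal \<epsilon>"
      using \<epsilon> by (subst ennreal_plus[symmetric]) auto
    finally show "L2_norm_sq RM (\<lambda>x. f x - product_sum F f x) \<le> ennreal \<epsilon>"
      by (simp add: add_left_mono add_right_mono)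
  qed
qed

text \<open>The test function \<open>tensor \<phi> (0, 0)\<close> has \<open>\<phi>\<close> as its
  component at \<open>(0, 0)\<close>, where the class consists of the integral indices. One summand
  of Parseval's identity is at most the whole error.\<close>

lemma frame_product_only_if:
  assumes conv: "\<And>f. f \<in> L2_space RM \<Longrightarrow>
      ((\<lambda>F. L2_norm_sq RM (\<lambda>x. f x - product_sum F f x)) \<longlongrightarrow> 0) (finite_subsets_at_top (R \<times> R))"
    and \<phi>: "\<phi> \<in> L2_space lborel"
  shows "((\<lambda>G. L2_norm_sq lborel (\<lambda>t. \<phi> t - frame_sum \<alpha> \<beta> g h G \<phi> t)) \<longlongrightarrow> 0) (finite_subsets_at_top (\<int> \<times> \<int>))"
proof (rule tendsto_0_ennrealI)
  fix \<epsilon> :: real assume \<epsilon>: "\<epsilon> > 0"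
  have Y0: "(0, 0) \<in> Y \<times> Y" using R_zero by (simp add: Y_def)
  let ?f = "tensor \<phi> (0, 0)"
  have fL: "?f \<in> L2_space RM" using R_zero by (intro tensor_L2[OF \<phi>]) auto
  have c0: "comp ?f (0, 0) = \<phi>" by (rule ext) (simp add: comp_tensor[OF Y0 Y0])
  have "eventually (\<lambda>F. L2_norm_sq RM (\<lambda>x. ?f x - product_sum F ?f x) < ennreal \<epsilon>) (finite_subsets_at_top (R \<times> R))"
    using conv[OF fL] by (rule order_tendstoD(2)) (use \<epsilon> in simp)
  then obtain X where X: "finite X" "X \<subseteq> R \<times> R" "\<And>F. finite F \<Longrightarrow> X \<subseteq> F \<Longrightarrow> F \<subseteq> R \<times> R \<Longrightarrow>
      L2_norm_sq RM (\<lambda>x. ?f x - product_sum F ?f x) < ennreal \<epsilon>"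
    by (rule eventually_finite_subsetsE) (rule that)
  have "\<int> \<subseteq> R" by (rule subsetI, erule Ints_cases) (simp only: R_int)
  then have ZR: "\<int> \<times> \<int> \<subseteq> R \<times> R" by blast
  show "eventually (\<lambda>G. L2_norm_sq lborel (\<lambda>t. \<phi> t - frame_sum \<alpha> \<beta> g h G \<phi> t) \<le> ennreal \<epsilon>) (finite_subsets_at_top (\<int> \<times> \<int>))"
    unfolding eventually_finite_subsets_at_top
  proof (intro exI conjI allI impI)
    show "finite (X \<inter> \<int> \<times> \<int>)" using X(1) by blast
    show "X \<inter> \<int> \<times> \<int> \<subseteq> \<int> \<times> \<int>" by blast
    fix G :: "(rat \<times> rat) set" assume G: "finite G \<and> X \<inter> \<int> \<times> \<int> \<subseteq> G \<and> G \<subseteq> \<int> \<times> \<int>"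
    \<comment> \<open>Adding \<open>X\<close> puts the index set far enough along the net. The
      integral points of \<open>X\<close> already lie in \<open>G\<close>, so the class of
      \<open>(0, 0)\<close> in \<open>G \<union> X\<close> is exactly \<open>G\<close>.\<close>
    let ?F = "G \<union> X"
    let ?d = "\<lambda>j. L2_norm_sq lborel (\<lambda>t. comp ?f j t - frame_sum \<alpha> \<beta> g h {k\<in>?F. cl k = j} (comp ?f j) t)"
    have F: "finite ?F" "?F \<subseteq> R \<times> R" using G X(1,2) ZR by (blast, blast)
    have clz: "cl k = (0, 0) \<longleftrightarrow> k \<in> \<int> \<times> \<int>" for k
      by (cases k) (simp add: cl_def frac_eq_0_iff)
    have "{k\<in>?F. cl k = (0, 0)} = G" unfolding clz using G by blast
    then have "?d (0, 0) = L2_norm_sq lborel (\<lambda>t. \<phi> t - frame_sum \<alpha> \<beta> g h G \<phi> t)"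
      by (simp only: c0)
    then have "L2_norm_sq lborel (\<lambda>t. \<phi> t - frame_sum \<alpha> \<beta> g h G \<phi> t) = sum ?d {(0, 0)}"
      by (simp only: sum.insert sum.empty finite.emptyI empty_iff not_False_eq_True add_0_right)
    also have "\<dots> \<le> (\<integral>\<^sup>+j. ?d j \<partial>count_space (Y \<times> Y))"
      using Y0 by (intro sum_le_nn_integral_count_space) auto
    also have "\<dots> = L2_norm_sq RM (\<lambda>x. ?f x - product_sum ?F ?f x)"
      by (rule product_error[OF fL F, symmetric])
    also have "\<dots> \<le> ennreal \<epsilon>" by (rule less_imp_le[OF X(3)[OF F(1) Un_upper2 F(2)]])
    finally show "L2_norm_sq lborel (\<lambda>t. \<phi> t - frame_sum \<alpha> \<beta> g h G \<phi> t) \<le> ennreal \<epsilon>" .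
  qed
qed

end

end

section \<open>Lattices and dual frames\<close>

text \<open>A form of the lattice condition that passes to products: isolating open sets, and a
  compact set of coset representatives in place of a quotient topology.\<close>

definition cocompact_discrete :: "('a, 'm) monoid_scheme \<Rightarrow> 'a topology \<Rightarrow> 'a set \<Rightarrow> bool" where
  "cocompact_discrete G T \<Lambda> \<longleftrightarrow>
     group G \<and> topspace T = carrier G \<and> subgroup \<Lambda> G \<and>
     (\<forall>x\<in>\<Lambda>. \<exists>U. openin T U \<and> U \<inter> \<Lambda> = {x}) \<and>
     (\<exists>K. compactin T K \<and> (\<forall>y\<in>carrier G. \<exists>l\<in>\<Lambda>. \<exists>k\<in>K. y = l \<otimes>\<^bsub>G\<^esub> k))"

text \<open>The final topology on the image serves; it supplies the topology whose existence
  \<open>is_lattice\<close> asks for.\<close>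

lemma quotient_topology_exists:
  "\<exists>Q. quotient_map T Q f"
proof -
  let ?o = "\<lambda>V. V \<subseteq> f ` topspace T \<and> openin T {x \<in> topspace T. f x \<in> V}"
  have i: "istopology ?o"
    unfolding istopology_def
  proof (intro conjI allI impI)
    fix S V assume "?o S" "?o V"
    moreover have "{x \<in> topspace T. f x \<in> S \<inter> V} = {x \<in> topspace T. f x \<in> S} \<inter> {x \<in> topspace T. f x \<in> V}" by auto
    ultimately show "S \<inter> V \<subseteq> f ` topspace T" "openin T {x \<in> topspace T. f x \<in> S \<inter> V}" by auto
  next
    fix \<K> assume K: "\<forall>V\<in>\<K>. ?o V"
    then show "\<Union>\<K> \<subseteq> f ` topspace T" by blast
    have "{x \<in> topspace T. f x \<in> \<Union>\<K>} = (\<Union>V\<in>\<K>. {x \<in> topspace T. f x \<in> V})" by auto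
    also have "openin T \<dots>" using K by (intro openin_Union) blast
    finally show "openin T {x \<in> topspace T. f x \<in> \<Union>\<K>}" .
  qed
  have o: "openin (topology ?o) = ?o" by (rule topology_inverse'[OF i])
  have "?o (f ` topspace T)" by (auto intro: back_subst[of "openin T", OF openin_topspace])
  then have "f ` topspace T \<subseteq> \<Union>{V. ?o V}" by (intro Union_upper) simp
  moreover have "\<Union>{V. ?o V} \<subseteq> f ` topspace T" by (rule Union_least) simp
  ultimately have "topspace (topology ?o) = f ` topspace T"
    unfolding topspace_def[of "topology ?o"] o by (rule antisym[rotated])
  then have "quotient_map T (topology ?o) f"
    unfolding quotient_map_def by (simp add: o)
  then show ?thesis ..
qed

lemma cocompact_discrete_lattice:
  assumes "cocompact_discrete G T \<Lambda>" shows "is_lattice G T \<Lambda>"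
proof -
  interpret group G using assms by (simp add: cocompact_discrete_def)
  have ts: "topspace T = carrier G" and sg: "subgroup \<Lambda> G"
    using assms by (auto simp: cocompact_discrete_def)
  obtain K where K: "compactin T K" "\<And>y. y \<in> carrier G \<Longrightarrow> \<exists>l\<in>\<Lambda>. \<exists>k\<in>K. y = l \<otimes>\<^bsub>G\<^esub> k"
    using assms by (auto simp: cocompact_discrete_def)
  have sub: "\<Lambda> \<subseteq> carrier G" by (rule subgroup.subset[OF sg])
  have "openin (subtopology T \<Lambda>) {x}" if "x \<in> \<Lambda>" for x
  proof -
    obtain U where "openin T U" "U \<inter> \<Lambda> = {x}" using assms \<open>x \<in> \<Lambda>\<close> by (auto simp: cocompact_discrete_def)
    then show ?thesis by (metis openin_subtopology_Int)
  qed
  then have d: "subtopology T \<Lambda> = discrete_topology \<Lambda>"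
    using sub ts discrete_topology_unique[of \<Lambda> "subtopology T \<Lambda>"] by (auto simp: Int_absorb1)
  obtain Q where Q: "quotient_map T Q (\<lambda>x. \<Lambda> #>\<^bsub>G\<^esub> x)" using quotient_topology_exists by blast
  have "topspace Q = (\<lambda>x. \<Lambda> #>\<^bsub>G\<^esub> x) ` carrier G"
    using Q ts by (simp add: quotient_map_def)
  \<comment> \<open>Every coset meets \<open>K\<close>, so the quotient is the continuous image of a
    compact set.\<close>
  also have "\<dots> = (\<lambda>x. \<Lambda> #>\<^bsub>G\<^esub> x) ` K"
  proof (intro equalityI subsetI)
    fix c assume "c \<in> (\<lambda>x. \<Lambda> #>\<^bsub>G\<^esub> x) ` carrier G"
    then obtain y where y: "y \<in> carrier G" "c = \<Lambda> #>\<^bsub>G\<^esub> y" by auto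
    obtain l k where lk: "l \<in> \<Lambda>" "k \<in> K" "y = l \<otimes>\<^bsub>G\<^esub> k" using K(2)[OF y(1)] by auto
    have k: "k \<in> carrier G" using compactin_subset_topspace[OF K(1)] ts lk by auto
    have "y \<in> \<Lambda> #>\<^bsub>G\<^esub> k" unfolding lk(3) by (rule rcosI[OF lk(1) sub k])
    then have "c = \<Lambda> #>\<^bsub>G\<^esub> k" using repr_independence[OF _ k sg] y(2) by simp
    then show "c \<in> (\<lambda>x. \<Lambda> #>\<^bsub>G\<^esub> x) ` K" using lk(2) by simp
  next
    fix c assume "c \<in> (\<lambda>x. \<Lambda> #>\<^bsub>G\<^esub> x) ` K"
    then show "c \<in> (\<lambda>x. \<Lambda> #>\<^bsub>G\<^esub> x) ` carrier G" using compactin_subset_topspace[OF K(1)] ts by auto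
  qed
  also have "compactin Q \<dots>"
    by (rule image_compactin[OF K(1) quotient_imp_continuous_map[OF Q]])
  finally have "compact_space Q" by (simp add: compact_space_def)
  then show ?thesis using sg d Q unfolding is_lattice_def by blast
qed

lemma cocompact_discrete_Times:
  assumes "cocompact_discrete G T \<Lambda>" "cocompact_discrete G' T' \<Lambda>'"
  shows "cocompact_discrete (G \<times>\<times> G') (prod_topology T T') (\<Lambda> \<times> \<Lambda>')"
proof -
  have g: "group G" "group G'" "subgroup \<Lambda> G" "subgroup \<Lambda>' G'"
    and ts: "topspace T = carrier G" "topspace T' = carrier G'"
    and U: "\<And>x. x \<in> \<Lambda> \<Longrightarrow> \<exists>U. openin T U \<and> U \<inter> \<Lambda> = {x}" "\<And>x. x \<in> \<Lambda>' \<Longrightarrow> \<exists>U. openin T' U \<and> U \<inter> \<Lambda>' = {x}"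
    using assms by (auto simp: cocompact_discrete_def)
  obtain K where K: "compactin T K" "\<And>y. y \<in> carrier G \<Longrightarrow> \<exists>l\<in>\<Lambda>. \<exists>k\<in>K. y = l \<otimes>\<^bsub>G\<^esub> k"
    using assms by (auto simp: cocompact_discrete_def)
  obtain K' where K': "compactin T' K'" "\<And>y. y \<in> carrier G' \<Longrightarrow> \<exists>l\<in>\<Lambda>'. \<exists>k\<in>K'. y = l \<otimes>\<^bsub>G'\<^esub> k"
    using assms by (auto simp: cocompact_discrete_def)
  have "\<exists>U. openin (prod_topology T T') U \<and> U \<inter> (\<Lambda> \<times> \<Lambda>') = {x}" if x: "x \<in> \<Lambda> \<times> \<Lambda>'" for x
  proof -
    obtain V V' where "openin T V" "V \<inter> \<Lambda> = {fst x}" "openin T' V'" "V' \<inter> \<Lambda>' = {snd x}"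
      using U(1)[of "fst x"] U(2)[of "snd x"] x by auto
    moreover from this have "(V \<times> V') \<inter> (\<Lambda> \<times> \<Lambda>') = {x}" by (simp add: Times_Int_Times)
    ultimately show ?thesis by (intro exI[of _ "V \<times> V'"]) (simp add: openin_prod_Times_iff)
  qed
  moreover have "\<exists>l\<in>\<Lambda> \<times> \<Lambda>'. \<exists>k\<in>K \<times> K'. y = l \<otimes>\<^bsub>G \<times>\<times> G'\<^esub> k" if y0: "y \<in> carrier (G \<times>\<times> G')" for y
  proof -
    obtain a b where y: "y = (a, b)" "a \<in> carrier G" "b \<in> carrier G'"
      using y0 by (cases y) auto
    obtain l k where "l \<in> \<Lambda>" "k \<in> K" "a = l \<otimes>\<^bsub>G\<^esub> k" using K(2)[OF y(2)] by auto
    moreover obtain l' k' where "l' \<in> \<Lambda>'" "k' \<in> K'" "b = l' \<otimes>\<^bsub>G'\<^esub> k'" using K'(2)[OF y(3)] by auto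
    ultimately show ?thesis using y(1)
      by (intro bexI[of _ "(l, l')"] bexI[of _ "(k, k')"]) auto
  qed
  moreover have "compactin (prod_topology T T') (K \<times> K')" using K(1) K'(1) by (simp add: compactin_Times)
  ultimately show ?thesis
    unfolding cocompact_discrete_def
    using DirProd_group[OF g(1,2)] DirProd_subgroups[OF g(1,3,2,4)] ts by auto
qed

section \<open>The real line and its lattices\<close>

lemma real_lca_comm_group: "comm_group real_lca"
proof (rule comm_groupI)
  fix x assume "x \<in> carrier real_lca"
  show "\<exists>y\<in>carrier real_lca. y \<otimes>\<^bsub>real_lca\<^esub> x = \<one>\<^bsub>real_lca\<^esub>"
    by (rule bexI[of _ "- x"]) (auto simp: real_lca_def)
qed (auto simp: real_lca_def)

lemma real_lca_group: "group real_lca"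
  using real_lca_comm_group by (rule comm_group.axioms(2))

lemma real_lca_inv: "inv\<^bsub>real_lca\<^esub> x = - x"
  by (rule group.inv_equality[OF real_lca_group]) (auto simp: real_lca_def)

lemma real_lca_lattice:
  assumes "\<alpha> > 0" shows "cocompact_discrete real_lca euclidean (range (\<lambda>m::int. \<alpha> * of_int m))"
proof -
  let ?L = "range (\<lambda>m::int. \<alpha> * of_int m)"
  have "subgroup ?L real_lca"
  proof (rule group.subgroupI[OF real_lca_group])
    fix x y assume "x \<in> ?L" "y \<in> ?L"
    then obtain m n :: int where "x = \<alpha> * of_int m" "y = \<alpha> * of_int n" by auto
    then show "inv\<^bsub>real_lca\<^esub> x \<in> ?L" "x \<otimes>\<^bsub>real_lca\<^esub> y \<in> ?L"
      unfolding real_lca_inv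
      by (auto simp: real_lca_def image_iff intro: exI[of _ "- m"] exI[of _ "m + n"] simp: algebra_simps)
  qed (auto simp: real_lca_def)
  moreover have "\<exists>U. open U \<and> U \<inter> ?L = {x}" if "x \<in> ?L" for x
  proof (intro exI conjI)
    show "ball x \<alpha> \<inter> ?L = {x}"
    proof (intro equalityI subsetI)
      fix y assume y: "y \<in> ball x \<alpha> \<inter> ?L"
      obtain m n :: int where mn: "x = \<alpha> * of_int m" "y = \<alpha> * of_int n" using \<open>x \<in> ?L\<close> y by auto
      have "\<alpha> * \<bar>of_int m - of_int n\<bar> < \<alpha> * 1"
        using y assms by (simp add: dist_real_def mn abs_mult flip: right_diff_distrib)
      then have "\<bar>of_int (m - n) :: real\<bar> < 1" using assms by simp
      then have "m = n" by linarith
      then show "y \<in> {x}" by (simp add: mn)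
    qed (use that assms in auto)
  qed simp
  moreover have "\<exists>l\<in>?L. \<exists>k\<in>{0..\<alpha>}. y = l + k" for y
  proof (intro bexI)
    show "y = \<alpha> * of_int \<lfloor>y / \<alpha>\<rfloor> + (y - \<alpha> * of_int \<lfloor>y / \<alpha>\<rfloor>)" by simp
    have "y - \<alpha> * of_int \<lfloor>y / \<alpha>\<rfloor> = \<alpha> * frac (y / \<alpha>)" using assms by (simp add: frac_def right_diff_distrib)
    then show "y - \<alpha> * of_int \<lfloor>y / \<alpha>\<rfloor> \<in> {0..\<alpha>}"
      using assms frac_ge_0[of "y / \<alpha>"] frac_lt_1[of "y / \<alpha>"] by simp
  qed (rule rangeI)
  ultimately show ?thesis
    unfolding cocompact_discrete_def using real_lca_group
    by (auto simp: real_lca_def intro: exI[of _ "{0..\<alpha>}"])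
qed

lemma real_lca_tf_shift: "tf_shift real_lca (a, b) \<phi> = real_tf a b \<phi>"
  by (rule ext) (simp add: tf_shift_def modulation_def time_shift_def real_lca_inv real_tf_def,
      simp add: real_lca_def)

lemma tendsto_finite_subsets_image:
  assumes "inj_on f A"
  shows "(X \<longlongrightarrow> l) (finite_subsets_at_top (f ` A)) \<longleftrightarrow> ((\<lambda>F. X (f ` F)) \<longlongrightarrow> l) (finite_subsets_at_top A)"
  unfolding filtermap_image_finite_subsets_at_top[OF assms, symmetric]
  by (simp add: filterlim_filtermap)

text \<open>Adds the group, its topology and the embedding of \<open>R\<close>. The pairing
  \<open>\<xi>\<close> enters through its values at embedded elements, which \<open>chi_iota\<close>
  identifies with the characters \<open>\<psi>\<close>.\<close>

locale diagonal_lattice = coset_characters M R C \<psi>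
  for M :: "'h measure" and R C \<psi> +
  fixes H :: "'h monoid" and T :: "'h topology" and \<iota> :: "rat \<Rightarrow> 'h" and \<xi> :: "'h \<Rightarrow> 'h \<Rightarrow> complex"
  assumes H_comm_group: "comm_group H"
    and space_M: "space M = carrier H"
    and topspace_T: "topspace T = carrier H"
    and iota_closed: "q \<in> R \<Longrightarrow> \<iota> q \<in> carrier H"
    and iota_add: "q \<in> R \<Longrightarrow> r \<in> R \<Longrightarrow> \<iota> (q + r) = \<iota> q \<otimes>\<^bsub>H\<^esub> \<iota> r"
    and C_translate: "q \<in> R \<Longrightarrow> u \<in> carrier H \<Longrightarrow> u \<otimes>\<^bsub>H\<^esub> inv\<^bsub>H\<^esub> \<iota> q \<in> C 0 \<longleftrightarrow> u \<in> C q"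
    and one_C: "\<one>\<^bsub>H\<^esub> \<in> C 0"
    and C_open: "q \<in> R \<Longrightarrow> openin T (C q)"
    and C_compact: "compactin T (C 0)"
    and chi_iota: "r \<in> R \<Longrightarrow> u \<in> carrier H \<Longrightarrow> \<xi> (\<iota> r) u = \<psi> r u"
begin

lemma H_group: "group H"
  using H_comm_group by (rule comm_group.axioms(2))

lemma iota_zero: "\<iota> 0 = \<one>\<^bsub>H\<^esub>"
proof -
  interpret group H by (rule H_group)
  show ?thesis using iota_add[OF R_zero R_zero] iota_closed[OF R_zero] by (simp add: r_cancel_one')
qed

lemma iota_minus: assumes "q \<in> R" shows "\<iota> (- q) = inv\<^bsub>H\<^esub> \<iota> q"
proof -
  have "\<iota> (- q) \<otimes>\<^bsub>H\<^esub> \<iota> q = \<one>\<^bsub>H\<^esub>"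
    using iota_add[OF R_minus[OF assms] assms] by (simp add: iota_zero)
  then show ?thesis
    using group.inv_equality[OF H_group, of "\<iota> (- q)" "\<iota> q"] iota_closed[OF assms] iota_closed[OF R_minus[OF assms]] by simp
qed

lemma iota_C: "q \<in> R \<Longrightarrow> \<iota> q \<in> C q"
  using C_translate[of q "\<iota> q"] iota_closed[of q] one_C group.r_inv[OF H_group] by simp

text \<open>The Feichtinger algebra is a parameter, to be filled by \<open>S0_real_padic p\<close>
  or \<open>S0_adele\<close>.\<close>

definition lca :: "(real \<times> 'h \<Rightarrow> complex) set \<Rightarrow> (real \<times> 'h) lca" where
  "lca S = monoid.extend (real_lca \<times>\<times> H)
     (lca.fields (prod_topology euclidean T) RM
       (\<lambda>(\<omega>, \<eta>) (t, u). cis (2 * pi * \<omega> * t) * \<xi> \<eta> u) S)"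

lemma lca_simps:
  "carrier (lca S) = UNIV \<times> carrier H" "\<one>\<^bsub>lca S\<^esub> = (0, \<one>\<^bsub>H\<^esub>)"
  "x \<otimes>\<^bsub>lca S\<^esub> y = (fst x + fst y, snd x \<otimes>\<^bsub>H\<^esub> snd y)"
  "lca_top (lca S) = prod_topology euclidean T" "lca_measure (lca S) = RM" "feichtinger (lca S) = S"
  "lca_char (lca S) = (\<lambda>(\<omega>, \<eta>) (t, u). cis (2 * pi * \<omega> * t) * \<xi> \<eta> u)"
  by (simp_all add: lca_def monoid.defs lca.defs DirProd_def real_lca_def split_beta)

lemma lca_group: "group (lca S)"
proof -
  interpret group H by (rule H_group)
  show ?thesis
  proof (rule groupI)
    fix x assume "x \<in> carrier (lca S)"
    then show "\<exists>y\<in>carrier (lca S). y \<otimes>\<^bsub>lca S\<^esub> x = \<one>\<^bsub>lca S\<^esub>"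
      by (intro bexI[of _ "(- fst x, inv\<^bsub>H\<^esub> snd x)"]) (auto simp: lca_simps)
  qed (auto simp: lca_simps m_assoc)
qed

lemma lca_inv: "u \<in> carrier H \<Longrightarrow> inv\<^bsub>lca S\<^esub> (t, u) = (- t, inv\<^bsub>H\<^esub> u)"
  by (rule group.inv_equality[OF lca_group])
    (auto simp: lca_simps group.l_inv[OF H_group] group.inv_closed[OF H_group])

text \<open>Lattice points in one coset differ by integers, so the real components of distinct ones
  are at least \<open>\<alpha>\<close> apart. For co-compactness the component in \<open>H\<close>
  is corrected first; the remaining freedom of an integer, which preserves the coset, then brings
  the real component into \<open>[0, \<alpha>]\<close>.\<close>

lemma lca_lattice:
  assumes \<alpha>: "\<alpha> > 0"
  shows "cocompact_discrete (lca S) (prod_topology euclidean T) ((\<lambda>q. (\<alpha> * of_rat q, \<iota> q)) ` R)"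
proof -
  let ?l = "\<lambda>q. (\<alpha> * of_rat q, \<iota> q)"
  have "subgroup (?l ` R) (lca S)"
  proof (rule group.subgroupI[OF lca_group])
    show "?l ` R \<subseteq> carrier (lca S)" by (auto simp: lca_simps iota_closed)
    show "?l ` R \<noteq> {}" using R_zero by auto
    fix x assume "x \<in> ?l ` R"
    then obtain q where q: "q \<in> R" "x = ?l q" by auto
    have "inv\<^bsub>lca S\<^esub> x = ?l (- q)" using q by (simp add: lca_inv iota_closed iota_minus of_rat_minus)
    then show "inv\<^bsub>lca S\<^esub> x \<in> ?l ` R" using R_minus[OF q(1)] by blast
    fix y assume "y \<in> ?l ` R"
    then obtain r where r: "r \<in> R" "y = ?l r" by auto
    have "x \<otimes>\<^bsub>lca S\<^esub> y = ?l (q + r)" using q r by (simp add: lca_simps iota_add of_rat_add distrib_left)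
    then show "x \<otimes>\<^bsub>lca S\<^esub> y \<in> ?l ` R" using R_add[OF q(1) r(1)] by blast
  qed
  moreover have "\<exists>U. openin (prod_topology euclidean T) U \<and> U \<inter> ?l ` R = {x}" if "x \<in> ?l ` R" for x
  proof -
    obtain q where q: "q \<in> R" "x = ?l q" using \<open>x \<in> ?l ` R\<close> by auto
    have "(ball (\<alpha> * of_rat q) \<alpha> \<times> C q) \<inter> ?l ` R = {x}"
    proof (intro equalityI subsetI)
      fix y assume y: "y \<in> (ball (\<alpha> * of_rat q) \<alpha> \<times> C q) \<inter> ?l ` R"
      then obtain r where r: "r \<in> R" "y = ?l r" by auto
      have "q - r \<in> \<int>" using C_disj[OF q(1) r(1), of "\<iota> r"] iota_C[OF r(1)] y r by auto
      then obtain n where n: "q - r = of_int n" by (auto elim: Ints_cases)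
      have "\<bar>\<alpha> * of_rat (q - r)\<bar> < \<alpha>" using y r by (simp add: dist_real_def of_rat_diff right_diff_distrib)
      then have "\<alpha> * \<bar>of_int n\<bar> < \<alpha> * 1" using \<alpha> unfolding n by (simp add: abs_mult)
      then have "\<bar>of_int n :: real\<bar> < 1" using \<alpha> by simp
      then have "n = 0" by linarith
      then have "q = r" using n by simp
      then show "y \<in> {x}" by (simp add: r q)
    qed (use q \<alpha> iota_C in auto)
    then show ?thesis using C_open[OF q(1)]
      by (intro exI[of _ "ball (\<alpha> * of_rat q) \<alpha> \<times> C q"]) (simp add: openin_prod_Times_iff)
  qed
  moreover have "\<exists>l\<in>?l ` R. \<exists>k\<in>{0..\<alpha>} \<times> C 0. y = l \<otimes>\<^bsub>lca S\<^esub> k" if y0: "y \<in> carrier (lca S)" for y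
  proof -
    interpret comm_group H by (rule H_comm_group)
    obtain t u where y: "y = (t, u)" "u \<in> carrier H" using y0 by (cases y) (auto simp: lca_simps)
    obtain q where q: "q \<in> R" "u \<in> C q" using y(2) C_cover space_M by auto
    define s where "s = t / \<alpha> - of_rat q"
    define r where "r = q + of_int \<lfloor>s\<rfloor>"
    have r: "r \<in> R" unfolding r_def by (intro R_add R_int q)
    have "u \<in> C r" using q by (simp add: r_def C_int)
    then have c: "u \<otimes>\<^bsub>H\<^esub> inv\<^bsub>H\<^esub> \<iota> r \<in> C 0" using C_translate[OF r y(2)] by simp
    have rr: "of_rat r = t / \<alpha> - frac s"
      by (simp add: r_def of_rat_add frac_def s_def)
    have "t - \<alpha> * of_rat r = \<alpha> * frac s" using \<alpha> unfolding rr by (simp add: field_simps)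
    moreover have "0 \<le> \<alpha> * frac s" "\<alpha> * frac s \<le> \<alpha> * 1"
      using \<alpha> frac_ge_0[of s] frac_lt_1[of s] by (simp_all del: mult_1_right)
    ultimately have t: "t - \<alpha> * of_rat r \<in> {0..\<alpha>}" by simp
    have "\<iota> r \<otimes>\<^bsub>H\<^esub> (u \<otimes>\<^bsub>H\<^esub> inv\<^bsub>H\<^esub> \<iota> r) = u"
      using y(2) iota_closed[OF r] by (metis inv_closed m_closed m_comm inv_solve_right')
    then have "y = ?l r \<otimes>\<^bsub>lca S\<^esub> (t - \<alpha> * of_rat r, u \<otimes>\<^bsub>H\<^esub> inv\<^bsub>H\<^esub> \<iota> r)" by (simp add: lca_simps y)
    then show ?thesis using r t c by blast
  qed
  moreover have "compactin (prod_topology euclidean T) ({0..\<alpha>} \<times> C 0)"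
    using C_compact by (simp add: compactin_Times)
  ultimately show ?thesis
    unfolding cocompact_discrete_def using lca_group by (auto simp: lca_simps(1) topspace_T)
qed

text \<open>\<open>w\<close> is left general because the adelic window is a product of local
  indicators, compared with the indicator of \<open>C 0\<close> on the carrier only.\<close>

lemma lca_tf_shift:
  assumes q: "q \<in> R" and r: "r \<in> R" and u: "u \<in> carrier H"
    and w: "\<And>v. v \<in> carrier H \<Longrightarrow> w v = indicator (C 0) v"
  shows "tf_shift (lca S) ((\<alpha> * of_rat q, \<iota> q), (\<beta> * of_rat r, \<iota> r)) (\<lambda>(s, x). g s * w x) (t, u)
    = tensor (real_tf (\<alpha> * of_rat q) (\<beta> * of_rat r) g) (q, r) (t, u)"
proof -
  interpret group H by (rule H_group)
  have "w (u \<otimes>\<^bsub>H\<^esub> inv\<^bsub>H\<^esub> \<iota> q) = indicator (C q) u"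
    using C_translate[OF q u] u iota_closed[OF q] by (subst w) (auto simp: indicator_def)
  then show ?thesis
    by (simp add: tf_shift_def modulation_def time_shift_def lca_inv iota_closed q lca_simps chi_iota r u
      tensor_def e_def real_tf_def)
qed

text \<open>The right-hand side no longer mentions the group \<open>H\<close>, so the p-adic and the
  adelic statement are both compared with the same expansion on the line.\<close>

lemma dual_gabor_frames_lca_iff:
  assumes pos: "\<alpha> > 0" "\<beta> > 0" and g: "g \<in> L2_space lborel" and h: "h \<in> L2_space lborel"
    and w: "\<And>v. v \<in> carrier H \<Longrightarrow> w v = indicator (C 0) v"
    and S: "(\<lambda>(s, x). g s * w x) \<in> S" "(\<lambda>(s, x). h s * w x) \<in> S"
  shows "dual_gabor_frames (lca S)
      {((\<alpha> * of_rat q, \<iota> q), (\<beta> * of_rat r, \<iota> r)) | q r. q \<in> R \<and> r \<in> R}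
      (\<lambda>(s, x). g s * w x) (\<lambda>(s, x). h s * w x) \<longleftrightarrow>
    (\<forall>\<phi>\<in>L2_space lborel. ((\<lambda>F. L2_norm_sq lborel (\<lambda>t. \<phi> t - frame_sum \<alpha> \<beta> g h F \<phi> t)) \<longlongrightarrow> 0)
      (finite_subsets_at_top (\<int> \<times> \<int>)))"
    (is "dual_gabor_frames ?G ?\<Lambda> ?g ?h \<longleftrightarrow> ?conv")
proof -
  let ?l = "\<lambda>k. ((\<alpha> * of_rat (fst k), \<iota> (fst k)), (\<beta> * of_rat (snd k), \<iota> (snd k)))"
  have \<Lambda>: "?\<Lambda> = ?l ` (R \<times> R)" by force
  have inj: "inj_on ?l (R \<times> R)" using pos by (auto simp: inj_on_def prod_eq_iff)
  have \<Lambda>': "?\<Lambda> = ((\<lambda>q. (\<alpha> * of_rat q, \<iota> q)) ` R) \<times> ((\<lambda>r. (\<beta> * of_rat r, \<iota> r)) ` R)" by auto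
  have lat: "is_lattice (?G \<times>\<times> ?G) (prod_topology (lca_top ?G) (lca_top ?G)) ?\<Lambda>"
    unfolding \<Lambda>' lca_simps using pos by (intro cocompact_discrete_lattice cocompact_discrete_Times lca_lattice)
  have sp: "space RM = UNIV \<times> carrier H" by (simp add: space_pair_measure space_M)
  have shift: "tf_shift ?G (?l k) (\<lambda>(s, x). f s * w x) z
      = tensor (real_tf (\<alpha> * of_rat (fst k)) (\<beta> * of_rat (snd k)) f) k z"
    if "k \<in> R \<times> R" "z \<in> space RM" for f k z
  proof -
    obtain q r t u where kz: "k = (q, r)" "z = (t, u)" by (cases k, cases z)
    show ?thesis using that kz lca_tf_shift[of q r u w S \<alpha> \<beta> f t] w by (auto simp: sp)
  qed
  have inner: "L2_inner RM f (tf_shift ?G (?l k) ?g)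
      = L2_inner RM f (tensor (real_tf (\<alpha> * of_rat (fst k)) (\<beta> * of_rat (snd k)) g) k)"
    if "k \<in> R \<times> R" for f k
    unfolding L2_inner_def by (rule Bochner_Integration.integral_cong) (simp_all add: shift[OF that])
  have sum: "L2_norm_sq RM (\<lambda>t. f t - (\<Sum>x\<in>?l ` F. L2_inner RM f (tf_shift ?G x ?g) * tf_shift ?G x ?h t))
      = L2_norm_sq RM (\<lambda>x. f x - product_sum \<alpha> \<beta> g h F f x)" if F: "F \<subseteq> R \<times> R" for F f
    unfolding L2_norm_sq_def
  proof (rule nn_integral_cong)
    fix z assume z: "z \<in> space RM"
    have "(\<Sum>x\<in>?l ` F. L2_inner RM f (tf_shift ?G x ?g) * tf_shift ?G x ?h z)
      = (\<Sum>k\<in>F. L2_inner RM f (tf_shift ?G (?l k) ?g) * tf_shift ?G (?l k) ?h z)"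
      by (rule sum.reindex_cong[OF inj_on_subset[OF inj F] refl refl])
    also have "\<dots> = product_sum \<alpha> \<beta> g h F f z"
      unfolding product_sum_def[OF g h]
    proof (rule sum.cong[OF refl])
      fix k assume "k \<in> F"
      then have k: "k \<in> R \<times> R" using F by auto
      show "L2_inner RM f (tf_shift ?G (?l k) ?g) * tf_shift ?G (?l k) ?h z =
         L2_inner RM f (tensor (real_tf (\<alpha> * of_rat (fst k)) (\<beta> * of_rat (snd k)) g) k) *
         tensor (real_tf (\<alpha> * of_rat (fst k)) (\<beta> * of_rat (snd k)) h) k z"
        by (simp only: inner[OF k] shift[OF k z])
    qed
    finally show "ennreal ((cmod (f z - (\<Sum>x\<in>?l ` F. L2_inner RM f (tf_shift ?G x ?g) * tf_shift ?G x ?h z)))\<^sup>2)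
      = ennreal ((cmod (f z - product_sum \<alpha> \<beta> g h F f z))\<^sup>2)" by (simp only:)
  qed
  have conv: "((\<lambda>F. L2_norm_sq RM (\<lambda>t. f t - (\<Sum>x\<in>F. L2_inner RM f (tf_shift ?G x ?g) * tf_shift ?G x ?h t))) \<longlongrightarrow> 0)
      (finite_subsets_at_top ?\<Lambda>) \<longleftrightarrow>
    ((\<lambda>F. L2_norm_sq RM (\<lambda>x. f x - product_sum \<alpha> \<beta> g h F f x)) \<longlongrightarrow> 0) (finite_subsets_at_top (R \<times> R))" for f
    unfolding \<Lambda> tendsto_finite_subsets_image[OF inj]
    by (rule tendsto_cong, rule eventually_finite_subsets_at_top_weakI) (rule sum)
  have "dual_gabor_frames ?G ?\<Lambda> ?g ?h \<longleftrightarrow> (\<forall>f\<in>L2_space RM.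
     ((\<lambda>F. L2_norm_sq RM (\<lambda>x. f x - product_sum \<alpha> \<beta> g h F f x)) \<longlongrightarrow> 0) (finite_subsets_at_top (R \<times> R)))"
    unfolding dual_gabor_frames_def using lat S by (simp add: lca_simps(5,6) conv)
  also have "\<dots> \<longleftrightarrow> ?conv"
    using frame_product_if[OF g h] frame_product_only_if[OF g h] by blast
  finally show ?thesis .
qed

end

lemma dual_gabor_frames_real_iff:
  assumes pos: "\<alpha> > 0" "\<beta> > 0" and S: "g \<in> S0_real" "h \<in> S0_real"
  shows "dual_gabor_frames real_lca {(\<alpha> * of_int m, \<beta> * of_int n) | m n :: int. True} g h \<longleftrightarrow>
    (\<forall>\<phi>\<in>L2_space lborel. ((\<lambda>F. L2_norm_sq lborel (\<lambda>t. \<phi> t - frame_sum \<alpha> \<beta> g h F \<phi> t)) \<longlongrightarrow> 0)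
      (finite_subsets_at_top (\<int> \<times> \<int>)))"
    (is "dual_gabor_frames _ ?\<Lambda> _ _ \<longleftrightarrow> _")
proof -
  let ?l = "\<lambda>k. (\<alpha> * of_rat (fst k), \<beta> * of_rat (snd k))"
  have \<Lambda>: "?\<Lambda> = ?l ` (\<int> \<times> \<int>)" by (force simp: Ints_def)
  have inj: "inj_on ?l (\<int> \<times> \<int>)" using pos by (auto simp: inj_on_def prod_eq_iff)
  have \<Lambda>': "?\<Lambda> = range (\<lambda>m::int. \<alpha> * of_int m) \<times> range (\<lambda>m::int. \<beta> * of_int m)" by auto
  have top: "lca_top real_lca = euclidean" "lca_measure real_lca = lborel" "feichtinger real_lca = S0_real"
    by (simp_all add: real_lca_def)
  have lat: "is_lattice (real_lca \<times>\<times> real_lca) (prod_topology (lca_top real_lca) (lca_top real_lca)) ?\<Lambda>"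
    unfolding \<Lambda>' top using pos by (intro cocompact_discrete_lattice cocompact_discrete_Times real_lca_lattice)
  have sum: "(\<Sum>x\<in>?l ` F. L2_inner lborel \<phi> (tf_shift real_lca x g) * tf_shift real_lca x h t)
      = frame_sum \<alpha> \<beta> g h F \<phi> t" if F: "F \<subseteq> \<int> \<times> \<int>" for F \<phi> t
    unfolding frame_sum_def
    by (rule sum.reindex_cong[OF inj_on_subset[OF inj F] refl]) (simp add: real_lca_tf_shift)
  have conv: "((\<lambda>F. L2_norm_sq lborel (\<lambda>t. \<phi> t - (\<Sum>x\<in>F. L2_inner lborel \<phi> (tf_shift real_lca x g) * tf_shift real_lca x h t))) \<longlongrightarrow> 0)
      (finite_subsets_at_top ?\<Lambda>) \<longleftrightarrow>
    ((\<lambda>F. L2_norm_sq lborel (\<lambda>t. \<phi> t - frame_sum \<alpha> \<beta> g h F \<phi> t)) \<longlongrightarrow> 0) (finite_subsets_at_top (\<int> \<times> \<int>))" for \<phi>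
    unfolding \<Lambda> tendsto_finite_subsets_image[OF inj]
    by (rule tendsto_cong, rule eventually_finite_subsets_at_top_weakI) (simp only: sum)
  show ?thesis
    unfolding dual_gabor_frames_def top(2,3) conv using lat S by blast
qed

text \<open>The map preserves the measure and the set but multiplies the function by
  \<open>w\<close>, so the integral equals \<open>w\<close> times itself.\<close>

lemma integral_zero_by_translation:
  assumes \<tau>: "\<tau> \<in> measurable M M" "distr M M \<tau> = M"
    and C: "C \<in> sets M" "\<And>u. u \<in> space M \<Longrightarrow> \<tau> u \<in> C \<longleftrightarrow> u \<in> C"
    and f: "f \<in> borel_measurable M" "\<And>u. u \<in> space M \<Longrightarrow> f (\<tau> u) = w * f u" and w: "w \<noteq> (1 :: complex)"
  shows "(LINT u|M. indicator C u * f u) = 0"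
proof -
  have m: "(\<lambda>u. indicator C u * f u :: complex) \<in> borel_measurable M" using C(1) f(1) by measurable
  have "(LINT u|M. indicator C u * f u) = (LINT u|distr M M \<tau>. indicator C u * f u)" by (simp only: \<tau>(2))
  also have "\<dots> = (LINT u|M. indicator C (\<tau> u) * f (\<tau> u))" by (rule integral_distr[OF \<tau>(1) m])
  also have "\<dots> = (LINT u|M. w * (indicator C u * f u))"
    using C(2) f(2) by (intro Bochner_Integration.integral_cong) (auto simp: indicator_def)
  finally have "(LINT u|M. indicator C u * f u) = w * (LINT u|M. indicator C u * f u)" by simp
  then show ?thesis using w by (metis mult_cancel_right1)
qed

section \<open>The p-adic case\<close>

context padic_prime
begin

lemma P_R_0_eq_iff: "P (R q) 0 = P (R r) 0 \<longleftrightarrow> q - r \<in> zl"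
proof -
  have e: "P (R q) 0 - q \<in> I 0" "P (R r) 0 - r \<in> I 0" by (rule P_R)+
  have "P (R q) 0 = P (R r) 0 \<longleftrightarrow> P (R q) 0 - P (R r) 0 \<in> I 0"
    by (rule P_eq_iff_I[symmetric]) (rule R_carrier)+
  also have "\<dots> \<longleftrightarrow> q - r \<in> I 0"
  proof
    assume "P (R q) 0 - P (R r) 0 \<in> I 0"
    from I_diff[OF I_add[OF this e(2)] e(1)] show "q - r \<in> I 0" by simp
  next
    assume "q - r \<in> I 0"
    from I_diff[OF I_add[OF this e(1)] e(2)] show "P (R q) 0 - P (R r) 0 \<in> I 0" by simp
  qed
  finally show ?thesis by (simp add: I_zero_eq)
qed

lemma B_R_0_eq_iff: "R r \<in> B (R q) 0 \<longleftrightarrow> q - r \<in> zl"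
  using P_R_0_eq_iff[of r q] zl_minus[of "r - q"] zl_minus[of "q - r"] by (auto simp: B_def R_carrier)

lemma R_partial: assumes "u \<in> cP" shows "P (R (P u 0)) 0 = P u 0"
  using P_bounds[OF assms, of 0] by (intro P_R_eq P_Zi) auto

lemma chi_sub:
  assumes "y \<in> cP" "u \<in> cP" "x \<in> cP" shows "chi y u = chi y x * chi y (sub u x)"
  using chi_mult_right[OF assms(1,3) sub_closed[OF assms(2,3)]] G_mult_sub[OF assms(2,3)] by simp

lemma chi_zero: assumes "x \<in> cP" shows "chi x (\<lambda>_. 0) = 1"
proof -
  have "chi x (\<lambda>_. 0) = chi x (\<lambda>_. 0) * chi x (\<lambda>_. 0)"
    using chi_mult_right[OF assms R_carrier R_carrier, of 0 0] unfolding R_add[symmetric] by (simp add: R_0)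
  then show ?thesis using chi_norm[of x "\<lambda>_. 0"] by (metis mult_cancel_left1 norm_zero zero_neq_one)
qed

lemma chi_ne_0 [simp]: "chi x y \<noteq> 0"
  using chi_norm[of x y] by (metis norm_zero zero_neq_one)

lemma chi_eq_iff: "y \<in> cP \<Longrightarrow> u \<in> cP \<Longrightarrow> x \<in> cP \<Longrightarrow> chi y u = chi y x \<longleftrightarrow> chi y (sub u x) = 1"
  by (subst chi_sub[of y u x]) auto

lemma chi_level_open: assumes "x \<in> cP" shows "openin (padic_top p) {u \<in> cP. chi x u \<in> A}"
proof -
  obtain n where n: "n \<ge> 0" "\<And>u v. u \<in> cP \<Longrightarrow> v \<in> cP \<Longrightarrow> P u n = P v n \<Longrightarrow> chi x u = chi x v"
    using chi_locally_constant[OF assms] by blast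
  show ?thesis unfolding openin_padic_iff
  proof (intro conjI ballI)
    fix u assume u: "u \<in> {u \<in> cP. chi x u \<in> A}"
    have "B u n \<subseteq> {u \<in> cP. chi x u \<in> A}"
    proof
      fix v assume v: "v \<in> B u n"
      then have "chi x v = chi x u" using u by (intro n(2)) (auto simp: B_def)
      then show "v \<in> {u \<in> cP. chi x u \<in> A}" using u v by (auto simp: B_def)
    qed
    then show "\<exists>n\<ge>0. B u n \<subseteq> {u \<in> cP. chi x u \<in> A}" using n(1) by blast
  qed auto
qed

lemma openin_sets: "openin (padic_top p) U \<Longrightarrow> U \<in> sets (padic_haar p)"
  by (simp add: padic_haar_eq sets_mu flip: borel_padic) (simp add: borel_sets_of_def sigma_sets.Basic)

lemma space_haar: "space (padic_haar p) = cP" by (simp add: padic_haar_eq space_mu)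

lemma chi_measurable: assumes "x \<in> cP" shows "chi x \<in> borel_measurable (padic_haar p)"
proof (rule measurableI)
  fix A :: "complex set"
  have "chi x -` A \<inter> space (padic_haar p) = {u \<in> cP. chi x u \<in> A}" by (auto simp: space_haar)
  then show "chi x -` A \<inter> space (padic_haar p) \<in> sets (padic_haar p)"
    using openin_sets[OF chi_level_open[OF assms]] by simp
qed simp

lemma cnj_chi_measurable: "x \<in> cP \<Longrightarrow> (\<lambda>u. cnj (chi x u)) \<in> borel_measurable (padic_haar p)"
  by (rule measurable_compose[OF chi_measurable]) (auto intro!: borel_measurable_continuous_onI continuous_intros)

lemma haar_translate:
  assumes x: "x \<in> cP"
  shows "(\<lambda>u. sub u x) \<in> measurable (padic_haar p) (padic_haar p)"
    "distr (padic_haar p) (padic_haar p) (\<lambda>u. sub u x) = padic_haar p"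
proof -
  show m: "(\<lambda>u. sub u x) \<in> measurable (padic_haar p) (padic_haar p)"
    by (rule sub_measurable[OF x]) (simp_all add: padic_haar_eq sets_mu)
  show "distr (padic_haar p) (padic_haar p) (\<lambda>u. sub u x) = padic_haar p"
  proof (rule measure_eqI)
    fix A assume "A \<in> sets (distr (padic_haar p) (padic_haar p) (\<lambda>u. sub u x))"
    then have A: "A \<in> sets (padic_haar p)" by simp
    then have Ac: "A \<subseteq> cP" using sets.sets_into_space space_haar by blast
    have "emeasure (distr (padic_haar p) (padic_haar p) (\<lambda>u. sub u x)) A
      = emeasure (padic_haar p) ((\<lambda>u. sub u x) -` A \<inter> space (padic_haar p))"
      by (rule emeasure_distr[OF m A])
    also have "(\<lambda>u. sub u x) -` A \<inter> space (padic_haar p) = x <#\<^bsub>G\<^esub> A"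
      unfolding l_coset_eq[OF x Ac] by (auto simp: space_haar)
    also have "emeasure (padic_haar p) \<dots> = emeasure (padic_haar p) A"
      using mu_translate[OF x] A by (simp add: padic_haar_eq)
    finally show "emeasure (distr (padic_haar p) (padic_haar p) (\<lambda>u. sub u x)) A = emeasure (padic_haar p) A" .
  qed simp
qed

text \<open>Within a coset of \<open>Z_p\<close> the level sets of the character of frequency
  \<open>p^-n\<close> are the cosets of \<open>p^n Z_p\<close>. This places the balls in the
  sigma-algebra generated by level sets.\<close>

lemma ball_eq_level_set:
  assumes x: "x \<in> cP" and n: "n \<ge> 0"
  shows "B x n = {u \<in> B x 0. chi (R (pp (- n))) u = chi (R (pp (- n))) x}"
proof (intro equalityI subsetI)
  fix u assume u: "u \<in> B x n"
  have uc: "u \<in> cP" and un: "P u n = P x n" using u by (auto simp: B_def)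
  have u0: "P u 0 = P x 0" by (rule P_eq_down[OF uc x un n])
  have "chi (R (pp (- n))) (sub u x) = 1"
    using chi_scaled_eq_1_iff[OF _ n, of "sub u x"] sub_Zp_iff[OF uc x] sub_zero_iff[OF uc x] u0 un by simp
  then show "u \<in> {u \<in> B x 0. chi (R (pp (- n))) u = chi (R (pp (- n))) x}"
    using uc u0 by (simp add: B_def chi_eq_iff[OF R_carrier uc x])
next
  fix u assume "u \<in> {u \<in> B x 0. chi (R (pp (- n))) u = chi (R (pp (- n))) x}"
  then have uc: "u \<in> cP" and u0: "P u 0 = P x 0" and c: "chi (R (pp (- n))) u = chi (R (pp (- n))) x"
    by (auto simp: B_def)
  have "chi (R (pp (- n))) (sub u x) = 1" using c chi_eq_iff[OF R_carrier uc x] by simp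
  then have "P u n = P x n"
    using chi_scaled_eq_1_iff[OF _ n, of "sub u x"] sub_Zp_iff[OF uc x] sub_zero_iff[OF uc x] u0 by simp
  then show "u \<in> B x n" using uc by (simp add: B_def)
qed

text \<open>An integral frequency pairs trivially with the difference of two points of a coset of
  \<open>Z_p\<close>.\<close>

lemma psi_int_const:
  assumes "u \<in> B x 0" "v \<in> B x 0" "y \<in> Zp p" "x \<in> cP" shows "chi y u = chi y v"
proof -
  have c: "u \<in> cP" "v \<in> cP" "P u 0 = P v 0" "y \<in> cP" using assms by (auto simp: B_def Zp_iff)
  have "sub u v \<in> Zp p" using sub_Zp_iff c by simp
  then show ?thesis using chi_eq_iff[of y u v] chi_Zp[OF assms(3)] c by simp
qed

lemma coset_characters_padic:
  "coset_characters (padic_haar p) Zi (\<lambda>q. B (R q) 0) (\<lambda>r u. cnj (chi (R r) u))"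
proof
  fix q r assume q: "q \<in> Zi" and r: "r \<in> Zi"
  show "q + r \<in> Zi" using q r by (rule Zi_add)
  show "- q \<in> Zi" using q by (rule Zi_minus)
  show "B (R q) 0 \<in> sets (padic_haar p)" by (rule openin_sets[OF openin_B[OF R_carrier]])
  show "emeasure (padic_haar p) (B (R q) 0) = 1" using mu_B[OF R_carrier, of 0 q] by (simp add: padic_haar_eq)
  show B: "B (R (q + of_int n)) 0 = B (R q) 0" for n
    by (rule B_eq[symmetric, THEN sym, OF _]) (use B_R_0_eq_iff[of "q + of_int n" q] zl_int[of "- n"] in \<open>simp add: B_R_0_eq_iff\<close>)
  show "q - r \<in> \<int>" if "u \<in> B (R q) 0" "u \<in> B (R r) 0" for u
    using that P_R_0_eq_iff[of q r] Zi_zl[OF Zi_diff[OF q r]] by (auto simp: B_def)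
  show "(\<lambda>u. cnj (chi (R r) u)) \<in> borel_measurable (padic_haar p)"
    by (rule cnj_chi_measurable[OF R_carrier])
  show "cmod (cnj (chi (R r) u)) = 1" for u by simp
  show "cnj (chi (R (q + r)) u) = cnj (chi (R q) u) * cnj (chi (R r) u)" if "u \<in> space (padic_haar p)" for u
    using that unfolding R_add space_haar by (simp only: chi_mult_left[OF R_carrier R_carrier] complex_cnj_mult)
  show "cnj (chi (R (of_int n)) u) = cnj (chi (R (of_int n)) v)" if "u \<in> B (R q) 0" "v \<in> B (R q) 0" for u v n
    using psi_int_const[OF that _ R_carrier, of "R (of_int n)"] by (simp add: R_Zp_iff zl_int)
  show "(LINT u|padic_haar p. indicator (B (R q) 0) u * cnj (chi (R r) u)) = 0" if "r \<notin> \<int>"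
  \<comment> \<open>Translation by 1 preserves the cosets of \<open>Z_p\<close>, while a character
    of nonintegral frequency is nontrivial at 1.\<close>
  proof (rule integral_zero_by_translation[OF haar_translate[OF R_carrier, of 1]])
    show "B (R q) 0 \<in> sets (padic_haar p)" by (rule openin_sets[OF openin_B[OF R_carrier]])
    show "sub u (R 1) \<in> B (R q) 0 \<longleftrightarrow> u \<in> B (R q) 0" if "u \<in> space (padic_haar p)" for u
    proof -
      have "B (R q \<otimes>\<^bsub>G\<^esub> R 1) 0 = B (R q) 0" using B[of 1] by (simp only: R_add of_int_1)
      then show ?thesis using sub_B_vimage[OF R_carrier R_carrier, of 1 q 0] that space_haar by blast
    qed
    show "(\<lambda>u. cnj (chi (R r) u)) \<in> borel_measurable (padic_haar p)"
      by (rule cnj_chi_measurable[OF R_carrier])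
    have "r \<notin> zl" using \<open>r \<notin> \<int>\<close> Zi_zl[OF r] by blast
    then show "1 / cnj (chi (R r) (R 1)) \<noteq> 1"
      using chi_one_ne[OF R_carrier, of r] by (simp add: R_Zp_iff)
    show "cnj (chi (R r) (sub u (R 1))) = 1 / cnj (chi (R r) (R 1)) * cnj (chi (R r) u)"
      if "u \<in> space (padic_haar p)" for u
      using that chi_sub[OF R_carrier _ R_carrier, of u r 1] by (simp add: space_haar)
  qed
next
  show "of_int n \<in> Zi" for n by (rule Zi_int)
  show cov: "space (padic_haar p) = (\<Union>q\<in>Zi. B (R q) 0)"
  proof (intro equalityI subsetI)
    fix u assume "u \<in> space (padic_haar p)"
    then have u: "u \<in> cP" by (simp add: space_haar)
    \<comment> \<open>The fractional part of \<open>u\<close> is a representative of its coset in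
      \<open>Z[1/p]\<close>.\<close>
    then have "u \<in> B (R (P u 0)) 0" by (simp add: B_def R_partial)
    then show "u \<in> (\<Union>q\<in>Zi. B (R q) 0)" using P_Zi by blast
  qed (auto simp: space_haar B_def)
  let ?S = "{{u \<in> B (R q) 0. cnj (chi (R r) u) = w} | q r w. q \<in> Zi \<and> r \<in> Zi}"
  have "balls \<subseteq> sigma_sets cP ?S"
  proof
    fix V assume "V \<in> balls"
    then consider "V = {}" | x n where "x \<in> cP" "n \<ge> 0" "V = B x n" by (auto simp: balls_def)
    then show "V \<in> sigma_sets cP ?S"
    proof cases
      case 1 then show ?thesis by (simp add: sigma_sets.Empty)
    next
      case (2 x n)
      have "B x 0 = B (R (P x 0)) 0" using R_partial[OF 2(1)] by (simp add: B_def)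
      then have "V = {u \<in> B (R (P x 0)) 0. cnj (chi (R (pp (- n))) u) = cnj (chi (R (pp (- n))) x)}"
        using ball_eq_level_set[OF 2(1,2)] 2(3) by simp
      then have "V \<in> ?S" using P_Zi pp_Zi by blast
      then show ?thesis by (rule sigma_sets.Basic)
    qed
  qed
  then have "sigma_sets cP balls \<subseteq> sigma_sets cP ?S" by (rule sigma_sets_mono)
  then show "sets (padic_haar p) \<subseteq> sigma_sets (space (padic_haar p)) ?S"
    by (simp add: padic_haar_eq sets_mu space_mu)
qed

lemma diagonal_lattice_padic:
  "diagonal_lattice (padic_haar p) Zi (\<lambda>q. B (R q) 0) (\<lambda>r u. cnj (chi (R r) u)) G (padic_top p) R
    (\<lambda>\<eta> u. cis (- 2 * pi * padic_frac p (\<eta> \<otimes>\<^bsub>Qp p\<^esub> u)))"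
proof (rule diagonal_lattice.intro[OF coset_characters_padic], rule diagonal_lattice_axioms.intro)
  have Z: "B (R 0) 0 = Zp p" by (simp add: R_0 Zp_eq_B)
  show "comm_group G" by (rule G_comm_group)
  show "space (padic_haar p) = carrier G" "topspace (padic_top p) = carrier G"
    by (simp_all only: space_haar G_carrier topspace_padic)
  show "R q \<in> carrier G" for q by (simp only: G_carrier R_carrier)
  show "R (q + r) = R q \<otimes>\<^bsub>G\<^esub> R r" for q r by (rule R_add)
  show "u \<otimes>\<^bsub>G\<^esub> inv\<^bsub>G\<^esub> R q \<in> B (R 0) 0 \<longleftrightarrow> u \<in> B (R q) 0" if "u \<in> carrier G" for u q
    using that sub_Zp_iff[OF _ R_carrier, of u q] unfolding Z B_def[of "R q"] G_carrier
    by (simp only: sub_def mem_Collect_eq simp_thms)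
  show "\<one>\<^bsub>G\<^esub> \<in> B (R 0) 0" unfolding G_one R_0 by (rule B_self[OF zero_carrier])
  show "openin (padic_top p) (B (R q) 0)" for q by (rule openin_B[OF R_carrier])
  show "compactin (padic_top p) (B (R 0) 0)" unfolding Z by (rule compact_Zp)
  show "cis (- 2 * pi * padic_frac p (R r \<otimes>\<^bsub>Qp p\<^esub> u)) = cnj (chi (R r) u)" for r u
    by (simp add: chi_def cis_cnj)
qed

text \<open>Only the coset of 0 carries the function, and it is constant there, so the one nonzero
  coefficient sits at coset 0 and frequency 0.\<close>

lemma indicator_Zp_coeffs:
  "S0_padic_coeffs p (indicator_Zp p) (\<lambda>yz. if yz = (\<lambda>_. 0, \<lambda>_. 0) then 1 else 0)"
proof -
  let ?o = "\<lambda>_. 0 :: nat"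
  let ?c = "\<lambda>yz. if yz = (?o, ?o) then 1 else (0 :: complex)"
  have o: "?o \<in> padic_reps p" by (rule zero_reps[OF prime_p])
  have oZ: "?o \<in> Zp p" using zero_carrier by (simp add: Zp_def)
  have "((\<lambda>yz. norm (?c yz)) has_sum 1) (padic_reps p \<times> padic_reps p)"
    by (rule has_sum_finite_neutralI[of "{(?o, ?o)}"]) (use o in auto)
  moreover have "((\<lambda>z. ?c (y, z) * cis (2 * pi * padic_frac p ((x \<ominus>\<^bsub>Qp p\<^esub> y) \<otimes>\<^bsub>Qp p\<^esub> z)))
      has_sum indicator_Zp p x) (padic_reps p)"
    if y: "y \<in> padic_reps p" and x: "x \<in> y <#\<^bsub>G\<^esub> Zp p" for x y
  proof -
    have yc: "y \<in> cP" by (rule reps_carrier[OF y])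
    have xc: "x \<in> cP" and s: "sub x y \<in> Zp p"
      using x l_coset_eq[OF yc, of "Zp p"] Zp_subset[of p] by auto
    have P: "P x 0 = P y 0" using s sub_Zp_iff[OF xc yc] by simp
    have e: "cis (2 * pi * padic_frac p ((x \<ominus>\<^bsub>Qp p\<^esub> y) \<otimes>\<^bsub>Qp p\<^esub> ?o)) = 1"
      using chi_Zp[OF s oZ] by (simp add: a_minus_eq_sub chi_def)
    have "indicator_Zp p x = (if y = ?o then 1 else 0)"
    proof (cases "y = ?o")
      case True
      then have "x \<in> Zp p" using P xc oZ by (simp add: Zp_iff)
      then show ?thesis using True by (simp add: indicator_Zp_def)
    next
      case False
      have "x \<notin> Zp p"
      proof
        assume "x \<in> Zp p"
        then have "y \<in> ball_at p ?o 0" using P yc by (simp add: Zp_iff flip: Zp_eq_B)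
        then show False using reps_disjoint[OF prime_p o y, of y] B_self[OF yc] False by simp
      qed
      then show ?thesis using False by (simp add: indicator_Zp_def)
    qed
    then show ?thesis
      by (intro has_sum_finite_neutralI[of "{?o}"]) (use o e in auto)
  qed
  ultimately show ?thesis unfolding S0_padic_coeffs_def by (auto intro: has_sum_imp_summable)
qed

lemma indicator_Zp_S0: "indicator_Zp p \<in> S0_padic p" "S0_padic_norm p (indicator_Zp p) < \<infinity>"
proof -
  show "indicator_Zp p \<in> S0_padic p" using indicator_Zp_coeffs unfolding S0_padic_def by blast
  have "S0_padic_norm p (indicator_Zp p) \<le> ennreal (\<Sum>\<^sub>\<infinity>yz\<in>padic_reps p \<times> padic_reps p.
      norm (if yz = (\<lambda>_. 0, \<lambda>_. 0) then 1 else 0 :: complex))"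
    unfolding S0_padic_norm_def by (rule INF_lower) (use indicator_Zp_coeffs in simp)
  then show "S0_padic_norm p (indicator_Zp p) < \<infinity>" by (rule le_less_trans) simp
qed

end

lemma S0_real_zero: "S0_real_norm (\<lambda>_. 0) = 0" "(\<lambda>_. 0) \<in> S0_real"
  by (simp_all add: S0_real_norm_def S0_real_def)

text \<open>A pure tensor as a series: the real factor is zero after the first term, so the other
  factor can be the same in every term.\<close>

lemma single_term_sums: "(\<lambda>j::nat. (if j = 0 then g else (\<lambda>_. 0)) s * w) sums (g s * w :: complex)"
  using sums_If_finite_set[of "{0}" "\<lambda>j. g s * w"] by (simp add: if_distrib[of "\<lambda>f. f s * w"] cong: if_cong)

lemma single_term_norms:
  assumes "g \<in> S0_real" "w < \<infinity>"
  shows "(\<Sum>j::nat. S0_real_norm (if j = 0 then g else (\<lambda>_. 0)) * w) < \<infinity>"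
proof -
  have "(\<Sum>j::nat. S0_real_norm (if j = 0 then g else (\<lambda>_. 0)) * w) = S0_real_norm g * w"
    using suminf_finite[of "{0::nat}" "\<lambda>j. S0_real_norm (if j = 0 then g else (\<lambda>_. 0)) * w"]
    by (simp add: S0_real_zero)
  also have "\<dots> < \<infinity>" using assms by (simp add: S0_real_def ennreal_mult_less_top)
  finally show ?thesis .
qed

lemma S0_real_padic_tensor:
  assumes p: "prime p" and g: "g \<in> S0_real"
  shows "(\<lambda>(s, x). g s * indicator_Zp p x) \<in> S0_real_padic p"
proof -
  interpret padic_prime p by (rule padic_primeI[OF p])
  have [measurable]: "g \<in> borel_measurable lborel" using g by (auto simp: S0_real_def)
  have [measurable]: "Zp p \<in> sets (padic_haar p)" by (rule openin_sets[OF openin_Zp])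
  have "(\<lambda>(s, x). g s * indicator_Zp p x) \<in> borel_measurable (real_padic_measure p)"
    unfolding real_padic_measure_def indicator_Zp_def by measurable
  then show ?thesis unfolding S0_real_padic_def
    using g S0_real_zero indicator_Zp_S0 single_term_norms[OF g indicator_Zp_S0(2)] single_term_sums[of g]
    by (auto intro!: exI[of _ "\<lambda>j. if j = 0 then g else (\<lambda>_. 0)"] exI[of _ "\<lambda>_. indicator_Zp p"])
qed

lemma dual_gabor_frames_real_padic_iff:
  assumes p: "prime p" and pos: "\<alpha> > 0" "\<beta> > 0" and g: "g \<in> S0_real" and h: "h \<in> S0_real"
  shows "dual_gabor_frames (real_padic_lca p)
      {((\<alpha> * of_rat q, padic_of_rat p q), (\<beta> * of_rat r, padic_of_rat p r)) | q r. q \<in> Z_inv p \<and> r \<in> Z_inv p}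
      (\<lambda>(s, x). g s * indicator_Zp p x) (\<lambda>(s, x). h s * indicator_Zp p x) \<longleftrightarrow>
    (\<forall>\<phi>\<in>L2_space lborel. ((\<lambda>F. L2_norm_sq lborel (\<lambda>t. \<phi> t - frame_sum \<alpha> \<beta> g h F \<phi> t)) \<longlongrightarrow> 0)
      (finite_subsets_at_top (\<int> \<times> \<int>)))"
proof -
  interpret padic_prime p by (rule padic_primeI[OF p])
  interpret D: diagonal_lattice "padic_haar p" Zi "\<lambda>q. B (R q) 0" "\<lambda>r u. cnj (chi (R r) u)" G "padic_top p" R
    "\<lambda>\<eta> u. cis (- 2 * pi * padic_frac p (\<eta> \<otimes>\<^bsub>Qp p\<^esub> u))" by (rule diagonal_lattice_padic)
  have "(\<lambda>(\<omega>, \<eta>) (t, u). cis (2 * pi * (\<omega> * t - padic_frac p (\<eta> \<otimes>\<^bsub>Qp p\<^esub> u))))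
    = (\<lambda>(\<omega>, \<eta>) (t, u). cis (2 * pi * \<omega> * t) * cis (- 2 * pi * padic_frac p (\<eta> \<otimes>\<^bsub>Qp p\<^esub> u)))"
    by (auto simp: fun_eq_iff cis_mult algebra_simps)
  then have L: "real_padic_lca p = D.lca (S0_real_padic p)"
    unfolding real_padic_lca_def D.lca_def real_padic_measure_def by simp
  show ?thesis unfolding L
    by (rule D.dual_gabor_frames_lca_iff[OF pos S0_real_subset_L2[OF g] S0_real_subset_L2[OF h] _
          S0_real_padic_tensor[OF p g] S0_real_padic_tensor[OF p h]])
      (simp add: indicator_Zp_def R_0 Zp_eq_B)
qed

section \<open>The adelic case\<close>

definition add_at :: "nat \<Rightarrow> padic \<Rightarrow> padic \<Rightarrow> padic" where
  "add_at p x y = x \<otimes>\<^bsub>add_monoid (Qp p)\<^esub> y"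

abbreviation "H\<^sub>A \<equiv> fin_adele_group"

lemma add_at_simps:
  assumes p: "prime p"
  shows add_at_closed: "x \<in> padic_carrier p \<Longrightarrow> y \<in> padic_carrier p \<Longrightarrow> add_at p x y \<in> padic_carrier p"
    and add_at_commute: "x \<in> padic_carrier p \<Longrightarrow> y \<in> padic_carrier p \<Longrightarrow> add_at p x y = add_at p y x"
    and add_at_assoc: "x \<in> padic_carrier p \<Longrightarrow> y \<in> padic_carrier p \<Longrightarrow> z \<in> padic_carrier p \<Longrightarrow>
      add_at p (add_at p x y) z = add_at p x (add_at p y z)"
    and add_at_zero: "x \<in> padic_carrier p \<Longrightarrow> add_at p (\<lambda>_. 0) x = x"
    and sub_at_eq: "sub_at p x y = add_at p x (inv\<^bsub>add_monoid (Qp p)\<^esub> y)"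
    and neg_at_closed: "x \<in> padic_carrier p \<Longrightarrow> inv\<^bsub>add_monoid (Qp p)\<^esub> x \<in> padic_carrier p"
    and neg_at: "x \<in> padic_carrier p \<Longrightarrow> add_at p x (inv\<^bsub>add_monoid (Qp p)\<^esub> x) = (\<lambda>_. 0)"
proof -
  interpret padic_prime p by (rule padic_primeI[OF p])
  note [simp del] = monoid.simps
  show "x \<in> cP \<Longrightarrow> y \<in> cP \<Longrightarrow> add_at p x y \<in> cP" unfolding add_at_def by (rule G_mult_closed)
  show "x \<in> cP \<Longrightarrow> y \<in> cP \<Longrightarrow> add_at p x y = add_at p y x" unfolding add_at_def by (rule G_comm)
  show "x \<in> cP \<Longrightarrow> y \<in> cP \<Longrightarrow> z \<in> cP \<Longrightarrow> add_at p (add_at p x y) z = add_at p x (add_at p y z)"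
    unfolding add_at_def by (rule G_assoc)
  show "x \<in> cP \<Longrightarrow> add_at p (\<lambda>_. 0) x = x" unfolding add_at_def G_one[symmetric]
    by (rule monoid.l_one[OF group.axioms(1)[OF G_group]]) (simp only: G_carrier)
  show "sub x y = add_at p x (inv\<^bsub>G\<^esub> y)" unfolding add_at_def sub_def ..
  show "x \<in> cP \<Longrightarrow> inv\<^bsub>G\<^esub> x \<in> cP" by (rule G_inv_closed)
  show "x \<in> cP \<Longrightarrow> add_at p x (inv\<^bsub>G\<^esub> x) = (\<lambda>_. 0)" unfolding add_at_def G_one[symmetric] by (rule G_r_inv)
qed

lemma Zp_closed:
  assumes p: "prime p" and x: "x \<in> Zp p"
  shows add_at_Zp: "y \<in> Zp p \<Longrightarrow> add_at p x y \<in> Zp p"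
    and neg_at_Zp: "inv\<^bsub>add_monoid (Qp p)\<^esub> x \<in> Zp p"
    and sub_at_Zp: "y \<in> Zp p \<Longrightarrow> sub_at p x y \<in> Zp p"
proof -
  interpret padic_prime p by (rule padic_primeI[OF p])
  have xc: "x \<in> cP" "P x 0 = 0" using x by (auto simp: Zp_iff)
  have ic: "inv\<^bsub>G\<^esub> x \<in> cP" by (rule G_inv_closed[OF xc(1)])
  have "P (inv\<^bsub>G\<^esub> x) 0 \<in> I 0" using P_inv[OF xc(1), of 0] xc(2) by simp
  then show "inv\<^bsub>G\<^esub> x \<in> Zp p" unfolding Zp_iff using ic P_in_I_iff[OF ic] by blast
  assume y: "y \<in> Zp p"
  then have yc: "y \<in> cP" "P y 0 = 0" by (auto simp: Zp_iff)
  show "sub x y \<in> Zp p" using sub_Zp_iff[OF xc(1) yc(1)] xc yc by simp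
  have c: "x \<otimes>\<^bsub>G\<^esub> y \<in> cP" by (rule G_mult_closed[OF xc(1) yc(1)])
  have "P (x \<otimes>\<^bsub>G\<^esub> y) 0 \<in> I 0" using P_G_mult[OF xc(1) yc(1), of 0] unfolding xc(2) yc(2) by simp
  then show "add_at p x y \<in> Zp p" unfolding Zp_iff add_at_def using c P_in_I_iff[OF c] by blast
qed

lemma fin_adele_group_simps:
  "carrier H\<^sub>A = fin_adeles" "\<one>\<^bsub>H\<^sub>A\<^esub> = (\<lambda>p\<in>primes. \<lambda>_. 0)"
  "x \<otimes>\<^bsub>H\<^sub>A\<^esub> y = (\<lambda>p\<in>primes. add_at p (x p) (y p))"
proof -
  have "(\<lambda>p\<in>primes. \<one>\<^bsub>add_monoid (Qp p)\<^esub>) = (\<lambda>p\<in>primes. \<lambda>_. 0)"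
    by (rule restrict_ext) (simp only: padic_prime.G_one padic_primeI mem_Collect_eq)
  then show "\<one>\<^bsub>H\<^sub>A\<^esub> = (\<lambda>p\<in>primes. \<lambda>_. 0)" by (simp add: fin_adele_group_def)
qed (simp_all add: fin_adele_group_def add_at_def)

text \<open>Almost all components of both arguments are integral, and there the result is integral
  too.\<close>

lemma fin_adeles_pointwise:
  assumes x: "x \<in> fin_adeles" and y: "y \<in> fin_adeles"
    and c: "\<And>p. prime p \<Longrightarrow> f p \<in> padic_carrier p"
    and z: "\<And>p. prime p \<Longrightarrow> x p \<in> Zp p \<Longrightarrow> y p \<in> Zp p \<Longrightarrow> f p \<in> Zp p"
  shows "(\<lambda>p\<in>primes. f p) \<in> fin_adeles"
proof (rule fin_adelesI)
  have "{p. prime p \<and> (\<lambda>p\<in>primes. f p) p \<notin> Zp p} \<subseteq> {p. prime p \<and> x p \<notin> Zp p} \<union> {p. prime p \<and> y p \<notin> Zp p}"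
    using z by auto
  then show "finite {p. prime p \<and> (\<lambda>p\<in>primes. f p) p \<notin> Zp p}"
    by (rule finite_subset) (intro finite_UnI fin_adeles_bad x y)
qed (use c in auto)

lemma fin_adele_neg:
  assumes x: "x \<in> fin_adeles"
  defines "y \<equiv> \<lambda>p\<in>primes. inv\<^bsub>add_monoid (Qp p)\<^esub> x p"
  shows "y \<in> carrier H\<^sub>A" "y \<otimes>\<^bsub>H\<^sub>A\<^esub> x = \<one>\<^bsub>H\<^sub>A\<^esub>"
proof -
  note c = fin_adeles_component[OF x]
  show "y \<in> carrier H\<^sub>A" unfolding fin_adele_group_simps y_def
    by (rule fin_adeles_pointwise[OF x x]) (blast intro: c neg_at_closed neg_at_Zp)+
  show "y \<otimes>\<^bsub>H\<^sub>A\<^esub> x = \<one>\<^bsub>H\<^sub>A\<^esub>"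
    unfolding fin_adele_group_simps
  proof (rule restrict_ext)
    fix p :: nat assume "p \<in> primes"
    then have p: "prime p" by simp
    have "add_at p (inv\<^bsub>add_monoid (Qp p)\<^esub> x p) (x p) = (\<lambda>_. 0)"
      by (subst add_at_commute[OF p neg_at_closed[OF p c[OF p]] c[OF p]]) (rule neg_at[OF p c[OF p]])
    then show "add_at p (y p) (x p) = (\<lambda>_. 0)" using p by (simp only: y_def restrict_apply mem_Collect_eq if_True)
  qed
qed

lemma fin_adele_comm_group: "comm_group H\<^sub>A"
proof (rule comm_groupI)
  fix x y assume "x \<in> carrier H\<^sub>A" "y \<in> carrier H\<^sub>A"
  then have xy: "x \<in> fin_adeles" "y \<in> fin_adeles" by (auto simp: fin_adele_group_simps)
  note c = fin_adeles_component[OF xy(1)] fin_adeles_component[OF xy(2)]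
  show "x \<otimes>\<^bsub>H\<^sub>A\<^esub> y \<in> carrier H\<^sub>A"
    unfolding fin_adele_group_simps by (rule fin_adeles_pointwise[OF xy]) (simp_all add: c add_at_closed add_at_Zp)
  show "x \<otimes>\<^bsub>H\<^sub>A\<^esub> y = y \<otimes>\<^bsub>H\<^sub>A\<^esub> x"
    unfolding fin_adele_group_simps by (rule restrict_ext) (simp add: add_at_commute c)
  fix z assume "z \<in> carrier H\<^sub>A"
  then have z: "z \<in> fin_adeles" by (auto simp: fin_adele_group_simps)
  show "x \<otimes>\<^bsub>H\<^sub>A\<^esub> y \<otimes>\<^bsub>H\<^sub>A\<^esub> z = x \<otimes>\<^bsub>H\<^sub>A\<^esub> (y \<otimes>\<^bsub>H\<^sub>A\<^esub> z)"
    unfolding fin_adele_group_simps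
    by (rule restrict_ext) (simp add: add_at_assoc c fin_adeles_component[OF z])
next
  show "\<one>\<^bsub>H\<^sub>A\<^esub> \<in> carrier H\<^sub>A"
    unfolding fin_adele_group_simps by (rule fin_adelesI) (auto simp: Zp_def padic_prime.zero_carrier padic_primeI)
next
  fix x assume "x \<in> carrier H\<^sub>A"
  then have x: "x \<in> fin_adeles" by (auto simp: fin_adele_group_simps)
  note c = fin_adeles_component[OF x]
  show "\<one>\<^bsub>H\<^sub>A\<^esub> \<otimes>\<^bsub>H\<^sub>A\<^esub> x = x"
    by (rule extensionalityI[of _ primes]) (auto simp: fin_adele_group_simps add_at_zero c fin_adeles_ext[OF x])
  show "\<exists>y\<in>carrier H\<^sub>A. y \<otimes>\<^bsub>H\<^sub>A\<^esub> x = \<one>\<^bsub>H\<^sub>A\<^esub>" using fin_adele_neg[OF x] by blast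
qed

definition adele_sub :: "(nat \<Rightarrow> padic) \<Rightarrow> (nat \<Rightarrow> padic) \<Rightarrow> nat \<Rightarrow> padic" where
  "adele_sub x y = (\<lambda>p\<in>primes. sub_at p (x p) (y p))"

lemma adele_sub_apply: "prime p \<Longrightarrow> adele_sub x y p = sub_at p (x p) (y p)"
  by (simp add: adele_sub_def)

lemma adele_sub_closed: "x \<in> fin_adeles \<Longrightarrow> y \<in> fin_adeles \<Longrightarrow> adele_sub x y \<in> fin_adeles"
  unfolding adele_sub_def
  by (rule fin_adeles_pointwise[of x y]) (simp_all add: fin_adeles_component padic_prime.sub_closed padic_primeI sub_at_Zp)

lemma fin_adele_inv:
  assumes x: "x \<in> fin_adeles" shows "inv\<^bsub>H\<^sub>A\<^esub> x = (\<lambda>p\<in>primes. inv\<^bsub>add_monoid (Qp p)\<^esub> x p)"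
  by (rule group.inv_equality[OF comm_group.axioms(2)[OF fin_adele_comm_group]])
    (use fin_adele_neg[OF x] x in \<open>simp_all only: fin_adele_group_simps\<close>)

lemma fin_adele_sub: assumes "y \<in> fin_adeles" shows "x \<otimes>\<^bsub>H\<^sub>A\<^esub> inv\<^bsub>H\<^sub>A\<^esub> y = adele_sub x y"
  unfolding fin_adele_group_simps fin_adele_inv[OF assms] adele_sub_def
  by (rule restrict_ext) (simp only: restrict_apply mem_Collect_eq if_True sub_at_eq)

section \<open>Rational numbers among the finite adeles\<close>

lemma finite_bad_primes: "finite {p. prime p \<and> q \<notin> zl_at p}"
proof -
  obtain a b where ab: "quotient_of q = (a, b)" by (cases "quotient_of q")
  then have q: "q = of_int a / of_int b" and b: "b > 0" by (auto simp: quotient_of_div quotient_of_denom_pos)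
  have "{p. prime p \<and> q \<notin> zl_at p} \<subseteq> {p. p dvd nat b}"
  proof clarify
    fix p assume p: "prime p" "q \<notin> zl_at p"
    then have "int p dvd b" using padic_prime.zlI[OF padic_primeI[OF p(1)], of b a] q by auto
    then show "p dvd nat b" using b by (simp add: nat_dvd_iff flip: int_dvd_int_iff)
  qed
  then show ?thesis by (rule finite_subset) (use b in \<open>simp add: finite_divisors_nat\<close>)
qed

text \<open>A prime factor of the reduced denominator would be a place where \<open>q\<close> is not
  integral. This makes cosets of the integral adeles with rational representatives disjoint unless
  these differ by an integer.\<close>

lemma rat_integral_everywhere:
  assumes "\<And>p. prime p \<Longrightarrow> q \<in> zl_at p" shows "q \<in> \<int>"
proof (rule ccontr)
  assume "q \<notin> \<int>"
  obtain a b where ab: "quotient_of q = (a, b)" by (cases "quotient_of q")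
  then have q: "q = of_int a / of_int b" and b: "b > 0" and cop: "coprime a b"
    by (auto simp: quotient_of_div quotient_of_denom_pos quotient_of_coprime)
  have "b \<noteq> 1" using \<open>q \<notin> \<int>\<close> q by auto
  then have "nat b \<noteq> 1" using b by simp
  then obtain p where p: "prime p" "p dvd nat b" using prime_factor_nat by blast
  have pb: "int p dvd b" using p(2) b by (simp flip: int_dvd_int_iff)
  obtain c d where cd: "q = of_int c / of_int d" "\<not> int p dvd d" "d \<noteq> 0"
    by (rule padic_prime.zlE[OF padic_primeI[OF p(1)] assms[OF p(1)]])
  have "(of_int a * of_int d :: rat) = of_int c * of_int b" using q cd(1,3) b by (simp add: field_simps)
  then have "a * d = c * b" by (simp flip: of_int_mult)
  then have "int p dvd a * d" using pb by simp
  then have "int p dvd a" using cd(2) p(1) by (simp add: prime_dvd_mult_iff)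
  then have "int p dvd 1" using pb cop by (meson coprime_common_divisor coprime_def)
  then show False using p(1) by (simp add: prime_nat_iff)
qed

text \<open>Powers of another prime \<open>l\<close> are units at \<open>p\<close>.\<close>

lemma Z_inv_zl: assumes "prime l" "prime p" "l \<noteq> p" "q \<in> Z_inv l" shows "q \<in> zl_at p"
proof -
  interpret l: padic_prime l by (rule padic_primeI[OF assms(1)])
  interpret p: padic_prime p by (rule padic_primeI[OF assms(2)])
  obtain a k where q: "q = of_int a * of_nat l powi k" using assms(4) by (auto simp: Z_inv_def)
  show ?thesis
  proof (cases "k \<ge> 0")
    case True
    then have "q = of_int (a * int l ^ nat k)" by (simp add: q power_int_def)
    then show ?thesis using p.zl_int by metis
  next
    case False
    then have "q = of_int a / of_int (int l ^ nat (- k))" by (simp add: q power_int_def field_simps)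
    moreover have "\<not> int p dvd int l ^ nat (- k)"
      using assms(1-3) by (metis prime_dvd_power primes_dvd_imp_eq int_dvd_int_iff of_nat_power)
    ultimately show ?thesis using p.zlI by metis
  qed
qed

lemma fin_adele_of_rat_apply: "prime p \<Longrightarrow> fin_adele_of_rat q p = padic_of_rat p q"
  by (simp add: fin_adele_of_rat_def)

lemma fin_adele_of_rat_closed: "fin_adele_of_rat q \<in> fin_adeles"
proof (rule fin_adelesI)
  have "{p. prime p \<and> fin_adele_of_rat q p \<notin> Zp p} = {p. prime p \<and> q \<notin> zl_at p}"
    by (auto simp: fin_adele_of_rat_apply padic_prime.R_Zp_iff padic_primeI)
  then show "finite {p. prime p \<and> fin_adele_of_rat q p \<notin> Zp p}" using finite_bad_primes by simp
qed (auto simp: fin_adele_of_rat_def padic_prime.R_carrier padic_primeI)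

lemma fin_adele_of_rat_add: "fin_adele_of_rat (q + r) = fin_adele_of_rat q \<otimes>\<^bsub>H\<^sub>A\<^esub> fin_adele_of_rat r"
  unfolding fin_adele_group_simps
  by (subst fin_adele_of_rat_def, rule restrict_ext) (simp only: mem_Collect_eq fin_adele_of_rat_apply padic_prime.R_add padic_primeI add_at_def)

definition adele_coset :: "rat \<Rightarrow> (nat \<Rightarrow> padic) set" where
  "adele_coset q = (\<Pi>\<^sub>E p\<in>primes. ball_at p (padic_of_rat p q) 0)"

lemma ball_R_Zp: assumes p: "prime p" and q: "q \<in> zl_at p" shows "ball_at p (padic_of_rat p q) 0 = Zp p"
proof -
  interpret padic_prime p by (rule padic_primeI[OF p])
  have "P (R q) 0 = P (R 0) 0" using q by (simp add: P_R_0_eq_iff)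
  then show ?thesis by (simp add: Zp_eq_B B_def R_0)
qed

lemma adele_coset_finite: "finite {p. prime p \<and> ball_at p (padic_of_rat p q) 0 \<noteq> Zp p}"
  by (rule finite_subset[OF _ finite_bad_primes[of q]]) (use ball_R_Zp in blast)

lemma adele_coset_box: "adele_coset q \<in> adele_boxes"
proof -
  have "ball_at p (padic_of_rat p q) 0 \<in> balls_at p" if "prime p" for p
    by (rule ball_in_balls[OF that padic_prime.R_carrier[OF padic_primeI[OF that]]]) simp
  then show ?thesis using adele_coset_finite unfolding adele_boxes_def adele_coset_def by blast
qed

lemma adele_coset_subset: "adele_coset q \<subseteq> fin_adeles"
  using adele_coset_box adele_boxes_Pow by auto

lemma adele_coset_iff:
  assumes "u \<in> fin_adeles"
  shows "u \<in> adele_coset q \<longleftrightarrow> (\<forall>p. prime p \<longrightarrow> u p \<in> ball_at p (padic_of_rat p q) 0)"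
  using fin_adeles_ext[OF assms] by (auto simp: adele_coset_def PiE_iff)

lemma adele_coset_int: "adele_coset (q + of_int n) = adele_coset q"
proof -
  have "ball_at p (padic_of_rat p (q + of_int n)) 0 = ball_at p (padic_of_rat p q) 0" if "prime p" for p
  proof -
    interpret padic_prime p by (rule padic_primeI[OF that])
    show ?thesis using P_R_0_eq_iff[of "q + of_int n" q] zl_int[of n] by (simp add: B_def)
  qed
  then show ?thesis unfolding adele_coset_def by (intro PiE_cong) simp
qed

lemma adele_coset_disj: assumes "u \<in> adele_coset q" "u \<in> adele_coset r" shows "q - r \<in> \<int>"
proof (rule rat_integral_everywhere)
  fix p :: nat assume p: "prime p"
  interpret padic_prime p by (rule padic_primeI[OF p])
  have "u p \<in> B (R q) 0" "u p \<in> B (R r) 0" using assms p by (auto simp: adele_coset_def)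
  then show "q - r \<in> zl" using P_R_0_eq_iff[of q r] by (simp add: B_def)
qed

text \<open>Strong approximation: the sum of all fractional parts of a finite adele differs from each
  component by a p-adic integer.\<close>

lemma adele_coset_cover: "fin_adeles = (\<Union>q. adele_coset q)"
proof (intro equalityI subsetI)
  fix u assume u: "u \<in> fin_adeles"
  let ?S = "{p. prime p \<and> u p \<notin> Zp p}"
  let ?f = "\<lambda>p. padic_partial p (u p) 0"
  have "u p \<in> ball_at p (padic_of_rat p (sum ?f ?S)) 0" if p: "prime p" for p
  proof -
    interpret padic_prime p by (rule padic_primeI[OF p])
    have uc: "u p \<in> cP" by (rule fin_adeles_component[OF u p])
    \<comment> \<open>Fractional parts at primes other than \<open>p\<close> have denominators prime
      to \<open>p\<close>; modulo p-adic integers only the one at \<open>p\<close> survives.\<close>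
    have "sum ?f ?S - P (u p) 0 = sum ?f (?S - {p})"
    proof (cases "p \<in> ?S")
      case True
      then show ?thesis using sum_diff1[of ?S ?f p] fin_adeles_bad[OF u] by simp
    next
      case False
      then have "P (u p) 0 = 0" using p Zp_iff[of "u p"] by simp
      then show ?thesis using False by simp
    qed
    moreover have "sum ?f (?S - {p}) \<in> I 0"
    proof (rule I_sum)
      fix l assume l: "l \<in> ?S - {p}"
      then have "?f l \<in> Z_inv l" using padic_prime.P_Zi[OF padic_primeI] by simp
      then show "?f l \<in> I 0" unfolding I_zero_eq using Z_inv_zl[of l p] l p by simp
    qed
    ultimately have "sum ?f ?S - P (u p) 0 \<in> I 0" by simp
    from I_add[OF P_R[of "sum ?f ?S" 0] this] have "P (R (sum ?f ?S)) 0 - P (u p) 0 \<in> I 0" by simp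
    then show ?thesis using P_eq_iff_I[OF R_carrier uc] uc by (simp add: B_def)
  qed
  then show "u \<in> (\<Union>q. adele_coset q)" using adele_coset_iff[OF u] by blast
qed (use adele_coset_subset in auto)

lemma adele_coset_0: "adele_coset 0 = (\<Pi>\<^sub>E p\<in>primes. Zp p)"
  unfolding adele_coset_def
  by (rule PiE_cong) (use padic_prime.zl_int[OF padic_primeI, of _ 0] in \<open>simp add: ball_R_Zp\<close>)

lemma adele_coset_translate:
  assumes u: "u \<in> fin_adeles"
  shows "adele_sub u (fin_adele_of_rat q) \<in> adele_coset 0 \<longleftrightarrow> u \<in> adele_coset q"
proof -
  have "adele_sub u (fin_adele_of_rat q) p \<in> Zp p \<longleftrightarrow> u p \<in> ball_at p (padic_of_rat p q) 0" if p: "prime p" for p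
  proof -
    interpret padic_prime p by (rule padic_primeI[OF p])
    show ?thesis using sub_Zp_iff[OF fin_adeles_component[OF u p] R_carrier, of q] fin_adeles_component[OF u p] p
      by (simp add: adele_sub_apply fin_adele_of_rat_apply B_def)
  qed
  moreover have "adele_sub u (fin_adele_of_rat q) \<in> adele_coset 0 \<longleftrightarrow>
      (\<forall>p. prime p \<longrightarrow> adele_sub u (fin_adele_of_rat q) p \<in> Zp p)"
    unfolding adele_coset_0 using fin_adeles_ext[OF adele_sub_closed[OF u fin_adele_of_rat_closed]]
    by (auto simp: PiE_iff)
  ultimately show ?thesis using adele_coset_iff[OF u] by blast
qed

text \<open>Tychonoff's theorem. A box differs from \<open>Zp p\<close> at finitely many primes, so
  on the product of the \<open>Zp p\<close> the restricted product topology is no finer than the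
  product topology.\<close>

lemma compact_integral_adeles: "compactin fin_adele_top (\<Pi>\<^sub>E p\<in>primes. Zp p)"
proof -
  let ?T = "\<lambda>p. subtopology (padic_top p) (Zp p)"
  let ?X = "product_topology ?T primes"
  have tZ: "topspace (?T p) = Zp p" if "prime p" for p
    using Zp_subset[of p] that by (simp add: padic_prime.topspace_padic padic_primeI Int_absorb1)
  then have ts: "topspace ?X = (\<Pi>\<^sub>E p\<in>primes. Zp p)" by (auto simp: PiE_iff)
  have "compact_space (?T p)" if "prime p" for p
    using padic_prime.compact_Zp[OF padic_primeI[OF that]] compact_space_subtopology by blast
  then have "compact_space ?X" by (simp add: compact_space_product_topology)
  moreover have "continuous_map ?X fin_adele_top (\<lambda>x. x)"
    unfolding continuous_map_def
  proof (intro conjI allI impI)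
    have sub: "(\<Pi>\<^sub>E p\<in>primes. Zp p) \<subseteq> fin_adeles" using adele_coset_subset adele_coset_0 by metis
    then show "(\<lambda>x. x) \<in> topspace ?X \<rightarrow> topspace fin_adele_top" unfolding ts topspace_fin_adele by blast
    fix W assume W: "openin fin_adele_top W"
    show "openin ?X {x \<in> topspace ?X. x \<in> W}"
    proof (subst openin_subopen, intro ballI)
      fix x assume x: "x \<in> {x \<in> topspace ?X. x \<in> W}"
      obtain V where V: "V \<in> adele_boxes" "x \<in> V" "V \<subseteq> W" using adele_box_basis[OF W, of x] x by auto
      obtain U where U: "V = (\<Pi>\<^sub>E p\<in>primes. U p)" "\<And>p. prime p \<Longrightarrow> U p \<in> balls_at p" "finite {p. prime p \<and> U p \<noteq> Zp p}"
        using V(1) unfolding adele_boxes_def by auto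
      \<comment> \<open>The finiteness condition for basic open sets ranges over all natural
        numbers, so indices that are not prime get the full space.\<close>
      define Y where "Y p = (if prime p then U p \<inter> Zp p else topspace (?T p))" for p
      have "openin ?X (\<Pi>\<^sub>E p\<in>primes. Y p)"
      proof (rule product_topology_basis)
        show "openin (?T p) (Y p)" for p
          using openin_ball[OF _ U(2)] by (cases "prime p") (auto simp: Y_def openin_subtopology_Int)
        have "{p. Y p \<noteq> topspace (?T p)} \<subseteq> {p. prime p \<and> U p \<noteq> Zp p}"
          using tZ by (auto simp: Y_def)
        then show "finite {p. Y p \<noteq> topspace (?T p)}" using U(3) by (rule finite_subset)
      qed
      moreover have "x \<in> (\<Pi>\<^sub>E p\<in>primes. Y p)" using x V(2) unfolding ts U(1) by (auto simp: PiE_iff Y_def)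
      moreover have "(\<Pi>\<^sub>E p\<in>primes. Y p) \<subseteq> {x \<in> topspace ?X. x \<in> W}"
        proof
        fix z assume "z \<in> (\<Pi>\<^sub>E p\<in>primes. Y p)"
        then have "z \<in> (\<Pi>\<^sub>E p\<in>primes. U p)" "z \<in> (\<Pi>\<^sub>E p\<in>primes. Zp p)" by (auto simp: PiE_iff Y_def)
        then show "z \<in> {x \<in> topspace ?X. x \<in> W}" using V(3) unfolding ts U(1) by blast
      qed
      ultimately show "\<exists>V. openin ?X V \<and> x \<in> V \<and> V \<subseteq> {x \<in> topspace ?X. x \<in> W}" by blast
    qed
  qed
  ultimately have "compactin fin_adele_top ((\<lambda>x. x) ` topspace ?X)"
    unfolding compact_space_def by (rule image_compactin)
  then show ?thesis by (simp only: image_ident ts)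
qed


section \<open>The pairing of the finite adeles\<close>

lemma prime_prod_cong: "(\<And>p. prime p \<Longrightarrow> a p = b p) \<Longrightarrow> prime_prod a = prime_prod b"
  unfolding prime_prod_def by (rule prod.cong) auto

lemma prime_prod_mult:
  fixes a b :: "nat \<Rightarrow> 'a :: comm_monoid_mult"
  assumes "finite {p. prime p \<and> a p \<noteq> 1}" "finite {p. prime p \<and> b p \<noteq> 1}"
  shows "prime_prod (\<lambda>p. a p * b p) = prime_prod a * prime_prod b"
proof -
  let ?S = "{p. prime p \<and> a p \<noteq> 1} \<union> {p. prime p \<and> b p \<noteq> 1}"
  have "prime_prod f = prod f ?S" if "\<And>p. prime p \<Longrightarrow> p \<notin> ?S \<Longrightarrow> f p = 1" for f :: "nat \<Rightarrow> 'a"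
    by (rule prime_prod_eq) (use assms that in auto)
  from this[of a] this[of b] this[of "\<lambda>p. a p * b p"] show ?thesis by (simp add: prod.distrib)
qed

definition adele_char :: "(nat \<Rightarrow> padic) \<Rightarrow> (nat \<Rightarrow> padic) \<Rightarrow> complex" where
  "adele_char x u = prime_prod (\<lambda>p. cnj (chi_at p (x p) (u p)))"

lemma adele_char_finite:
  assumes "x \<in> fin_adeles" "u \<in> fin_adeles"
  shows "finite {p. prime p \<and> cnj (chi_at p (x p) (u p)) \<noteq> 1}"
  by (rule finite_subset[OF _ finite_UnI[OF fin_adeles_bad[OF assms(1)] fin_adeles_bad[OF assms(2)]]])
    (use padic_prime.chi_Zp[OF padic_primeI] in auto)

lemma adele_char_mult:
  assumes x: "x \<in> fin_adeles" and y: "y \<in> fin_adeles" and u: "u \<in> fin_adeles"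
    and e: "\<And>p. prime p \<Longrightarrow> chi_at p (z p) (w p) = chi_at p (x p) (u p) * chi_at p (y p) (v p)" and v: "v \<in> fin_adeles"
  shows "adele_char z w = adele_char x u * adele_char y v"
  unfolding adele_char_def prime_prod_mult[OF adele_char_finite[OF x u] adele_char_finite[OF y v], symmetric]
  by (rule prime_prod_cong) (simp add: e)

lemma adele_char_norm [simp]: "cmod (adele_char x u) = 1"
  unfolding adele_char_def prime_prod_def prod_norm[symmetric]
  by (rule prod.neutral) (simp add: padic_prime.chi_norm padic_primeI)

lemma adele_char_zero: assumes "u \<in> fin_adeles" shows "adele_char (fin_adele_of_rat 0) u = 1"
proof -
  have "adele_char (fin_adele_of_rat 0) u = prime_prod (\<lambda>p. 1)"
    unfolding adele_char_def
  proof (rule prime_prod_cong)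
    fix p :: nat assume p: "prime p"
    interpret padic_prime p by (rule padic_primeI[OF p])
    show "cnj (chi (fin_adele_of_rat 0 p) (u p)) = 1"
      using chi_zero[OF fin_adeles_component[OF assms p]] by (simp add: fin_adele_of_rat_apply p R_0 chi_commute[of "\<lambda>_. 0"])
  qed
  then show ?thesis by (simp add: prime_prod_def)
qed

lemma adele_char_ne_0 [simp]: "adele_char x u \<noteq> 0"
  using adele_char_norm[of x u] by (metis norm_zero zero_neq_one)

lemma adele_char_sub:
  assumes x: "x \<in> fin_adeles" and u: "u \<in> fin_adeles" and v: "v \<in> fin_adeles"
  shows "adele_char x u = adele_char x v * adele_char x (adele_sub u v)"
  by (rule adele_char_mult[OF x x v _ adele_sub_closed[OF u v]], unfold adele_sub_apply)
    (rule padic_prime.chi_sub[OF padic_primeI]; (assumption | rule fin_adeles_component[OF x] fin_adeles_component[OF u] fin_adeles_component[OF v]))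

text \<open>Where \<open>x\<close> and \<open>u\<close> are both integral, the pairing is trivial on
  all of \<open>Zp p\<close>; a neighbourhood of \<open>u\<close> on which the character is constant
  therefore has to be small at finitely many primes only.\<close>

lemma adele_char_level_open:
  assumes x: "x \<in> fin_adeles" shows "openin fin_adele_top {u \<in> fin_adeles. adele_char x u \<in> A}"
proof (subst openin_subopen, intro ballI)
  fix u assume u: "u \<in> {u \<in> fin_adeles. adele_char x u \<in> A}"
  then have uA: "u \<in> fin_adeles" by simp
  have "\<exists>n\<ge>0. \<forall>v\<in>ball_at p (u p) n. chi_at p (x p) v = chi_at p (x p) (u p)" if p: "prime p" for p
  proof -
    interpret padic_prime p by (rule padic_primeI[OF p])
    obtain n where n: "n \<ge> 0" "\<And>u v. u \<in> cP \<Longrightarrow> v \<in> cP \<Longrightarrow> P u n = P v n \<Longrightarrow> chi (x p) u = chi (x p) v"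
      using chi_locally_constant[OF fin_adeles_component[OF x p]] by blast
    have "chi (x p) v = chi (x p) (u p)" if "v \<in> B (u p) n" for v
      using that by (intro n(2) fin_adeles_component[OF uA p]) (simp_all add: B_def)
    then show ?thesis using n(1) by blast
  qed
  then obtain n where n: "\<And>p. prime p \<Longrightarrow> n p \<ge> 0"
    "\<And>p v. prime p \<Longrightarrow> v \<in> ball_at p (u p) (n p) \<Longrightarrow> chi_at p (x p) v = chi_at p (x p) (u p)" by metis
  define U where "U p = (if x p \<in> Zp p \<and> u p \<in> Zp p then Zp p else ball_at p (u p) (n p))" for p
  let ?V = "\<Pi>\<^sub>E p\<in>primes. U p"
  have fin: "finite {p. prime p \<and> U p \<noteq> Zp p}"
    by (rule finite_subset[OF _ finite_UnI[OF fin_adeles_bad[OF x] fin_adeles_bad[OF uA]]]) (auto simp: U_def)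
  have "openin fin_adele_top ?V"
    by (rule openin_box[OF _ fin])
      (auto simp: U_def padic_prime.openin_Zp padic_primeI intro: padic_prime.openin_B[OF padic_primeI] fin_adeles_component[OF uA])
  moreover have "u \<in> ?V"
    using fin_adeles_ext[OF uA] by (auto simp: PiE_iff U_def intro: padic_prime.B_self[OF padic_primeI] fin_adeles_component[OF uA])
  moreover have "?V \<subseteq> {u \<in> fin_adeles. adele_char x u \<in> A}"
  proof
    fix v assume v: "v \<in> ?V"
    have "v \<in> fin_adeles"
      by (rule subsetD[OF box_subset_fin_adeles[OF _ fin] v])
        (use Zp_subset in \<open>auto simp: U_def padic_prime.B_def padic_primeI split: if_splits\<close>)
    moreover have "adele_char x v = adele_char x u"
      unfolding adele_char_def
    proof (rule prime_prod_cong)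
      fix p :: nat assume p: "prime p"
      have "v p \<in> U p" using v p by auto
      then show "cnj (chi_at p (x p) (v p)) = cnj (chi_at p (x p) (u p))"
        using n(2)[OF p] padic_prime.chi_Zp[OF padic_primeI[OF p]] by (auto simp: U_def split: if_splits)
    qed
    ultimately show "v \<in> {u \<in> fin_adeles. adele_char x u \<in> A}" using u by simp
  qed
  ultimately show "\<exists>V. openin fin_adele_top V \<and> u \<in> V \<and> V \<subseteq> {u \<in> fin_adeles. adele_char x u \<in> A}" by blast
qed

lemma space_fin_adele_measure: "space fin_adele_measure = fin_adeles"
  and sets_fin_adele_measure: "sets fin_adele_measure = borel_sets_of fin_adele_top"
  by (simp_all add: fin_adele_measure_eq space_adele_mu sets_adele_mu)

lemma fin_adele_openin_sets: "openin fin_adele_top U \<Longrightarrow> U \<in> sets fin_adele_measure"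
  unfolding sets_fin_adele_measure borel_sets_of_def by (rule sigma_sets.Basic) simp

lemma adele_char_measurable: assumes "x \<in> fin_adeles" shows "adele_char x \<in> borel_measurable fin_adele_measure"
proof (rule measurableI)
  fix A :: "complex set"
  have "adele_char x -` A \<inter> space fin_adele_measure = {u \<in> fin_adeles. adele_char x u \<in> A}"
    by (auto simp: space_fin_adele_measure)
  then show "adele_char x -` A \<inter> space fin_adele_measure \<in> sets fin_adele_measure"
    using fin_adele_openin_sets[OF adele_char_level_open[OF assms]] by simp
qed simp

text \<open>Translation by an integral adele preserves every \<open>Zp p\<close>, so preimages of
  boxes are boxes of the same measure, by invariance at each prime; boxes determine the
  measure.\<close>

lemma adele_translate:
  assumes v: "v \<in> (\<Pi>\<^sub>E p\<in>primes. Zp p)"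
  shows "(\<lambda>u. adele_sub u v) \<in> measurable fin_adele_measure fin_adele_measure"
    "distr fin_adele_measure fin_adele_measure (\<lambda>u. adele_sub u v) = fin_adele_measure"
proof -
  let ?M = "fin_adele_measure" and ?\<tau> = "\<lambda>u. adele_sub u v"
  have vA: "v \<in> fin_adeles" using v adele_coset_subset[of 0] by (auto simp: adele_coset_0)
  let ?pre = "\<lambda>p A. {u \<in> padic_carrier p. sub_at p u (v p) \<in> A}"
  have pre_balls: "?pre p A \<in> balls_at p" "emeasure (padic_haar p) (?pre p A) = emeasure (padic_haar p) A"
    if p: "prime p" and A: "A \<in> balls_at p" for p A
  proof -
    interpret padic_prime p by (rule padic_primeI[OF p])
    have vc: "v p \<in> cP" by (rule fin_adeles_component[OF vA p])
    consider "A = {}" | y n where "y \<in> cP" "n \<ge> 0" "A = B y n" using A by (auto simp: balls_def)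
    then show "?pre p A \<in> balls"
    proof cases
      case 1 then show ?thesis by (simp add: balls_def)
    next
      case 2
      have "add_at p y (v p) \<in> cP" using add_at_closed[OF p 2(1) vc] .
      then show ?thesis using 2 sub_B_vimage[OF vc 2(1), of n] unfolding add_at_def balls_def by blast
    qed
    have As: "A \<in> sets (padic_haar p)" by (rule balls_sets[OF p A])
    have "emeasure (distr (padic_haar p) (padic_haar p) (\<lambda>u. sub u (v p))) A = emeasure (padic_haar p) (?pre p A)"
      by (subst emeasure_distr[OF haar_translate(1)[OF vc] As]) (auto simp: space_haar intro: arg_cong[where f="emeasure _"])
    then show "emeasure (padic_haar p) (?pre p A) = emeasure (padic_haar p) A"
      by (simp only: haar_translate(2)[OF vc])
  qed
  have pre_Zp: "?pre p (Zp p) = Zp p" if p: "prime p" for p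
  proof -
    interpret padic_prime p by (rule padic_primeI[OF p])
    have vp: "v p \<in> cP" "P (v p) 0 = 0" using v p Zp_iff by auto
    have "sub u (v p) \<in> Zp p \<longleftrightarrow> u \<in> Zp p" if "u \<in> cP" for u
      using sub_Zp_iff[OF that vp(1)] vp(2) that Zp_iff[of u] by simp
    then show ?thesis using Zp_subset[of p] by blast
  qed
  have vim: "?\<tau> -` (\<Pi>\<^sub>E p\<in>primes. A p) \<inter> space ?M = (\<Pi>\<^sub>E p\<in>primes. ?pre p (A p))"
    and fin: "finite {p. prime p \<and> ?pre p (A p) \<noteq> Zp p}" if A: "finite {p. prime p \<and> A p \<noteq> Zp p}" for A
  proof -
    show fin: "finite {p. prime p \<and> ?pre p (A p) \<noteq> Zp p}"
      by (rule finite_subset[OF _ A]) (use pre_Zp in auto)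
    have "(\<Pi>\<^sub>E p\<in>primes. ?pre p (A p)) \<subseteq> fin_adeles" by (rule box_subset_fin_adeles[OF _ fin]) auto
    moreover have "?\<tau> u \<in> (\<Pi>\<^sub>E p\<in>primes. A p) \<longleftrightarrow> u \<in> (\<Pi>\<^sub>E p\<in>primes. ?pre p (A p))" if u: "u \<in> fin_adeles" for u
      using fin_adeles_ext[OF u] fin_adeles_ext[OF adele_sub_closed[OF u vA]] fin_adeles_component[OF u]
      by (auto simp: PiE_iff adele_sub_apply)
    ultimately show "?\<tau> -` (\<Pi>\<^sub>E p\<in>primes. A p) \<inter> space ?M = (\<Pi>\<^sub>E p\<in>primes. ?pre p (A p))"
      unfolding space_fin_adele_measure by blast
  qed
  have boxes: "(\<Pi>\<^sub>E p\<in>primes. ?pre p (A p)) \<in> adele_boxes"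
    if "\<And>p. prime p \<Longrightarrow> A p \<in> balls_at p" "finite {p. prime p \<and> A p \<noteq> Zp p}" for A
    using pre_balls(1)[OF _ that(1)] fin[OF that(2)] unfolding adele_boxes_def by (intro CollectI exI[of _ "\<lambda>p. ?pre p (A p)"]) simp
  show m: "?\<tau> \<in> measurable ?M ?M"
  proof (rule measurable_sigma_sets[OF _ adele_boxes_Pow])
    show "sets ?M = sigma_sets fin_adeles adele_boxes" by (simp add: sets_fin_adele_measure borel_adele)
    show "?\<tau> \<in> space ?M \<rightarrow> fin_adeles" using adele_sub_closed[OF _ vA] by (auto simp: space_fin_adele_measure)
    fix V assume "V \<in> adele_boxes"
    then obtain A where A: "V = (\<Pi>\<^sub>E p\<in>primes. A p)" "\<And>p. prime p \<Longrightarrow> A p \<in> balls_at p" "finite {p. prime p \<and> A p \<noteq> Zp p}"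
      unfolding adele_boxes_def by auto
    show "?\<tau> -` V \<inter> space ?M \<in> sets ?M"
      unfolding A(1) vim[OF A(3)] by (rule fin_adele_openin_sets[OF openin_adele_box[OF boxes[OF A(2,3)]]])
  qed
  show "distr ?M ?M ?\<tau> = ?M"
  proof (rule adele_measure_unique)
    show "sets (distr ?M ?M ?\<tau>) = borel_sets_of fin_adele_top" "sets ?M = borel_sets_of fin_adele_top"
      by (simp_all add: sets_fin_adele_measure)
    fix A assume A: "\<And>p. prime p \<Longrightarrow> A p \<in> balls_at p" "finite {p. prime p \<and> A p \<noteq> Zp p}"
    have sA: "(\<Pi>\<^sub>E p\<in>primes. A p) \<in> sets ?M"
      by (rule fin_adele_openin_sets[OF openin_box[OF openin_ball[OF _ A(1)] A(2)]])
    have "emeasure (distr ?M ?M ?\<tau>) (\<Pi>\<^sub>E p\<in>primes. A p) = emeasure ?M (\<Pi>\<^sub>E p\<in>primes. ?pre p (A p))"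
      by (simp only: emeasure_distr[OF m sA] vim[OF A(2)])
    also have "\<dots> = prime_prod (\<lambda>p. emeasure (padic_haar p) (?pre p (A p)))"
      unfolding fin_adele_measure_eq
      by (rule adele_mu_box[OF balls_sets[OF _ pre_balls(1)[OF _ A(1)]] fin[OF A(2)]])
    also have "\<dots> = prime_prod (\<lambda>p. emeasure (padic_haar p) (A p))"
      by (rule prime_prod_cong) (rule pre_balls(2)[OF _ A(1)])
    finally show "emeasure (distr ?M ?M ?\<tau>) (\<Pi>\<^sub>E p\<in>primes. A p) = prime_prod (\<lambda>p. emeasure (padic_haar p) (A p)) \<and>
        emeasure ?M (\<Pi>\<^sub>E p\<in>primes. A p) = prime_prod (\<lambda>p. emeasure (padic_haar p) (A p))"
      using adele_mu_box[OF balls_sets[OF _ A(1)] A(2)] by (simp add: fin_adele_measure_eq)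
  qed
qed

text \<open>At some prime \<open>r\<close> is not integral. The adele with component 1 there and 0
  elsewhere reduces the product to the single local factor treated by
  \<open>chi_one_ne\<close>.\<close>

lemma adele_char_one_ne:
  assumes r: "r \<notin> \<int>"
  obtains v where "v \<in> (\<Pi>\<^sub>E p\<in>primes. Zp p)" "adele_char (fin_adele_of_rat r) v \<noteq> 1"
proof -
  obtain p where p: "prime p" "r \<notin> zl_at p" using rat_integral_everywhere r by blast
  interpret padic_prime p by (rule padic_primeI[OF p(1)])
  let ?v = "\<lambda>l\<in>primes. if l = p then R 1 else (\<lambda>_. 0)"
  have "R 1 \<in> Zp p" using R_Zp_iff[of 1] zl_int[of 1] by simp
  then have v: "?v \<in> (\<Pi>\<^sub>E p\<in>primes. Zp p)"
    by (auto simp: Zp_def padic_prime.zero_carrier padic_primeI)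
  have "adele_char (fin_adele_of_rat r) ?v = (\<Prod>l\<in>{p}. cnj (chi_at l (fin_adele_of_rat r l) (?v l)))"
    unfolding adele_char_def
  proof (rule prime_prod_eq)
    fix l assume l: "prime l" "l \<notin> {p}"
    interpret l: padic_prime l by (rule padic_primeI[OF l(1)])
    have "l.chi (l.R r) (\<lambda>_. 0) = 1"
      using l.chi_zero[OF l.R_carrier] .
    then show "cnj (chi_at l (fin_adele_of_rat r l) (?v l)) = 1" using l by (simp add: fin_adele_of_rat_apply)
  qed (use p in auto)
  also have "\<dots> = cnj (chi (R r) (R 1))" using p(1) by (simp add: fin_adele_of_rat_apply)
  also have "\<dots> \<noteq> 1" using chi_one_ne[OF R_carrier, of r] p(2) by (simp add: R_Zp_iff)
  finally show ?thesis by (rule that[OF v])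
qed


lemma adele_coset_invariant:
  assumes v: "v \<in> (\<Pi>\<^sub>E p\<in>primes. Zp p)" and u: "u \<in> fin_adeles"
  shows "adele_sub u v \<in> adele_coset q \<longleftrightarrow> u \<in> adele_coset q"
proof -
  have vA: "v \<in> fin_adeles" using v adele_coset_subset[of 0] by (auto simp: adele_coset_0)
  have "sub_at p (u p) (v p) \<in> ball_at p (padic_of_rat p q) 0 \<longleftrightarrow> u p \<in> ball_at p (padic_of_rat p q) 0"
    if p: "prime p" for p
  proof -
    interpret padic_prime p by (rule padic_primeI[OF p])
    have uc: "u p \<in> cP" and vc: "v p \<in> cP" and v0: "P (v p) 0 = 0"
      using fin_adeles_component[OF u p] v p Zp_iff[of "v p"] by auto
    have "P (sub (u p) (v p)) 0 - (P (u p) 0 - 0) \<in> I 0" using P_sub[OF uc vc, of 0] v0 by simp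
    then have "P (sub (u p) (v p)) 0 = P (u p) 0"
      using P_eq_iff_I[OF sub_closed[OF uc vc] uc, of 0] by simp
    then show ?thesis using uc sub_closed[OF uc vc] by (simp add: B_def)
  qed
  then show ?thesis
    unfolding adele_coset_iff[OF u] adele_coset_iff[OF adele_sub_closed[OF u vA]] by (simp add: adele_sub_apply)
qed

text \<open>The frequency \<open>p^-n\<close> is integral at all other primes and the difference of
  two points of a coset is integral everywhere, so the product over all primes reduces to the factor
  at \<open>p\<close>. One global character thus tests a ball at one prime.\<close>

lemma adele_char_eq_iff:
  assumes p: "prime p" and u: "u \<in> adele_coset q" and x: "x \<in> adele_coset q" and n: "n \<ge> 0"
  defines "r \<equiv> padic_prime.pp p (- n)"
  shows "adele_char (fin_adele_of_rat r) u = adele_char (fin_adele_of_rat r) x \<longleftrightarrow> u p \<in> ball_at p (x p) n"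
proof -
  interpret padic_prime p by (rule padic_primeI[OF p])
  have uA: "u \<in> fin_adeles" and xA: "x \<in> fin_adeles" using u x adele_coset_subset by auto
  note uc = fin_adeles_component[OF uA] and xc = fin_adeles_component[OF xA]
  let ?d = "adele_sub u x"
  have dZ: "?d l \<in> Zp l" if l: "prime l" for l
  proof -
    interpret l: padic_prime l by (rule padic_primeI[OF l])
    have "u l \<in> l.B (l.R q) 0" "x l \<in> l.B (l.R q) 0"
      using adele_coset_iff[OF uA, of q] adele_coset_iff[OF xA, of q] u x l by auto
    then have "l.P (u l) 0 = l.P (x l) 0" by (simp add: l.B_def)
    then show ?thesis using l.sub_Zp_iff[OF uc[OF l] xc[OF l]] l by (simp add: adele_sub_apply)
  qed
  have "adele_char (fin_adele_of_rat r) ?d = (\<Prod>l\<in>{p}. cnj (chi_at l (fin_adele_of_rat r l) (?d l)))"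
    unfolding adele_char_def
  proof (rule prime_prod_eq)
    fix l assume l: "prime l" "l \<notin> {p}"
    have "r \<in> zl_at l" using Z_inv_zl[OF p l(1) _ pp_Zi] l(2) unfolding r_def by auto
    then have "padic_of_rat l r \<in> Zp l" using padic_prime.R_Zp_iff[OF padic_primeI[OF l(1)]] by simp
    then show "cnj (chi_at l (fin_adele_of_rat r l) (?d l)) = 1"
      using padic_prime.chi_Zp[OF padic_primeI[OF l(1)] _ dZ[OF l(1)]] l(1) by (simp add: fin_adele_of_rat_apply)
  qed (use p in auto)
  also have "\<dots> = cnj (chi (R r) (?d p))" using p by (simp add: fin_adele_of_rat_apply)
  finally have d: "adele_char (fin_adele_of_rat r) ?d = cnj (chi (R r) (?d p))" .
  have "adele_char (fin_adele_of_rat r) u = adele_char (fin_adele_of_rat r) x \<longleftrightarrow> adele_char (fin_adele_of_rat r) ?d = 1"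
    by (subst adele_char_sub[OF fin_adele_of_rat_closed uA xA]) simp
  also have "\<dots> \<longleftrightarrow> chi (R r) (?d p) = 1" by (simp add: d)
  also have "\<dots> \<longleftrightarrow> P (sub (u p) (x p)) n = 0"
    unfolding r_def using chi_scaled_eq_1_iff[OF dZ[OF p] n] p by (simp add: adele_sub_apply)
  also have "\<dots> \<longleftrightarrow> u p \<in> B (x p) n" using sub_zero_iff[OF uc[OF p] xc[OF p]] uc[OF p] by (simp add: B_def)
  finally show ?thesis .
qed

lemma coset_characters_adele:
  "coset_characters fin_adele_measure UNIV adele_coset (\<lambda>r. adele_char (fin_adele_of_rat r))"
proof
  fix q r :: rat
  show C: "adele_coset q \<in> sets fin_adele_measure"
    by (rule fin_adele_openin_sets[OF openin_adele_box[OF adele_coset_box]])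
  have "emeasure fin_adele_measure (adele_coset q) = prime_prod (\<lambda>p. emeasure (padic_haar p) (ball_at p (padic_of_rat p q) 0))"
    unfolding fin_adele_measure_eq adele_coset_def
    by (rule adele_mu_box[OF _ adele_coset_finite])
      (simp add: balls_sets ball_in_balls padic_prime.R_carrier padic_primeI)
  also have "\<dots> = prime_prod (\<lambda>p. 1)"
    by (rule prime_prod_cong) (simp add: haar_ball padic_prime.R_carrier padic_primeI)
  finally show "emeasure fin_adele_measure (adele_coset q) = 1" by (simp add: prime_prod_def)
  show "adele_coset (q + of_int n) = adele_coset q" for n by (rule adele_coset_int)
  show "q - r \<in> \<int>" if "u \<in> adele_coset q" "u \<in> adele_coset r" for u
    using that by (rule adele_coset_disj)
  show "adele_char (fin_adele_of_rat r) \<in> borel_measurable fin_adele_measure"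
    by (rule adele_char_measurable[OF fin_adele_of_rat_closed])
  show "cmod (adele_char (fin_adele_of_rat r) u) = 1" for u by simp
  show "adele_char (fin_adele_of_rat (q + r)) u = adele_char (fin_adele_of_rat q) u * adele_char (fin_adele_of_rat r) u"
    if "u \<in> space fin_adele_measure" for u
  proof (rule adele_char_mult[OF fin_adele_of_rat_closed fin_adele_of_rat_closed _ _ ])
    show u: "u \<in> fin_adeles" "u \<in> fin_adeles" using that by (simp_all add: space_fin_adele_measure)
    fix p :: nat assume p: "prime p"
    interpret padic_prime p by (rule padic_primeI[OF p])
    show "chi (fin_adele_of_rat (q + r) p) (u p) = chi (fin_adele_of_rat q p) (u p) * chi (fin_adele_of_rat r p) (u p)"
      unfolding fin_adele_of_rat_apply[OF p] R_add
      by (rule chi_mult_left[OF R_carrier R_carrier fin_adeles_component[OF u(1) p]])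
  qed
  show "adele_char (fin_adele_of_rat (of_int n)) u = adele_char (fin_adele_of_rat (of_int n)) v"
    if uv: "u \<in> adele_coset q" "v \<in> adele_coset q" for u v n
    unfolding adele_char_def
  proof (rule prime_prod_cong)
    fix p :: nat assume p: "prime p"
    interpret padic_prime p by (rule padic_primeI[OF p])
    have "u p \<in> B (R q) 0" "v p \<in> B (R q) 0" using uv p by (auto simp: adele_coset_def)
    from psi_int_const[OF this _ R_carrier, of "R (of_int n)"]
    show "cnj (chi_at p (fin_adele_of_rat (of_int n) p) (u p)) = cnj (chi_at p (fin_adele_of_rat (of_int n) p) (v p))"
      by (simp add: fin_adele_of_rat_apply p R_Zp_iff zl_int)
  qed
  show "(LINT u|fin_adele_measure. indicator (adele_coset q) u * adele_char (fin_adele_of_rat r) u) = 0"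
    if r: "r \<notin> \<int>"
  proof -
    let ?c = "adele_char (fin_adele_of_rat r)"
    obtain v where v: "v \<in> (\<Pi>\<^sub>E p\<in>primes. Zp p)" and ne: "?c v \<noteq> 1" by (rule adele_char_one_ne[OF r])
    have vA: "v \<in> fin_adeles" using v adele_coset_subset[of 0] by (auto simp: adele_coset_0)
    show ?thesis
    proof (rule integral_zero_by_translation[OF adele_translate[OF v] C])
      show "adele_sub u v \<in> adele_coset q \<longleftrightarrow> u \<in> adele_coset q" if "u \<in> space fin_adele_measure" for u
        using that by (intro adele_coset_invariant[OF v]) (simp add: space_fin_adele_measure)
      show "?c \<in> borel_measurable fin_adele_measure" by (rule adele_char_measurable[OF fin_adele_of_rat_closed])
      show "1 / ?c v \<noteq> 1" using ne by simp
      show "?c (adele_sub u v) = 1 / ?c v * ?c u" if "u \<in> space fin_adele_measure" for u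
        using that adele_char_sub[OF fin_adele_of_rat_closed _ vA, of u r] by (simp add: space_fin_adele_measure)
    qed
  qed
next
  show "space fin_adele_measure = (\<Union>q\<in>UNIV. adele_coset q)"
    unfolding space_fin_adele_measure by (rule adele_coset_cover)
  let ?S = "{{u \<in> adele_coset q. adele_char (fin_adele_of_rat r) u = w} | q r w. q \<in> UNIV \<and> r \<in> UNIV}"
  have "?S \<subseteq> Pow fin_adeles" using adele_coset_subset by blast
  then interpret S: sigma_algebra fin_adeles "sigma_sets fin_adeles ?S" by (rule sigma_algebra_sigma_sets)
  have "adele_boxes \<subseteq> sigma_sets fin_adeles ?S"
  proof
    fix V assume "V \<in> adele_boxes"
    then obtain U where U: "V = (\<Pi>\<^sub>E p\<in>primes. U p)" "\<And>p. prime p \<Longrightarrow> U p \<in> balls_at p" "finite {p. prime p \<and> U p \<noteq> Zp p}"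
      unfolding adele_boxes_def by auto
    show "V \<in> sigma_sets fin_adeles ?S"
    proof (cases "V = {}")
      case False
      then obtain x where x: "x \<in> V" by auto
      have VA: "V \<subseteq> fin_adeles" using \<open>V \<in> adele_boxes\<close> adele_boxes_Pow by auto
      then obtain q where q: "x \<in> adele_coset q" using x adele_coset_cover by auto
      have xU: "x p \<in> U p" if "prime p" for p using x U(1) that by auto
      have "\<exists>n\<ge>0. U p = ball_at p (x p) n" if p: "prime p" for p
      proof -
        interpret padic_prime p by (rule padic_primeI[OF p])
        obtain y n where "n \<ge> 0" "U p = B y n" using U(2)[OF p] xU[OF p] by (auto simp: balls_def)
        then show ?thesis using xU[OF p] B_eq by metis
      qed
      then obtain n where n: "\<And>p. prime p \<Longrightarrow> n p \<ge> 0" "\<And>p. prime p \<Longrightarrow> U p = ball_at p (x p) (n p)" by metis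
      let ?E = "\<lambda>p. {u \<in> adele_coset q. u p \<in> U p}"
      have E: "?E p \<in> sigma_sets fin_adeles ?S" if p: "prime p" for p
      proof -
        let ?r = "padic_prime.pp p (- n p)"
        have "?E p = {u \<in> adele_coset q. adele_char (fin_adele_of_rat ?r) u = adele_char (fin_adele_of_rat ?r) x}"
          using adele_char_eq_iff[OF p _ q n(1)[OF p]] n(2)[OF p] by auto
        then have "?E p \<in> ?S" by blast
        then show ?thesis by (rule sigma_sets.Basic)
      qed
      have fin_int: "{u \<in> adele_coset q. \<forall>p\<in>D. u p \<in> U p} \<in> sigma_sets fin_adeles ?S"
        if "finite D" "D \<subseteq> primes" for D
        using that
      proof (induction D)
        case empty
        \<comment> \<open>The trivial character exhibits the whole coset as a level set.\<close>
        have "adele_coset q = {u \<in> adele_coset q. adele_char (fin_adele_of_rat 0) u = 1}"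
          using adele_coset_subset adele_char_zero by auto
        then have "adele_coset q \<in> ?S" by blast
        then show ?case using sigma_sets.Basic by simp
      next
        case (insert p D)
        have "{u \<in> adele_coset q. \<forall>p\<in>insert p D. u p \<in> U p} = ?E p \<inter> {u \<in> adele_coset q. \<forall>p\<in>D. u p \<in> U p}" by auto
        then show ?case using S.Int[OF E insert.IH] insert.prems by simp
      qed
      \<comment> \<open>At a prime with \<open>U p = Zp p\<close> the coset of \<open>q\<close>
        contains the integral component \<open>x p\<close>, so it forces integrality there; finitely
        many conditions remain.\<close>
      have "V = {u \<in> adele_coset q. \<forall>p\<in>{p. prime p \<and> U p \<noteq> Zp p}. u p \<in> U p}"
      proof (intro equalityI subsetI)
        fix u assume u: "u \<in> V"
        then have uU: "u p \<in> U p" if "prime p" for p using U(1) that by auto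
        have "u p \<in> ball_at p (padic_of_rat p q) 0" if p: "prime p" for p
        proof -
          interpret padic_prime p by (rule padic_primeI[OF p])
          have "x p \<in> B (R q) 0" using q p by (auto simp: adele_coset_def)
          moreover have "u p \<in> B (x p) 0"
            using uU[OF p] n[OF p] B_mono[of "x p" 0 "n p"] \<open>x p \<in> B (R q) 0\<close> B_subset by auto
          ultimately show ?thesis by (simp add: B_def)
        qed
        then show "u \<in> {u \<in> adele_coset q. \<forall>p\<in>{p. prime p \<and> U p \<noteq> Zp p}. u p \<in> U p}"
          using adele_coset_iff u VA uU by auto
      next
        fix u assume u: "u \<in> {u \<in> adele_coset q. \<forall>p\<in>{p. prime p \<and> U p \<noteq> Zp p}. u p \<in> U p}"
        have "u p \<in> U p" if p: "prime p" for p
        proof (cases "U p = Zp p")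
          case True
          interpret padic_prime p by (rule padic_primeI[OF p])
          have "x p \<in> Zp p" using xU[OF p] True by simp
          moreover have "x p \<in> B (R q) 0" "u p \<in> B (R q) 0" using q u p by (auto simp: adele_coset_def)
          ultimately show ?thesis unfolding True by (simp add: Zp_iff B_def)
        qed (use u p in auto)
        moreover have "u \<in> fin_adeles" using u adele_coset_subset by auto
        ultimately show "u \<in> V" unfolding U(1) using fin_adeles_ext[of u] by (simp add: PiE_iff)
      qed
      then show ?thesis using fin_int[OF U(3)] by auto
    qed (simp only: sigma_sets.Empty)
  qed
  then have "sigma_sets fin_adeles adele_boxes \<subseteq> sigma_sets fin_adeles ?S" by (rule sigma_sets_mono)
  then show "sets fin_adele_measure \<subseteq> sigma_sets (space fin_adele_measure) ?S"
    by (simp only: sets_fin_adele_measure borel_adele space_fin_adele_measure)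
qed simp_all

lemma diagonal_lattice_adele:
  "diagonal_lattice fin_adele_measure UNIV adele_coset (\<lambda>r. adele_char (fin_adele_of_rat r))
    H\<^sub>A fin_adele_top fin_adele_of_rat
    (\<lambda>\<eta> u. prime_prod (\<lambda>p. cis (- 2 * pi * padic_frac p (\<eta> p \<otimes>\<^bsub>Qp p\<^esub> u p))))"
proof (rule diagonal_lattice.intro[OF coset_characters_adele], rule diagonal_lattice_axioms.intro)
  show "comm_group H\<^sub>A" by (rule fin_adele_comm_group)
  show "space fin_adele_measure = carrier H\<^sub>A" "topspace fin_adele_top = carrier H\<^sub>A"
    by (simp_all add: space_fin_adele_measure topspace_fin_adele fin_adele_group_simps)
  show "fin_adele_of_rat q \<in> carrier H\<^sub>A" for q by (simp add: fin_adele_group_simps fin_adele_of_rat_closed)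
  show "fin_adele_of_rat (q + r) = fin_adele_of_rat q \<otimes>\<^bsub>H\<^sub>A\<^esub> fin_adele_of_rat r" for q r
    by (rule fin_adele_of_rat_add)
  show "u \<otimes>\<^bsub>H\<^sub>A\<^esub> inv\<^bsub>H\<^sub>A\<^esub> fin_adele_of_rat q \<in> adele_coset 0 \<longleftrightarrow> u \<in> adele_coset q"
    if "u \<in> carrier H\<^sub>A" for u q
    unfolding fin_adele_sub[OF fin_adele_of_rat_closed]
    by (rule adele_coset_translate) (use that in \<open>simp add: fin_adele_group_simps\<close>)
  show "\<one>\<^bsub>H\<^sub>A\<^esub> \<in> adele_coset 0"
    unfolding fin_adele_group_simps adele_coset_0 by (auto simp: Zp_def padic_prime.zero_carrier padic_primeI)
  show "openin fin_adele_top (adele_coset q)" for q by (rule openin_adele_box[OF adele_coset_box])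
  show "compactin fin_adele_top (adele_coset 0)" unfolding adele_coset_0 by (rule compact_integral_adeles)
  show "prime_prod (\<lambda>p. cis (- 2 * pi * padic_frac p (fin_adele_of_rat r p \<otimes>\<^bsub>Qp p\<^esub> u p))) = adele_char (fin_adele_of_rat r) u"
    for r u
    unfolding adele_char_def by (rule prime_prod_cong) (simp add: padic_prime.chi_def padic_primeI cis_cnj)
qed

section \<open>The adelic windows and the equivalence of the three expansions\<close>

lemma prime_prod_indicator_Zp:
  assumes "x \<in> fin_adeles"
  shows "prime_prod (\<lambda>p. indicator_Zp p (x p)) = (indicator (adele_coset 0) x :: complex)"
proof (cases "x \<in> adele_coset 0")
  case True
  then have "prime_prod (\<lambda>p. indicator_Zp p (x p)) = prime_prod (\<lambda>p. 1 :: complex)"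
    by (intro prime_prod_cong) (use PiE_mem[of x primes] in \<open>auto simp: adele_coset_0 indicator_Zp_def\<close>)
  then show ?thesis using True by (simp add: prime_prod_def)
next
  case False
  \<comment> \<open>On a finite adele the set of nontrivial factors is finite, so the product is a
    genuine one and a single zero factor makes it vanish.\<close>
  have "{p. prime p \<and> indicator_Zp p (x p) \<noteq> 1} = {p. prime p \<and> x p \<notin> Zp p}"
    by (auto simp: indicator_Zp_def indicator_def)
  moreover obtain p where "prime p" "x p \<notin> Zp p"
    using False fin_adeles_ext[OF assms] by (auto simp: adele_coset_0 PiE_iff)
  moreover from this have "indicator_Zp p (x p) = 0" by (simp add: indicator_Zp_def)
  ultimately have "prime_prod (\<lambda>p. indicator_Zp p (x p)) = 0"
    unfolding prime_prod_def using fin_adeles_bad[OF assms]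
    by (intro prod_zero) auto
  then show ?thesis using False by simp
qed

lemma S0_adele_tensor:
  assumes g: "g \<in> S0_real"
  shows "(\<lambda>(s, x). g s * prime_prod (\<lambda>p. indicator_Zp p (x p))) \<in> S0_adele"
proof -
  have [measurable]: "g \<in> borel_measurable lborel" using g by (auto simp: S0_real_def)
  have [measurable]: "adele_coset 0 \<in> sets fin_adele_measure"
    by (rule fin_adele_openin_sets[OF openin_adele_box[OF adele_coset_box]])
  have "(\<lambda>(s, x). g s * indicator (adele_coset 0) x) \<in> borel_measurable adele_measure"
    unfolding adele_measure_def by measurable
  then have "(\<lambda>(s, x). g s * prime_prod (\<lambda>p. indicator_Zp p (x p))) \<in> borel_measurable adele_measure"
    by (subst measurable_cong[where g="\<lambda>(s, x). g s * indicator (adele_coset 0) x"])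
      (auto simp: adele_measure_def space_pair_measure space_fin_adele_measure prime_prod_indicator_Zp)
  moreover have "prime_prod (\<lambda>p. S0_padic_norm p (indicator_Zp p)) < \<infinity>"
    by (rule prime_prod_finite) (rule padic_prime.indicator_Zp_S0(2)[OF padic_primeI])
  ultimately show ?thesis unfolding S0_adele_def
    using g S0_real_zero padic_prime.indicator_Zp_S0(1)[OF padic_primeI] single_term_norms[OF g] single_term_sums[of g]
    by (auto intro!: exI[of _ "\<lambda>j. if j = 0 then g else (\<lambda>_. 0)"] exI[of _ "\<lambda>_. indicator_Zp"])
qed

lemma dual_gabor_frames_adele_iff:
  assumes pos: "\<alpha> > 0" "\<beta> > 0" and g: "g \<in> S0_real" and h: "h \<in> S0_real"
  shows "dual_gabor_frames adele_lca
      {((\<alpha> * of_rat q, fin_adele_of_rat q), (\<beta> * of_rat r, fin_adele_of_rat r)) | q r. True}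
      (\<lambda>(s, x). g s * prime_prod (\<lambda>p. indicator_Zp p (x p)))
      (\<lambda>(s, x). h s * prime_prod (\<lambda>p. indicator_Zp p (x p))) \<longleftrightarrow>
    (\<forall>\<phi>\<in>L2_space lborel. ((\<lambda>F. L2_norm_sq lborel (\<lambda>t. \<phi> t - frame_sum \<alpha> \<beta> g h F \<phi> t)) \<longlongrightarrow> 0)
      (finite_subsets_at_top (\<int> \<times> \<int>)))"
proof -
  interpret D: diagonal_lattice fin_adele_measure UNIV adele_coset "\<lambda>r. adele_char (fin_adele_of_rat r)"
    H\<^sub>A fin_adele_top fin_adele_of_rat
    "\<lambda>\<eta> u. prime_prod (\<lambda>p. cis (- 2 * pi * padic_frac p (\<eta> p \<otimes>\<^bsub>Qp p\<^esub> u p)))" by (rule diagonal_lattice_adele)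
  have L: "adele_lca = D.lca S0_adele"
    unfolding adele_lca_def D.lca_def adele_measure_def by simp
  have "dual_gabor_frames (D.lca S0_adele)
      {((\<alpha> * of_rat q, fin_adele_of_rat q), (\<beta> * of_rat r, fin_adele_of_rat r)) | q r. q \<in> UNIV \<and> r \<in> UNIV}
      (\<lambda>(s, x). g s * prime_prod (\<lambda>p. indicator_Zp p (x p)))
      (\<lambda>(s, x). h s * prime_prod (\<lambda>p. indicator_Zp p (x p))) \<longleftrightarrow>
    (\<forall>\<phi>\<in>L2_space lborel. ((\<lambda>F. L2_norm_sq lborel (\<lambda>t. \<phi> t - frame_sum \<alpha> \<beta> g h F \<phi> t)) \<longlongrightarrow> 0)
      (finite_subsets_at_top (\<int> \<times> \<int>)))"
    by (rule D.dual_gabor_frames_lca_iff[OF pos S0_real_subset_L2[OF g] S0_real_subset_L2[OF h] _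
          S0_adele_tensor[OF g] S0_adele_tensor[OF h]])
      (simp add: prime_prod_indicator_Zp fin_adele_group_simps)
  then show ?thesis by (simp only: L UNIV_I simp_thms)
qed

theorem theorem4p2:
  fixes \<alpha> \<beta> :: real and gR hR :: "real \<Rightarrow> complex"
  assumes "\<alpha> > 0" and "\<beta> > 0"
    and "gR \<in> S0_real" and "hR \<in> S0_real"
  shows
    "(dual_gabor_frames real_lca
        {(\<alpha> * of_int m, \<beta> * of_int n) | m n :: int. True} gR hR
      \<longleftrightarrow>
      (\<forall>p::nat. prime p \<longrightarrow>
        dual_gabor_frames (real_padic_lca p)
          {((\<alpha> * of_rat q, padic_of_rat p q), (\<beta> * of_rat r, padic_of_rat p r)) | q r.
              q \<in> Z_inv p \<and> r \<in> Z_inv p}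
          (\<lambda>(s, x). gR s * indicator_Zp p x)
          (\<lambda>(s, x). hR s * indicator_Zp p x)))
     \<and>
     (dual_gabor_frames real_lca
        {(\<alpha> * of_int m, \<beta> * of_int n) | m n :: int. True} gR hR
      \<longleftrightarrow>
      dual_gabor_frames adele_lca
        {((\<alpha> * of_rat q, fin_adele_of_rat q), (\<beta> * of_rat r, fin_adele_of_rat r)) | q r. True}
        (\<lambda>(s, x). gR s * prime_prod (\<lambda>p. indicator_Zp p (x p)))
        (\<lambda>(s, x). hR s * prime_prod (\<lambda>p. indicator_Zp p (x p))))"
  \<comment> \<open>The prime 2 provides an instance of the statement for all primes, from which the
    expansion on the line follows.\<close>
  using dual_gabor_frames_real_iff[OF assms] dual_gabor_frames_adele_iff[OF assms]
    dual_gabor_frames_real_padic_iff[OF _ assms] two_is_prime_nat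
  by blast

end
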